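(* Let $\mathcal{S}$ be a polytopal cut and project scheme (possibly with a polytopal labelling partition of its window), with associated cut and project set $\Lambda$. When property C holds, fix a CSR decomposition (see context), relative to which property $\mathrm{D}_F$ is understood. Then: (a) if $\Lambda$ is linearly repetitive (LR), then properties C and $\mathrm{D}_F$ hold. (b) Conversely, there is some $N\in\mathbb{N}$ (which may be taken as $N=1$ in codimension $n=1$) such that, if C holds and $\mathrm{D}_F$ still holds after replacing the lattice $\Gamma$ with $\frac1N\Gamma$ (that is, each $\frac1N(\Gamma_i)_<$ is Diophantine in $X_i$ with respect to $F_i$, with $F_i$ unchanged), then $\Lambda$ is LR.
   Context: SCHEMES. A ($k$-to-$d$) polytopal cut and project scheme $\mathcal{S}$ consists of a $k$-dimensional real vector space $\mathbb{E}$ (total space), complementary subspaces $\mathbb{E}_\vee$ (physical space, dimension $d\ge 1$) and $\mathbb{E}_<$ (internal space, dimension $n=k-d\ge 1$, the codimension) with $\mathbb{E}=\mathbb{E}_\vee\oplus\mathbb{E}_<$, a lattice $\Gamma<\mathbb{E}$ and a (non-empty) polytopal window $W\subset\mathbb{E}_<$. The projections to $\mathbb{E}_\vee,\mathbb{E}_<$ are written $x\mapsto x_\vee$, $x\mapsto x_<$ (also for subsets). A set $W$ is polytopal if it is compact, the closure of its interior, and $\partial W$ is contained in the union of a finite set $\mathscr{H}$ of properly supporting hyperplanes (affine, codimension 1); $H$ is properly supporting if there are $w_H\in H$, an open neighbourhood $U_H$ of $w_H$ and a closed half-space $H^+$ of $H$ with $W\cap U_H=H^+\cap U_H$. (Equivalently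 $W$ is a finite union of convex polytopes with non-empty interior; $\mathscr H$ is then exactly the set of properly supporting hyperplanes.) The window may carry a labelling $W=\bigcup_i W_i$ with each $W_i$ polytopal and distinct $W_i$ meeting at most on their boundaries; then $\mathscr{H}$ denotes the union of the sets of supporting hyperplanes of the $W_i$. For $H\in\mathscr H$, $V(H)=H-H$; $\mathscr{H}_0=\{V(H): H\in\mathscr{H}\}$. Standing assumptions: both projections are injective on $\Gamma$; $\Gamma_<$ is dense in $\mathbb{E}_<$; the scheme is non-singular, i.e. $\gamma_<\notin\partial W$ (resp. $\notin\partial W_i$ for all $i$) for all $\gamma\in\Gamma$. For $x=\gamma_\vee\in\Gamma_\vee$ put $x^\star=\gamma_<$. The cut and project set is $\Lambda=\{x\in\Gamma_\vee: x^\star\in W\}$, where $x$ has label $i$ if $x^\star\in W_i$ in the labelled case. PATCHES. Fix norms on $\mathbb{E}_\vee,\mathbb{E}_<$. For $x\in\Lambda$ the $r$-patch $P_r(x)$ is $\Lambda\cap B_r(x)$ (closed ball, with labels) with marked centre $x$; $r$-patches are identified if they agree up to a translation taking centre to centre. $p(r)$ is the number of $r$-patches. Property C: there is $C>0$ with $p(r)\le Cr^d$ for all sufficiently large $r$. LR: there is $C>0$ such that for all sufficiently large $r$, every $Cr$-patch of $\Lambda$ contains every $r$-patch (up to translation). GENERALISED VERTICES. A flag in $\mathscr{H}$ is a set $f\subseteq\mathscr{H}$ of exactly $n$ hyperplanes intersecting in a single point, denoted $v(f)$; $\mathscr{F}$ is the set of flags in $\mathscr H$. $F=\{v(f)-v(f'):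 f,f'\in\mathscr{F}\}$. STABILISERS AND DECOMPOSITIONS. For $V\in\mathscr{H}_0$, $\Gamma^V=\{\gamma\in\Gamma:\gamma_<\in V\}$, $\mathrm{rk}(V)=\mathrm{rk}(\Gamma^V)$; for $S\subseteq\mathscr{H}_0$, $\Gamma^S=\bigcap_{V\in S}\Gamma^V$ and $X_S=\bigcap_{V\in S}V$ (with $\Gamma^\emptyset=\Gamma$, $X_\emptyset=\mathbb{E}_<$). A decomposition is a collection $Q=\{S_1,\dots,S_\ell\}$ of strict subsets of $\mathscr{H}_0$ such that each $V\in\mathscr{H}_0$ fails to lie in exactly one $S_i$, and $\mathbb{E}_<=X_1+\cdots+X_\ell$ with $X_i=X_{S_i}$ (the sum is then direct). Put $\Gamma_i=\Gamma^{S_i}$, $k_i=\mathrm{rk}(\Gamma_i)$, $n_i=\dim X_i$, $d_i=k_i-n_i$, $\delta_i=d_i/n_i$. Call $Q$ a CSR decomposition if $\Gamma_1+\cdots+\Gamma_\ell$ has finite index in $\Gamma$ and, for all $i$ and all $V\in\mathscr{H}_0\setminus S_i$, $\mathrm{rk}(\Gamma^V\cap\Gamma_i)=k_i-\delta_i-1$. If C holds then a CSR decomposition exists; if moreover all $V\in\mathscr H_0$ have equal rank, the trivial decomposition $\{\emptyset\}$ is one. For a decomposition, $F_i\subset X_i$ denotes the image of $F$ under the projection $\mathbb{E}_<\to X_i$ along the other $X_j$; one has $F=F_1+\cdots+F_\ell$. DIOPHANTINE. Let $G\cong\mathbb{Z}^k$ be a subgroup of an $n$-dimensional real vector space $X$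 with norm $\|\cdot\|$, let $\eta(g)=\max_i|g_i|$ be the norm on $G$ from an isomorphism $G\cong\mathbb{Z}^k$, and let $A\subset X$ be finite and non-empty. $G$ is Diophantine in $X$ with respect to $A$ if there is $c>0$ with $\|g-a\|\ge c\,\eta(g)^{-\delta}$ for all $a\in A$ and all $0\neq g\in G$ with $g\ne a$, where $\delta=(k-n)/n$. (Independent of the choices of norms.) Property $\mathrm{D}_F$ (relative to a CSR decomposition): each $(\Gamma_i)_<$ is Diophantine in $X_i$ with respect to $F_i$ (as a rank $k_i$ subgroup of the $n_i$-dimensional space $X_i$). In the constant stabiliser rank case, with the trivial decomposition, this says $\Gamma_<$ is Diophantine in $\mathbb{E}_<$ with respect to $F$. *)

theory Defs
  imports "HOL-Analysis.Analysis"
begin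

text \<open>
  The total space is the product \<open>'p \<times> 'i\<close> of the physical space \<open>'p\<close> and the internal space
  \<open>'i\<close>, so that the two projections are \<^const>\<open>fst\<close> and \<^const>\<open>snd\<close>; thus \<open>d = DIM('p)\<close>,
  \<open>n = DIM('i)\<close> and \<open>k = d + n\<close>. The Euclidean structure of these types provides
  their topology and the description of hyperplanes as \<open>{x. a \<bullet> x = b}\<close>; all metric notions use
  arbitrary norms \<open>Np\<close> and \<open>Ni\<close> given as functions.
\<close>

definition is_norm :: "('a::real_vector \<Rightarrow> real) \<Rightarrow> bool" where
  "is_norm N \<longleftrightarrow> (\<forall>x. N x = 0 \<longleftrightarrow> x = 0) \<and> (\<forall>x y. N (x + y) \<le> N x + N y) \<and>
     (\<forall>c x. N (c *\<^sub>R x) = \<bar>c\<bar> * N x)"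

text \<open>Subgroups of a real vector space, viewed as modules over the integers.\<close>

definition int_scale :: "int \<Rightarrow> 'a::real_vector \<Rightarrow> 'a" where
  "int_scale m x = of_int m *\<^sub>R x"

interpretation int_mod: module "int_scale :: int \<Rightarrow> 'a::real_vector \<Rightarrow> 'a"
  by unfold_locales (simp_all add: int_scale_def scaleR_add_right scaleR_add_left)

definition int_rank :: "'a::real_vector set \<Rightarrow> nat" where
  "int_rank G = Sup {card B | B. finite B \<and> B \<subseteq> G \<and> int_mod.independent B}"

definition int_basis :: "'a::real_vector set \<Rightarrow> 'a set \<Rightarrow> bool" where
  "int_basis G B \<longleftrightarrow> finite B \<and> int_mod.independent B \<and> int_mod.span B = G"

definition is_lattice :: "'a::real_vector set \<Rightarrow> bool" where
  "is_lattice G \<longleftrightarrow> (\<exists>B. independent B \<and> span B = UNIV \<and> G = int_mod.span B)"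

definition set_family_sum :: "('s \<Rightarrow> 'a::comm_monoid_add set) \<Rightarrow> 's set \<Rightarrow> 'a set" where
  "set_family_sum X Q = {\<Sum>S\<in>Q. x S | x. \<forall>S\<in>Q. x S \<in> X S}"

definition finite_index :: "'a::ab_group_add set \<Rightarrow> 'a set \<Rightarrow> bool" where
  "finite_index H G \<longleftrightarrow> H \<subseteq> G \<and> finite ((\<lambda>g. (\<lambda>h. g + h) ` H) ` G)"


subsection \<open>Polytopal windows and schemes\<close>

definition properly_supports :: "'i::euclidean_space set \<Rightarrow> 'i set \<Rightarrow> bool" where
  "properly_supports W H \<longleftrightarrow> (\<exists>a b w U. a \<noteq> 0 \<and> H = {x. a \<bullet> x = b} \<and> w \<in> H \<and> open U \<and> w \<in> U \<and>
     W \<inter> U = {x. a \<bullet> x \<le> b} \<inter> U)"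

definition supporting_hyperplanes :: "'i::euclidean_space set \<Rightarrow> 'i set set" where
  "supporting_hyperplanes W = {H. properly_supports W H}"

definition polytopal :: "'i::euclidean_space set \<Rightarrow> bool" where
  "polytopal W \<longleftrightarrow> compact W \<and> closure (interior W) = W \<and>
     (\<exists>\<H>. finite \<H> \<and> (\<forall>H\<in>\<H>. properly_supports W H) \<and> frontier W \<subseteq> \<Union>\<H>)"

text \<open>
  A scheme consists of a lattice \<open>\<Gamma>\<close> and a window \<open>\<Union>l\<in>L. W l\<close> labelled by the finite set \<open>L\<close>.
  An unlabelled window is the case where \<open>L\<close> is a singleton.
\<close>

definition polytopal_scheme ::
    "('p::euclidean_space \<times> 'i::euclidean_space) set \<Rightarrow> 'l set \<Rightarrow> ('l \<Rightarrow> 'i set) \<Rightarrow> bool" where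
  "polytopal_scheme \<Gamma> L W \<longleftrightarrow>
     is_lattice \<Gamma> \<and>
     (\<Union>l\<in>L. W l) \<noteq> {} \<and> polytopal (\<Union>l\<in>L. W l) \<and>
     finite L \<and> (\<forall>l\<in>L. polytopal (W l)) \<and>
     (\<forall>l\<in>L. \<forall>m\<in>L. l \<noteq> m \<longrightarrow> W l \<inter> W m \<subseteq> frontier (W l) \<inter> frontier (W m)) \<and>
     inj_on fst \<Gamma> \<and> inj_on snd \<Gamma> \<and>
     closure (snd ` \<Gamma>) = UNIV \<and>
     (\<forall>\<gamma>\<in>\<Gamma>. \<forall>l\<in>L. snd \<gamma> \<notin> frontier (W l))"

definition hyperplanes :: "'l set \<Rightarrow> ('l \<Rightarrow> 'i::euclidean_space set) \<Rightarrow> 'i set set" where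
  "hyperplanes L W = (\<Union>l\<in>L. supporting_hyperplanes (W l))"


subsection \<open>Cut and project sets and their patches\<close>

definition star :: "('p \<times> 'i) set \<Rightarrow> 'p \<Rightarrow> 'i" where
  "star \<Gamma> x = (THE y. (x, y) \<in> \<Gamma>)"

definition cps :: "('p \<times> 'i) set \<Rightarrow> 'l set \<Rightarrow> ('l \<Rightarrow> 'i set) \<Rightarrow> 'p set" where
  "cps \<Gamma> L W = {x \<in> fst ` \<Gamma>. star \<Gamma> x \<in> (\<Union>l\<in>L. W l)}"

definition labelled_patch ::
    "('p::real_vector \<Rightarrow> real) \<Rightarrow> ('p \<times> 'i) set \<Rightarrow> 'l set \<Rightarrow> ('l \<Rightarrow> 'i set) \<Rightarrow> real \<Rightarrow> 'p \<Rightarrow> ('p \<times> 'l) set"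
  where
  "labelled_patch Np \<Gamma> L W r x =
     {(y, l). y \<in> cps \<Gamma> L W \<and> Np (y - x) \<le> r \<and> l \<in> L \<and> star \<Gamma> y \<in> W l}"

text \<open>The translate of the patch with its centre moved to the origin: it represents the patch
  up to translations taking centre to centre.\<close>

definition patch_class ::
    "('p::real_vector \<Rightarrow> real) \<Rightarrow> ('p \<times> 'i) set \<Rightarrow> 'l set \<Rightarrow> ('l \<Rightarrow> 'i set) \<Rightarrow> real \<Rightarrow> 'p \<Rightarrow> ('p \<times> 'l) set"
  where
  "patch_class Np \<Gamma> L W r x = (\<lambda>(y, l). (y - x, l)) ` labelled_patch Np \<Gamma> L W r x"

definition patches ::
    "('p::real_vector \<Rightarrow> real) \<Rightarrow> ('p \<times> 'i) set \<Rightarrow> 'l set \<Rightarrow> ('l \<Rightarrow> 'i set) \<Rightarrow> real \<Rightarrow> ('p \<times> 'l) set set"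
  where
  "patches Np \<Gamma> L W r = patch_class Np \<Gamma> L W r ` cps \<Gamma> L W"

text \<open>Finiteness is included because \<^const>\<open>card\<close> is zero on infinite sets.\<close>

definition property_C ::
    "('p::euclidean_space \<Rightarrow> real) \<Rightarrow> ('p \<times> 'i) set \<Rightarrow> 'l set \<Rightarrow> ('l \<Rightarrow> 'i set) \<Rightarrow> bool" where
  "property_C Np \<Gamma> L W \<longleftrightarrow> (\<exists>C>0. \<forall>\<^sub>F r in at_top.
     finite (patches Np \<Gamma> L W r) \<and> real (card (patches Np \<Gamma> L W r)) \<le> C * r ^ DIM('p))"

definition linearly_repetitive ::
    "('p::real_vector \<Rightarrow> real) \<Rightarrow> ('p \<times> 'i) set \<Rightarrow> 'l set \<Rightarrow> ('l \<Rightarrow> 'i set) \<Rightarrow> bool" where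
  "linearly_repetitive Np \<Gamma> L W \<longleftrightarrow> (\<exists>C>0. \<forall>\<^sub>F r in at_top.
     \<forall>x \<in> cps \<Gamma> L W. \<forall>y \<in> cps \<Gamma> L W. \<exists>z \<in> cps \<Gamma> L W.
       patch_class Np \<Gamma> L W r z = patch_class Np \<Gamma> L W r y \<and>
       labelled_patch Np \<Gamma> L W r z \<subseteq> labelled_patch Np \<Gamma> L W (C * r) x)"


subsection \<open>Flags and generalised vertices\<close>

definition flags :: "'i::euclidean_space set set \<Rightarrow> 'i set set set" where
  "flags \<H> = {f. f \<subseteq> \<H> \<and> finite f \<and> card f = DIM('i) \<and> (\<exists>v. \<Inter>f = {v})}"

definition vertex_differences :: "'i::euclidean_space set set \<Rightarrow> 'i set" where
  "vertex_differences \<H> = {the_elem (\<Inter>f) - the_elem (\<Inter>f') | f f'. f \<in> flags \<H> \<and> f' \<in> flags \<H>}"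


subsection \<open>Stabilisers and decompositions\<close>

definition linear_part :: "'i::real_vector set \<Rightarrow> 'i set" where
  "linear_part H = {x - y | x y. x \<in> H \<and> y \<in> H}"

definition linear_parts :: "'i::real_vector set set \<Rightarrow> 'i set set" where
  "linear_parts \<H> = linear_part ` \<H>"

text \<open>With \<open>S = {V}\<close> this is the stabiliser of a single \<open>V\<close>. The corresponding subspace
  \<open>X\<^sub>S\<close> is written \<open>\<Inter>S\<close>; both conventions for \<open>S = {}\<close> hold automatically.\<close>

definition stabiliser :: "('p \<times> 'i) set \<Rightarrow> 'i set set \<Rightarrow> ('p \<times> 'i) set" where
  "stabiliser \<Gamma> S = {\<gamma> \<in> \<Gamma>. \<forall>V\<in>S. snd \<gamma> \<in> V}"

definition decomposition :: "'i::euclidean_space set set \<Rightarrow> 'i set set set \<Rightarrow> bool" where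
  "decomposition \<H> Q \<longleftrightarrow>
     (\<forall>S\<in>Q. S \<subset> linear_parts \<H>) \<and>
     (\<forall>V \<in> linear_parts \<H>. \<exists>!S. S \<in> Q \<and> V \<notin> S) \<and>
     set_family_sum Inter Q = UNIV"

text \<open>The exponent \<open>\<delta> = (k - n) / n\<close> of a rank \<open>k\<close> subgroup of an \<open>n\<close>-dimensional space.\<close>

definition dioph_exponent :: "nat \<Rightarrow> nat \<Rightarrow> real" where
  "dioph_exponent k n = (real k - real n) / real n"

definition CSR_decomposition ::
    "('p::euclidean_space \<times> 'i::euclidean_space) set \<Rightarrow> 'i set set \<Rightarrow> 'i set set set \<Rightarrow> bool" where
  "CSR_decomposition \<Gamma> \<H> Q \<longleftrightarrow>
     decomposition \<H> Q \<and>
     finite_index (set_family_sum (stabiliser \<Gamma>) Q) \<Gamma> \<and>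
     (\<forall>S\<in>Q. \<forall>V \<in> linear_parts \<H> - S.
        real (int_rank (stabiliser \<Gamma> {V} \<inter> stabiliser \<Gamma> S)) =
          real (int_rank (stabiliser \<Gamma> S))
            - dioph_exponent (int_rank (stabiliser \<Gamma> S)) (dim (\<Inter>S)) - 1)"

text \<open>The image of \<open>A\<close> under the projection to \<open>\<Inter>S\<close> along the sum of the other subspaces.\<close>

definition component :: "'i::euclidean_space set set set \<Rightarrow> 'i set \<Rightarrow> 'i set set \<Rightarrow> 'i set" where
  "component Q A S = {x \<in> \<Inter>S. \<exists>y \<in> set_family_sum Inter (Q - {S}). x + y \<in> A}"


subsection \<open>Diophantine condition\<close>

definition coord_norm :: "'a::real_vector set \<Rightarrow> 'a \<Rightarrow> real" where
  "coord_norm B g = Max ((\<lambda>b. \<bar>real_of_int (int_mod.representation B g b)\<bar>) ` B)"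

definition diophantine ::
    "('a::real_vector \<Rightarrow> real) \<Rightarrow> 'a set \<Rightarrow> 'a set \<Rightarrow> 'a set \<Rightarrow> bool" where
  "diophantine N G X A \<longleftrightarrow> G \<subseteq> X \<and> (\<exists>B. int_basis G B \<and>
     (\<exists>c>0. \<forall>a\<in>A. \<forall>g\<in>G. g \<noteq> 0 \<longrightarrow> g \<noteq> a \<longrightarrow>
        N (g - a) \<ge> c * coord_norm B g powr (- dioph_exponent (int_rank G) (dim X))))"

definition property_DF ::
    "('i::euclidean_space \<Rightarrow> real) \<Rightarrow> ('p::euclidean_space \<times> 'i) set \<Rightarrow> 'i set set \<Rightarrow> 'i set set set \<Rightarrow> bool"
  where
  "property_DF Ni \<Gamma> \<H> Q \<longleftrightarrow> (\<forall>S\<in>Q.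
     diophantine Ni (snd ` stabiliser \<Gamma> S) (\<Inter>S) (component Q (vertex_differences \<H>) S))"

definition refined_lattice :: "nat \<Rightarrow> 'a::real_vector set \<Rightarrow> 'a set" where
  "refined_lattice N G = (\<lambda>\<gamma>. (1 / real N) *\<^sub>R \<gamma>) ` G"

end

theory Submission
  imports Defs
begin

text \<open>
  Fix a flag \<open>f\<close> with edge directions \<open>e\<^sub>H\<close>. Counting ranks, a CSR decomposition forces the subgroups of
  those \<open>\<gamma> \<in> \<Gamma>\<close> whose internal part lies on the line \<open>\<real> e\<^sub>H\<close> to span a subgroup of finite index, the
  one belonging to a hyperplane of type \<open>i\<close> having rank \<open>\<delta>\<^sub>i + 1\<close>; the exponents of the hyperplanes
  of \<open>f\<close> sum to \<open>d\<close>. Let \<open>N\<close> be a common multiple of these indices.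

  From \<open>D\<^sub>F\<close> to LR: the hyperplanes, translated by lattice elements of size \<open>r\<close>, cut the window into
  cells on which the \<open>r\<close>-patch is constant. The vertices of the cells lie in \<open>v(f') + (1/N) \<Gamma>\<close>, so
  exchanging one hyperplane at a vertex and applying \<open>D\<^sub>F\<close> for \<open>(1/N) \<Gamma>\<close> shows that vertices keep a
  distance \<open>c r powr -\<delta>\<^sub>i\<close> from the hyperplanes of type \<open>i\<close> not containing them; hence every cell
  contains a box of these sizes. Boxes of size \<open>r\<close> in physical space and a small multiple of
  \<open>r powr -\<delta>\<^sub>i\<close> in internal space have constant volume and are disjoint modulo \<open>\<Gamma>\<close> by the Diophantine
  condition at \<open>0\<close>, and a packing argument turns this into the statement that every orbit visits
  each such box within \<open>O(r)\<close> steps.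

  From LR to \<open>D\<^sub>F\<close>: translates by at most \<open>O(r ^ d)\<close> lattice elements of the set of points with a
  given \<open>r\<close>-patch cover the window, so no such set lies in a box of volume much smaller than
  \<open>1 / r ^ d\<close>. If \<open>\<gamma>\<close> of size \<open>r\<close> is \<open>\<epsilon>\<close>-close to an element of \<open>F\<^sub>i\<close>, a hyperplane of one flag
  cuts off a cell of width \<open>O(\<epsilon>)\<close> at the vertex of a translated flag; with Dirichlet's theorem on
  the remaining edges one gets a patch located in a box of volume \<open>O(\<epsilon> r powr (\<delta>\<^sub>i - d))\<close>.
\<close>

subsection \<open>Rational linear algebra\<close>

text \<open>No single rate of approximation fits all internal directions, since the summands of a
  CSR decomposition may have different exponents. Estimates are therefore made in the coordinates of
  a flag, given by its normals and the dual edges, with one length scale for each type; this works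
  because every edge lies in the summand of its type. The two directions involve different lattices.
  A vertex of the arrangement has a separate translation for each of its hyperplanes, and it becomes
  a translate of the vertex of a flag only once these translations are split along the edges; this
  costs the factor N. In the converse direction a whole flag is moved by one element of a
  stabiliser, so \<Gamma> itself appears. The obstacle there is that an element of
  \<open>F_i\<close> is only a component of a difference of vertices. It is realised as a full
  difference by a flag that takes its hyperplanes of type i from one flag and the others from
  another. Ranks are handled as dimensions over the rationals, where intersections obey the
  dimension formula.\<close>

definition rat_scale :: "rat \<Rightarrow> 'a::real_vector \<Rightarrow> 'a" where
  "rat_scale q x = of_rat q *\<^sub>R x"

interpretation rat_vs: vector_space "rat_scale :: rat \<Rightarrow> 'a::real_vector \<Rightarrow> 'a"
  by unfold_locales
    (simp_all add: rat_scale_def scaleR_add_right scaleR_add_left of_rat_add of_rat_mult)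

section \<open>Dimension of sets contained in a finitely generated subspace\<close>

context vector_space
begin

text \<open>A Euclidean space has infinite dimension over the rationals, so \<open>dim\<close> is
  controlled only inside the span of a finite set; the statements that follow carry such a set
  F.\<close>

lemma obtain_finite_basis:
  assumes "finite F" and "V \<subseteq> span F"
  obtains B where "B \<subseteq> V" and "finite B" and "independent B" and "V \<subseteq> span B" and "card B = dim V"
proof -
  obtain B where B: "B \<subseteq> V" "independent B" "V \<subseteq> span B" "card B = dim V"
    by (rule basis_exists)
  moreover have "finite B" using independent_span_bound[OF assms(1) B(2)] B(1) assms(2) by blast
  ultimately show ?thesis using that by blast
qed

lemma independent_card_le_dim_finite:
  assumes "finite F" and "V \<subseteq> span F" and "B \<subseteq> V" and "independent B"
  shows "finite B \<and> card B \<le> dim V"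
proof -
  obtain C where "finite C" "V \<subseteq> span C" "card C = dim V"
    using obtain_finite_basis[OF assms(1,2)] by metis
  then show ?thesis using independent_span_bound[of C B] assms(3,4) by auto
qed

lemma dim_mono_finite:
  assumes "finite F" and "V \<subseteq> span F" and "U \<subseteq> V"
  shows "dim U \<le> dim V"
proof -
  obtain B where "B \<subseteq> U" "independent B" "U \<subseteq> span B" "card B = dim U" by (rule basis_exists)
  then show ?thesis using independent_card_le_dim_finite[OF assms(1,2), of B] assms(3) by auto
qed

lemma dim_le_span_finite:
  assumes "finite F" and "V \<subseteq> span F" and "U \<subseteq> V" and "dim V \<le> dim U"
  shows "V \<subseteq> span U"
proof
  fix x assume x: "x \<in> V"
  have "U \<subseteq> span F" using assms by blast
  then obtain B where B: "B \<subseteq> U" "finite B" "independent B" "U \<subseteq> span B" "card B = dim U"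
    using obtain_finite_basis[OF assms(1)] by metis
  show "x \<in> span U"
  proof (rule ccontr)
    assume "x \<notin> span U"
    then have n: "x \<notin> span B" "x \<notin> B"
      using B(1) span_mono span_base by blast+
    then have "card (insert x B) \<le> dim V"
      using independent_card_le_dim_finite[OF assms(1,2), of "insert x B"] independent_insertI B x assms(3)
      by auto
    then show False using n B assms(4) by simp
  qed
qed

text \<open>A basis I of the intersection is extended to bases IA and IB, and IA \<union> (IB - I)
  is shown independent by adding the vectors of IB - I one at a time. If b = a + x with a from the
  span of IA and x from the span of earlier vectors, then a also lies in B, hence in the span of I,
  and b depends on the rest of IB.\<close>

lemma dim_Int_ge_finite:
  assumes "finite F" and "subspace A" and "subspace B" and "subspace C"
    and "A \<subseteq> C" and "B \<subseteq> C" and "C \<subseteq> span F"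
  shows "dim A + dim B \<le> dim C + dim (A \<inter> B)"
proof -
  have "A \<inter> B \<subseteq> span F" using assms by blast
  then obtain I where I: "I \<subseteq> A \<inter> B" "finite I" "independent I" "A \<inter> B \<subseteq> span I" "card I = dim (A \<inter> B)"
    using obtain_finite_basis[OF assms(1)] by metis
  obtain IA where IA: "I \<subseteq> IA" "IA \<subseteq> A" "independent IA" "A \<subseteq> span IA"
    using maximal_independent_subset_extend[of I A] I by blast
  obtain IB where IB: "I \<subseteq> IB" "IB \<subseteq> B" "independent IB" "B \<subseteq> span IB"
    using maximal_independent_subset_extend[of I B] I by blast
  have fA: "finite IA" and fB: "finite IB"
    using independent_card_le_dim_finite[OF assms(1,7)] IA IB assms(5,6) by (meson subset_trans)+
  have ind: "independent (IA \<union> X) \<and> X \<inter> IA = {}" if "X \<subseteq> IB - I" "finite X" for X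
    using that(2,1)
  proof (induction X rule: finite_induct)
    case empty
    then show ?case using IA by simp
  next
    case (insert b X)
    have "b \<notin> span (IA \<union> X)"
    proof
      assume "b \<in> span (IA \<union> X)"
      then obtain a x where ax: "b = a + x" "a \<in> span IA" "x \<in> span X"
        by (auto simp: span_Un)
      have aA: "a \<in> A" using ax(2) IA(2) assms(2) span_minimal by blast
      have "span X \<subseteq> B" using insert.prems IB(2) assms(3) by (intro span_minimal) auto
      then have "x \<in> B" using ax by blast
      moreover have "b \<in> B" using insert.prems IB by blast
      ultimately have "a \<in> B" using ax(1) assms(3) subspace_diff[of B b x] by simp
      then have "a \<in> span I" using aA I(4) by blast
      then have "b \<in> span (I \<union> X)" using ax by (auto simp: span_Un)
      moreover have "I \<union> X \<subseteq> IB - {b}" using insert IB(1) by blast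
      ultimately have "b \<in> span (IB - {b})" using span_mono by blast
      then show False using IB(3) insert.prems dependent_def by auto
    qed
    then show ?case using insert independent_insertI[of b "IA \<union> X"] span_base by auto
  qed
  have X: "independent (IA \<union> (IB - I))" "(IB - I) \<inter> IA = {}"
    using ind[of "IB - I"] fB by auto
  have "card (IA \<union> (IB - I)) \<le> dim C"
    using independent_card_le_dim_finite[OF assms(1,7) _ X(1)] IA(2) IB(2) assms(5,6) by blast
  moreover have "card (IA \<union> (IB - I)) = card IA + (card IB - card I)"
    using X(2) fA fB IB(1) I(2) by (simp add: card_Un_disjoint card_Diff_subset inf.commute)
  moreover have "card IA = dim A" "card IB = dim B"
    using basis_card_eq_dim IA IB by auto
  moreover have "card I \<le> card IB" using IB(1) fB card_mono by blast
  ultimately show ?thesis using I by linarith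
qed

end

subsection \<open>Ranks of subgroups\<close>

lemma int_scale_rat: "int_scale m x = rat_scale (of_int m) x"
  by (simp add: int_scale_def rat_scale_def)

lemma rat_subspace_imp_int_subspace: "rat_vs.subspace G \<Longrightarrow> int_mod.subspace G"
  by (auto simp: rat_vs.subspace_def int_mod.subspace_def int_scale_rat)

lemma common_denominator:
  fixes u :: "'a \<Rightarrow> rat"
  assumes "finite t"
  shows "\<exists>D::int. D > 0 \<and> (\<forall>v\<in>t. \<exists>z::int. of_int D * u v = of_int z)"
  using assms
proof (induction t rule: finite_induct)
  case empty
  then show ?case by (intro exI[of _ 1]) auto
next
  case (insert a t)
  then obtain D where D: "D > 0" "\<forall>v\<in>t. \<exists>z::int. of_int D * u v = of_int z" by auto
  define p q where "p = fst (quotient_of (u a))" and "q = snd (quotient_of (u a))"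
  have q: "q > 0" unfolding q_def by (rule quotient_of_denom_pos')
  have "u a = of_int p / of_int q"
    unfolding p_def q_def by (rule quotient_of_div) simp
  then have "of_int (D * q) * u a = of_int (D * p)"
    using q by simp
  moreover have "\<exists>z::int. of_int (D * q) * u v = of_int z" if v: "v \<in> t" for v
  proof -
    obtain z :: int where "of_int D * u v = of_int z"
      using D(2)[rule_format, OF v] by (elim exE)
    then have "of_int (D * q) * u v = of_int (q * z)"
      by (metis mult.assoc mult.commute of_int_mult)
    then show ?thesis by blast
  qed
  ultimately have "\<forall>v\<in>insert a t. \<exists>z::int. of_int (D * q) * u v = of_int z" by blast
  moreover have "D * q > 0" using D(1) q by simp
  ultimately show ?case by blast
qed

text \<open>Clearing denominators makes a rational relation integral. Ranks of subgroups thereby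
  become rational dimensions.\<close>

lemma int_dependent_iff: "int_mod.dependent B \<longleftrightarrow> rat_vs.dependent B"
proof
  assume "int_mod.dependent B"
  then obtain t u where "finite t" "t \<subseteq> B" "(\<Sum>v\<in>t. int_scale (u v) v) = 0" "\<exists>v\<in>t. u v \<noteq> 0"
    unfolding int_mod.dependent_explicit by blast
  then show "rat_vs.dependent B"
    unfolding rat_vs.dependent_explicit int_scale_rat
    by (intro exI[of _ t] exI[of _ "\<lambda>v. of_int (u v)"]) auto
next
  assume "rat_vs.dependent B"
  then obtain t u where t: "finite t" "t \<subseteq> B" "(\<Sum>v\<in>t. rat_scale (u v) v) = 0" "\<exists>v\<in>t. u v \<noteq> 0"
    unfolding rat_vs.dependent_explicit by blast
  obtain D :: int where D: "D > 0" "\<forall>v\<in>t. \<exists>z::int. of_int D * u v = of_int z"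
    using common_denominator[OF t(1), of u] by blast
  then obtain z :: "'a \<Rightarrow> int" where z: "\<forall>v\<in>t. of_int D * u v = of_int (z v)" by metis
  have "(\<Sum>v\<in>t. int_scale (z v) v) = (\<Sum>v\<in>t. rat_scale (of_int D) (rat_scale (u v) v))"
    by (intro sum.cong refl) (metis z int_scale_rat rat_vs.scale_scale)
  also have "\<dots> = rat_scale (of_int D) (\<Sum>v\<in>t. rat_scale (u v) v)"
    by (simp add: rat_vs.scale_sum_right)
  finally have "(\<Sum>v\<in>t. int_scale (z v) v) = 0" using t by simp
  moreover have "\<exists>v\<in>t. z v \<noteq> 0"
  proof -
    obtain v where v: "v \<in> t" "u v \<noteq> 0" using t by blast
    then have "of_int D * u v \<noteq> 0" using D by simp
    then have "z v \<noteq> 0" using z v by fastforce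
    then show ?thesis using v by blast
  qed
  ultimately show "int_mod.dependent B" unfolding int_mod.dependent_explicit using t by blast
qed

lemma int_span_subset_rat_span: "int_mod.span B \<subseteq> rat_vs.span B"
  by (intro int_mod.span_minimal rat_vs.span_superset rat_subspace_imp_int_subspace rat_vs.subspace_span)

lemma rat_span_real_span: "rat_vs.span B \<subseteq> span B"
proof (rule rat_vs.span_minimal[OF span_superset])
  show "rat_vs.subspace (span B)"
    by (auto simp: rat_vs.subspace_def rat_scale_def span_zero span_add span_scale)
qed

text \<open>A common denominator carries a rational combination into the subgroup. Statements up to
  finite index become statements about rational spans in this way.\<close>

lemma rat_span_subgroup:
  assumes "int_mod.subspace G"
  shows "x \<in> rat_vs.span G \<longleftrightarrow> (\<exists>m::int. m > 0 \<and> of_int m *\<^sub>R x \<in> G)"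
proof
  assume "\<exists>m::int. m > 0 \<and> of_int m *\<^sub>R x \<in> G"
  then obtain m :: int where m: "m > 0" "of_int m *\<^sub>R x \<in> G" by blast
  then have "rat_scale (1 / of_int m) (of_int m *\<^sub>R x) \<in> rat_vs.span G"
    by (intro rat_vs.span_scale rat_vs.span_base)
  moreover have "rat_scale (1 / of_int m) (of_int m *\<^sub>R x) = x"
    using m(1) by (simp add: rat_scale_def of_rat_divide)
  ultimately show "x \<in> rat_vs.span G" by simp
next
  assume "x \<in> rat_vs.span G"
  then obtain t u where t: "finite t" "t \<subseteq> G" "x = (\<Sum>v\<in>t. rat_scale (u v) v)"
    unfolding rat_vs.span_explicit by blast
  obtain D :: int where D: "D > 0" "\<forall>v\<in>t. \<exists>z::int. of_int D * u v = of_int z"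
    using common_denominator[OF t(1), of u] by blast
  then obtain z :: "'a \<Rightarrow> int" where z: "\<forall>v\<in>t. of_int D * u v = of_int (z v)" by metis
  have "of_int D *\<^sub>R x = rat_scale (of_int D) x" by (simp add: rat_scale_def)
  also have "\<dots> = (\<Sum>v\<in>t. int_scale (z v) v)"
    unfolding t(3) rat_vs.scale_sum_right
    by (intro sum.cong refl) (metis z int_scale_rat rat_vs.scale_scale)
  also have "\<dots> \<in> G"
    using t assms by (intro int_mod.subspace_sum int_mod.subspace_scale) auto
  finally show "\<exists>m::int. m > 0 \<and> of_int m *\<^sub>R x \<in> G" using D(1) by blast
qed

text \<open>If m x lies in G and k x in H, then m k x lies in both; for sets that are not subgroups
  the second inclusion can fail. The dimension formula thereby becomes one for ranks.\<close>

lemma rat_span_Int_subgroups: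
  assumes "int_mod.subspace G" and "int_mod.subspace H"
  shows "rat_vs.span (G \<inter> H) = rat_vs.span G \<inter> rat_vs.span H"
proof
  show "rat_vs.span (G \<inter> H) \<subseteq> rat_vs.span G \<inter> rat_vs.span H"
    by (simp add: rat_vs.span_mono)
next
  show "rat_vs.span G \<inter> rat_vs.span H \<subseteq> rat_vs.span (G \<inter> H)"
  proof
    fix x assume x: "x \<in> rat_vs.span G \<inter> rat_vs.span H"
    then obtain m k :: int where m: "m > 0" "of_int m *\<^sub>R x \<in> G" and k: "k > 0" "of_int k *\<^sub>R x \<in> H"
      using rat_span_subgroup assms by blast
    have "of_int (m * k) *\<^sub>R x = int_scale k (of_int m *\<^sub>R x)" "of_int (m * k) *\<^sub>R x = int_scale m (of_int k *\<^sub>R x)"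
      by (simp_all add: int_scale_def mult.commute)
    then have "of_int (m * k) *\<^sub>R x \<in> G \<inter> H"
      using m k assms int_mod.subspace_scale by (metis IntI)
    then show "x \<in> rat_vs.span (G \<inter> H)"
      using rat_span_subgroup int_mod.subspace_inter[OF assms] m k by (metis mult_pos_pos)
  qed
qed

text \<open>\<open>Sup\<close> on \<open>nat\<close> carries information only for bounded sets. The
  finite set F gives the bound, and a rational basis chosen inside G attains it.\<close>

lemma int_rank_eq_dim:
  fixes G :: "'a::real_vector set"
  assumes "finite F" and "G \<subseteq> rat_vs.span F"
  shows "int_rank G = rat_vs.dim G"
  unfolding int_rank_def int_dependent_iff
proof (rule cSup_eq_maximum)
  obtain B where "B \<subseteq> G" "finite B" "rat_vs.independent B" "card B = rat_vs.dim G"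
    by (rule rat_vs.obtain_finite_basis[OF assms])
  then show "rat_vs.dim G \<in> {card B |B. finite B \<and> B \<subseteq> G \<and> rat_vs.independent B}" by force
next
  fix x assume "x \<in> {card B |B. finite B \<and> B \<subseteq> G \<and> rat_vs.independent B}"
  then show "x \<le> rat_vs.dim G"
    using rat_vs.independent_card_le_dim_finite[OF assms] by blast
qed

lemma int_rank_Int_ge:
  fixes G H K :: "'a::real_vector set"
  assumes "finite F" and "int_mod.subspace G" and "int_mod.subspace H"
    and "G \<subseteq> K" and "H \<subseteq> K" and "K \<subseteq> rat_vs.span F"
  shows "int_rank G + int_rank H \<le> int_rank K + int_rank (G \<inter> H)"
proof -
  have sub: "rat_vs.span G \<subseteq> rat_vs.span K" "rat_vs.span H \<subseteq> rat_vs.span K" "rat_vs.span K \<subseteq> rat_vs.span F"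
    using assms(4-6) by (simp_all add: rat_vs.span_mono rat_vs.span_minimal)
  have "rat_vs.dim (rat_vs.span G) + rat_vs.dim (rat_vs.span H) \<le>
      rat_vs.dim (rat_vs.span K) + rat_vs.dim (rat_vs.span G \<inter> rat_vs.span H)"
    by (intro rat_vs.dim_Int_ge_finite[OF assms(1) _ _ _ sub] rat_vs.subspace_span)
  also have "rat_vs.span G \<inter> rat_vs.span H = rat_vs.span (G \<inter> H)"
    using rat_span_Int_subgroups[OF assms(2,3)] by simp
  finally have *: "rat_vs.dim G + rat_vs.dim H \<le> rat_vs.dim K + rat_vs.dim (G \<inter> H)"
    by (simp only: rat_vs.dim_span)
  have "G \<subseteq> rat_vs.span F" "H \<subseteq> rat_vs.span F" "G \<inter> H \<subseteq> rat_vs.span F"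
    using assms by auto
  then show ?thesis using * int_rank_eq_dim[OF assms(1)] assms(6) by metis
qed

text \<open>Induction on the basis: unless they all vanish, the b-coordinates of G have a least
  positive value m, and they are all multiples of it. An element with b-coordinate m is added to a
  basis of the part of G without b.\<close>

lemma int_basis_of_subgroup:
  fixes B G :: "'a::real_vector set"
  assumes "finite B" and "int_mod.independent B" and "int_mod.subspace G" and "G \<subseteq> int_mod.span B"
  shows "\<exists>B'. int_basis G B'"
  using assms
proof (induction B arbitrary: G rule: finite_induct)
  case empty
  then have "G = {0}" using int_mod.subspace_0 by auto
  then show ?case unfolding int_basis_def by (intro exI[of _ "{}"]) (auto simp: int_dependent_iff rat_vs.independent_empty)
next
  case (insert b B G)
  have indB: "int_mod.independent B" using insert.prems(1) int_mod.independent_mono by blast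
  let ?c = "\<lambda>g. int_mod.representation (insert b B) g b"
  have repr: "g - int_scale (?c g) b \<in> int_mod.span B" if "g \<in> int_mod.span (insert b B)" for g
  proof -
    have "g = (\<Sum>x\<in>insert b B. int_scale (int_mod.representation (insert b B) g x) x)"
      using int_mod.sum_representation_eq[OF insert.prems(1) that _ subset_refl] insert.hyps by simp
    also have "\<dots> = int_scale (?c g) b + (\<Sum>x\<in>B. int_scale (int_mod.representation (insert b B) g x) x)"
      using insert.hyps by simp
    finally have "g - int_scale (?c g) b = (\<Sum>x\<in>B. int_scale (int_mod.representation (insert b B) g x) x)"
      by (simp add: algebra_simps)
    then show ?thesis by (simp add: int_mod.span_sum int_mod.span_scale int_mod.span_base)
  qed
  have G: "int_mod.subspace (G \<inter> int_mod.span B)"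
    using insert.prems int_mod.subspace_inter by blast
  obtain B0 where B0: "int_basis (G \<inter> int_mod.span B) B0"
    using insert.IH[OF indB G] by blast
  show ?case
  proof (cases "\<exists>g\<in>G. ?c g > 0")
    case False
    have "?c g = 0" if "g \<in> G" for g
    proof -
      have "?c (- g) = - ?c g"
        using int_mod.representation_neg[OF insert.prems(1)] that insert.prems by auto
      moreover have "- g \<in> G" using that insert.prems int_mod.subspace_neg by blast
      ultimately have "\<not> 0 < ?c g" "\<not> 0 < - ?c g" using False that by metis+
      then show ?thesis by linarith
    qed
    then have "G \<subseteq> int_mod.span B" using repr insert.prems by fastforce
    then show ?thesis using B0 by (metis inf.absorb1)
  next
    case True
    define m where "m = (LEAST m::nat. m > 0 \<and> (\<exists>g\<in>G. ?c g = int m))"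
    have ex: "\<exists>m::nat. m > 0 \<and> (\<exists>g\<in>G. ?c g = int m)"
      using True by (metis zero_less_imp_eq_int)
    have m: "m > 0" "\<exists>g\<in>G. ?c g = int m"
      using LeastI_ex[OF ex] unfolding m_def by auto
    have least: "n \<ge> m" if "n > 0" "g \<in> G" "?c g = int n" for n g
      unfolding m_def using that by (intro Least_le) auto
    obtain g0 where g0: "g0 \<in> G" "?c g0 = int m" using m by blast
    have sub: "g \<in> int_mod.span (insert g0 B0)" if g: "g \<in> G" for g
    proof -
      \<comment> \<open>Division with remainder: the b-coordinate of h \<in> G is the remainder
        modulo m, so it vanishes by the choice of m.\<close>
      define q where "q = ?c g div int m"
      define h where "h = g - int_scale q g0"
      have h: "h \<in> G" unfolding h_def using g g0 insert.prems(2)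
        by (intro int_mod.subspace_diff int_mod.subspace_scale) auto
      have "?c h = ?c g - q * int m"
        unfolding h_def using g g0 insert.prems
        by (subst int_mod.representation_diff[OF insert.prems(1)])
           (auto simp: int_mod.representation_scale[OF insert.prems(1)] intro!: int_mod.span_scale)
      then have ch: "?c h = ?c g mod int m" unfolding q_def
        by (simp add: minus_div_mult_eq_mod)
      have "?c h = 0"
      proof (rule ccontr)
        assume "?c h \<noteq> 0"
        moreover have "?c h \<ge> 0" "?c h < int m" using ch m by auto
        ultimately have "nat (?c h) > 0" "?c h = int (nat (?c h))" by auto
        then have "m \<le> nat (?c h)" using least h by blast
        then show False using \<open>?c h < int m\<close> \<open>?c h \<ge> 0\<close> by linarith
      qed
      then have "h \<in> G \<inter> int_mod.span B" using repr[of h] h insert.prems by auto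
      then have "h \<in> int_mod.span B0" using B0 unfolding int_basis_def by simp
      then show ?thesis unfolding int_mod.span_insert h_def by blast
    qed
    have B0G: "B0 \<subseteq> G \<inter> int_mod.span B" using B0 int_mod.span_superset unfolding int_basis_def by blast
    \<comment> \<open>A multiple k g0 in the span of B would have b-coordinate 0, whereas it is k
      m.\<close>
    have nin: "g0 \<notin> rat_vs.span B0"
    proof
      assume "g0 \<in> rat_vs.span B0"
      moreover have "rat_vs.span B0 \<subseteq> rat_vs.span (int_mod.span B)"
        using B0G by (intro rat_vs.span_mono) auto
      ultimately obtain k :: int where k: "k > 0" "of_int k *\<^sub>R g0 \<in> int_mod.span B"
        using rat_span_subgroup[OF int_mod.subspace_span] by blast
      then have kg: "int_scale k g0 \<in> int_mod.span B" by (simp add: int_scale_def)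
      have "?c (int_scale k g0) = k * int m"
        using int_mod.representation_scale[OF insert.prems(1), of g0 k] g0 insert.prems by auto
      moreover have "?c (int_scale k g0) = 0"
        using int_mod.representation_extend[OF insert.prems(1) kg subset_insertI] insert.hyps
          int_mod.representation_ne_zero[of B "int_scale k g0" b] by auto
      ultimately show False using k m by auto
    qed
    have "rat_vs.independent (insert g0 B0)"
      using nin B0 unfolding int_basis_def int_dependent_iff by (intro rat_vs.independent_insertI) auto
    moreover have "int_mod.span (insert g0 B0) \<subseteq> G"
      using g0 B0G insert.prems by (intro int_mod.span_minimal) auto
    ultimately have "int_basis G (insert g0 B0)"
      using sub B0 unfolding int_basis_def int_dependent_iff by auto
    then show ?thesis by blast
  qed
qed

subsection \<open>Packing and covering by boxes\<close>

text \<open>Volumes are taken in coordinates, in a product of copies of \<open>lborel\<close>. The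
  boxes are later given by linear functionals, and no determinant of a change of coordinates
  enters.\<close>

lemma emeasure_box:
  fixes l u :: "'j \<Rightarrow> real"
  assumes "finite J" and "\<And>j. j \<in> J \<Longrightarrow> l j \<le> u j"
  shows "emeasure (PiM J (\<lambda>_. lborel)) (\<Pi>\<^sub>E j\<in>J. {l j..u j}) = ennreal (\<Prod>j\<in>J. u j - l j)"
proof -
  interpret product_sigma_finite "\<lambda>_::'j. lborel :: real measure"
    by unfold_locales
  have "emeasure (PiM J (\<lambda>_. lborel)) (\<Pi>\<^sub>E j\<in>J. {l j..u j}) = (\<Prod>j\<in>J. emeasure lborel {l j..u j})"
    using assms by (intro emeasure_PiM) auto
  also have "\<dots> = (\<Prod>j\<in>J. ennreal (u j - l j))"
    using assms by (intro prod.cong) auto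
  also have "\<dots> = ennreal (\<Prod>j\<in>J. u j - l j)"
    using assms by (intro prod_ennreal) auto
  finally show ?thesis .
qed

lemma sets_box: "finite J \<Longrightarrow> (\<Pi>\<^sub>E j\<in>J. {l j..u j::real}) \<in> sets (PiM J (\<lambda>_. lborel))"
  by (intro sets_PiM_I_finite) auto

text \<open>Subadditivity of volume. It will bound from below the region of a patch whose translates
  cover a fixed box in the window.\<close>

lemma box_cover:
  fixes l u s :: "'j \<Rightarrow> real" and c :: "'t \<Rightarrow> 'j \<Rightarrow> real"
  assumes "finite J" and "finite T" and lu: "\<And>j. j \<in> J \<Longrightarrow> l j \<le> u j" and s: "\<And>j. j \<in> J \<Longrightarrow> 0 \<le> s j"
    and cov: "\<And>x. (\<And>j. j \<in> J \<Longrightarrow> l j \<le> x j \<and> x j \<le> u j) \<Longrightarrow> \<exists>t\<in>T. \<forall>j\<in>J. \<bar>x j - c t j\<bar> \<le> s j"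
  shows "(\<Prod>j\<in>J. u j - l j) \<le> real (card T) * (\<Prod>j\<in>J. 2 * s j)"
proof -
  let ?M = "PiM J (\<lambda>_. lborel :: real measure)"
  let ?B = "\<lambda>t. \<Pi>\<^sub>E j\<in>J. {c t j - s j..c t j + s j}"
  have sub: "(\<Pi>\<^sub>E j\<in>J. {l j..u j}) \<subseteq> (\<Union>t\<in>T. ?B t)"
  proof
    fix x assume x: "x \<in> (\<Pi>\<^sub>E j\<in>J. {l j..u j})"
    then obtain t where "t \<in> T" "\<forall>j\<in>J. \<bar>x j - c t j\<bar> \<le> s j"
      using cov[of x] by (auto simp: PiE_iff)
    with x show "x \<in> (\<Union>t\<in>T. ?B t)" by (auto simp: PiE_iff abs_le_iff algebra_simps)
  qed
  have "ennreal (\<Prod>j\<in>J. u j - l j) = emeasure ?M (\<Pi>\<^sub>E j\<in>J. {l j..u j})"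
    using emeasure_box[OF assms(1) lu] by simp
  also have "\<dots> \<le> emeasure ?M (\<Union>t\<in>T. ?B t)"
    using assms by (intro emeasure_mono sub sets.finite_UN sets_box) auto
  also have "\<dots> \<le> (\<Sum>t\<in>T. emeasure ?M (?B t))"
    using assms by (intro emeasure_subadditive_finite) (auto intro!: sets_box)
  also have "\<dots> = (\<Sum>t\<in>T. ennreal (\<Prod>j\<in>J. 2 * s j))"
    using s by (intro sum.cong refl, subst emeasure_box[OF assms(1)]) (auto simp: add_increasing2 algebra_simps)
  also have "\<dots> = ennreal (real (card T) * (\<Prod>j\<in>J. 2 * s j))"
    using s by (simp add: ennreal_mult prod_nonneg flip: ennreal_of_nat_eq_real_of_nat)
  finally show ?thesis
    using s by (simp add: ennreal_le_iff prod_nonneg)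
qed

text \<open>Additivity of volume over disjoint boxes. It serves both to count lattice points and to
  bound the height in the covering argument.\<close>

lemma box_pack:
  fixes l u s :: "'j \<Rightarrow> real" and c :: "'t \<Rightarrow> 'j \<Rightarrow> real"
  assumes "finite J" and "finite T" and lu: "\<And>j. j \<in> J \<Longrightarrow> l j \<le> u j" and s: "\<And>j. j \<in> J \<Longrightarrow> 0 \<le> s j"
    and inside: "\<And>t j. t \<in> T \<Longrightarrow> j \<in> J \<Longrightarrow> l j \<le> c t j - s j \<and> c t j + s j \<le> u j"
    and disj: "\<And>t t' x. t \<in> T \<Longrightarrow> t' \<in> T \<Longrightarrow> (\<And>j. j \<in> J \<Longrightarrow> \<bar>x j - c t j\<bar> \<le> s j) \<Longrightarrow>
      (\<And>j. j \<in> J \<Longrightarrow> \<bar>x j - c t' j\<bar> \<le> s j) \<Longrightarrow> t = t'"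
  shows "real (card T) * (\<Prod>j\<in>J. 2 * s j) \<le> (\<Prod>j\<in>J. u j - l j)"
proof -
  let ?M = "PiM J (\<lambda>_. lborel :: real measure)"
  let ?B = "\<lambda>t. \<Pi>\<^sub>E j\<in>J. {c t j - s j..c t j + s j}"
  have dj: "disjoint_family_on ?B T"
    unfolding disjoint_family_on_def
  proof (intro ballI impI)
    fix t t' assume t: "t \<in> T" "t' \<in> T" "t \<noteq> t'"
    show "?B t \<inter> ?B t' = {}"
    proof (rule ccontr)
      assume "?B t \<inter> ?B t' \<noteq> {}"
      then obtain x where x: "x \<in> ?B t" "x \<in> ?B t'" by blast
      have "\<bar>x j - c t j\<bar> \<le> s j" "\<bar>x j - c t' j\<bar> \<le> s j" if "j \<in> J" for j
        using x that unfolding PiE_iff by (fastforce simp: abs_le_iff)+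
      then show False using disj[of t t' x] t by blast
    qed
  qed
  have "ennreal (real (card T) * (\<Prod>j\<in>J. 2 * s j)) = (\<Sum>t\<in>T. ennreal (\<Prod>j\<in>J. 2 * s j))"
    using s by (simp add: ennreal_mult prod_nonneg flip: ennreal_of_nat_eq_real_of_nat)
  also have "\<dots> = (\<Sum>t\<in>T. emeasure ?M (?B t))"
    using s by (intro sum.cong refl, subst emeasure_box[OF assms(1)]) (auto simp: add_increasing2 algebra_simps)
  also have "\<dots> = emeasure ?M (\<Union>t\<in>T. ?B t)"
    using assms dj by (intro sum_emeasure) (auto intro!: sets_box)
  also have "\<dots> \<le> emeasure ?M (\<Pi>\<^sub>E j\<in>J. {l j..u j})"
  proof (intro emeasure_mono sets_box assms(1) UN_least)
    fix t assume t: "t \<in> T"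
    show "?B t \<subseteq> (\<Pi>\<^sub>E j\<in>J. {l j..u j})"
      by (rule PiE_mono) (use inside[OF t] in auto)
  qed
  also have "\<dots> = ennreal (\<Prod>j\<in>J. u j - l j)"
    using emeasure_box[OF assms(1) lu] by simp
  finally show ?thesis
    using lu by (subst (asm) ennreal_le_iff) (auto intro!: prod_nonneg)
qed

subsection \<open>Norms\<close>

text \<open>The basis vectors give the upper bound and with it Lipschitz continuity of N; the
  minimum over the unit sphere gives the lower bound.\<close>

lemma is_norm_equivalent:
  fixes N :: "'a::euclidean_space \<Rightarrow> real"
  assumes "is_norm N"
  shows "\<exists>C>0. \<forall>x. norm x \<le> C * N x \<and> N x \<le> C * norm x"
proof -
  have zero: "N x = 0 \<longleftrightarrow> x = 0" and tri: "N (x + y) \<le> N x + N y" and hom: "N (c *\<^sub>R x) = \<bar>c\<bar> * N x" for x y c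
    using assms unfolding is_norm_def by auto
  have neg: "N (- x) = N x" for x using hom[of "-1" x] by simp
  have nonneg: "N x \<ge> 0" for x using tri[of x "- x"] neg[of x] zero[of 0] by simp
  have sumle: "N (sum f A) \<le> (\<Sum>b\<in>A. N (f b))" if "finite A" for f :: "'a \<Rightarrow> 'a" and A
    using that
  proof (induction A rule: finite_induct)
    case empty
    then show ?case using zero[of 0] by simp
  next
    case (insert x F)
    then show ?case using tri[of "f x" "sum f F"] by simp
  qed
  define K where "K = (\<Sum>b\<in>(Basis::'a set). N b)"
  have up: "N x \<le> K * norm x" for x
  proof -
    have "N x = N (\<Sum>b\<in>Basis. (x \<bullet> b) *\<^sub>R b)" by (simp add: euclidean_representation)
    also have "\<dots> \<le> (\<Sum>b\<in>Basis. \<bar>x \<bullet> b\<bar> * N b)" using sumle[of Basis "\<lambda>b. (x \<bullet> b) *\<^sub>R b"] hom by simp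
    also have "\<dots> \<le> (\<Sum>b\<in>Basis. norm x * N b)"
      by (intro sum_mono mult_right_mono nonneg Basis_le_norm)
    finally show ?thesis by (simp add: K_def sum_distrib_left mult.commute)
  qed
  have lip: "\<bar>N x - N y\<bar> \<le> K * norm (x - y)" for x y
    using tri[of "x - y" y] tri[of "y - x" x] up[of "x - y"] neg[of "x - y"] by simp
  have cont: "continuous_on S N" for S
  proof -
    have "K \<ge> 0" unfolding K_def by (simp add: sum_nonneg nonneg)
    then have "K-lipschitz_on S N"
      unfolding lipschitz_on_def using lip by (simp add: dist_norm)
    then show ?thesis by (rule lipschitz_on_continuous_on)
  qed
  obtain b :: 'a where b: "b \<in> Basis" using nonempty_Basis by blast
  have "\<exists>x\<in>sphere (0::'a) 1. \<forall>y\<in>sphere 0 1. N x \<le> N y"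
    using b by (intro continuous_attains_inf cont compact_sphere) (auto intro!: exI[of _ b])
  then obtain x0 :: 'a where x0: "norm x0 = 1" "\<And>y. norm y = 1 \<Longrightarrow> N x0 \<le> N y" by auto
  have m: "N x0 > 0" using x0(1) zero[of x0] nonneg[of x0] by force
  have low: "N x0 * norm x \<le> N x" for x
  proof (cases "x = 0")
    case False
    have "N x0 \<le> N ((1 / norm x) *\<^sub>R x)" using False by (intro x0) simp
    then have "N x0 \<le> N x / norm x" using hom by simp
    then show ?thesis using False by (simp add: field_simps)
  qed (use zero[of 0] in simp)
  let ?C = "max K (1 / N x0)"
  have "?C > 0" using m by (simp add: less_max_iff_disj)
  moreover have "norm x \<le> ?C * N x \<and> N x \<le> ?C * norm x" for x
  proof
    have "norm x \<le> (1 / N x0) * N x" using low[of x] m by (simp add: field_simps)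
    also have "\<dots> \<le> ?C * N x" by (intro mult_right_mono nonneg) simp
    finally show "norm x \<le> ?C * N x" .
    have "N x \<le> K * norm x" by (rule up)
    also have "\<dots> \<le> ?C * norm x" by (intro mult_right_mono) simp_all
    finally show "N x \<le> ?C * norm x" .
  qed
  ultimately show ?thesis by blast
qed

subsection \<open>Lattices\<close>

lemma lattice_basis:
  fixes \<Gamma> :: "'a::euclidean_space set"
  assumes "is_lattice \<Gamma>"
  obtains B where "finite B" "independent B" "rat_vs.independent B" "span B = UNIV" "card B = DIM('a)"
    "\<Gamma> = int_mod.span B" "rat_vs.span \<Gamma> = rat_vs.span B"
proof -
  obtain B where B: "independent B" "span B = UNIV" "\<Gamma> = int_mod.span B"
    using assms unfolding is_lattice_def by blast
  have "finite B" using B(1) independent_imp_finite by blast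
  moreover have "card B = DIM('a)" using B by (metis dim_UNIV dim_span dim_eq_card_independent)
  moreover have "rat_vs.independent B"
  proof
    assume "rat_vs.dependent B"
    then obtain b where b: "b \<in> B" "b \<in> rat_vs.span (B - {b})" unfolding rat_vs.dependent_def by blast
    then have "b \<in> span (B - {b})" using rat_span_real_span by blast
    then show False using B(1) b(1) unfolding dependent_def by blast
  qed
  moreover have "rat_vs.span \<Gamma> = rat_vs.span B"
  proof
    show "rat_vs.span \<Gamma> \<subseteq> rat_vs.span B"
      unfolding B(3) by (intro rat_vs.span_minimal int_span_subset_rat_span rat_vs.subspace_span)
    show "rat_vs.span B \<subseteq> rat_vs.span \<Gamma>"
      unfolding B(3) by (intro rat_vs.span_mono int_mod.span_superset)
  qed
  ultimately show ?thesis using that B by blast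
qed

lemma lattice_subspace: "is_lattice \<Gamma> \<Longrightarrow> int_mod.subspace \<Gamma>"
  unfolding is_lattice_def by auto

lemma lattice_rank:
  fixes \<Gamma> :: "'a::euclidean_space set"
  assumes "is_lattice \<Gamma>"
  shows "int_rank \<Gamma> = DIM('a)"
proof -
  obtain B where B: "finite B" "rat_vs.independent B" "card B = DIM('a)" "rat_vs.span \<Gamma> = rat_vs.span B"
    using lattice_basis[OF assms] by metis
  have "int_rank \<Gamma> = rat_vs.dim \<Gamma>"
    using B rat_vs.span_superset by (intro int_rank_eq_dim[OF B(1)]) blast
  also have "\<dots> = card B"
    using B rat_vs.dim_span rat_vs.dim_span_eq_card_independent by metis
  finally show ?thesis using B by simp
qed

text \<open>Extended to a rational basis of the span of \<Gamma>, the set S has at most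
  \<open>DIM('a)\<close> elements and spans the space over the reals, so it is part of a real basis.
  For subsets of the space that lie in no lattice this fails.\<close>

lemma lattice_independent:
  fixes \<Gamma> :: "'a::euclidean_space set"
  assumes "is_lattice \<Gamma>" and "S \<subseteq> \<Gamma>" and "rat_vs.independent S"
  shows "independent S" and "finite S"
proof -
  obtain B where B: "finite B" "rat_vs.independent B" "card B = DIM('a)" "span B = UNIV"
     "rat_vs.span \<Gamma> = rat_vs.span B"
    using lattice_basis[OF assms(1)] by metis
  have SB: "S \<subseteq> rat_vs.span B" using assms(2) B(5) rat_vs.span_superset by blast
  obtain T where T: "S \<subseteq> T" "T \<subseteq> rat_vs.span B" "rat_vs.independent T" "rat_vs.span B \<subseteq> rat_vs.span T"
    using rat_vs.maximal_independent_subset_extend[OF SB assms(3)] by blast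
  have fT: "finite T" "card T \<le> card B"
    using rat_vs.independent_span_bound[OF B(1) T(3,2)] by auto
  have "B \<subseteq> span T" using T(4) rat_vs.span_superset[of B] rat_span_real_span[of T] by blast
  then have "span T = UNIV" using B(4) by (metis span_mono span_span top.extremum_uniqueI)
  then have "independent T"
    using card_le_dim_spanning[of T UNIV] fT B(3) by auto
  then show "independent S" using T(1) independent_mono by blast
  show "finite S" using T(1) fT finite_subset by blast
qed

lemma lattice_subgroup_basis:
  fixes \<Gamma> :: "'a::euclidean_space set"
  assumes "is_lattice \<Gamma>" and "int_mod.subspace G" and "G \<subseteq> \<Gamma>"
  obtains B where "int_basis G B" "finite B" "rat_vs.independent B" "independent B" "int_mod.span B = G" "card B = int_rank G"
proof -
  obtain A where A: "finite A" "rat_vs.independent A" "\<Gamma> = int_mod.span A"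
    using lattice_basis[OF assms(1)] by metis
  obtain B where B: "int_basis G B"
    using int_basis_of_subgroup[of A G] A assms int_dependent_iff by blast
  then have B': "finite B" "rat_vs.independent B" "int_mod.span B = G" "B \<subseteq> G"
    unfolding int_basis_def int_dependent_iff using int_mod.span_superset by auto
  have "G \<subseteq> rat_vs.span B" using B'(3) int_span_subset_rat_span by blast
  then have "card B = int_rank G"
    using int_rank_eq_dim[OF B'(1)] rat_vs.basis_card_eq_dim[OF B'(4) _ B'(2)] by simp
  moreover have "independent B" using lattice_independent[OF assms(1) _ B'(2)] B'(4) assms(3) by blast
  ultimately show ?thesis using that B B' by blast
qed

section \<open>Additive functions on subgroups of a lattice\<close>

lemma additive_int_scale:
  fixes \<psi> :: "'a::real_vector \<Rightarrow> 'b::real_vector"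
  assumes G: "int_mod.subspace G" and add: "\<And>x y. x \<in> G \<Longrightarrow> y \<in> G \<Longrightarrow> \<psi> (x + y) = \<psi> x + \<psi> y"
    and x: "x \<in> G"
  shows "\<psi> (int_scale m x) = int_scale m (\<psi> x)"
proof -
  have 0: "\<psi> 0 = 0" using add[of 0 0] int_mod.subspace_0[OF G] by simp
  have nat: "\<psi> (int_scale (int k) x) = int_scale (int k) (\<psi> x)" for k
  proof (induction k)
    case (Suc k)
    have "int_scale (int (Suc k)) x = int_scale (int k) x + x" by (simp add: int_scale_def scaleR_add_left)
    then show ?case
      using add[of "int_scale (int k) x" x] x int_mod.subspace_scale[OF G x, of "int k"] Suc
      by (simp add: int_scale_def scaleR_add_left add.commute)
  qed (simp add: 0)
  show ?thesis
  proof (cases "m \<ge> 0")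
    case True
    then show ?thesis using nat[of "nat m"] by simp
  next
    case False
    have "int_scale m x = - int_scale (int (nat (- m))) x" using False by (simp add: int_scale_def)
    moreover have "\<psi> (- y) = - \<psi> y" if "y \<in> G" for y
      using add[of y "- y"] that int_mod.subspace_neg[OF G] 0 by (simp add: eq_neg_iff_add_eq_0 add.commute)
    ultimately have "\<psi> (int_scale m x) = - int_scale (int (nat (- m))) (\<psi> x)"
      using nat[of "nat (- m)"] int_mod.subspace_scale[OF G x] by simp
    then show ?thesis using False by (simp add: int_scale_def)
  qed
qed

text \<open>An integral basis of G is linearly independent over the reals, so an additive function
  on G is the restriction of a linear map. Coordinates and edge components of lattice elements are
  bounded in this way.\<close>

lemma additive_bounded:
  fixes \<Gamma> :: "'a::euclidean_space set" and \<psi> :: "'a \<Rightarrow> 'b::real_normed_vector"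
  assumes "is_lattice \<Gamma>" and G: "int_mod.subspace G" and "G \<subseteq> \<Gamma>"
    and add: "\<And>x y. x \<in> G \<Longrightarrow> y \<in> G \<Longrightarrow> \<psi> (x + y) = \<psi> x + \<psi> y"
  shows "\<exists>C>0. \<forall>g\<in>G. norm (\<psi> g) \<le> C * norm g"
proof -
  obtain B where B: "finite B" "independent B" "int_mod.span B = G"
    using lattice_subgroup_basis[OF assms(1-3)] by metis
  obtain f where f: "linear f" "\<forall>x\<in>B. f x = \<psi> x"
    using linear_independent_extend[OF B(2)] by blast
  have eq: "g \<in> G \<and> f g = \<psi> g" if "g \<in> int_mod.span B" for g
    using that
  proof (induction rule: int_mod.span_induct_alt)
    case base
    show ?case using f linear_0 add[of 0 0] int_mod.subspace_0[OF G] by force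
  next
    case (step c x y)
    then have xy: "x \<in> G" "y \<in> G" "int_scale c x \<in> G"
      using B(3) int_mod.span_base int_mod.subspace_scale[OF G] by auto
    then have "\<psi> (int_scale c x + y) = int_scale c (\<psi> x) + \<psi> y"
      using add additive_int_scale[OF G add] by simp
    then show ?case using step f xy int_mod.subspace_add[OF G]
      by (simp add: linear_add linear_scale int_scale_def)
  qed
  obtain C where "C > 0" "\<forall>x. norm (f x) \<le> C * norm x"
    using linear_bounded_pos[OF f(1)] by blast
  then show ?thesis using eq B(3) by (metis)
qed

text \<open>Coordinates are integers bounded by a multiple of \<open>norm g\<close>, and some
  coordinate of a non-zero g is at least 1 in absolute value.\<close>

lemma lattice_discrete:
  fixes \<Gamma> :: "'a::euclidean_space set"
  assumes "is_lattice \<Gamma>"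
  shows "\<exists>\<epsilon>>0. \<forall>g\<in>\<Gamma>. g \<noteq> 0 \<longrightarrow> \<epsilon> \<le> norm g"
proof -
  note sub = lattice_subspace[OF assms]
  obtain B where B: "finite B" "int_mod.independent B" "int_mod.span B = \<Gamma>"
    using lattice_subgroup_basis[OF assms sub subset_refl] int_dependent_iff by metis
  define \<psi> :: "'a \<Rightarrow> real" where "\<psi> g = (\<Sum>b\<in>B. of_int (int_mod.representation B g b))" for g
  have "\<exists>C>0. \<forall>g\<in>\<Gamma>. norm (real_of_int (int_mod.representation B g b)) \<le> C * norm g" for b
    using B int_mod.representation_add[OF B(2)] by (intro additive_bounded[OF assms sub]) auto
  then obtain C where C: "\<And>b. C b > 0" "\<And>b g. g \<in> \<Gamma> \<Longrightarrow> norm (real_of_int (int_mod.representation B g b)) \<le> C b * norm g"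
    by metis
  \<comment> \<open>The sum dominates each \<open>C b\<close>; the 1 keeps the constant positive for
    an empty index set. Constants of this shape recur.\<close>
  define D where "D = 1 + (\<Sum>b\<in>B. C b)"
  have "D > 0" unfolding D_def using C(1) by (simp add: add_pos_nonneg less_imp_le sum_nonneg)
  moreover have "1 / D \<le> norm g" if g: "g \<in> \<Gamma>" "g \<noteq> 0" for g
  proof -
    have "\<exists>b\<in>B. int_mod.representation B g b \<noteq> 0"
    proof (rule ccontr)
      assume "\<not> (\<exists>b\<in>B. int_mod.representation B g b \<noteq> 0)"
      then have "(\<Sum>b\<in>B. int_scale (int_mod.representation B g b) b) = 0" by simp
      then show False
        using int_mod.sum_representation_eq[OF B(2) _ B(1) subset_refl, of g] g B(3) by simp
    qed
    then obtain b where b: "b \<in> B" "int_mod.representation B g b \<noteq> 0" by blast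
    then have "1 \<le> norm (real_of_int (int_mod.representation B g b))" by simp
    also have "\<dots> \<le> C b * norm g" using C(2) g by blast
    also have "\<dots> \<le> D * norm g"
    proof (rule mult_right_mono)
      have "C b \<le> (\<Sum>b\<in>B. C b)" using B(1) b(1) C(1) by (intro member_le_sum) (auto intro: less_imp_le)
      then show "C b \<le> D" unfolding D_def by simp
    qed simp
    finally show ?thesis using \<open>D > 0\<close> by (simp add: field_simps)
  qed
  ultimately show ?thesis by (intro exI[of _ "1 / D"]) auto
qed

subsection \<open>Dual systems and lattice point counts\<close>

text \<open>A basis e together with its coordinate functionals a. The index set is kept abstract so
  that the normals of a flag can be indexed by its hyperplanes.\<close>

definition dual_system :: "'j set \<Rightarrow> ('j \<Rightarrow> 'a::euclidean_space) \<Rightarrow> ('j \<Rightarrow> 'a) \<Rightarrow> bool" where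
  "dual_system J a e \<longleftrightarrow> finite J \<and> (\<forall>j\<in>J. \<forall>k\<in>J. a j \<bullet> e k = (if j = k then 1 else 0)) \<and>
     (\<forall>x. x = (\<Sum>j\<in>J. (a j \<bullet> x) *\<^sub>R e j))"

lemma dual_systemD:
  assumes "dual_system J a e"
  shows "finite J" and "j \<in> J \<Longrightarrow> k \<in> J \<Longrightarrow> a j \<bullet> e k = (if j = k then 1 else 0)"
    and "x = (\<Sum>j\<in>J. (a j \<bullet> x) *\<^sub>R e j)"
  using assms unfolding dual_system_def by blast+

lemma dual_system_eqI:
  assumes "dual_system J a e" and "\<And>j. j \<in> J \<Longrightarrow> a j \<bullet> x = a j \<bullet> y"
  shows "x = y"
  using assms(2) dual_systemD(3)[OF assms(1), of x] dual_systemD(3)[OF assms(1), of y]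
  by (metis (no_types, lifting) sum.cong)

lemma dual_system_sum:
  assumes "dual_system J a e" and "j \<in> J"
  shows "a j \<bullet> (\<Sum>k\<in>J. c k *\<^sub>R e k) = c j"
proof -
  have "a j \<bullet> (\<Sum>k\<in>J. c k *\<^sub>R e k) = (\<Sum>k\<in>J. if j = k then c k else 0)"
    unfolding inner_sum_right using dual_systemD(2)[OF assms]
    by (intro sum.cong) auto
  then show ?thesis using assms(2) dual_systemD(1)[OF assms(1)] by simp
qed

lemma dual_system_expand:
  assumes "dual_system J a e"
  shows "b \<bullet> x = (\<Sum>j\<in>J. (a j \<bullet> x) * (b \<bullet> e j))"
proof -
  have "b \<bullet> x = b \<bullet> (\<Sum>j\<in>J. (a j \<bullet> x) *\<^sub>R e j)" using dual_systemD(3)[OF assms, of x] by simp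
  then show ?thesis by (simp add: inner_sum_right)
qed

lemma dual_system_card:
  fixes a :: "'j \<Rightarrow> 'a::euclidean_space"
  assumes "dual_system J a e"
  shows "card J = DIM('a)"
proof -
  have inj: "inj_on e J"
  proof (rule inj_onI)
    fix j k assume "j \<in> J" "k \<in> J" "e j = e k"
    then show "j = k" using dual_systemD(2)[OF assms, of j j] dual_systemD(2)[OF assms, of j k]
      by (auto split: if_splits)
  qed
  have ind: "independent (e ` J)"
  proof (rule independent_if_scalars_zero)
    show "finite (e ` J)" using dual_systemD(1)[OF assms] by simp
    fix f x assume s: "(\<Sum>x\<in>e ` J. f x *\<^sub>R x) = 0" and "x \<in> e ` J"
    then obtain j where j: "j \<in> J" "x = e j" by blast
    have "(\<Sum>k\<in>J. f (e k) *\<^sub>R e k) = 0" using s by (simp add: sum.reindex[OF inj])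
    then show "f x = 0" using dual_system_sum[OF assms j(1), of "\<lambda>k. f (e k)"] j by simp
  qed
  have "x \<in> span (e ` J)" for x
    using dual_systemD(3)[OF assms, of x] span_sum[of J "\<lambda>j. (a j \<bullet> x) *\<^sub>R e j" "e ` J"]
    by (simp add: span_scale span_base)
  then have "span (e ` J) = UNIV" by blast
  then have "card (e ` J) = DIM('a)" using ind
    by (metis dim_UNIV dim_span dim_eq_card_independent)
  then show ?thesis using inj by (simp add: card_image)
qed

lemma dual_system_Basis: "dual_system (Basis :: 'a::euclidean_space set) (\<lambda>b. b) (\<lambda>b. b)"
  unfolding dual_system_def by (auto simp: inner_Basis inner_commute[of _ x for x] euclidean_representation)

text \<open>Coordinates of the total space: \<open>Inl\<close> is a standard physical coordinate,
  \<open>Inr\<close> an internal one. The same formula serves the functionals and the dual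
  vectors.\<close>

definition prod_normal :: "('j \<Rightarrow> 'i::zero) \<Rightarrow> 'p::zero + 'j \<Rightarrow> 'p \<times> 'i" where
  "prod_normal a k = (case k of Inl b \<Rightarrow> (b, 0) | Inr j \<Rightarrow> (0, a j))"

lemma prod_normal_simps [simp]:
  "prod_normal a (Inl b) = (b, 0)" "prod_normal a (Inr j) = (0, a j)"
  by (auto simp: prod_normal_def)

lemma dual_system_prod:
  fixes a e :: "'j \<Rightarrow> 'i::euclidean_space"
  assumes "dual_system J a e"
  shows "dual_system ((Basis :: 'p::euclidean_space set) <+> J) (prod_normal a) (prod_normal e)"
  unfolding dual_system_def
proof (intro conjI ballI allI)
  show "finite ((Basis :: 'p set) <+> J)" using dual_systemD(1)[OF assms] by simp
next
  fix j k assume "j \<in> (Basis :: 'p set) <+> J" "k \<in> (Basis :: 'p set) <+> J"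
  then show "prod_normal a j \<bullet> prod_normal e k = (if j = k then 1 else 0)"
    using dual_systemD(2)[OF assms] by (auto simp: inner_Basis split: if_splits)
next
  fix x :: "'p \<times> 'i"
  have "(\<Sum>j\<in>(Basis :: 'p set) <+> J. (prod_normal a j \<bullet> x) *\<^sub>R prod_normal e j) =
      (\<Sum>b\<in>Basis. (b \<bullet> fst x) *\<^sub>R (b, 0)) + (\<Sum>j\<in>J. (a j \<bullet> snd x) *\<^sub>R (0, e j))"
    using dual_systemD(1)[OF assms] by (subst sum.Plus) (auto simp: inner_prod_def)
  also have "(\<Sum>b\<in>Basis. (b \<bullet> fst x) *\<^sub>R (b, 0::'i)) = (fst x, 0)"
    by (simp add: prod_eq_iff fst_sum snd_sum euclidean_representation inner_commute[of _ "fst x"])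
  also have "(\<Sum>j\<in>J. (a j \<bullet> snd x) *\<^sub>R (0::'p, e j)) = (0, snd x)"
    using dual_systemD(3)[OF assms, of "snd x"] by (simp add: prod_eq_iff fst_sum snd_sum)
  finally show "x = (\<Sum>j\<in>(Basis :: 'p set) <+> J. (prod_normal a j \<bullet> x) *\<^sub>R prod_normal e j)"
    by simp
qed

text \<open>Bounded natural coefficients form a finite function space of known size; for an
  independent B the corresponding (M + 1) ^ \<open>card B\<close> lattice points are distinct, which
  feeds the packing and pigeonhole arguments.\<close>

definition nat_comb :: "'a::real_vector set \<Rightarrow> ('a \<Rightarrow> nat) \<Rightarrow> 'a" where
  "nat_comb B f = (\<Sum>b\<in>B. int_scale (int (f b)) b)"

lemma nat_comb_span: "nat_comb B f \<in> int_mod.span B"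
  unfolding nat_comb_def by (intro int_mod.span_sum int_mod.span_scale int_mod.span_base)

lemma nat_comb_inj:
  assumes "finite B" and "rat_vs.independent B"
    and "f \<in> (\<Pi>\<^sub>E b\<in>B. {..M})" and "f' \<in> (\<Pi>\<^sub>E b\<in>B. {..M})" and "nat_comb B f = nat_comb B f'"
  shows "f = f'"
proof -
  have "(\<Sum>b\<in>B. int_scale (int (f b) - int (f' b)) b) = 0"
    using assms(5) by (simp add: nat_comb_def int_mod.scale_left_diff_distrib sum_subtractf)
  then have "int (f b) - int (f' b) = 0" if "b \<in> B" for b
    using int_mod.independentD[of B B "\<lambda>b. int (f b) - int (f' b)" b] assms(1,2) that
    by (simp add: int_dependent_iff)
  then show ?thesis using assms(3,4) by (intro PiE_ext) auto
qed

text \<open>By discreteness, boxes of half-width \<eta> about the lattice points are disjoint. As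
  all \<open>s j\<close> are at least 1, enlarging the big box by \<eta> costs at most a factor 1 +
  \<eta> in each direction.\<close>

lemma lattice_count:
  fixes \<Gamma> :: "'a::euclidean_space set" and a e :: "'j \<Rightarrow> 'a"
  assumes "is_lattice \<Gamma>" and dual: "dual_system J a e"
  shows "\<exists>C>0. \<forall>s. (\<forall>j\<in>J. 1 \<le> s j) \<longrightarrow> finite {g\<in>\<Gamma>. \<forall>j\<in>J. \<bar>a j \<bullet> g\<bar> \<le> s j} \<and>
    real (card {g\<in>\<Gamma>. \<forall>j\<in>J. \<bar>a j \<bullet> g\<bar> \<le> s j}) \<le> C * (\<Prod>j\<in>J. s j)"
proof -
  obtain \<epsilon> where \<epsilon>: "\<epsilon> > 0" "\<And>g. g \<in> \<Gamma> \<Longrightarrow> g \<noteq> 0 \<Longrightarrow> \<epsilon> \<le> norm g"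
    using lattice_discrete[OF assms(1)] by blast
  define E where "E = 1 + (\<Sum>j\<in>J. norm (e j))"
  have E: "E > 0" unfolding E_def by (simp add: add_pos_nonneg sum_nonneg)
  \<comment> \<open>Points whose boxes meet differ by at most 2 \<eta> in every coordinate, hence by
    at most 2 \<eta> E = \<epsilon> / 2 in norm.\<close>
  define \<eta> where "\<eta> = \<epsilon> / (4 * E)"
  have \<eta>: "\<eta> > 0" using \<epsilon> E by (simp add: \<eta>_def)
  have small: "norm x < \<epsilon>" if "\<And>j. j \<in> J \<Longrightarrow> \<bar>a j \<bullet> x\<bar> \<le> 2 * \<eta>" for x
  proof -
    have "norm x = norm (\<Sum>j\<in>J. (a j \<bullet> x) *\<^sub>R e j)" using dual_systemD(3)[OF dual, of x] by simp
    also have "\<dots> \<le> (\<Sum>j\<in>J. \<bar>a j \<bullet> x\<bar> * norm (e j))" by (rule order_trans[OF norm_sum]) simp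
    also have "\<dots> \<le> (\<Sum>j\<in>J. 2 * \<eta> * norm (e j))" by (intro sum_mono mult_right_mono that) auto
    also have "\<dots> = 2 * \<eta> * (\<Sum>j\<in>J. norm (e j))" by (simp add: sum_distrib_left)
    also have "\<dots> \<le> 2 * \<eta> * E" using \<eta> by (simp add: E_def)
    also have "\<dots> < \<epsilon>" using E \<epsilon>(1) by (simp add: \<eta>_def)
    finally show ?thesis .
  qed
  define C where "C = (\<Prod>j\<in>J. (1 + \<eta>) / \<eta>)"
  have "C > 0" unfolding C_def using \<eta> by (intro prod_pos) simp
  have bound: "real (card T) \<le> C * (\<Prod>j\<in>J. s j)"
    if s: "\<forall>j\<in>J. 1 \<le> s j" and T: "finite T" "T \<subseteq> {g\<in>\<Gamma>. \<forall>j\<in>J. \<bar>a j \<bullet> g\<bar> \<le> s j}" for s T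
  proof -
    have "real (card T) * (\<Prod>j\<in>J. 2 * \<eta>) \<le> (\<Prod>j\<in>J. (s j + \<eta>) - (- (s j + \<eta>)))"
    proof (rule box_pack[where c = "\<lambda>g j. a j \<bullet> g"])
      fix g j assume "g \<in> T" "j \<in> J"
      then have "\<bar>a j \<bullet> g\<bar> \<le> s j" using T by auto
      then show "- (s j + \<eta>) \<le> a j \<bullet> g - \<eta> \<and> a j \<bullet> g + \<eta> \<le> s j + \<eta>" by auto
    next
      fix g g' and x :: "'j \<Rightarrow> real" assume g: "g \<in> T" "g' \<in> T"
        and x: "\<And>j. j \<in> J \<Longrightarrow> \<bar>x j - a j \<bullet> g\<bar> \<le> \<eta>" "\<And>j. j \<in> J \<Longrightarrow> \<bar>x j - a j \<bullet> g'\<bar> \<le> \<eta>"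
      have "norm (g - g') < \<epsilon>"
      proof (rule small)
        fix j assume "j \<in> J"
        then show "\<bar>a j \<bullet> (g - g')\<bar> \<le> 2 * \<eta>" using x[of j] by (simp add: inner_diff_right)
      qed
      moreover have "g - g' \<in> \<Gamma>" using g T lattice_subspace[OF assms(1)] by (auto intro: int_mod.subspace_diff)
      ultimately show "g = g'" using \<epsilon>(2)[of "g - g'"] by fastforce
    qed (use dual_systemD(1)[OF dual] T \<eta> s in \<open>auto simp: add_nonneg_nonneg\<close>)
    also have "\<dots> \<le> (\<Prod>j\<in>J. 2 * ((1 + \<eta>) * s j))"
    proof (intro prod_mono conjI)
      fix j assume "j \<in> J"
      then have "1 \<le> s j" using s by blast
      then have "\<eta> * 1 \<le> \<eta> * s j" using \<eta> by (intro mult_left_mono) auto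
      then show "s j + \<eta> - - (s j + \<eta>) \<le> 2 * ((1 + \<eta>) * s j)" by (simp add: algebra_simps)
      show "0 \<le> s j + \<eta> - - (s j + \<eta>)" using \<open>1 \<le> s j\<close> \<eta> by simp
    qed
    also have "\<dots> = C * (\<Prod>j\<in>J. s j) * (\<Prod>j\<in>J. 2 * \<eta>)"
      unfolding C_def prod.distrib[symmetric] using \<eta> by (intro prod.cong) auto
    finally show ?thesis using \<eta> by (simp add: prod_pos)
  qed
  have "finite {g\<in>\<Gamma>. \<forall>j\<in>J. \<bar>a j \<bullet> g\<bar> \<le> s j} \<and>
    real (card {g\<in>\<Gamma>. \<forall>j\<in>J. \<bar>a j \<bullet> g\<bar> \<le> s j}) \<le> C * (\<Prod>j\<in>J. s j)" if s: "\<forall>j\<in>J. 1 \<le> s j" for s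
  proof -
    have fin: "finite {g\<in>\<Gamma>. \<forall>j\<in>J. \<bar>a j \<bullet> g\<bar> \<le> s j}" (is "finite ?A")
    proof (rule ccontr)
      assume "infinite ?A"
      from infinite_arbitrarily_large[OF this, of "Suc (nat \<lceil>C * (\<Prod>j\<in>J. s j)\<rceil>)"] obtain T
        where T: "T \<subseteq> ?A" "finite T" "card T = Suc (nat \<lceil>C * (\<Prod>j\<in>J. s j)\<rceil>)"
        by (elim exE conjE)
      have "C * (\<Prod>j\<in>J. s j) < real (card T)"
        unfolding T(3) by (rule le_less_trans[OF real_nat_ceiling_ge]) simp
      then show False using bound[OF s T(2,1)] by linarith
    qed
    then show ?thesis using bound[OF s fin] by blast
  qed
  then show ?thesis using \<open>C > 0\<close> by blast
qed

text \<open>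
  If \<open>m\<close> is minimal such that a given point lies in \<open>\<Gamma> + mK\<close>, then the points at heights
  \<open>0, 3, 6, \<dots>\<close> on the segment leading to it have disjoint translates of \<open>K\<close> modulo \<open>\<Gamma>\<close>,
  so that \<open>m\<close> is bounded by packing. This replaces Minkowski's second theorem.
\<close>

lemma lattice_cover:
  fixes \<Gamma> :: "'a::euclidean_space set" and a e :: "'j \<Rightarrow> 'a"
  assumes "is_lattice \<Gamma>" and dual: "dual_system J a e"
  shows "\<exists>C>0. \<forall>s. (\<forall>j\<in>J. 0 < s j) \<longrightarrow> (\<forall>g\<in>\<Gamma>. (\<forall>j\<in>J. \<bar>a j \<bullet> g\<bar> \<le> 2 * s j) \<longrightarrow> g = 0) \<longrightarrow>
    (\<forall>z. \<exists>g\<in>\<Gamma>. \<forall>j\<in>J. \<bar>a j \<bullet> (z - g)\<bar> \<le> C / (\<Prod>j\<in>J. s j) * s j)"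
proof -
  obtain B where B: "finite B" "independent B" "rat_vs.independent B" "card B = DIM('a)" "\<Gamma> = int_mod.span B"
    using lattice_basis[OF assms(1)] by metis
  note sub = lattice_subspace[OF assms(1)]
  have finJ: "finite J" using dual_systemD(1)[OF dual] .
  define D where "D = 1 + (\<Sum>j\<in>J. \<Sum>b\<in>B. \<bar>a j \<bullet> b\<bar>)"
  have D: "D \<ge> 1" unfolding D_def by (simp add: sum_nonneg)
  have Dj: "(\<Sum>b\<in>B. \<bar>a j \<bullet> b\<bar>) \<le> D" if "j \<in> J" for j
  proof -
    have "(\<Sum>b\<in>B. \<bar>a j \<bullet> b\<bar>) \<le> (\<Sum>j\<in>J. \<Sum>b\<in>B. \<bar>a j \<bullet> b\<bar>)"
      using that finJ by (intro member_le_sum) (auto intro: sum_nonneg)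
    then show ?thesis by (simp add: D_def)
  qed
  define pt where "pt = nat_comb B"
  have pt: "pt f \<in> \<Gamma>" for f unfolding pt_def B(5) by (rule nat_comb_span)
  have pt_inj: "f = f'" if "f \<in> (\<Pi>\<^sub>E b\<in>B. {..M})" "f' \<in> (\<Pi>\<^sub>E b\<in>B. {..M})" "pt f = pt f'" for f f' M
    using nat_comb_inj[OF B(1,3) that(1,2)] that(3) by (simp add: pt_def)
  have pt_le: "\<bar>a j \<bullet> pt f\<bar> \<le> real M * D" if "f \<in> (\<Pi>\<^sub>E b\<in>B. {..M})" "j \<in> J" for f M j
  proof -
    have "\<bar>a j \<bullet> pt f\<bar> = \<bar>\<Sum>b\<in>B. real (f b) * (a j \<bullet> b)\<bar>"
      by (simp add: pt_def nat_comb_def int_scale_def inner_sum_right)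
    also have "\<dots> \<le> (\<Sum>b\<in>B. real (f b) * \<bar>a j \<bullet> b\<bar>)"
      by (rule order_trans[OF sum_abs]) (simp add: abs_mult)
    also have "\<dots> \<le> (\<Sum>b\<in>B. real M * \<bar>a j \<bullet> b\<bar>)"
      using that by (intro sum_mono mult_right_mono) (auto simp: PiE_iff)
    also have "\<dots> \<le> real M * D" using Dj[OF that(2)] by (simp add: mult_left_mono flip: sum_distrib_left)
    finally show ?thesis .
  qed
  \<comment> \<open>The packing will yield
    \<open>(q + 1) * (\<Prod>j\<in>J. s j) \<le> (2 * D) ^ DIM('a)\<close>, and m is at most 3 (q +
    1).\<close>
  define C where "C = 3 * (2 * D) ^ DIM('a)"
  have C: "C > 0" using D by (simp add: C_def)
  have main: "\<exists>g\<in>\<Gamma>. \<forall>j\<in>J. \<bar>a j \<bullet> (z - g)\<bar> \<le> C / (\<Prod>j\<in>J. s j) * s j"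
    if s: "\<forall>j\<in>J. 0 < s j" and inj: "\<forall>g\<in>\<Gamma>. (\<forall>j\<in>J. \<bar>a j \<bullet> g\<bar> \<le> 2 * s j) \<longrightarrow> g = 0" for s z
  proof -
    define K where "K \<rho> x \<longleftrightarrow> (\<forall>j\<in>J. \<bar>a j \<bullet> x\<bar> \<le> \<rho> * s j)" for \<rho> :: real and x
    have Kadd: "K (\<rho> + \<rho>') (x + y)" if "K \<rho> x" "K \<rho>' y" for \<rho> \<rho>' x y
      unfolding K_def
    proof
      fix j assume "j \<in> J"
      then have "\<bar>a j \<bullet> x\<bar> \<le> \<rho> * s j" "\<bar>a j \<bullet> y\<bar> \<le> \<rho>' * s j" using that unfolding K_def by auto
      then show "\<bar>a j \<bullet> (x + y)\<bar> \<le> (\<rho> + \<rho>') * s j" unfolding inner_add_right distrib_right by linarith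
    qed
    have Kscale: "K (c * \<rho>) (c *\<^sub>R x)" if "K \<rho> x" "c \<ge> 0" for c \<rho> x
      using that unfolding K_def by (auto simp: abs_mult mult.assoc mult_left_mono)
    have Kneg: "K \<rho> (- x)" if "K \<rho> x" for \<rho> x using that by (simp add: K_def)
    have Kmono: "K \<rho>' x" if "K \<rho> x" "\<rho> \<le> \<rho>'" for \<rho> \<rho>' x
      using that s unfolding K_def by (meson less_imp_le mult_right_mono order_trans)
    have "\<exists>m::nat. \<exists>g\<in>\<Gamma>. K (real m) (z - g)"
    proof -
      define R where "R = (\<Sum>j\<in>J. \<bar>a j \<bullet> z\<bar> / s j)"
      have "K R z" unfolding K_def
      proof
        fix j assume j: "j \<in> J"
        have "\<bar>a j \<bullet> z\<bar> / s j \<le> R" unfolding R_def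
          using finJ j s by (intro member_le_sum) (auto intro: less_imp_le)
        then show "\<bar>a j \<bullet> z\<bar> \<le> R * s j" using j s by (simp add: pos_divide_le_eq)
      qed
      then have "K (real (nat \<lceil>R\<rceil>)) (z - 0)" using Kmono by (simp add: real_nat_ceiling_ge)
      then show ?thesis using int_mod.subspace_0[OF sub] by blast
    qed
    then obtain m where m: "\<exists>g\<in>\<Gamma>. K (real m) (z - g)"
      and least: "\<And>m'. m' < m \<Longrightarrow> \<not> (\<exists>g\<in>\<Gamma>. K (real m') (z - g))"
      using exists_least_iff[of "\<lambda>m. \<exists>g\<in>\<Gamma>. K (real m) (z - g)"] by blast
    obtain g0 where g0: "g0 \<in> \<Gamma>" "K (real m) (z - g0)" using m by blast
    define x where "x = z - g0"
    \<comment> \<open>The point at height 3 i on the segment from 0 to x: it needs 3 i copies of the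
      box, and the remainder x - \<open>p i\<close> needs m - 3 i.\<close>
    define p where "p i = (real (3 * i) / real m) *\<^sub>R x" for i
    have p1: "K (real (3 * i)) (p i)" if "m > 0" for i
      using Kscale[OF g0(2), of "real (3 * i) / real m"] that by (simp add: p_def x_def)
    have p2: "K (real m - real (3 * i)) (x - p i)" if "m > 0" "3 * i \<le> m" for i
    proof -
      have "x - p i = ((real m - real (3 * i)) / real m) *\<^sub>R x"
        using that by (simp add: p_def diff_divide_distrib scaleR_diff_left)
      then show ?thesis
        using Kscale[OF g0(2), of "(real m - real (3 * i)) / real m"] that by (simp add: x_def)
    qed
    define q where "q = m div 3"
    \<comment> \<open>If the boxes at heights 3 j < 3 i met modulo the lattice, x could be reached
      with height m - 3 i + 2 + 3 j, at most m - 1. The spacing 3 exceeds by one the 2 lost in the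
      meeting of two boxes.\<close>
    have far: False
      if "g \<in> \<Gamma>" "g' \<in> \<Gamma>" "j < i" "i \<le> q" "K 2 ((g + p i) - (g' + p j))" for g g' i j
    proof -
      have m0: "m > 0" using that(3,4) q_def by (metis div_0 gr0I le_zero_eq not_less_zero)
      have i: "3 * i \<le> m" using that(4) unfolding q_def by simp
      have "K (real m - real (3 * i) + (2 + real (3 * j))) ((x - p i) + (((g + p i) - (g' + p j)) + p j))"
        using p2[OF m0 i] that(5) p1[OF m0, of j] Kadd by blast
      moreover have "(x - p i) + (((g + p i) - (g' + p j)) + p j) = z - (g0 - g + g')"
        by (simp add: x_def)
      ultimately have "K (real m - real (3 * i) + (2 + real (3 * j))) (z - (g0 - g + g'))" by (simp only:)
      moreover have "real m - real (3 * i) + (2 + real (3 * j)) \<le> real (m - 1)"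
        using m0 that(3) by linarith
      ultimately have "K (real (m - 1)) (z - (g0 - g + g'))" by (rule Kmono)
      then show False
        using least[of "m - 1"] m0 that g0 sub by (meson diff_less int_mod.subspace_add int_mod.subspace_diff zero_less_one)
    qed
    define X where "X = (\<Sum>j\<in>J. s j + (\<Sum>i\<le>q. \<bar>a j \<bullet> p i\<bar>))"
    have X: "s j + \<bar>a j \<bullet> p i\<bar> \<le> X" if "j \<in> J" "i \<le> q" for j i
    proof -
      have "\<bar>a j \<bullet> p i\<bar> \<le> (\<Sum>i\<le>q. \<bar>a j \<bullet> p i\<bar>)"
        using that by (intro member_le_sum) auto
      moreover have "s j + (\<Sum>i\<le>q. \<bar>a j \<bullet> p i\<bar>) \<le> X" unfolding X_def
        using that finJ s by (intro member_le_sum) (auto intro!: add_nonneg_nonneg sum_nonneg simp: less_imp_le)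
      ultimately show ?thesis by simp
    qed
    \<comment> \<open>M dominates the half-widths and the points \<open>p i\<close>, so that all the
      boxes fit into one whose sides are proportional to M + 1. The powers of M + 1 then cancel and
      a bound on q remains.\<close>
    define M where "M = nat \<lceil>X\<rceil>"
    have M: "X \<le> real M" unfolding M_def by (rule real_nat_ceiling_ge)
    define T where "T = (\<Pi>\<^sub>E b\<in>B. {..M}) \<times> {..q}"
    define c where "c t j = a j \<bullet> (pt (fst t) + p (snd t))" for t j
    define L where "L = 2 * (real M + 1) * D"
    have pack: "real (card T) * (\<Prod>j\<in>J. 2 * s j) \<le> (\<Prod>j\<in>J. L - (- L))"
    proof (rule box_pack[where c = c])
      show "finite T" unfolding T_def using B(1) by (intro finite_cartesian_product finite_PiE) auto
    next
      fix t j assume "t \<in> T" and j: "j \<in> J"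
      then have t: "fst t \<in> (\<Pi>\<^sub>E b\<in>B. {..M})" "snd t \<le> q" unfolding T_def by auto
      have "real M * 1 \<le> real M * D" using D by (intro mult_left_mono) auto
      then have "\<bar>a j \<bullet> pt (fst t)\<bar> + (s j + \<bar>a j \<bullet> p (snd t)\<bar>) \<le> L"
        using pt_le[OF t(1) j] X[OF j t(2)] M D unfolding L_def by (simp add: algebra_simps)
      then show "- L \<le> c t j - s j \<and> c t j + s j \<le> L"
        unfolding c_def inner_add_right by linarith
    next
      fix t t' and y :: "'j \<Rightarrow> real" assume "t \<in> T" "t' \<in> T"
        and y: "\<And>j. j \<in> J \<Longrightarrow> \<bar>y j - c t j\<bar> \<le> s j" "\<And>j. j \<in> J \<Longrightarrow> \<bar>y j - c t' j\<bar> \<le> s j"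
      then have t: "fst t \<in> (\<Pi>\<^sub>E b\<in>B. {..M})" "snd t \<le> q" "fst t' \<in> (\<Pi>\<^sub>E b\<in>B. {..M})" "snd t' \<le> q"
        unfolding T_def by auto
      have k: "K 2 ((pt (fst t) + p (snd t)) - (pt (fst t') + p (snd t')))"
        unfolding K_def
      proof
        fix j assume "j \<in> J"
        then show "\<bar>a j \<bullet> ((pt (fst t) + p (snd t)) - (pt (fst t') + p (snd t')))\<bar> \<le> 2 * s j"
          using y[of j] unfolding c_def by (simp add: inner_diff_right)
      qed
      have k': "K 2 ((pt (fst t') + p (snd t')) - (pt (fst t) + p (snd t)))"
        using Kneg[OF k] by simp
      \<comment> \<open>Distinct heights are excluded by \<open>far\<close> in both orders; for
        equal heights the difference of the lattice points lies in the doubled box and is 0 by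
        hypothesis.\<close>
      have eq: "snd t = snd t'"
        using far[OF pt pt _ t(2) k] far[OF pt pt _ t(4) k'] by (meson linorder_neqE_nat)
      then have "K 2 (pt (fst t) - pt (fst t'))" using k by simp
      then have "pt (fst t) - pt (fst t') = 0"
        using inj pt int_mod.subspace_diff[OF sub] unfolding K_def by blast
      then have "fst t = fst t'" using pt_inj t by auto
      then show "t = t'" using eq by (simp add: prod_eq_iff)
    next
      fix j assume "j \<in> J"
      then show "0 \<le> s j" using s by (auto intro: less_imp_le)
      show "- L \<le> L" using D by (simp add: L_def)
    qed (rule finJ)
    have cT: "real (card T) = (real M + 1) ^ DIM('a) * (real q + 1)"
      unfolding T_def using B(1,4) by (simp add: card_cartesian_product card_PiE algebra_simps)
    have c2: "(\<Prod>j\<in>J. 2 * s j) = 2 ^ DIM('a) * (\<Prod>j\<in>J. s j)"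
      by (simp add: prod.distrib dual_system_card[OF dual])
    have cL: "(\<Prod>j\<in>J. L - (- L)) = (2 * D) ^ DIM('a) * 2 ^ DIM('a) * (real M + 1) ^ DIM('a)"
    proof -
      have "L - (- L) = (2 * D) * 2 * (real M + 1)" unfolding L_def by simp
      then show ?thesis by (simp only: prod_constant dual_system_card[OF dual] power_mult_distrib)
    qed
    have "((real M + 1) ^ DIM('a) * 2 ^ DIM('a)) * ((real q + 1) * (\<Prod>j\<in>J. s j)) \<le>
        ((real M + 1) ^ DIM('a) * 2 ^ DIM('a)) * (2 * D) ^ DIM('a)"
      using pack unfolding cT c2 cL by (simp only: mult_ac)
    then have le: "(real q + 1) * (\<Prod>j\<in>J. s j) \<le> (2 * D) ^ DIM('a)"
      by (rule mult_left_le_imp_le) auto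
    have ps: "(\<Prod>j\<in>J. s j) > 0" using s by (intro prod_pos) auto
    have "m \<le> 3 * (q + 1)" unfolding q_def by presburger
    then have "real m \<le> 3 * (real q + 1)"
      using of_nat_mono[of m "3 * (q + 1)", where 'a = real] by simp
    then have "real m * (\<Prod>j\<in>J. s j) \<le> 3 * (real q + 1) * (\<Prod>j\<in>J. s j)"
      using ps by (intro mult_right_mono) auto
    also have "\<dots> \<le> C" using mult_left_mono[OF le, of 3] unfolding C_def by (simp only: mult.assoc)
    finally have "real m \<le> C / (\<Prod>j\<in>J. s j)" using ps by (simp add: field_simps)
    then have "K (C / (\<Prod>j\<in>J. s j)) (z - g0)" using g0(2) Kmono by blast
    then show ?thesis using g0(1) unfolding K_def by blast
  qed
  show ?thesis using C main by blast
qed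

text \<open>Pigeonhole: the (M + 1) ^ \<rho> combinations with coefficients up to M have
  \<phi>-values in an interval of length 2 M F, which is cut into M ^ \<rho> cells. Two of them
  share a cell, and g is their difference.\<close>

lemma lattice_dirichlet:
  fixes \<Gamma> :: "'a::euclidean_space set" and \<phi> :: "'a \<Rightarrow> real"
  assumes "is_lattice \<Gamma>" and G: "int_mod.subspace G" and "G \<subseteq> \<Gamma>" and "linear \<phi>"
  shows "\<exists>C>0. \<forall>R\<ge>C. \<exists>g\<in>G. int_rank G > 0 \<longrightarrow> g \<noteq> 0 \<and> norm g \<le> R \<and>
    \<bar>\<phi> g\<bar> \<le> C * R powr (1 - real (int_rank G))"
proof (cases "int_rank G = 0")
  case True
  then show ?thesis using int_mod.subspace_0[OF G] by (intro exI[of _ 1]) auto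
next
  case False
  define \<rho> where "\<rho> = int_rank G"
  have \<rho>: "\<rho> \<ge> 1" using False by (simp add: \<rho>_def)
  obtain B where B: "finite B" "rat_vs.independent B" "int_mod.span B = G" "card B = \<rho>"
    using lattice_subgroup_basis[OF assms(1-3)] unfolding \<rho>_def by metis
  define K where "K = 1 + (\<Sum>b\<in>B. norm b)"
  define F where "F = 1 + (\<Sum>b\<in>B. \<bar>\<phi> b\<bar>)"
  have K: "K \<ge> 1" and F: "F \<ge> 1" unfolding K_def F_def by (simp_all add: sum_nonneg)
  define pt where "pt = nat_comb B"
  have pt: "pt f \<in> G" for f unfolding pt_def B(3)[symmetric] by (rule nat_comb_span)
  have pt_inj: "f = f'" if "f \<in> (\<Pi>\<^sub>E b\<in>B. {..M})" "f' \<in> (\<Pi>\<^sub>E b\<in>B. {..M})" "pt f = pt f'" for f f' M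
    using nat_comb_inj[OF B(1,2) that(1,2)] that(3) by (simp add: pt_def)
  \<comment> \<open>The summand K makes R \<ge> C imply R / K \<ge> 1, hence M \<ge> 1. The other
    summand comes from the cell length 2 M F / M ^ \<rho> with R / (2 K) \<le> M \<le> R /
    K.\<close>
  define C where "C = (2 * K) ^ \<rho> * 2 * F + K"
  have "(2 * K) ^ \<rho> * 2 * F > 0" using K F by simp
  then have C: "C \<ge> K" "C > 0" "(2 * K) ^ \<rho> * 2 * F \<le> C" unfolding C_def using K by linarith+
  have main: "\<exists>g\<in>G. g \<noteq> 0 \<and> norm g \<le> R \<and> \<bar>\<phi> g\<bar> \<le> C * R powr (1 - real \<rho>)" if R: "R \<ge> C" for R
  proof -
    define M where "M = nat \<lfloor>R / K\<rfloor>"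
    have RK: "R / K \<ge> 1" using R C K by (simp add: le_divide_eq)
    then have M: "real M \<le> R / K" "R / K < real M + 1" unfolding M_def by linarith+
    have M1: "M \<ge> 1" using RK unfolding M_def by (simp add: le_nat_floor)
    \<comment> \<open>The value of \<phi> is rescaled from the interval (- M F, M F) to the unit
      interval before it is sorted into cells.\<close>
    define cell where "cell f = nat \<lfloor>(\<phi> (pt f) / (real M * F) + 1) / 2 * real M ^ \<rho>\<rfloor>" for f
    have lt: "\<bar>\<phi> (pt f)\<bar> < real M * F" if "f \<in> (\<Pi>\<^sub>E b\<in>B. {..M})" for f
    proof -
      have "\<phi> (pt f) = (\<Sum>b\<in>B. real (f b) * \<phi> b)"
        unfolding pt_def nat_comb_def int_scale_def by (simp add: linear_sum[OF assms(4)] linear_scale[OF assms(4)])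
      then have "\<bar>\<phi> (pt f)\<bar> \<le> (\<Sum>b\<in>B. real (f b) * \<bar>\<phi> b\<bar>)"
        by (simp add: abs_mult order_trans[OF sum_abs])
      also have "\<dots> \<le> (\<Sum>b\<in>B. real M * \<bar>\<phi> b\<bar>)"
        using that by (intro sum_mono mult_right_mono) (auto simp: PiE_iff)
      also have "\<dots> < real M * F" using M1 by (simp add: F_def flip: sum_distrib_left)
      finally show ?thesis .
    qed
    have MF: "real M * F > 0" using M1 F by simp
    have Mp: "real M ^ \<rho> > 0" using M1 by simp
    have u01: "0 \<le> (\<phi> (pt f) / (real M * F) + 1) / 2 \<and> (\<phi> (pt f) / (real M * F) + 1) / 2 < 1"
      if "f \<in> (\<Pi>\<^sub>E b\<in>B. {..M})" for f
    proof -
      have "\<bar>\<phi> (pt f) / (real M * F)\<bar> < 1" using lt[OF that] MF by (simp add: abs_divide)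
      moreover have "0 \<le> (x + 1) / 2 \<and> (x + 1) / 2 < 1" if "\<bar>x\<bar> < 1" for x :: real
        using that by auto
      ultimately show ?thesis by blast
    qed
    have "cell ` (\<Pi>\<^sub>E b\<in>B. {..M}) \<subseteq> {..<M ^ \<rho>}"
    proof (rule image_subsetI)
      fix f assume f: "f \<in> (\<Pi>\<^sub>E b\<in>B. {..M})"
      have "(\<phi> (pt f) / (real M * F) + 1) / 2 * real M ^ \<rho> < 1 * real M ^ \<rho>"
        using u01[OF f] Mp by (intro mult_strict_right_mono) auto
      then have "\<lfloor>(\<phi> (pt f) / (real M * F) + 1) / 2 * real M ^ \<rho>\<rfloor> < int (M ^ \<rho>)"
        by (simp add: floor_less_iff)
      then show "cell f \<in> {..<M ^ \<rho>}" unfolding cell_def lessThan_iff using M1 zless_nat_conj[of _ "int (M ^ \<rho>)"]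
        by (simp only: nat_int) simp
    qed
    moreover have "card {..<M ^ \<rho>} < card (\<Pi>\<^sub>E b\<in>B. {..M})"
      using B \<rho> by (simp add: card_PiE power_strict_mono)
    ultimately have "\<not> inj_on cell (\<Pi>\<^sub>E b\<in>B. {..M})"
      using card_inj_on_le[of cell "\<Pi>\<^sub>E b\<in>B. {..M}" "{..<M ^ \<rho>}"] by fastforce
    then obtain f f' where f: "f \<in> (\<Pi>\<^sub>E b\<in>B. {..M})" "f' \<in> (\<Pi>\<^sub>E b\<in>B. {..M})" "f \<noteq> f'" "cell f = cell f'"
      unfolding inj_on_def by blast
    have nn: "0 \<le> \<lfloor>(\<phi> (pt h) / (real M * F) + 1) / 2 * real M ^ \<rho>\<rfloor>" if "h \<in> (\<Pi>\<^sub>E b\<in>B. {..M})" for h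
      using u01[OF that] Mp by simp
    have "\<lfloor>(\<phi> (pt f) / (real M * F) + 1) / 2 * real M ^ \<rho>\<rfloor> = \<lfloor>(\<phi> (pt f') / (real M * F) + 1) / 2 * real M ^ \<rho>\<rfloor>"
      using f(4) nn[OF f(1)] nn[OF f(2)] unfolding cell_def by (simp only: nat_eq_iff2 if_True int_nat_eq)
    then have "\<bar>(\<phi> (pt f) / (real M * F) + 1) / 2 * real M ^ \<rho> - (\<phi> (pt f') / (real M * F) + 1) / 2 * real M ^ \<rho>\<bar> \<le> 1"
      by linarith
    moreover have "(\<phi> (pt f) / (real M * F) + 1) / 2 * real M ^ \<rho> - (\<phi> (pt f') / (real M * F) + 1) / 2 * real M ^ \<rho>
        = \<phi> (pt f - pt f') * (real M ^ \<rho> / (2 * (real M * F)))"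
    proof -
      have "(x / A + 1) / 2 * P - (y / A + 1) / 2 * P = (x - y) * (P / (2 * A))" if "A > 0" for x y A P :: real
        using that by (simp add: divide_simps) (simp add: algebra_simps)
      from this[OF MF] show ?thesis by (simp only: linear_diff[OF assms(4)])
    qed
    ultimately have "\<bar>\<phi> (pt f - pt f') * (real M ^ \<rho> / (2 * (real M * F)))\<bar> \<le> 1"
      by (simp only:)
    moreover have "\<bar>x\<bar> \<le> 2 * A / P" if "A > 0" "P > 0" "\<bar>x * (P / (2 * A))\<bar> \<le> 1" for x A P :: real
      using that by (simp add: abs_mult field_simps)
    ultimately have le: "\<bar>\<phi> (pt f - pt f')\<bar> \<le> 2 * (real M * F) / real M ^ \<rho>"
      using MF Mp by blast
    have R0: "R > 0" using R C by linarith
    have "2 * (real M * F) / real M ^ \<rho> \<le> 2 * ((R / K) * F) / (R / (2 * K)) ^ \<rho>"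
    proof (intro frac_le mult_left_mono mult_right_mono power_mono)
      have "R / (2 * K) = R / K / 2" by simp
      then show "R / (2 * K) \<le> real M" using M M1 by linarith
    qed (use M F K R0 in auto)
    also have "\<dots> = (2 * K) ^ \<rho> * 2 * F / K * (R / R ^ \<rho>)"
      using R0 K by (simp add: field_simps)
    also have "R / R ^ \<rho> = R powr (1 - real \<rho>)"
      using R0 by (simp add: powr_diff powr_realpow)
    also have "(2 * K) ^ \<rho> * 2 * F / K * R powr (1 - real \<rho>) \<le> C * R powr (1 - real \<rho>)"
    proof (rule mult_right_mono)
      have "(2 * K) ^ \<rho> * 2 * F / K \<le> (2 * K) ^ \<rho> * 2 * F / 1"
        using K F by (intro divide_left_mono) auto
      then show "(2 * K) ^ \<rho> * 2 * F / K \<le> C" using C(3) by simp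
    qed simp
    finally have "\<bar>\<phi> (pt f - pt f')\<bar> \<le> C * R powr (1 - real \<rho>)" using le by simp
    moreover have "norm (pt f - pt f') \<le> R"
    proof -
      have "norm (pt f - pt f') = norm (\<Sum>b\<in>B. (real (f b) - real (f' b)) *\<^sub>R b)"
        by (simp add: pt_def nat_comb_def int_scale_def sum_subtractf scaleR_diff_left)
      also have "\<dots> \<le> (\<Sum>b\<in>B. \<bar>real (f b) - real (f' b)\<bar> * norm b)"
        by (rule order_trans[OF norm_sum]) simp
      also have "\<dots> \<le> (\<Sum>b\<in>B. real M * norm b)"
      proof (intro sum_mono mult_right_mono)
        fix b assume "b \<in> B"
        then have "f b \<le> M" "f' b \<le> M" using f by (auto simp: PiE_iff)
        then show "\<bar>real (f b) - real (f' b)\<bar> \<le> real M" by linarith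
      qed simp
      also have "\<dots> \<le> real M * K" unfolding K_def by (simp add: mult_left_mono flip: sum_distrib_left)
      also have "\<dots> \<le> R" using M(1) K by (simp add: field_simps)
      finally show ?thesis .
    qed
    moreover have "pt f - pt f' \<noteq> 0" using pt_inj f by auto
    ultimately show ?thesis using int_mod.subspace_diff[OF G pt pt] by blast
  qed
  then show ?thesis using C(2) unfolding \<rho>_def by (intro exI[of _ C]) blast
qed

subsection \<open>Hyperplanes and flags\<close>

text \<open>A point lying in the next set T is moved a little towards a point of S outside T: it
  leaves T and stays off the finitely many closed sets already avoided. This supplies generic
  points.\<close>

lemma affine_not_covered:
  fixes S U :: "'a::euclidean_space set"
  assumes "finite F" and "affine S" and "open U" and "U \<inter> S \<noteq> {}"
    and "\<And>T. T \<in> F \<Longrightarrow> closed T \<and> affine T \<and> \<not> S \<subseteq> T"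
  shows "U \<inter> S - \<Union>F \<noteq> {}"
  using assms
proof (induction F rule: finite_induct)
  case (insert T F)
  then obtain x where x: "x \<in> U" "x \<in> S" "x \<notin> \<Union>F" by auto
  have T: "closed T" "affine T" "\<not> S \<subseteq> T" using insert.prems(4) by auto
  show ?case
  proof (cases "x \<in> T")
    case False
    then show ?thesis using x by auto
  next
    case True
    obtain h where h: "h \<in> S" "h \<notin> T" using T by blast
    have "closed (\<Union>F)" using insert by (intro closed_Union) auto
    then have "open (U - \<Union>F)" using insert.prems(2) by auto
    then obtain \<epsilon> where \<epsilon>: "\<epsilon> > 0" "ball x \<epsilon> \<subseteq> U - \<Union>F" using x by (meson Diff_iff openE)
    define t where "t = \<epsilon> / (2 * (norm (h - x) + 1))"
    define y where "y = (1 - t) *\<^sub>R x + t *\<^sub>R h"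
    have p: "norm (h - x) + 1 > 0" by (simp add: add_nonneg_pos)
    then have t: "t > 0" using \<epsilon> by (simp add: t_def)
    have "y - x = t *\<^sub>R (h - x)" by (simp add: y_def algebra_simps)
    then have "dist x y = t * norm (h - x)" using t by (metis abs_of_pos dist_commute dist_norm norm_scaleR)
    also have "\<dots> \<le> t * (norm (h - x) + 1)" using t by simp
    also have "\<dots> = \<epsilon> / 2" using p unfolding t_def by (simp only: times_divide_eq_left mult.commute[of 2] divide_divide_eq_left[symmetric] nonzero_mult_div_cancel_right)
    finally have "y \<in> ball x \<epsilon>" using \<epsilon>(1) by simp
    moreover have "y \<in> S" unfolding y_def
      using insert.prems(1) x h by (simp add: affine_alt)
    moreover have "y \<notin> T"
    proof
      assume y: "y \<in> T"
      have "h = (1 - 1/t) *\<^sub>R x + (1/t) *\<^sub>R y"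
      proof -
        have "(1/t) *\<^sub>R y = (1/t - 1) *\<^sub>R x + h"
          using t by (simp add: y_def scaleR_add_right diff_divide_distrib)
        then show ?thesis by (simp add: scaleR_diff_left)
      qed
      also have "\<dots> \<in> T" using T(2) True y by (simp add: affine_alt)
      finally show False using h by blast
    qed
    ultimately show ?thesis using \<epsilon> by auto
  qed
qed auto

lemma closed_affine_hyperplane: "closed {x. a \<bullet> x = b}" "affine {x. a \<bullet> x = b}"
  by (simp_all add: closed_hyperplane affine_hyperplane)

lemma hyperplane_subset_imp_eq:
  fixes a a' :: "'a::euclidean_space"
  assumes "a \<noteq> 0" and "a' \<noteq> 0" and "{x. a \<bullet> x = b} \<subseteq> {x. a' \<bullet> x = b'}"
  shows "{x. a \<bullet> x = b} = {x. a' \<bullet> x = b'}"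
proof (rule affine_dim_equal)
  show "{x. a \<bullet> x = b} \<noteq> {}"
    using assms(1) by (intro ex_in_conv[THEN iffD1] exI[of _ "(b / (a \<bullet> a)) *\<^sub>R a"]) simp
qed (use assms in \<open>simp_all add: affine_hyperplane\<close>)

text \<open>Near its contact point a supporting hyperplane lies in the frontier, so finitely many
  hyperplanes of the witnessing set cover an open piece of it, and one of them must be equal to it.
  Hence the witnessing set contains every supporting hyperplane.\<close>

lemma supporting_hyperplanes_polytopal:
  fixes W :: "'i::euclidean_space set"
  assumes "polytopal W"
  shows "finite (supporting_hyperplanes W)" and "frontier W \<subseteq> \<Union>(supporting_hyperplanes W)"
proof -
  obtain F where F: "finite F" "\<And>H. H \<in> F \<Longrightarrow> properly_supports W H" "frontier W \<subseteq> \<Union>F"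
    using assms unfolding polytopal_def by blast
  have "H \<in> F" if supp: "properly_supports W H" for H
  proof -
    obtain a b w U where H: "a \<noteq> 0" "H = {x. a \<bullet> x = b}" "w \<in> H" "open U" "w \<in> U"
      "W \<inter> U = {x. a \<bullet> x \<le> b} \<inter> U"
      using supp unfolding properly_supports_def by blast
    have front: "x \<in> frontier W" if x: "x \<in> H" "x \<in> U" for x
    proof -
      have "x \<in> {x. a \<bullet> x \<le> b} \<inter> U" using H(2) x by simp
      then have "x \<in> W" using H(6) by blast
      moreover have "x \<notin> interior W"
      proof
        assume "x \<in> interior W"
        then have "x \<in> interior W \<inter> U" using x by auto
        then obtain \<epsilon> where \<epsilon>: "\<epsilon> > 0" "ball x \<epsilon> \<subseteq> interior W \<inter> U"
          using H(4) open_Int open_interior by (metis openE)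
        \<comment> \<open>A small step along the outward normal leaves W, so x is not an interior
          point.\<close>
        define y where "y = x + (\<epsilon> / (2 * norm a)) *\<^sub>R a"
        have "y \<in> ball x \<epsilon>" using \<epsilon> H(1) by (simp add: y_def dist_norm)
        then have "y \<in> W" "y \<in> U" using \<epsilon> interior_subset[of W] by blast+
        then have "a \<bullet> y \<le> b" using H(6) by auto
        moreover have "a \<bullet> y > b" using x H \<epsilon> by (simp add: y_def inner_add_right)
        ultimately show False by simp
      qed
      ultimately show ?thesis unfolding frontier_def using closure_subset by auto
    qed
    have "\<exists>H'\<in>F. H \<subseteq> H'"
    proof (rule ccontr)
      assume "\<not> (\<exists>H'\<in>F. H \<subseteq> H')"
      then have n: "\<And>H'. H' \<in> F \<Longrightarrow> \<not> H \<subseteq> H'" by blast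
      have "U \<inter> H - \<Union>F \<noteq> {}"
      proof (rule affine_not_covered[OF F(1) _ H(4)])
        show "affine H" using H(2) closed_affine_hyperplane by auto
        show "U \<inter> H \<noteq> {}" using H by blast
        fix T assume T: "T \<in> F"
        then obtain a' b' where "T = {x. a' \<bullet> x = b'}"
          using F(2) unfolding properly_supports_def by blast
        then show "closed T \<and> affine T \<and> \<not> H \<subseteq> T" using closed_affine_hyperplane n[OF T] by auto
      qed
      then show False using front F(3) by blast
    qed
    then obtain H' where H': "H' \<in> F" "H \<subseteq> H'" by blast
    then obtain a' b' where "a' \<noteq> 0" "H' = {x. a' \<bullet> x = b'}"
      using F(2) unfolding properly_supports_def by blast
    then have "H = H'" using hyperplane_subset_imp_eq[OF H(1)] H(2) H'(2) by blast
    then show ?thesis using H' by simp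
  qed
  then have "supporting_hyperplanes W = F" unfolding supporting_hyperplanes_def using F(2) by blast
  then show "finite (supporting_hyperplanes W)" "frontier W \<subseteq> \<Union>(supporting_hyperplanes W)"
    using F by auto
qed

lemma linear_part_hyperplane:
  fixes a :: "'a::euclidean_space"
  assumes "a \<noteq> 0"
  shows "linear_part {x. a \<bullet> x = b} = {x. a \<bullet> x = 0}"
proof
  show "linear_part {x. a \<bullet> x = b} \<subseteq> {x. a \<bullet> x = 0}"
    unfolding linear_part_def by (auto simp: inner_diff_right)
  show "{x. a \<bullet> x = 0} \<subseteq> linear_part {x. a \<bullet> x = b}"
  proof
    fix x assume "x \<in> {x. a \<bullet> x = 0}"
    then have x: "a \<bullet> x = 0" by simp
    define p where "p = (b / (a \<bullet> a)) *\<^sub>R a"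
    have "a \<bullet> p = b" using assms by (simp add: p_def)
    then show "x \<in> linear_part {x. a \<bullet> x = b}" unfolding linear_part_def
      using x by (intro CollectI exI[of _ "x + p"] exI[of _ p]) (simp add: inner_add_right)
  qed
qed

text \<open>The n - 1 other normals leave an orthogonal direction; by injectivity it is not
  orthogonal to \<open>a j\<close>, so it can be scaled to the dual vector.\<close>

lemma dual_system_exists:
  fixes a :: "'j \<Rightarrow> 'a::euclidean_space"
  assumes "finite J" and "card J = DIM('a)" and inj: "\<And>x. (\<And>j. j \<in> J \<Longrightarrow> a j \<bullet> x = 0) \<Longrightarrow> x = 0"
  shows "\<exists>e. dual_system J a e"
proof -
  have "\<exists>y. a j \<bullet> y = 1 \<and> (\<forall>k\<in>J - {j}. a k \<bullet> y = 0)" if j: "j \<in> J" for j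
  proof -
    have "dim (a ` (J - {j})) \<le> card (J - {j})"
      using assms(1) dim_le_card'[of "a ` (J - {j})"] card_image_le[of "J - {j}" a] by simp
    also have "\<dots> < DIM('a)" using assms j by (simp add: card_Diff_singleton)
    finally obtain x where x: "x \<noteq> 0" "\<And>y. y \<in> span (a ` (J - {j})) \<Longrightarrow> orthogonal x y"
      using orthogonal_to_subspace_exists by blast
    have o: "a k \<bullet> x = 0" if "k \<in> J - {j}" for k
      using x(2)[of "a k"] that by (simp add: span_base orthogonal_def inner_commute)
    then have "a j \<bullet> x \<noteq> 0" using inj[of x] x(1) j by (metis Diff_iff singletonD)
    then show ?thesis using o by (intro exI[of _ "(1 / (a j \<bullet> x)) *\<^sub>R x"]) auto
  qed
  then obtain e where e: "\<And>j. j \<in> J \<Longrightarrow> a j \<bullet> e j = 1 \<and> (\<forall>k\<in>J - {j}. a k \<bullet> e j = 0)" by metis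
  then have d: "a j \<bullet> e k = (if j = k then 1 else 0)" if "j \<in> J" "k \<in> J" for j k using that by auto
  have "x = (\<Sum>j\<in>J. (a j \<bullet> x) *\<^sub>R e j)" for x
  proof -
    have "x - (\<Sum>j\<in>J. (a j \<bullet> x) *\<^sub>R e j) = 0"
    proof (rule inj)
      fix k assume k: "k \<in> J"
      have "a k \<bullet> (\<Sum>j\<in>J. (a j \<bullet> x) *\<^sub>R e j) = (\<Sum>j\<in>J. if k = j then a j \<bullet> x else 0)"
        unfolding inner_sum_right using d[OF k] by (intro sum.cong) auto
      then show "a k \<bullet> (x - (\<Sum>j\<in>J. (a j \<bullet> x) *\<^sub>R e j)) = 0"
        using k assms(1) by (simp add: inner_diff_right)
    qed
    then show ?thesis by simp
  qed
  then have "dual_system J a e" unfolding dual_system_def using assms(1) d by simp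
  then show ?thesis by blast
qed

text \<open>A maximal independent subfamily of the normals. It extracts a flag from any set of
  hyperplanes whose normals span.\<close>

lemma dual_subsystem_exists:
  fixes a :: "'j \<Rightarrow> 'a::euclidean_space"
  assumes "finite J" and inj: "\<And>x. (\<And>j. j \<in> J \<Longrightarrow> a j \<bullet> x = 0) \<Longrightarrow> x = 0"
  shows "\<exists>J' e. J' \<subseteq> J \<and> dual_system J' a e"
proof -
  obtain B where B: "B \<subseteq> a ` J" "independent B" "a ` J \<subseteq> span B"
    using maximal_independent_subset by blast
  have "dim (a ` J) = DIM('a)"
  proof (rule ccontr)
    assume "dim (a ` J) \<noteq> DIM('a)"
    then have "dim (a ` J) < DIM('a)" using dim_subset_UNIV[of "a ` J"] by simp
    then obtain x where x: "x \<noteq> 0" "\<And>y. y \<in> span (a ` J) \<Longrightarrow> orthogonal x y"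
      using orthogonal_to_subspace_exists by blast
    then have "a j \<bullet> x = 0" if "j \<in> J" for j
      using that x(2)[of "a j"] by (simp add: span_base orthogonal_def inner_commute)
    then show False using inj x(1) by blast
  qed
  then have cB: "card B = DIM('a)" using B basis_card_eq_dim by metis
  then have spB: "span B = UNIV"
    using B(2) card_eq_dim[of B UNIV] independent_imp_finite by auto
  define J' where "J' = inv_into J a ` B"
  have J': "J' \<subseteq> J" "a ` J' = B" "inj_on a J'"
    using B(1) unfolding J'_def by (auto simp: inv_into_into image_image f_inv_into_f subset_iff inj_on_def)
  have "card J' = DIM('a)" using J' cB card_image by metis
  moreover have "x = 0" if "\<And>j. j \<in> J' \<Longrightarrow> a j \<bullet> x = 0" for x
  proof -
    have "B \<subseteq> {y. y \<bullet> x = 0}" using J'(2) that by blast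
    moreover have "subspace {y. y \<bullet> x = 0}" by (simp add: subspace_def inner_add_left)
    ultimately have "span B \<subseteq> {y. y \<bullet> x = 0}" by (rule span_minimal)
    then have "x \<bullet> x = 0" using spB by blast
    then show ?thesis by simp
  qed
  ultimately show ?thesis
    using dual_system_exists[of J' a] J'(1) assms(1) finite_subset by blast
qed

text \<open>Steinitz exchange: since \<open>a l\<close> does not vanish on the edge
  \<open>e k\<close>, the lost k-coordinate can be recovered from the value of \<open>a l\<close>
  and the other coordinates.\<close>

lemma dual_system_exchange:
  fixes a :: "'j \<Rightarrow> 'a::euclidean_space"
  assumes dual: "dual_system J a e" and k: "k \<in> J" and nz: "a l \<bullet> e k \<noteq> 0"
  shows "\<exists>e'. dual_system (insert l (J - {k})) a e'"
proof (rule dual_system_exists)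
  note fin = dual_systemD(1)[OF dual]
  show "finite (insert l (J - {k}))" using fin by simp
  have "l \<notin> J - {k}" using dual_systemD(2)[OF dual _ k, of l] nz by (auto split: if_splits)
  then show "card (insert l (J - {k})) = DIM('a)"
    using fin k dual_system_card[OF dual] by (metis card_Suc_Diff1 card_insert_disjoint finite_Diff)
  fix x assume x: "\<And>j. j \<in> insert l (J - {k}) \<Longrightarrow> a j \<bullet> x = 0"
  have "a l \<bullet> x = (\<Sum>j\<in>J. (a j \<bullet> x) * (a l \<bullet> e j))" by (rule dual_system_expand[OF dual])
  also have "\<dots> = (a k \<bullet> x) * (a l \<bullet> e k)"
    using x fin k by (subst sum.remove[of _ k]) (auto intro!: sum.neutral)
  finally have "a k \<bullet> x = 0" using nz x[of l] by simp
  then have "a j \<bullet> x = a j \<bullet> 0" if "j \<in> J" for j using x[of j] that by (cases "j = k") auto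
  then show "x = 0" by (rule dual_system_eqI[OF dual])
qed

text \<open>Normals and offsets are chosen once, so that hyperplanes can index coordinates. The sign
  of the normal is fixed by one label for which the window is locally the half-space on the side
  \<le>.\<close>

locale scheme =
  fixes \<Gamma> :: "('p::euclidean_space \<times> 'i::euclidean_space) set"
    and L :: "'l set" and W :: "'l \<Rightarrow> 'i set"
    and nrm :: "'i set \<Rightarrow> 'i" and off :: "'i set \<Rightarrow> real"
  assumes scheme: "polytopal_scheme \<Gamma> L W"
    and nrm: "H \<in> hyperplanes L W \<Longrightarrow> nrm H \<noteq> 0 \<and> H = {x. nrm H \<bullet> x = off H} \<and>
      (\<exists>l\<in>L. \<exists>w U. w \<in> H \<and> open U \<and> w \<in> U \<and> W l \<inter> U = {x. nrm H \<bullet> x \<le> off H} \<inter> U)"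

lemma scheme_exists:
  assumes "polytopal_scheme \<Gamma> L W"
  shows "\<exists>nrm off. scheme \<Gamma> L W nrm off"
proof -
  have "\<exists>a b. a \<noteq> 0 \<and> H = {x. a \<bullet> x = b} \<and>
      (\<exists>l\<in>L. \<exists>w U. w \<in> H \<and> open U \<and> w \<in> U \<and> W l \<inter> U = {x. a \<bullet> x \<le> b} \<inter> U)"
    if "H \<in> hyperplanes L W" for H
    using that unfolding hyperplanes_def supporting_hyperplanes_def properly_supports_def by blast
  then obtain nrm off where "\<And>H. H \<in> hyperplanes L W \<Longrightarrow> nrm H \<noteq> 0 \<and> H = {x. nrm H \<bullet> x = off H} \<and>
      (\<exists>l\<in>L. \<exists>w U. w \<in> H \<and> open U \<and> w \<in> U \<and> W l \<inter> U = {x. nrm H \<bullet> x \<le> off H} \<inter> U)"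
    by metis
  then have "scheme \<Gamma> L W nrm off" using assms by unfold_locales auto
  then show ?thesis by blast
qed

section \<open>Vertices, edges and line groups of a flag\<close>

context scheme
begin

abbreviation "Hs \<equiv> hyperplanes L W"

lemma lattice: "is_lattice \<Gamma>"
  and finite_L: "finite L"
  and inj_fst: "inj_on fst \<Gamma>" and inj_snd: "inj_on snd \<Gamma>"
  and dense: "closure (snd ` \<Gamma>) = UNIV"
  and polytopal_W: "l \<in> L \<Longrightarrow> polytopal (W l)"
  and nonsingular: "\<gamma> \<in> \<Gamma> \<Longrightarrow> l \<in> L \<Longrightarrow> snd \<gamma> \<notin> frontier (W l)"
  and W_nonempty: "(\<Union>l\<in>L. W l) \<noteq> {}"
  and polytopal_union: "polytopal (\<Union>l\<in>L. W l)"
  using scheme unfolding polytopal_scheme_def by auto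

lemmas sub_\<Gamma> = lattice_subspace[OF lattice]

lemma finite_Hs: "finite Hs"
  unfolding hyperplanes_def using finite_L polytopal_W supporting_hyperplanes_polytopal(1) by blast

lemma frontier_W: "l \<in> L \<Longrightarrow> frontier (W l) \<subseteq> \<Union>Hs"
proof -
  assume l: "l \<in> L"
  have "supporting_hyperplanes (W l) \<subseteq> Hs" unfolding hyperplanes_def using l by blast
  then show ?thesis using supporting_hyperplanes_polytopal(2)[OF polytopal_W[OF l]] by blast
qed

lemma nrm_nz: "H \<in> Hs \<Longrightarrow> nrm H \<noteq> 0" using nrm by blast

lemma in_hyperplane:
  assumes "H \<in> Hs" shows "x \<in> H \<longleftrightarrow> nrm H \<bullet> x = off H"
proof -
  have "H = {x. nrm H \<bullet> x = off H}" using nrm[OF assms] by (elim conjE)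
  then have "x \<in> H \<longleftrightarrow> x \<in> {x. nrm H \<bullet> x = off H}" by (rule arg_cong)
  then show ?thesis by (simp only: mem_Collect_eq)
qed

lemma linear_part_eq: "H \<in> Hs \<Longrightarrow> linear_part H = {x. nrm H \<bullet> x = 0}"
  using nrm linear_part_hyperplane by metis

lemma snd_eq_0: "g \<in> \<Gamma> \<Longrightarrow> snd g = 0 \<Longrightarrow> g = 0"
  using inj_snd int_mod.subspace_0[OF sub_\<Gamma>] by (metis inj_onD snd_zero)

definition vtx :: "'i set set \<Rightarrow> 'i" where "vtx f = the_elem (\<Inter>f)"

text \<open>The direction of the line in which the hyperplanes of f other than H meet, scaled so
  that \<open>nrm H\<close> takes the value 1 on it. The dual basis of a flag is unique on f, so the
  choice is harmless there.\<close>

definition edge :: "'i set set \<Rightarrow> 'i set \<Rightarrow> 'i" where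
  "edge f = (SOME e. dual_system f nrm e)"

lemma flag_dual:
  assumes f: "f \<in> flags Hs"
  shows "dual_system f nrm (edge f)"
proof -
  obtain v where v: "f \<subseteq> Hs" "finite f" "card f = DIM('i)" "\<Inter>f = {v}"
    using f unfolding flags_def by blast
  have "x = 0" if x: "\<And>H. H \<in> f \<Longrightarrow> nrm H \<bullet> x = 0" for x
  proof -
    have "v + x \<in> H" if "H \<in> f" for H
    proof -
      have "v \<in> H" using v(4) that by blast
      moreover have "H \<in> Hs" using v(1) that by blast
      ultimately show ?thesis using x[OF that] by (simp add: in_hyperplane inner_add_right)
    qed
    then have "v + x \<in> \<Inter>f" by blast
    then show ?thesis using v(4) by simp
  qed
  then show ?thesis unfolding edge_def
    using someI_ex[OF dual_system_exists[OF v(2,3)]] by blast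
qed

lemma flag_subset: "f \<in> flags Hs \<Longrightarrow> f \<subseteq> Hs"
  and flag_finite: "f \<in> flags Hs \<Longrightarrow> finite f"
  unfolding flags_def by auto

lemma vtx_in: "f \<in> flags Hs \<Longrightarrow> H \<in> f \<Longrightarrow> nrm H \<bullet> vtx f = off H"
proof -
  assume f: "f \<in> flags Hs" and H: "H \<in> f"
  then obtain v where "\<Inter>f = {v}" unfolding flags_def by blast
  then have "vtx f \<in> \<Inter>f" by (simp add: vtx_def)
  then have "vtx f \<in> H" using H by blast
  then show ?thesis using in_hyperplane flag_subset[OF f] H by blast
qed

lemma flagI:
  assumes "f \<subseteq> Hs" and "dual_system f nrm e" and "\<And>H. H \<in> f \<Longrightarrow> nrm H \<bullet> v = off H"
  shows "f \<in> flags Hs" and "vtx f = v"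
proof -
  have "\<Inter>f = {v}"
  proof
    show "{v} \<subseteq> \<Inter>f" using assms in_hyperplane by blast
    show "\<Inter>f \<subseteq> {v}"
    proof
      fix x assume x: "x \<in> \<Inter>f"
      have "x = v"
      proof (rule dual_system_eqI[OF assms(2)])
        fix H assume "H \<in> f"
        then have "x \<in> H" "H \<in> Hs" using x assms(1) by auto
        then show "nrm H \<bullet> x = nrm H \<bullet> v" using in_hyperplane[of H x] assms(3)[OF \<open>H \<in> f\<close>] by simp
      qed
      then show "x \<in> {v}" by simp
    qed
  qed
  then show "f \<in> flags Hs" "vtx f = v"
    unfolding flags_def vtx_def using assms dual_systemD(1) dual_system_card by auto
qed

lemma finite_flags: "finite (flags Hs)"
  by (rule finite_subset[of _ "Pow Hs"]) (auto simp: flags_def finite_Hs)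

text \<open>Independent normals suffice: the vertex is the vector with coordinates
  \<open>off H\<close>.\<close>

lemma flagI':
  assumes "f \<subseteq> Hs" and "dual_system f nrm e"
  shows "f \<in> flags Hs"
proof (rule flagI[OF assms])
  fix H assume "H \<in> f"
  then show "nrm H \<bullet> (\<Sum>H\<in>f. off H *\<^sub>R e H) = off H" by (rule dual_system_sum[OF assms(2)])
qed

definition line :: "'i set set \<Rightarrow> 'i set \<Rightarrow> ('p \<times> 'i) set" where
  "line f H = {g \<in> \<Gamma>. \<forall>H'\<in>f - {H}. nrm H' \<bullet> snd g = 0}"

lemma line_subset: "line f H \<subseteq> \<Gamma>" unfolding line_def by auto

lemma line_subspace: "int_mod.subspace (line f H)"
  using sub_\<Gamma> unfolding line_def int_mod.subspace_def
  by (auto simp: inner_add_right int_scale_def)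

lemma line_snd:
  assumes "f \<in> flags Hs" and "H \<in> f" and "g \<in> line f H"
  shows "snd g = (nrm H \<bullet> snd g) *\<^sub>R edge f H"
proof -
  note d = flag_dual[OF assms(1)]
  have "snd g = (\<Sum>K\<in>f. (nrm K \<bullet> snd g) *\<^sub>R edge f K)" by (rule dual_systemD(3)[OF d])
  also have "\<dots> = (nrm H \<bullet> snd g) *\<^sub>R edge f H"
    using assms flag_finite[OF assms(1)] unfolding line_def
    by (subst sum.remove[of _ H]) (auto intro!: sum.neutral)
  finally show ?thesis .
qed

text \<open>N annihilates the quotient of \<Gamma> by the sum of the line groups of f. The property
  passes to multiples of N, so one N can serve all flags.\<close>

definition splits :: "nat \<Rightarrow> 'i set set \<Rightarrow> bool" where
  "splits N f \<longleftrightarrow> (\<forall>g\<in>\<Gamma>. \<exists>c. (\<forall>H\<in>f. c H \<in> line f H) \<and> int_scale (int N) g = (\<Sum>H\<in>f. c H))"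

lemma splits_mult:
  assumes "splits N f"
  shows "splits (M * N) f"
  unfolding splits_def
proof
  fix g assume "g \<in> \<Gamma>"
  then obtain c where c: "\<forall>H\<in>f. c H \<in> line f H" "int_scale (int N) g = (\<Sum>H\<in>f. c H)"
    using assms unfolding splits_def by blast
  have "int_scale (int (M * N)) g = int_scale (int M) (int_scale (int N) g)" by simp
  also have "\<dots> = (\<Sum>H\<in>f. int_scale (int M) (c H))" unfolding c(2) by (rule int_mod.scale_sum_right)
  finally show "\<exists>c. (\<forall>H\<in>f. c H \<in> line f H) \<and> int_scale (int (M * N)) g = (\<Sum>H\<in>f. c H)"
    using c(1) int_mod.subspace_scale[OF line_subspace] by (intro exI[of _ "\<lambda>H. int_scale (int M) (c H)"]) auto
qed

text \<open>With a single hyperplane in the flag, the condition defining \<open>line\<close> is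
  empty. This is the source of N = 1 in codimension one.\<close>

lemma splits_codim_one:
  assumes "DIM('i) = 1" and "f \<in> flags Hs"
  shows "splits 1 f"
proof -
  have "card f = 1" using assms unfolding flags_def by auto
  then obtain H where H: "f = {H}" by (auto simp: card_1_singleton_iff)
  show ?thesis unfolding splits_def H line_def
    by (auto intro!: exI[of _ "\<lambda>_. g" for g])
qed

end

subsection \<open>The structure of CSR decompositions\<close>

lemma set_family_sum_subspace:
  assumes "\<And>S. S \<in> Q \<Longrightarrow> int_mod.subspace (X S)"
  shows "int_mod.subspace (set_family_sum X Q)"
  unfolding int_mod.subspace_def
proof (intro conjI ballI allI)
  have "0 = (\<Sum>S\<in>Q. 0::'b)" by simp
  then show "0 \<in> set_family_sum X Q" unfolding set_family_sum_def
    using assms int_mod.subspace_0 by (intro CollectI exI[of _ "\<lambda>_. 0"]) auto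
next
  fix x y assume "x \<in> set_family_sum X Q" "y \<in> set_family_sum X Q"
  then obtain f g where "x = sum f Q" "y = sum g Q" "\<forall>S\<in>Q. f S \<in> X S" "\<forall>S\<in>Q. g S \<in> X S"
    unfolding set_family_sum_def by blast
  then show "x + y \<in> set_family_sum X Q" unfolding set_family_sum_def
    using int_mod.subspace_add[OF assms]
    by (intro CollectI exI[of _ "\<lambda>S. f S + g S"]) (auto simp: sum.distrib)
next
  fix c x assume "x \<in> set_family_sum X Q"
  then obtain f where "x = sum f Q" "\<forall>S\<in>Q. f S \<in> X S" unfolding set_family_sum_def by blast
  then show "int_scale c x \<in> set_family_sum X Q" unfolding set_family_sum_def
    using int_mod.subspace_scale[OF assms]
    by (intro CollectI exI[of _ "\<lambda>S. int_scale c (f S)"]) (auto simp: int_mod.scale_sum_right)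
qed

text \<open>Two of the multiples 0, g, 2 g, ... lie in the same coset, and their difference is the
  required multiple.\<close>

lemma finite_index_multiple:
  fixes G H :: "'a::real_vector set"
  assumes "finite_index H G" and "int_mod.subspace G" and "int_mod.subspace H" and g: "g \<in> G"
  shows "\<exists>m::int. m > 0 \<and> int_scale m g \<in> H"
proof -
  have fin: "finite ((\<lambda>g. (\<lambda>h. g + h) ` H) ` G)" using assms unfolding finite_index_def by blast
  have "(\<lambda>k::nat. (\<lambda>h. int_scale (int k) g + h) ` H) ` UNIV \<subseteq> (\<lambda>g. (\<lambda>h. g + h) ` H) ` G"
    using g int_mod.subspace_scale[OF assms(2)] by auto
  then have "finite ((\<lambda>k::nat. (\<lambda>h. int_scale (int k) g + h) ` H) ` UNIV)"
    using fin finite_subset by blast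
  then have "\<not> inj (\<lambda>k::nat. (\<lambda>h. int_scale (int k) g + h) ` H)"
    using finite_imageD by blast
  then obtain i j :: nat where ij: "(\<lambda>h. int_scale (int i) g + h) ` H = (\<lambda>h. int_scale (int j) g + h) ` H" "i \<noteq> j"
    unfolding inj_def by blast
  have key: "\<exists>m::int. m > 0 \<and> int_scale m g \<in> H"
    if e: "(\<lambda>h. int_scale (int i) g + h) ` H = (\<lambda>h. int_scale (int j) g + h) ` H" and "i < j" for i j :: nat
  proof -
    have "int_scale (int j) g + 0 \<in> (\<lambda>h. int_scale (int i) g + h) ` H"
      unfolding e using int_mod.subspace_0[OF assms(3)] by (rule imageI)
    then obtain h where h: "h \<in> H" "int_scale (int j) g = int_scale (int i) g + h" by auto
    then have "int_scale (int j - int i) g = h" by (simp add: int_mod.scale_left_diff_distrib)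
    then show ?thesis using h that by (intro exI[of _ "int j - int i"]) auto
  qed
  show ?thesis using key[OF ij(1)] key[OF ij(1)[symmetric]] ij(2) by (meson linorder_neqE_nat)
qed

locale csr = scheme \<Gamma> L W nrm off
  for \<Gamma> :: "('p::euclidean_space \<times> 'i::euclidean_space) set" and L :: "'l set" and W nrm off +
  fixes Q :: "'i set set set"
  assumes csr: "CSR_decomposition \<Gamma> (hyperplanes L W) Q"
begin

lemma decomp: "decomposition Hs Q" using csr unfolding CSR_decomposition_def by blast

lemma finite_linear_parts: "finite (linear_parts Hs)"
  unfolding linear_parts_def using finite_Hs by simp

lemma finite_Q: "finite Q"
proof (rule finite_subset)
  show "Q \<subseteq> Pow (linear_parts Hs)" using decomp unfolding decomposition_def by blast
qed (use finite_linear_parts in simp)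

text \<open>Members of Q serve as names of the types: this is the only S such that the normal of H
  does not vanish on \<open>\<Inter>S\<close>.\<close>

definition htype :: "'i set \<Rightarrow> 'i set set" where
  "htype H = (THE S. S \<in> Q \<and> linear_part H \<notin> S)"

lemma htype_in_Q:
  assumes "H \<in> Hs"
  shows "htype H \<in> Q" and "linear_part H \<notin> htype H" and "S \<in> Q \<Longrightarrow> S \<noteq> htype H \<Longrightarrow> linear_part H \<in> S"
proof -
  have "linear_part H \<in> linear_parts Hs" unfolding linear_parts_def using assms by blast
  then have ex: "\<exists>!S. S \<in> Q \<and> linear_part H \<notin> S"
    using decomp unfolding decomposition_def by blast
  show "htype H \<in> Q" "linear_part H \<notin> htype H" using theI'[OF ex] unfolding htype_def by auto
  then show "S \<in> Q \<Longrightarrow> S \<noteq> htype H \<Longrightarrow> linear_part H \<in> S" using ex by blast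
qed

lemma nrm_other_type:
  assumes "H \<in> Hs" and "S \<in> Q" and "S \<noteq> htype H" and "x \<in> \<Inter>S"
  shows "nrm H \<bullet> x = 0"
proof -
  have "x \<in> linear_part H" using htype_in_Q(3)[OF assms(1-3)] assms(4) by blast
  then show ?thesis using linear_part_eq[OF assms(1)] by simp
qed

lemma member_Q: "S \<in> Q \<Longrightarrow> V \<in> S \<Longrightarrow> \<exists>H\<in>Hs. V = linear_part H"
  using decomp unfolding decomposition_def linear_parts_def by blast

lemma subspace_X:
  assumes "S \<in> Q" shows "subspace (\<Inter>S)"
proof (rule subspace_Inter, rule ballI)
  fix V assume "V \<in> S"
  then obtain H where "H \<in> Hs" "V = linear_part H" using member_Q[OF assms] by blast
  then show "subspace V" by (simp add: linear_part_eq subspace_hyperplane)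
qed

lemma decompose_vector: "\<exists>c. (\<forall>S\<in>Q. c S \<in> \<Inter>S) \<and> x = (\<Sum>S\<in>Q. c S)"
proof -
  have "x \<in> set_family_sum Inter Q" using decomp unfolding decomposition_def by blast
  then show ?thesis unfolding set_family_sum_def by blast
qed

lemma nrm_component:
  assumes "H \<in> Hs" and "\<forall>S\<in>Q. c S \<in> \<Inter>S"
  shows "nrm H \<bullet> (\<Sum>S\<in>Q. c S) = nrm H \<bullet> c (htype H)"
proof -
  have "nrm H \<bullet> (\<Sum>S\<in>Q. c S) = nrm H \<bullet> c (htype H) + (\<Sum>S\<in>Q - {htype H}. nrm H \<bullet> c S)"
    unfolding inner_sum_right using finite_Q htype_in_Q(1)[OF assms(1)] by (rule sum.remove)
  also have "(\<Sum>S\<in>Q - {htype H}. nrm H \<bullet> c S) = 0"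
    using nrm_other_type[OF assms(1)] assms(2) by (intro sum.neutral) blast
  finally show ?thesis by simp
qed

text \<open>The component of the edge in a summand of another type pairs to 0 with every normal of
  the flag, so it vanishes.\<close>

lemma edge_in:
  assumes f: "f \<in> flags Hs" and H: "H \<in> f"
  shows "edge f H \<in> \<Inter>(htype H)"
proof -
  note d = flag_dual[OF f]
  have fH: "\<And>K. K \<in> f \<Longrightarrow> K \<in> Hs" using flag_subset[OF f] by blast
  obtain c where c: "\<forall>S\<in>Q. c S \<in> \<Inter>S" "edge f H = (\<Sum>S\<in>Q. c S)"
    using decompose_vector by blast
  have z: "c S = 0" if S: "S \<in> Q" "S \<noteq> htype H" for S
  proof (rule dual_system_eqI[OF d])
    fix K assume K: "K \<in> f"
    show "nrm K \<bullet> c S = nrm K \<bullet> 0"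
    proof (cases "htype K = S")
      case True
      then have "K \<noteq> H" using S by blast
      then have "nrm K \<bullet> edge f H = 0" using dual_systemD(2)[OF d K H] by simp
      then show ?thesis using nrm_component[OF fH[OF K] c(1)] c(2) True by simp
    next
      case False
      then show ?thesis using nrm_other_type[OF fH[OF K] S(1)] c(1) S(1) by fastforce
    qed
  qed
  have "edge f H = c (htype H) + (\<Sum>S\<in>Q - {htype H}. c S)"
    unfolding c(2) using finite_Q htype_in_Q(1)[OF fH[OF H]] by (rule sum.remove)
  also have "(\<Sum>S\<in>Q - {htype H}. c S) = 0" using z by (intro sum.neutral) blast
  finally show ?thesis using c(1) htype_in_Q(1)[OF fH[OF H]] by simp
qed

lemma in_X_iff:
  assumes f: "f \<in> flags Hs" and S: "S \<in> Q"
  shows "x \<in> \<Inter>S \<longleftrightarrow> (\<forall>H\<in>f. htype H \<noteq> S \<longrightarrow> nrm H \<bullet> x = 0)"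
proof
  assume "x \<in> \<Inter>S"
  then show "\<forall>H\<in>f. htype H \<noteq> S \<longrightarrow> nrm H \<bullet> x = 0"
    using nrm_other_type[OF _ S] flag_subset[OF f] by (metis subsetD)
next
  assume z: "\<forall>H\<in>f. htype H \<noteq> S \<longrightarrow> nrm H \<bullet> x = 0"
  have "x = (\<Sum>H\<in>f. (nrm H \<bullet> x) *\<^sub>R edge f H)" by (rule dual_systemD(3)[OF flag_dual[OF f]])
  also have "\<dots> \<in> \<Inter>S"
  proof (rule subspace_sum[OF subspace_X[OF S]])
    fix H assume H: "H \<in> f"
    show "(nrm H \<bullet> x) *\<^sub>R edge f H \<in> \<Inter>S"
    proof (cases "htype H = S")
      case True
      then show ?thesis using subspace_scale[OF subspace_X[OF S]] edge_in[OF f H] by blast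
    next
      case False
      then have "nrm H \<bullet> x = 0" using z H by blast
      then show ?thesis using subspace_0[OF subspace_X[OF S]] by (simp only: scale_zero_left)
    qed
  qed
  finally show "x \<in> \<Inter>S" .
qed

text \<open>The edges of type S form a basis of \<open>\<Inter>S\<close>. In particular every flag
  has the same number of hyperplanes of each type.\<close>

lemma dim_X:
  assumes f: "f \<in> flags Hs" and S: "S \<in> Q"
  shows "dim (\<Inter>S) = card {H\<in>f. htype H = S}"
proof -
  note d = flag_dual[OF f]
  let ?F = "{H\<in>f. htype H = S}"
  have inj: "inj_on (edge f) ?F"
  proof (rule inj_onI)
    fix H K assume "H \<in> ?F" "K \<in> ?F" "edge f H = edge f K"
    then show "H = K" using dual_systemD(2)[OF d, of H H] dual_systemD(2)[OF d, of H K]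
      by (auto split: if_splits)
  qed
  have "independent (edge f ` ?F)"
  proof (rule independent_if_scalars_zero)
    show "finite (edge f ` ?F)" using flag_finite[OF f] by simp
    fix u x assume s: "(\<Sum>x\<in>edge f ` ?F. u x *\<^sub>R x) = 0" and "x \<in> edge f ` ?F"
    then obtain H where H: "H \<in> f" "htype H = S" "x = edge f H" by blast
    have "(\<Sum>K\<in>f. (if htype K = S then u (edge f K) else 0) *\<^sub>R edge f K) = (\<Sum>K\<in>?F. u (edge f K) *\<^sub>R edge f K)"
      using flag_finite[OF f] by (intro sum.mono_neutral_cong_right) auto
    also have "\<dots> = 0" using s by (simp add: sum.reindex[OF inj])
    finally show "u x = 0"
      using dual_system_sum[OF d H(1), of "\<lambda>K. if htype K = S then u (edge f K) else 0"] H by simp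
  qed
  moreover have "edge f ` ?F \<subseteq> \<Inter>S" using edge_in[OF f] by blast
  moreover have "\<Inter>S \<subseteq> span (edge f ` ?F)"
  proof
    fix x assume x: "x \<in> \<Inter>S"
    have "x = (\<Sum>H\<in>f. (nrm H \<bullet> x) *\<^sub>R edge f H)" by (rule dual_systemD(3)[OF d])
    also have "\<dots> \<in> span (edge f ` ?F)"
    proof (rule span_sum)
      fix H assume "H \<in> f"
      then show "(nrm H \<bullet> x) *\<^sub>R edge f H \<in> span (edge f ` ?F)"
        using in_X_iff[OF f S, of x] x by (cases "htype H = S") (auto intro: span_scale span_base span_zero)
    qed
    finally show "x \<in> span (edge f ` ?F)" .
  qed
  ultimately have "card (edge f ` ?F) = dim (\<Inter>S)" by (intro basis_card_eq_dim)
  then show ?thesis using inj by (simp add: card_image)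
qed

text \<open>Strictness of S provides a hyperplane of type S, and the S-component of its normal pairs
  with the normal to the square of its length.\<close>

lemma dim_X_pos:
  assumes S: "S \<in> Q" shows "dim (\<Inter>S) > 0"
proof -
  have "S \<subset> linear_parts Hs" using decomp S unfolding decomposition_def by blast
  then obtain H where H: "H \<in> Hs" "linear_part H \<notin> S" unfolding linear_parts_def by blast
  then have t: "htype H = S" using htype_in_Q(3)[OF H(1)] S by blast
  obtain c where c: "\<forall>S\<in>Q. c S \<in> \<Inter>S" "nrm H = (\<Sum>S\<in>Q. c S)" using decompose_vector by blast
  have "nrm H \<bullet> c S = nrm H \<bullet> nrm H" using nrm_component[OF H(1) c(1)] c(2) t by simp
  then have "c S \<noteq> 0" using nrm_nz[OF H(1)] by auto
  then show ?thesis using c(1) S by (metis dim_eq_0 gr0I singletonD subsetD)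
qed

section \<open>Ranks of the stabilisers and of the line groups\<close>

lemma stabiliser_subspace:
  assumes "S \<subseteq> linear_parts Hs"
  shows "int_mod.subspace (stabiliser \<Gamma> S)"
proof -
  have V: "subspace V" if "V \<in> S" for V
    using that assms unfolding linear_parts_def by (auto simp: linear_part_eq subspace_hyperplane)
  show ?thesis unfolding int_mod.subspace_def stabiliser_def
    using int_mod.subspace_0[OF sub_\<Gamma>] int_mod.subspace_add[OF sub_\<Gamma>] int_mod.subspace_scale[OF sub_\<Gamma>]
      subspace_0[OF V] subspace_add[OF V] subspace_scale[OF V]
    by (auto simp: int_scale_def)
qed

lemma stabiliser_eq: "stabiliser \<Gamma> S = {g\<in>\<Gamma>. snd g \<in> \<Inter>S}"
  unfolding stabiliser_def by auto

lemma Q_subset: "S \<in> Q \<Longrightarrow> S \<subseteq> linear_parts Hs"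
  using decomp unfolding decomposition_def by blast

definition krank :: "'i set set \<Rightarrow> nat" where "krank S = int_rank (stabiliser \<Gamma> S)"

definition dexp :: "'i set set \<Rightarrow> real" where "dexp S = dioph_exponent (krank S) (dim (\<Inter>S))"

lemma krank_eq: "S \<in> Q \<Longrightarrow> real (krank S) = real (dim (\<Inter>S)) * (dexp S + 1)"
proof -
  assume "S \<in> Q"
  then have "real (dim (\<Inter>S)) > 0" using dim_X_pos[of S] by (simp only: of_nat_0_less_iff)
  moreover have "k = n * ((k - n) / n + 1)" if "n > 0" for n k :: real
    using that by (simp add: distrib_left)
  ultimately show ?thesis unfolding dexp_def dioph_exponent_def by blast
qed

lemma csr_rank:
  assumes "H \<in> Hs"
  shows "real (int_rank (stabiliser \<Gamma> {linear_part H} \<inter> stabiliser \<Gamma> (htype H))) = real (krank (htype H)) - (dexp (htype H) + 1)"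
proof -
  have "linear_part H \<in> linear_parts Hs - htype H"
    using htype_in_Q(2)[OF assms] assms unfolding linear_parts_def by blast
  then show ?thesis using csr htype_in_Q(1)[OF assms] unfolding CSR_decomposition_def krank_def dexp_def by auto
qed

lemma finite_rank_\<Gamma>: "\<exists>F. finite F \<and> \<Gamma> \<subseteq> rat_vs.span F"
  using lattice_basis[OF lattice] int_span_subset_rat_span by metis

lemma int_rank_mono:
  assumes "G \<subseteq> H" and "H \<subseteq> \<Gamma>" shows "int_rank G \<le> int_rank H"
proof -
  obtain F where F: "finite F" "\<Gamma> \<subseteq> rat_vs.span F" using finite_rank_\<Gamma> by blast
  then have "H \<subseteq> rat_vs.span F" "G \<subseteq> rat_vs.span F" using assms by blast+
  then show ?thesis using rat_vs.dim_mono_finite[OF F(1) _ assms(1)] int_rank_eq_dim[OF F(1)] by metis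
qed

text \<open>The stabiliser of S has rank \<open>n_S\<close> (\<delta> + 1), and each of the other
  \<open>n_S\<close> - 1 hyperplanes of type S in the flag lowers the rank by at most \<delta> + 1.
  Hyperplanes of other types impose no condition there.\<close>

lemma line_rank_ge:
  assumes f: "f \<in> flags Hs" and H: "H \<in> f"
  shows "dexp (htype H) + 1 \<le> real (int_rank (line f H))"
proof -
  define S where "S = htype H"
  have fH: "\<And>K. K \<in> f \<Longrightarrow> K \<in> Hs" using flag_subset[OF f] by blast
  have S: "S \<in> Q" unfolding S_def using htype_in_Q(1) fH H by blast
  obtain F0 where F0: "finite F0" "\<Gamma> \<subseteq> rat_vs.span F0" using finite_rank_\<Gamma> by blast
  let ?A = "\<lambda>F. {g \<in> stabiliser \<Gamma> S. \<forall>K\<in>F. nrm K \<bullet> snd g = 0}"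
  have A: "real (krank S) - real (card F) * (dexp S + 1) \<le> real (int_rank (?A F))"
    if "finite F" "F \<subseteq> {K\<in>f. htype K = S}" for F
    using that
  proof (induction F rule: finite_induct)
    case empty
    then show ?case by (simp add: krank_def)
  next
    case (insert K F)
    then have K: "K \<in> Hs" "htype K = S" using fH by auto
    let ?B = "stabiliser \<Gamma> {linear_part K} \<inter> stabiliser \<Gamma> S"
    have "int_rank (?A F) + int_rank ?B \<le> int_rank (stabiliser \<Gamma> S) + int_rank (?A F \<inter> ?B)"
    proof (rule int_rank_Int_ge[OF F0(1)])
      show "int_mod.subspace (?A F)"
        using stabiliser_subspace[OF Q_subset[OF S]]
        by (auto simp: int_mod.subspace_def inner_add_right int_scale_def)
      have "linear_part K \<in> linear_parts Hs" using K unfolding linear_parts_def by blast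
      then show "int_mod.subspace ?B"
        using stabiliser_subspace Q_subset[OF S] by (intro int_mod.subspace_inter) auto
      show "stabiliser \<Gamma> S \<subseteq> rat_vs.span F0" using F0 unfolding stabiliser_def by blast
    qed auto
    moreover have "?A F \<inter> ?B = ?A (insert K F)"
      using K by (auto simp: stabiliser_def linear_part_eq)
    moreover have "real (int_rank ?B) = real (krank S) - (dexp S + 1)"
      using csr_rank[OF K(1)] K(2) by simp
    ultimately have "real (int_rank (?A F)) - (dexp S + 1) \<le> real (int_rank (?A (insert K F)))"
      using of_nat_mono[of "int_rank (?A F) + int_rank ?B", where 'a = real] unfolding krank_def by fastforce
    then show ?case using insert by (simp add: algebra_simps)
  qed
  let ?F = "{K\<in>f. htype K = S} - {H}"
  have fin: "finite {K\<in>f. htype K = S}" using flag_finite[OF f] by simp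
  have "card ?F = dim (\<Inter>S) - 1"
    using H fin dim_X[OF f S] by (simp add: S_def card_Diff_singleton)
  then have cF: "real (card ?F) = real (dim (\<Inter>S)) - 1"
    using dim_X_pos[OF S] by simp
  have "dexp S + 1 = real (krank S) - real (card ?F) * (dexp S + 1)"
    unfolding cF krank_eq[OF S] by (simp add: algebra_simps)
  also have "\<dots> \<le> real (int_rank (?A ?F))" using fin by (intro A) auto
  also have "\<dots> \<le> real (int_rank (line f H))"
  proof -
    have "?A ?F \<subseteq> line f H"
    proof
      fix g assume g: "g \<in> ?A ?F"
      have "nrm K \<bullet> snd g = 0" if K: "K \<in> f - {H}" for K
      proof (cases "htype K = S")
        case False
        then show ?thesis using nrm_other_type[of K S "snd g"] K g S fH by (auto simp: stabiliser_def)
      qed (use K g in auto)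
      then show "g \<in> line f H" using g unfolding line_def stabiliser_def by blast
    qed
    then show ?thesis using int_rank_mono line_subset by simp
  qed
  finally show ?thesis by (simp add: S_def)
qed

lemma sum_lines_subset: "set_family_sum (line f) F \<subseteq> \<Gamma>"
proof
  fix x assume "x \<in> set_family_sum (line f) F"
  then obtain c where c: "x = sum c F" "\<forall>H\<in>F. c H \<in> line f H" unfolding set_family_sum_def by blast
  have "c H \<in> \<Gamma>" if "H \<in> F" for H using c(2) that line_subset by blast
  then show "x \<in> \<Gamma>" unfolding c(1) by (rule int_mod.subspace_sum[OF sub_\<Gamma>])
qed

text \<open>The edges are independent and \<open>snd\<close> is injective on \<Gamma>, so each line
  group meets the sum of the previous ones trivially and the ranks add up.\<close>

lemma sum_rank_lines:
  assumes f: "f \<in> flags Hs" and "F \<subseteq> f"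
  shows "(\<Sum>H\<in>F. int_rank (line f H)) \<le> int_rank (set_family_sum (line f) F)"
proof -
  obtain F0 where F0: "finite F0" "\<Gamma> \<subseteq> rat_vs.span F0" using finite_rank_\<Gamma> by blast
  have "finite F" using assms flag_finite finite_subset by blast
  then show ?thesis using assms(2)
  proof (induction F rule: finite_induct)
    case (insert H F)
    have z: "int_rank (set_family_sum (line f) F \<inter> line f H) = 0"
    proof -
      have "g = 0" if g: "g \<in> set_family_sum (line f) F" "g \<in> line f H" for g
      proof -
        have "snd g = 0"
        proof (rule dual_system_eqI[OF flag_dual[OF f]])
          fix K assume K: "K \<in> f"
          show "nrm K \<bullet> snd g = nrm K \<bullet> 0"
          proof (cases "K = H")
            case True
            obtain c where c: "g = (\<Sum>H\<in>F. c H)" "\<forall>H\<in>F. c H \<in> line f H"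
              using g(1) unfolding set_family_sum_def by blast
            have "nrm K \<bullet> snd (c J) = 0" if "J \<in> F" for J
              using c(2) that insert K True unfolding line_def by blast
            then show ?thesis unfolding c(1) by (simp add: snd_sum inner_sum_right)
          next
            case False
            then show ?thesis using g(2) K unfolding line_def by simp
          qed
        qed
        then show ?thesis using snd_eq_0 g(2) line_subset by blast
      qed
      then have "set_family_sum (line f) F \<inter> line f H \<subseteq> {0}" by blast
      then have "rat_vs.dim (set_family_sum (line f) F \<inter> line f H) \<le> card ({} :: ('p \<times> 'i) set)"
        by (intro rat_vs.dim_le_card) auto
      moreover have "set_family_sum (line f) F \<inter> line f H \<subseteq> rat_vs.span F0"
        using line_subset F0(2) by blast
      ultimately show ?thesis using int_rank_eq_dim[OF F0(1)] by simp
    qed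
    have "int_rank (set_family_sum (line f) F) + int_rank (line f H) \<le>
      int_rank (set_family_sum (line f) (insert H F)) + int_rank (set_family_sum (line f) F \<inter> line f H)"
    proof (rule int_rank_Int_ge[OF F0(1)])
      show "int_mod.subspace (set_family_sum (line f) F)"
        by (intro set_family_sum_subspace line_subspace)
      show "set_family_sum (line f) F \<subseteq> set_family_sum (line f) (insert H F)"
      proof
        fix x assume "x \<in> set_family_sum (line f) F"
        then obtain c where c: "x = sum c F" "\<forall>H\<in>F. c H \<in> line f H" unfolding set_family_sum_def by blast
        have "sum (c(H := 0)) (insert H F) = sum (c(H := 0)) F" using insert.hyps by simp
        also have "\<dots> = x" unfolding c(1) using insert.hyps by (intro sum.cong) auto
        finally have "sum (c(H := 0)) (insert H F) = x" .
        then show "x \<in> set_family_sum (line f) (insert H F)"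
          unfolding set_family_sum_def using c(2) int_mod.subspace_0[OF line_subspace]
          by (intro CollectI exI[of _ "c(H := 0)"]) auto
      qed
      show "line f H \<subseteq> set_family_sum (line f) (insert H F)"
      proof
        fix x assume x: "x \<in> line f H"
        have "sum ((\<lambda>_. 0)(H := x)) (insert H F) = x"
          using insert.hyps by (simp add: sum.neutral)
        then show "x \<in> set_family_sum (line f) (insert H F)"
          unfolding set_family_sum_def using x int_mod.subspace_0[OF line_subspace]
          by (intro CollectI exI[of _ "(\<lambda>_. 0)(H := x)"]) auto
      qed
      show "set_family_sum (line f) (insert H F) \<subseteq> rat_vs.span F0" using sum_lines_subset F0 by blast
    qed (rule line_subspace)
    then show ?case using insert z by simp
  qed simp
qed

text \<open>Bases of the summands together generate a subgroup containing one of finite index, hence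
  they span \<Gamma> rationally.\<close>

lemma rank_le_sum_krank: "DIM('p) + DIM('i) \<le> (\<Sum>S\<in>Q. krank S)"
proof -
  let ?T = "set_family_sum (stabiliser \<Gamma>) Q"
  have fi: "finite_index ?T \<Gamma>" using csr unfolding CSR_decomposition_def by blast
  have "\<exists>B. finite B \<and> int_mod.span B = stabiliser \<Gamma> S \<and> card B = krank S" if "S \<in> Q" for S
    using lattice_subgroup_basis[OF lattice stabiliser_subspace[OF Q_subset[OF that]]]
    unfolding krank_def by (metis (no_types, lifting) mem_Collect_eq stabiliser_def subsetI)
  then obtain B where B: "\<And>S. S \<in> Q \<Longrightarrow> finite (B S) \<and> int_mod.span (B S) = stabiliser \<Gamma> S \<and> card (B S) = krank S"
    by metis
  let ?U = "\<Union>S\<in>Q. B S"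
  have fU: "finite ?U" using finite_Q B by blast
  have T: "?T \<subseteq> int_mod.span ?U"
  proof
    fix x assume "x \<in> ?T"
    then obtain c where c: "x = sum c Q" "\<forall>S\<in>Q. c S \<in> stabiliser \<Gamma> S" unfolding set_family_sum_def by blast
    have "c S \<in> int_mod.span ?U" if "S \<in> Q" for S
    proof -
      have "int_mod.span (B S) \<subseteq> int_mod.span ?U" using that by (intro int_mod.span_mono) blast
      then show ?thesis using c(2) B that by blast
    qed
    then show "x \<in> int_mod.span ?U" unfolding c(1) by (rule int_mod.span_sum)
  qed
  have sT: "int_mod.subspace ?T" using stabiliser_subspace Q_subset by (intro set_family_sum_subspace) blast
  have "\<Gamma> \<subseteq> rat_vs.span ?U"
  proof
    fix g assume "g \<in> \<Gamma>"
    then obtain m :: int where m: "m > 0" "int_scale m g \<in> ?T"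
      using finite_index_multiple[OF fi sub_\<Gamma> sT] by blast
    then have "of_int m *\<^sub>R g \<in> int_mod.span ?U" using T by (auto simp: int_scale_def)
    then have "g \<in> rat_vs.span (int_mod.span ?U)"
      using rat_span_subgroup[OF int_mod.subspace_span] m(1) by blast
    moreover have "rat_vs.span (int_mod.span ?U) \<subseteq> rat_vs.span ?U"
      by (intro rat_vs.span_minimal int_span_subset_rat_span rat_vs.subspace_span)
    ultimately show "g \<in> rat_vs.span ?U" by blast
  qed
  then have "int_rank \<Gamma> \<le> card ?U"
    using int_rank_eq_dim[OF fU] rat_vs.dim_le_card[OF _ fU] by simp
  also have "\<dots> \<le> (\<Sum>S\<in>Q. card (B S))" by (rule card_UN_le[OF finite_Q])
  also have "\<dots> = (\<Sum>S\<in>Q. krank S)" using B by (intro sum.cong) auto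
  finally show ?thesis using lattice_rank[OF lattice] by simp
qed

lemma sum_types:
  assumes f: "f \<in> flags Hs"
  shows "(\<Sum>H\<in>f. dexp (htype H) + 1) = (\<Sum>S\<in>Q. real (krank S))"
proof -
  have "(\<Sum>H\<in>f. dexp (htype H) + 1) = (\<Sum>S\<in>Q. \<Sum>H\<in>{H\<in>f. htype H = S}. dexp (htype H) + 1)"
    using flag_subset[OF f] htype_in_Q(1) by (intro sum.group[symmetric] flag_finite[OF f] finite_Q) auto
  also have "\<dots> = (\<Sum>S\<in>Q. real (krank S))"
  proof (rule sum.cong[OF refl])
    fix S assume S: "S \<in> Q"
    have "(\<Sum>H\<in>{H\<in>f. htype H = S}. dexp (htype H) + 1) = (\<Sum>H\<in>{H\<in>f. htype H = S}. dexp S + 1)"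
      by (intro sum.cong) auto
    then show "(\<Sum>H\<in>{H\<in>f. htype H = S}. dexp (htype H) + 1) = real (krank S)"
      by (simp add: krank_eq[OF S] dim_X[OF f S])
  qed
  finally show ?thesis .
qed

text \<open>A chain of inequalities closes up: k is at most the sum of the ranks of the summands,
  which is the sum of \<delta> + 1 over the flag; this is at most the sum of the ranks of the line
  groups, which is at most the rank of their sum, which is at most k. So all are equalities, also
  term by term, and subtracting \<open>card f\<close> = n leaves d.\<close>

lemma flag_structure:
  assumes f: "f \<in> flags Hs"
  shows "int_rank (set_family_sum (line f) f) = DIM('p) + DIM('i)"
    and "H \<in> f \<Longrightarrow> real (int_rank (line f H)) = dexp (htype H) + 1"
    and "(\<Sum>H\<in>f. dexp (htype H)) = real DIM('p)"
proof -
  note sub = sum_lines_subset[of f f]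
  have 1: "int_rank (set_family_sum (line f) f) \<le> DIM('p) + DIM('i)"
    using int_rank_mono[OF sub subset_refl] lattice_rank[OF lattice] by simp
  have 2: "real (\<Sum>H\<in>f. int_rank (line f H)) \<le> real (int_rank (set_family_sum (line f) f))"
    using sum_rank_lines[OF f subset_refl] by (simp only: of_nat_le_iff)
  have 3: "(\<Sum>H\<in>f. dexp (htype H) + 1) \<le> (\<Sum>H\<in>f. real (int_rank (line f H)))"
    by (intro sum_mono line_rank_ge[OF f])
  have 4: "real (DIM('p) + DIM('i)) \<le> (\<Sum>S\<in>Q. real (krank S))"
    using rank_le_sum_krank by (simp only: of_nat_sum[symmetric] of_nat_le_iff)
  have eq: "(\<Sum>H\<in>f. dexp (htype H) + 1) = real (DIM('p) + DIM('i))"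
    "(\<Sum>H\<in>f. real (int_rank (line f H))) = real (DIM('p) + DIM('i))"
    using 1 2 3 4 sum_types[OF f] by auto
  show "int_rank (set_family_sum (line f) f) = DIM('p) + DIM('i)"
    using 1 2 eq by auto
  show "real (int_rank (line f H)) = dexp (htype H) + 1" if H: "H \<in> f"
  proof (rule ccontr)
    assume "real (int_rank (line f H)) \<noteq> dexp (htype H) + 1"
    then have "dexp (htype H) + 1 < real (int_rank (line f H))" using line_rank_ge[OF f H] by simp
    then have "(\<Sum>H\<in>f. dexp (htype H) + 1) < (\<Sum>H\<in>f. real (int_rank (line f H)))"
      using H line_rank_ge[OF f] flag_finite[OF f] by (intro sum_strict_mono_ex1) auto
    then show False using eq by simp
  qed
  have "card f = DIM('i)" using dual_system_card[OF flag_dual[OF f]] .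
  then show "(\<Sum>H\<in>f. dexp (htype H)) = real DIM('p)" using eq(1) by (simp add: sum.distrib)
qed

text \<open>The sum of the line groups has full rank, so every element of a basis of \<Gamma> has a
  multiple in it; N is the product of the factors.\<close>

lemma splits_exists:
  assumes f: "f \<in> flags Hs"
  shows "\<exists>N\<ge>1. splits N f"
proof -
  obtain B where B: "finite B" "\<Gamma> = int_mod.span B" "rat_vs.span \<Gamma> = rat_vs.span B"
    using lattice_basis[OF lattice] by metis
  let ?T = "set_family_sum (line f) f"
  have sT: "int_mod.subspace ?T" by (intro set_family_sum_subspace line_subspace)
  note sub = sum_lines_subset[of f f]
  have fin: "\<Gamma> \<subseteq> rat_vs.span B" using B rat_vs.span_superset by blast
  have "rat_vs.dim \<Gamma> \<le> rat_vs.dim ?T"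
    using flag_structure(1)[OF f] lattice_rank[OF lattice] int_rank_eq_dim[OF B(1)] fin sub
    by (metis DIM_prod dual_order.refl subset_trans)
  then have "\<Gamma> \<subseteq> rat_vs.span ?T" by (rule rat_vs.dim_le_span_finite[OF B(1) fin sub])
  then have "\<forall>b\<in>B. \<exists>m::int. m > 0 \<and> of_int m *\<^sub>R b \<in> ?T"
    using rat_span_subgroup[OF sT] B(2) int_mod.span_base by blast
  then obtain m :: "'p \<times> 'i \<Rightarrow> int" where m: "\<And>b. b \<in> B \<Longrightarrow> m b > 0 \<and> int_scale (m b) b \<in> ?T"
    unfolding int_scale_def by metis
  define N where "N = nat (\<Prod>b\<in>B. m b)"
  have pos: "(\<Prod>b\<in>B. m b) > 0" using m by (intro prod_pos) auto
  then have N: "int N = (\<Prod>b\<in>B. m b)" "N \<ge> 1" unfolding N_def by auto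
  have "int_scale (int N) g \<in> ?T" if "g \<in> int_mod.span B" for g
    using that
  proof (induction rule: int_mod.span_induct_alt)
    case base
    then show ?case using int_mod.subspace_0[OF sT] by simp
  next
    case (step c x y)
    have "int N = (\<Prod>b\<in>B - {x}. m b) * m x" unfolding N(1)
      using prod.remove[OF B(1) step(1)] by (simp add: mult.commute)
    then have "int_scale (int N) (int_scale c x) = int_scale (c * (\<Prod>b\<in>B - {x}. m b)) (int_scale (m x) x)"
      by (simp add: ac_simps)
    then have "int_scale (int N) (int_scale c x) \<in> ?T"
      using m[OF step(1)] int_mod.subspace_scale[OF sT] by metis
    then show ?case using step int_mod.subspace_add[OF sT] by (simp add: int_mod.scale_right_distrib)
  qed
  then have N': "int_scale (int N) g \<in> ?T" if "g \<in> \<Gamma>" for g using that B(2) by blast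
  have "splits N f" unfolding splits_def
  proof
    fix g assume "g \<in> \<Gamma>"
    from N'[OF this] show "\<exists>c. (\<forall>H\<in>f. c H \<in> line f H) \<and> int_scale (int N) g = (\<Sum>H\<in>f. c H)"
      unfolding set_family_sum_def by blast
  qed
  then show ?thesis using N by blast
qed

end

text \<open>\<open>splits\<close> does not mention Q, so an N obtained from one CSR decomposition
  serves all of them; this allows N to be chosen before Q. If there is no CSR decomposition, N = 1
  works vacuously.\<close>

lemma (in scheme) common_splitting:
  "\<exists>N\<ge>1. (DIM('i) = 1 \<longrightarrow> N = 1) \<and>
    (\<forall>Q. CSR_decomposition \<Gamma> (hyperplanes L W) Q \<longrightarrow> (\<forall>f\<in>flags (hyperplanes L W). splits N f))"
proof (cases "DIM('i) = 1 \<or> \<not> (\<exists>Q. CSR_decomposition \<Gamma> (hyperplanes L W) Q)")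
  case True
  then show ?thesis using splits_codim_one by (intro exI[of _ 1]) blast
next
  case False
  then obtain Q where Q: "CSR_decomposition \<Gamma> (hyperplanes L W) Q" by blast
  interpret csr \<Gamma> L W nrm off Q by unfold_locales (rule Q)
  have "\<exists>n. \<forall>f\<in>flags Hs. n f \<ge> 1 \<and> splits (n f) f" using splits_exists by metis
  then obtain n where n: "\<And>f. f \<in> flags Hs \<Longrightarrow> n f \<ge> 1 \<and> splits (n f) f" by blast
  define N where "N = (\<Prod>f\<in>flags Hs. n f)"
  have "splits N f" if f: "f \<in> flags Hs" for f
  proof -
    have "N = (\<Prod>f\<in>flags Hs - {f}. n f) * n f"
      unfolding N_def using prod.remove[OF finite_flags f, of n] by (simp add: mult.commute)
    then show ?thesis using splits_mult n f by metis
  qed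
  moreover have "N \<ge> 1" unfolding N_def using n by (intro prod_ge_1) auto
  ultimately show ?thesis using False by (intro exI[of _ N]) blast
qed

subsection \<open>The Diophantine condition\<close>

text \<open>Injectivity on G suffices. This is the situation of \<open>snd\<close>, which is
  injective on the lattice but not on the space.\<close>

lemma int_rank_image:
  fixes h :: "'a::real_vector \<Rightarrow> 'b::real_vector"
  assumes h: "linear h" and G: "int_mod.subspace G" and inj: "inj_on h G"
  shows "int_rank (h ` G) = int_rank G"
proof -
  have hom: "module_hom int_scale int_scale h"
    by unfold_locales (simp_all add: linear_add[OF h] linear_scale[OF h] int_scale_def)
  have indep: "int_mod.independent (h ` B)" if "B \<subseteq> G" "int_mod.independent B" for B
  proof -
    have "int_mod.span B \<subseteq> G" using that(1) G by (rule int_mod.span_minimal)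
    then have "inj_on h (int_mod.span B)" using inj inj_on_subset by blast
    then show ?thesis by (rule module_hom.independent_injective_image[OF hom that(2)])
  qed
  have indep': "int_mod.independent B" if B: "B \<subseteq> G" "int_mod.independent (h ` B)" for B
  proof
    assume "int_mod.dependent B"
    then obtain t u where t: "finite t" "t \<subseteq> B" "(\<Sum>v\<in>t. int_scale (u v) v) = 0" "\<exists>v\<in>t. u v \<noteq> 0"
      unfolding int_mod.dependent_explicit by blast
    have inj_t: "inj_on h t" using inj t(2) B(1) inj_on_subset by blast
    have "(\<Sum>v\<in>h ` t. int_scale (u (inv_into t h v)) v) = (\<Sum>v\<in>t. int_scale (u v) (h v))"
      using inj_t by (simp add: sum.reindex)
    also have "\<dots> = h (\<Sum>v\<in>t. int_scale (u v) v)"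
      by (simp add: linear_sum[OF h] linear_scale[OF h] int_scale_def)
    also have "\<dots> = 0" using t(3) linear_0[OF h] by simp
    finally have s: "(\<Sum>v\<in>h ` t. int_scale (u (inv_into t h v)) v) = 0" .
    obtain v where v: "v \<in> t" "u v \<noteq> 0" using t(4) by blast
    have "u (inv_into t h (h v)) = 0"
      using int_mod.independentD[OF B(2) _ _ s, of "h v"] t(1,2) v(1) by blast
    then show False using v inj_t by simp
  qed
  have "{card B |B. finite B \<and> B \<subseteq> h ` G \<and> int_mod.independent B} =
      {card B |B. finite B \<and> B \<subseteq> G \<and> int_mod.independent B}"
  proof (intro Set.equalityI subsetI)
    fix n assume "n \<in> {card B |B. finite B \<and> B \<subseteq> h ` G \<and> int_mod.independent B}"
    then obtain C where C: "n = card C" "finite C" "C \<subseteq> h ` G" "int_mod.independent C" by blast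
    define B where "B = inv_into G h ` C"
    have B: "B \<subseteq> G" "h ` B = C" "finite B"
      using C(2,3) unfolding B_def by (auto simp: image_image f_inv_into_f subset_iff inv_into_into)
    have "card B = n" using B inj C(1) by (metis card_image inj_on_subset)
    moreover have "int_mod.independent B" using indep' B C(4) by blast
    ultimately show "n \<in> {card B |B. finite B \<and> B \<subseteq> G \<and> int_mod.independent B}" using B by blast
  next
    fix n assume "n \<in> {card B |B. finite B \<and> B \<subseteq> G \<and> int_mod.independent B}"
    then obtain B where B: "n = card B" "finite B" "B \<subseteq> G" "int_mod.independent B" by blast
    have "card (h ` B) = n" using B inj by (metis card_image inj_on_subset)
    then show "n \<in> {card B |B. finite B \<and> B \<subseteq> h ` G \<and> int_mod.independent B}"
      using indep[OF B(3,4)] B by (intro CollectI exI[of _ "h ` B"]) auto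
  qed
  then show ?thesis unfolding int_rank_def by simp
qed

context scheme
begin

lemma dense_approx:
  assumes "\<epsilon> > 0" shows "\<exists>g\<in>\<Gamma>. norm (snd g - x) < \<epsilon>"
proof -
  have "x \<in> closure (snd ` \<Gamma>)" using dense by simp
  then show ?thesis using assms unfolding closure_approachable dist_norm by auto
qed

text \<open>The internal part of each component is determined by the H-coordinate of g, and
  \<open>snd\<close> is injective on \<Gamma>. So the component is additive in g, hence linearly
  bounded.\<close>

lemma splits_bounded:
  assumes f: "f \<in> flags Hs" and N: "splits N f"
  shows "\<exists>C>0. \<forall>g\<in>\<Gamma>. \<exists>c. (\<forall>H\<in>f. c H \<in> line f H \<and>
    snd (c H) = (real N * (nrm H \<bullet> snd g)) *\<^sub>R edge f H \<and> norm (c H) \<le> C * norm g) \<and>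
    int_scale (int N) g = (\<Sum>H\<in>f. c H)"
proof -
  note d = flag_dual[OF f]
  obtain c where c: "\<And>g. g \<in> \<Gamma> \<Longrightarrow> (\<forall>H\<in>f. c g H \<in> line f H) \<and> int_scale (int N) g = (\<Sum>H\<in>f. c g H)"
    using N unfolding splits_def by metis
  have snd_c: "snd (c g H) = (real N * (nrm H \<bullet> snd g)) *\<^sub>R edge f H" if g: "g \<in> \<Gamma>" and H: "H \<in> f" for g H
  proof -
    have "real N * (nrm H \<bullet> snd g) = nrm H \<bullet> snd (int_scale (int N) g)" by (simp add: int_scale_def)
    also have "\<dots> = (\<Sum>K\<in>f. nrm H \<bullet> snd (c g K))" using c[OF g] by (simp add: snd_sum inner_sum_right)
    also have "\<dots> = nrm H \<bullet> snd (c g H) + (\<Sum>K\<in>f - {H}. nrm H \<bullet> snd (c g K))"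
      using flag_finite[OF f] H by (rule sum.remove)
    also have "(\<Sum>K\<in>f - {H}. nrm H \<bullet> snd (c g K)) = 0"
      using c[OF g] H unfolding line_def by (intro sum.neutral) auto
    finally show ?thesis using line_snd[OF f H, of "c g H"] c[OF g] H by auto
  qed
  have "\<exists>C>0. \<forall>g\<in>\<Gamma>. norm (c g H) \<le> C * norm g" if H: "H \<in> f" for H
  proof (rule additive_bounded[OF lattice sub_\<Gamma> subset_refl])
    fix x y assume xy: "x \<in> \<Gamma>" "y \<in> \<Gamma>"
    then have s: "x + y \<in> \<Gamma>" using int_mod.subspace_add[OF sub_\<Gamma>] by blast
    have "snd (c (x + y) H) = snd (c x H + c y H)"
      using snd_c[OF _ H] xy s by (simp add: inner_add_right distrib_left scaleR_add_left)
    moreover have "c (x + y) H \<in> \<Gamma>" "c x H + c y H \<in> \<Gamma>"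
      using c[OF xy(1)] c[OF xy(2)] c[OF s] H line_subset int_mod.subspace_add[OF sub_\<Gamma>] by blast+
    ultimately show "c (x + y) H = c x H + c y H" using inj_snd by (meson inj_onD)
  qed
  then obtain C where C: "\<And>H. H \<in> f \<Longrightarrow> C H > 0 \<and> (\<forall>g\<in>\<Gamma>. norm (c g H) \<le> C H * norm g)" by metis
  define D where "D = 1 + (\<Sum>H\<in>f. C H)"
  have le: "C H \<le> D" if "H \<in> f" for H
  proof -
    have "C H \<le> (\<Sum>H\<in>f. C H)" using C that flag_finite[OF f] by (intro member_le_sum) (auto intro: less_imp_le)
    then show ?thesis by (simp add: D_def)
  qed
  have "D > 0" unfolding D_def using C by (simp add: add_pos_nonneg sum_nonneg less_imp_le)
  moreover have "norm (c g H) \<le> D * norm g" if "g \<in> \<Gamma>" "H \<in> f" for g H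
    using C[OF that(2)] that le[OF that(2)] by (meson mult_right_mono norm_ge_zero order_trans)
  ultimately show ?thesis using c snd_c by (intro exI[of _ D]) blast
qed

end

context csr
begin

text \<open>For \<delta> \<le> 0 the line group has rank at most one, so N times the H-coordinates
  of lattice elements would be multiples of one number \<beta>, against the density of the internal
  projections. Positivity is what makes the powers with exponent -\<delta> decrease.\<close>

lemma dexp_flag_pos:
  assumes f: "f \<in> flags Hs" and H: "H \<in> f"
  shows "dexp (htype H) > 0"
proof (rule ccontr)
  assume "\<not> dexp (htype H) > 0"
  then have rk: "int_rank (line f H) \<le> 1" using flag_structure(2)[OF f H] by linarith
  obtain N where N: "N \<ge> 1" "splits N f" using splits_exists[OF f] by blast
  obtain B where B: "finite B" "int_mod.span B = line f H" "card B = int_rank (line f H)"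
    using lattice_subgroup_basis[OF lattice line_subspace line_subset] by metis
  obtain b where b: "line f H \<subseteq> int_mod.span {b}"
  proof (cases "B = {}")
    case True
    have "line f H \<subseteq> int_mod.span {0}" unfolding B(2)[symmetric] True
      by (rule int_mod.span_mono) simp
    then show ?thesis by (rule that)
  next
    case False
    then have "card B \<noteq> 0" using B(1) by simp
    then have "card B = 1" using B(3) rk by linarith
    then show ?thesis using that B(2) by (auto simp: card_1_singleton_iff)
  qed
  define \<beta> where "\<beta> = nrm H \<bullet> snd b"
  have mult: "\<exists>m::int. nrm H \<bullet> snd g = of_int m * \<beta>" if "g \<in> line f H" for g
  proof -
    have "g \<in> range (\<lambda>k. int_scale k b)" using b that by (auto simp: int_mod.span_singleton)
    then obtain k where "g = int_scale k b" by blast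
    then show ?thesis by (intro exI[of _ k]) (simp add: \<beta>_def int_scale_def)
  qed
  \<comment> \<open>Half the generator is as far as possible from all multiples of \<beta>; for
    \<beta> = 0 any positive value would do.\<close>
  define t where "t = (if \<beta> = 0 then 1 else \<bar>\<beta>\<bar> / 2)"
  have t: "t > 0" "\<beta> \<noteq> 0 \<longrightarrow> 2 * t = \<bar>\<beta>\<bar>" unfolding t_def by auto
  define w where "w = (t / real N) *\<^sub>R edge f H"
  have e1: "nrm H \<bullet> edge f H = 1" using dual_systemD(2)[OF flag_dual[OF f] H H] by simp
  have nn: "norm (nrm H) > 0" using nrm_nz flag_subset[OF f] H by auto
  have pos: "t / (2 * real N * norm (nrm H)) > 0" using t N nn by simp
  obtain g where g: "g \<in> \<Gamma>" "norm (snd g - w) < t / (2 * real N * norm (nrm H))"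
    using dense_approx[OF pos] by blast
  have "\<bar>nrm H \<bullet> snd g - t / real N\<bar> = \<bar>nrm H \<bullet> (snd g - w)\<bar>" by (simp add: inner_diff_right w_def e1)
  also have "\<dots> \<le> norm (nrm H) * norm (snd g - w)" by (rule Cauchy_Schwarz_ineq2)
  also have "\<dots> < norm (nrm H) * (t / (2 * real N * norm (nrm H)))" using g(2) nn by (intro mult_strict_left_mono)
  also have "\<dots> = t / (2 * real N)" using nn by simp
  finally have "\<bar>nrm H \<bullet> snd g - t / real N\<bar> < t / (2 * real N)" .
  then have "real N * \<bar>nrm H \<bullet> snd g - t / real N\<bar> < real N * (t / (2 * real N))"
    using N by (intro mult_strict_left_mono) auto
  moreover have "real N * (t / (2 * real N)) = t / 2" using N by simp
  moreover have "real N * (nrm H \<bullet> snd g) - t = real N * (nrm H \<bullet> snd g - t / real N)"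
    using N by (simp add: right_diff_distrib)
  ultimately have "\<bar>real N * (nrm H \<bullet> snd g) - t\<bar> < t / 2"
    by (simp only: abs_mult abs_of_nat)
  moreover obtain c where "\<forall>K\<in>f. c K \<in> line f K" "snd (c H) = (real N * (nrm H \<bullet> snd g)) *\<^sub>R edge f H"
    using splits_bounded[OF f N(2)] g(1) H by meson
  moreover then obtain m :: int where "real N * (nrm H \<bullet> snd g) = of_int m * \<beta>"
    using mult[of "c H"] H e1 by auto
  ultimately have m: "\<bar>of_int m * \<beta> - t\<bar> < t / 2" by simp
  show False
  proof (cases "\<beta> = 0")
    case True
    then show ?thesis using m t by simp
  next
    case False
    have "\<bar>of_int m * \<beta>\<bar> = of_int \<bar>m\<bar> * \<bar>\<beta>\<bar>" by (simp add: abs_mult)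
    moreover have "t / 2 < \<bar>of_int m * \<beta>\<bar>" "\<bar>of_int m * \<beta>\<bar> < 3 / 2 * t" using m t by linarith+
    ultimately have "of_int \<bar>m\<bar> * \<bar>\<beta>\<bar> < 1 * \<bar>\<beta>\<bar>" "0 < of_int \<bar>m\<bar> * \<bar>\<beta>\<bar>" using t False by linarith+
    then have "of_int \<bar>m\<bar> < (1::real)" "\<bar>m\<bar> > 0" using False
      by (metis abs_ge_zero mult_less_cancel_right not_less) (use \<open>0 < of_int \<bar>m\<bar> * \<bar>\<beta>\<bar>\<close> False in \<open>auto simp: zero_less_mult_iff\<close>)
    then show False by linarith
  qed
qed

lemma dexp_pos:
  assumes f: "f \<in> flags Hs" and S: "S \<in> Q"
  shows "dexp S > 0"
proof -
  have "{H\<in>f. htype H = S} \<noteq> {}" using dim_X[OF f S] dim_X_pos[OF S] by (metis card.empty less_irrefl)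
  then show ?thesis using dexp_flag_pos[OF f] by blast
qed

lemma stabiliser_refined:
  assumes "S \<in> Q" and "N \<ge> 1"
  shows "snd ` stabiliser (refined_lattice N \<Gamma>) S = (\<lambda>g. (1 / real N) *\<^sub>R snd g) ` stabiliser \<Gamma> S"
proof -
  have "(1 / real N) *\<^sub>R y \<in> V \<longleftrightarrow> y \<in> V" if V: "V \<in> S" for V y
  proof -
    obtain H where "H \<in> Hs" "V = linear_part H" using member_Q[OF assms(1) V] by blast
    then show ?thesis using \<open>N \<ge> 1\<close> by (simp add: linear_part_eq)
  qed
  then have iff: "(\<forall>V\<in>S. (1 / real N) *\<^sub>R y \<in> V) \<longleftrightarrow> (\<forall>V\<in>S. y \<in> V)" for y by blast
  have "stabiliser (refined_lattice N \<Gamma>) S = (\<lambda>g. (1 / real N) *\<^sub>R g) ` stabiliser \<Gamma> S"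
  proof -
    have "stabiliser (refined_lattice N \<Gamma>) S =
        (\<lambda>g. (1 / real N) *\<^sub>R g) ` {g \<in> \<Gamma>. \<forall>V\<in>S. snd ((1 / real N) *\<^sub>R g) \<in> V}"
      unfolding stabiliser_def refined_lattice_def by blast
    then show ?thesis unfolding snd_scaleR iff stabiliser_def .
  qed
  then show ?thesis by (simp add: image_image)
qed

lemma stabiliser_sub: "stabiliser \<Gamma> S \<subseteq> \<Gamma>" by (auto simp: stabiliser_def)

lemma rank_scaled_stabiliser:
  assumes "S \<in> Q" and "N \<ge> 1"
  shows "int_rank ((\<lambda>g. (1 / real N) *\<^sub>R snd g) ` stabiliser \<Gamma> S) = krank S"
    and "inj_on (\<lambda>g. (1 / real N) *\<^sub>R snd g) (stabiliser \<Gamma> S)"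
proof -
  have lin: "linear (\<lambda>g::'p \<times> 'i. (1 / real N) *\<^sub>R snd g)"
    by (intro linearI) (auto simp: scaleR_add_right)
  show inj: "inj_on (\<lambda>g. (1 / real N) *\<^sub>R snd g) (stabiliser \<Gamma> S)"
  proof (rule inj_onI)
    fix x y assume "x \<in> stabiliser \<Gamma> S" "y \<in> stabiliser \<Gamma> S" "(1 / real N) *\<^sub>R snd x = (1 / real N) *\<^sub>R snd y"
    then have "snd x = snd y" "x \<in> \<Gamma>" "y \<in> \<Gamma>" using assms(2) stabiliser_sub by auto
    then show "x = y" using inj_snd by (meson inj_onD)
  qed
  show "int_rank ((\<lambda>g. (1 / real N) *\<^sub>R snd g) ` stabiliser \<Gamma> S) = krank S"
    unfolding krank_def by (rule int_rank_image[OF lin stabiliser_subspace[OF Q_subset[OF assms(1)]] inj])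
qed

text \<open>The coordinate norm is replaced by the norm of g in the total space. The coordinates are
  additive in g, hence at most D \<open>norm g\<close>, and the negative exponent reverses the
  inequality in the right direction.\<close>

lemma diophantine_lower:
  assumes f: "f \<in> flags Hs" and S: "S \<in> Q" and N: "N \<ge> 1" and Ni: "is_norm Ni"
    and dio: "diophantine Ni (snd ` stabiliser (refined_lattice N \<Gamma>) S) (\<Inter>S) A"
  shows "\<exists>c>0. \<forall>a\<in>A. \<forall>g\<in>stabiliser \<Gamma> S. g \<noteq> 0 \<longrightarrow> (1 / real N) *\<^sub>R snd g \<noteq> a \<longrightarrow>
    norm ((1 / real N) *\<^sub>R snd g - a) \<ge> c * norm g powr (- dexp S)"
proof -
  let ?G = "stabiliser \<Gamma> S" and ?h = "\<lambda>g::'p \<times> 'i. (1 / real N) *\<^sub>R snd g"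
  note sG = stabiliser_subspace[OF Q_subset[OF S]]
  obtain B c where B: "int_basis (?h ` ?G) B" and c: "c > 0"
    "\<And>a x. a \<in> A \<Longrightarrow> x \<in> ?h ` ?G \<Longrightarrow> x \<noteq> 0 \<Longrightarrow> x \<noteq> a \<Longrightarrow>
        Ni (x - a) \<ge> c * coord_norm B x powr (- dexp S)"
    using dio unfolding diophantine_def stabiliser_refined[OF S N] rank_scaled_stabiliser(1)[OF S N] dexp_def
    by blast
  have B': "finite B" "int_mod.independent B" "int_mod.span B = ?h ` ?G"
    using B unfolding int_basis_def by auto
  have "\<exists>C>0. \<forall>g\<in>?G. norm (real_of_int (int_mod.representation B (?h g) b)) \<le> C * norm g" for b
  proof (rule additive_bounded[OF lattice sG stabiliser_sub])
    fix x y assume "x \<in> ?G" "y \<in> ?G"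
    then have "?h x \<in> int_mod.span B" "?h y \<in> int_mod.span B" unfolding B'(3) by auto
    then show "real_of_int (int_mod.representation B (?h (x + y)) b) =
      real_of_int (int_mod.representation B (?h x) b) + real_of_int (int_mod.representation B (?h y) b)"
      using int_mod.representation_add[OF B'(2), of "?h y" "?h x"] by (simp add: scaleR_add_right add.commute)
  qed
  then obtain C where C: "\<And>b. C b > 0" "\<And>b g. g \<in> ?G \<Longrightarrow> norm (real_of_int (int_mod.representation B (?h g) b)) \<le> C b * norm g"
    by metis
  define D where "D = 1 + (\<Sum>b\<in>B. C b)"
  have D: "D > 0" unfolding D_def using C(1) by (simp add: add_pos_nonneg less_imp_le sum_nonneg)
  have CD: "C b \<le> D" if "b \<in> B" for b
  proof -
    have "C b \<le> (\<Sum>b\<in>B. C b)" using B'(1) that C(1) by (intro member_le_sum) (auto intro: less_imp_le)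
    then show ?thesis by (simp add: D_def)
  qed
  obtain K where K: "K > 0" "\<And>x. Ni x \<le> K * norm x" using is_norm_equivalent[OF Ni] by blast
  have main: "norm (?h g - a) \<ge> c / K * D powr (- dexp S) * norm g powr (- dexp S)"
    if a: "a \<in> A" and g: "g \<in> ?G" "g \<noteq> 0" "?h g \<noteq> a" for a g
  proof -
    have h: "?h g \<in> ?h ` ?G" using g by blast
    have h0: "?h g \<noteq> 0" using snd_eq_0[of g] g N stabiliser_sub by auto
    have "\<exists>b\<in>B. int_mod.representation B (?h g) b \<noteq> 0"
    proof (rule ccontr)
      assume "\<not> ?thesis"
      then have "(\<Sum>b\<in>B. int_scale (int_mod.representation B (?h g) b) b) = 0" by simp
      then show False
        using int_mod.sum_representation_eq[OF B'(2) _ B'(1) subset_refl, of "?h g"] h h0 unfolding B'(3) by simp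
    qed
    then obtain b0 where b0: "b0 \<in> B" "int_mod.representation B (?h g) b0 \<noteq> 0" by blast
    have "1 \<le> \<bar>real_of_int (int_mod.representation B (?h g) b0)\<bar>" using b0(2) by simp
    also have "\<dots> \<le> coord_norm B (?h g)" unfolding coord_norm_def using B'(1) b0(1) by (intro Max_ge) auto
    finally have pos: "0 < coord_norm B (?h g)" by simp
    have up: "coord_norm B (?h g) \<le> D * norm g"
      unfolding coord_norm_def
    proof (rule Max.boundedI)
      fix x assume "x \<in> (\<lambda>b. \<bar>real_of_int (int_mod.representation B (?h g) b)\<bar>) ` B"
      then obtain b where b: "b \<in> B" "x = \<bar>real_of_int (int_mod.representation B (?h g) b)\<bar>" by blast
      then have "x \<le> C b * norm g" using C(2)[OF g(1), of b] by simp
      also have "\<dots> \<le> D * norm g" using CD[OF b(1)] by (intro mult_right_mono) auto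
      finally show "x \<le> D * norm g" .
    qed (use B'(1) b0 in auto)
    have "c * (D * norm g) powr (- dexp S) \<le> c * coord_norm B (?h g) powr (- dexp S)"
      using dexp_pos[OF f S] pos up c(1) by (intro mult_left_mono powr_mono2') auto
    also have "\<dots> \<le> Ni (?h g - a)" using c(2)[OF a h h0 g(3)] .
    also have "\<dots> \<le> K * norm (?h g - a)" by (rule K(2))
    finally have "c * (D powr (- dexp S) * norm g powr (- dexp S)) \<le> K * norm (?h g - a)"
      using D by (simp add: powr_mult)
    then show ?thesis using K(1) by (simp add: field_simps)
  qed
  have "c / K * D powr (- dexp S) > 0" using c(1) K(1) D by simp
  then show ?thesis using main by blast
qed

text \<open>The comparison for N = 1 in the other direction: expanding g in a basis of the
  stabiliser bounds \<open>norm g\<close> by a multiple of the coordinate norm.\<close>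

lemma diophantine_upper:
  assumes f: "f \<in> flags Hs" and S: "S \<in> Q" and Ni: "is_norm Ni"
    and c: "c > 0" "\<And>a g. a \<in> A \<Longrightarrow> g \<in> stabiliser \<Gamma> S \<Longrightarrow> g \<noteq> 0 \<Longrightarrow> snd g \<noteq> a \<Longrightarrow>
      norm (snd g - a) \<ge> c * norm g powr (- dexp S)"
  shows "diophantine Ni (snd ` stabiliser \<Gamma> S) (\<Inter>S) A"
proof -
  let ?G = "stabiliser \<Gamma> S"
  note sG = stabiliser_subspace[OF Q_subset[OF S]]
  obtain B where B: "finite B" "int_mod.independent B" "int_mod.span B = ?G"
    using lattice_subgroup_basis[OF lattice sG stabiliser_sub] int_dependent_iff by metis
  have BG: "B \<subseteq> ?G" using B(3) int_mod.span_superset by blast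
  have inj: "inj_on snd ?G" using inj_snd stabiliser_sub inj_on_subset by blast
  have hom: "module_hom int_scale int_scale (snd :: 'p \<times> 'i \<Rightarrow> 'i)"
    by unfold_locales (simp_all add: int_scale_def)
  have ind: "int_mod.independent (snd ` B)"
    using inj B by (intro module_hom.independent_injective_image[OF hom]) auto
  have sp: "int_mod.span (snd ` B) = snd ` ?G"
    using module_hom.span_image[OF hom, of B] B(3) by simp
  have bas: "int_basis (snd ` ?G) (snd ` B)" unfolding int_basis_def using ind sp B(1) by simp
  have rk: "int_rank (snd ` ?G) = krank S"
    using rank_scaled_stabiliser(1)[OF S, of 1] by simp
  obtain K where K: "K > 0" "\<And>x. norm x \<le> K * Ni x" using is_norm_equivalent[OF Ni] by blast
  define D where "D = 1 + (\<Sum>b\<in>B. norm b)"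
  have D: "D > 0" unfolding D_def by (simp add: add_pos_nonneg sum_nonneg)
  have main: "Ni (snd g - a) \<ge> c / K * D powr (- dexp S) * coord_norm (snd ` B) (snd g) powr (- dexp S)"
    if a: "a \<in> A" and g: "g \<in> ?G" "snd g \<noteq> 0" "snd g \<noteq> a" for a g
  proof -
    have g0: "g \<noteq> 0" using g(2) by auto
    let ?r = "\<lambda>b. int_mod.representation (snd ` B) (snd g) (snd b)"
    have injB: "inj_on snd B" using inj BG inj_on_subset by blast
    have "snd g = (\<Sum>b\<in>snd ` B. int_scale (int_mod.representation (snd ` B) (snd g) b) b)"
      using int_mod.sum_representation_eq[OF ind _ _ subset_refl, of "snd g"] g(1) B(1) unfolding sp by simp
    also have "\<dots> = snd (\<Sum>b\<in>B. int_scale (?r b) b)"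
      by (simp add: sum.reindex[OF injB] snd_sum int_scale_def)
    finally have e: "snd g = snd (\<Sum>b\<in>B. int_scale (?r b) b)" .
    have "(\<Sum>b\<in>B. int_scale (?r b) b) \<in> ?G"
      unfolding B(3)[symmetric] by (intro int_mod.span_sum int_mod.span_scale int_mod.span_base)
    then have ge: "g = (\<Sum>b\<in>B. int_scale (?r b) b)" using inj e g(1) by (meson inj_onD)
    have "norm g \<le> (\<Sum>b\<in>B. \<bar>real_of_int (?r b)\<bar> * norm b)"
      by (subst ge, rule order_trans[OF norm_sum]) (simp add: int_scale_def)
    also have "\<dots> \<le> (\<Sum>b\<in>B. coord_norm (snd ` B) (snd g) * norm b)"
      unfolding coord_norm_def using B(1) by (intro sum_mono mult_right_mono Max_ge) auto
    also have "\<dots> = (\<Sum>b\<in>B. norm b) * coord_norm (snd ` B) (snd g)" by (simp add: sum_distrib_right mult.commute)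
    finally have le1: "norm g \<le> (\<Sum>b\<in>B. norm b) * coord_norm (snd ` B) (snd g)" .
    moreover have "norm g > 0" using g0 by simp
    ultimately have "coord_norm (snd ` B) (snd g) > 0"
      by (smt (verit, best) norm_ge_zero sum_nonneg zero_less_mult_iff)
    then have le: "norm g \<le> D * coord_norm (snd ` B) (snd g)" "coord_norm (snd ` B) (snd g) > 0"
      using le1 unfolding D_def by (simp_all add: distrib_right)
    have "c * (D * coord_norm (snd ` B) (snd g)) powr (- dexp S) \<le> c * norm g powr (- dexp S)"
      using dexp_pos[OF f S] le(1) g0 c(1) by (intro mult_left_mono powr_mono2') auto
    also have "\<dots> \<le> norm (snd g - a)" by (rule c(2)[OF a g(1) g0 g(3)])
    also have "\<dots> \<le> K * Ni (snd g - a)" by (rule K(2))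
    finally have "c * (D powr (- dexp S) * coord_norm (snd ` B) (snd g) powr (- dexp S)) \<le> K * Ni (snd g - a)"
      using D le(2) by (simp add: powr_mult)
    then show ?thesis using K(1) by (simp add: field_simps)
  qed
  have pos: "c / K * D powr (- dexp S) > 0" using c(1) K(1) D by simp
  have "snd ` ?G \<subseteq> \<Inter>S" by (auto simp: stabiliser_def)
  then show ?thesis unfolding diophantine_def rk dexp_def[symmetric]
    using bas pos main by (intro conjI exI[of _ "snd ` B"] exI[of _ "c / K * D powr (- dexp S)"]) auto
qed

end

subsection \<open>Cells of hyperplane arrangements\<close>

text \<open>Bounds depending on a flag, a hyperplane or a type survive a smaller c, so a minimum
  over the finitely many cases makes them uniform.\<close>

lemma finite_uniform_constant:
  assumes "finite A" and "\<And>x. x \<in> A \<Longrightarrow> \<exists>c>0. P x c"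
    and mono: "\<And>x c c'. P x c \<Longrightarrow> 0 < c' \<Longrightarrow> c' \<le> c \<Longrightarrow> P x c'"
  shows "\<exists>c>0::real. \<forall>x\<in>A. P x c"
  using assms(1,2)
proof (induction A rule: finite_induct)
  case empty
  then show ?case by (intro exI[of _ 1]) auto
next
  case (insert x A)
  then obtain c where c: "c > 0" "\<forall>x\<in>A. P x c" by auto
  obtain c' where c': "c' > 0" "P x c'" using insert.prems by blast
  have "P y (min c c')" if "y \<in> insert x A" for y
    using that c c' mono[of x c' "min c c'"] mono[of y c "min c c'"] by auto
  then show ?case using c c' by (intro exI[of _ "min c c'"]) auto
qed

lemma connected_frontier_same:
  assumes "connected T" and "T \<inter> frontier S = {}" and "x \<in> T" and "y \<in> T"
  shows "x \<in> S \<longleftrightarrow> y \<in> S"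
  using connected_Int_frontier[OF assms(1), of S] assms(2-4) by blast

text \<open>The centre is the barycentre of \<open>n + 1\<close> affinely independent vertices of the cell.\<close>

lemma cell_center:
  fixes n :: "'j \<Rightarrow> 'a::euclidean_space" and b d :: "'j \<Rightarrow> real"
  assumes "finite A" and w0: "\<And>a. a \<in> A \<Longrightarrow> n a \<bullet> w0 \<noteq> b a"
    and bdd: "bounded {w. \<forall>a\<in>A. sgn (n a \<bullet> w0 - b a) * (n a \<bullet> w - b a) > 0}"
    and vert: "\<And>J e u a. J \<subseteq> A \<Longrightarrow> dual_system J n e \<Longrightarrow> (\<And>a. a \<in> J \<Longrightarrow> n a \<bullet> u = b a) \<Longrightarrow> a \<in> A \<Longrightarrow>
       n a \<bullet> u = b a \<or> \<bar>n a \<bullet> u - b a\<bar> \<ge> d a"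
  shows "\<exists>w'. \<forall>w. (\<forall>a\<in>A. \<bar>n a \<bullet> (w - w')\<bar> < d a / (real DIM('a) + 1)) \<longrightarrow>
    (\<forall>a\<in>A. sgn (n a \<bullet> w0 - b a) * (n a \<bullet> w - b a) > 0)"
proof -
  define \<sigma> where "\<sigma> a = sgn (n a \<bullet> w0 - b a)" for a
  define h where "h a w = n a \<bullet> w - b a" for a w
  define C where "C = {w. \<forall>a\<in>A. \<sigma> a * h a w > 0}"
  define P where "P = {w. \<forall>a\<in>A. \<sigma> a * h a w \<ge> 0}"
  have \<sigma>1: "\<bar>\<sigma> a\<bar> = 1" if "a \<in> A" for a using w0[OF that] by (simp add: \<sigma>_def abs_sgn_eq)
  have h0: "\<sigma> a * h a w0 > 0" if "a \<in> A" for a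
    using w0[OF that] by (simp add: \<sigma>_def h_def sgn_mult_self_eq flip: abs_sgn) (simp add: sgn_if)
  have aff: "h a (x + t *\<^sub>R (y - x)) = h a x + t * (h a y - h a x)" for a x y t
    by (simp add: h_def inner_add_right inner_diff_right algebra_simps)
  have Peq: "P = (\<Inter>a\<in>A. {w. (\<sigma> a *\<^sub>R n a) \<bullet> w \<ge> \<sigma> a * b a})"
    unfolding P_def h_def by (auto simp: algebra_simps)
  have convP: "convex P" and closedP: "closed P"
    unfolding Peq by (intro convex_INT closed_INT ballI convex_halfspace_ge closed_halfspace_ge)+
  obtain R where R: "\<And>w. w \<in> C \<Longrightarrow> norm w \<le> R"
    using bdd unfolding C_def \<sigma>_def h_def bounded_iff by blast
  \<comment> \<open>The midpoint of w and w0 satisfies the strict inequalities, so boundedness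
    passes from the open cell to the closed polyhedron P.\<close>
  have "norm w \<le> 2 * R + norm w0" if w: "w \<in> P" for w
  proof -
    have "w + (1/2) *\<^sub>R (w0 - w) \<in> C"
      unfolding C_def mem_Collect_eq
    proof
      fix a assume a: "a \<in> A"
      have "\<sigma> a * h a (w + (1/2) *\<^sub>R (w0 - w)) = (\<sigma> a * h a w + \<sigma> a * h a w0) / 2"
        unfolding aff by (simp add: algebra_simps)
      then show "0 < \<sigma> a * h a (w + (1/2) *\<^sub>R (w0 - w))"
        using h0[OF a] w a unfolding P_def by (auto simp: add_nonneg_pos)
    qed
    then have "norm (w + (1/2) *\<^sub>R (w0 - w)) \<le> R" by (rule R)
    moreover have "w = 2 *\<^sub>R (w + (1/2) *\<^sub>R (w0 - w)) - w0"
      by (simp add: scaleR_add_right scaleR_diff_right scaleR_2)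
    then have "norm w \<le> norm (2 *\<^sub>R (w + (1/2) *\<^sub>R (w0 - w))) + norm w0"
      by (metis norm_triangle_ineq4)
    ultimately show ?thesis by simp
  qed
  then have "bounded P" unfolding bounded_iff by blast
  then have compP: "compact P" using closedP compact_eq_bounded_closed by blast
  define V where "V = {x. x extreme_point_of P}"
  \<comment> \<open>P is the hull of its extreme points and has interior, so the extreme points span
    the space affinely and contain n + 1 affinely independent ones.\<close>
  have PV: "P = convex hull V" unfolding V_def by (rule Krein_Milman_Minkowski[OF compP convP])
  have VP: "V \<subseteq> P" unfolding V_def extreme_point_of_def by blast
  have "open C"
  proof -
    have "C = (\<Inter>a\<in>A. {w. (\<sigma> a *\<^sub>R n a) \<bullet> w > \<sigma> a * b a})"
      unfolding C_def h_def by (auto simp: algebra_simps)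
    then show ?thesis using assms(1) by (simp only:) (intro open_INT ballI open_halfspace_gt)
  qed
  moreover have "w0 \<in> C" "C \<subseteq> P" using h0 unfolding C_def P_def by (auto intro: less_imp_le)
  ultimately have "interior P \<noteq> {}" using interior_maximal by blast
  then have "affine hull P = UNIV" by (rule affine_hull_nonempty_interior)
  then have hullV: "affine hull V = UNIV" unfolding PV by (simp add: affine_hull_convex_hull)
  obtain B where B: "\<not> affine_dependent B" "B \<subseteq> V" "affine hull B = UNIV"
    using affine_basis_exists[of V] hullV by metis
  have finB: "finite B" and cB: "card B = DIM('a) + 1"
  proof -
    show "finite B" using B(1) affine_independent_iff_card by blast
    have "aff_dim B = int (card B) - 1" using B(1) affine_independent_iff_card by blast
    moreover have "aff_dim B = int DIM('a)" using B(3) by (metis aff_dim_UNIV aff_dim_affine_hull)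
    ultimately show "card B = DIM('a) + 1" by linarith
  qed
  have extreme: "h a v = 0 \<or> \<bar>h a v\<bar> \<ge> d a" if v: "v \<in> V" and a: "a \<in> A" for v a
  proof -
    have vP: "v \<in> P" using v VP by blast
    define J0 where "J0 = {a\<in>A. h a v = 0}"
    \<comment> \<open>A direction parallel to all hyperplanes through v would let v move both ways
      inside P. Hence the normals of these hyperplanes contain a dual system, and
      \<open>vert\<close> applies.\<close>
    have "x = 0" if x: "\<And>a. a \<in> J0 \<Longrightarrow> n a \<bullet> x = 0" for x
    proof (rule ccontr)
      assume x0: "x \<noteq> 0"
      have "\<exists>t>0. \<forall>a\<in>A - J0. t * \<bar>n a \<bullet> x\<bar> \<le> \<sigma> a * h a v"
      proof (rule finite_uniform_constant)
        fix a assume "a \<in> A - J0"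
        then have "\<sigma> a * h a v > 0" using vP \<sigma>1[of a] unfolding P_def J0_def
          by (force simp: less_le)
        then show "\<exists>t>0. t * \<bar>n a \<bullet> x\<bar> \<le> \<sigma> a * h a v"
          by (intro exI[of _ "\<sigma> a * h a v / (\<bar>n a \<bullet> x\<bar> + 1)"]) (auto simp: field_simps add_pos_nonneg)
      next
        fix a c c' assume "c * \<bar>n a \<bullet> x\<bar> \<le> \<sigma> a * h a v" "0 < c'" "c' \<le> c"
        then show "c' * \<bar>n a \<bullet> x\<bar> \<le> \<sigma> a * h a v"
          by (meson abs_ge_zero mult_right_mono order_trans)
      qed (use assms(1) in simp)
      then obtain t where t: "t > 0" "\<forall>a\<in>A - J0. t * \<bar>n a \<bullet> x\<bar> \<le> \<sigma> a * h a v" by blast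
      have P: "v + s *\<^sub>R x \<in> P" if s: "\<bar>s\<bar> = t" for s
        unfolding P_def mem_Collect_eq
      proof
        fix a assume a: "a \<in> A"
        have e: "\<sigma> a * h a (v + s *\<^sub>R x) = \<sigma> a * h a v + \<sigma> a * s * (n a \<bullet> x)"
          by (simp add: h_def inner_add_right algebra_simps)
        show "0 \<le> \<sigma> a * h a (v + s *\<^sub>R x)"
        proof (cases "a \<in> J0")
          case True
          then show ?thesis unfolding e using x[OF True] by (simp add: J0_def)
        next
          case False
          have "\<bar>\<sigma> a * s * (n a \<bullet> x)\<bar> = t * \<bar>n a \<bullet> x\<bar>" using \<sigma>1[OF a] s by (simp add: abs_mult)
          moreover have "t * \<bar>n a \<bullet> x\<bar> \<le> \<sigma> a * h a v" using t(2) a False by blast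
          ultimately show ?thesis unfolding e by linarith
        qed
      qed
      have "v \<in> open_segment (v - t *\<^sub>R x) (v + t *\<^sub>R x)"
        using x0 t(1) unfolding in_segment
        by (intro conjI exI[of _ "1/2"]) (auto simp: algebra_simps simp flip: scaleR_add_left)
      moreover have "v - t *\<^sub>R x \<in> P" "v + t *\<^sub>R x \<in> P" using P[of "- t"] P[of t] t(1) by auto
      ultimately show False using v unfolding V_def extreme_point_of_def by blast
    qed
    then obtain J e where J: "J \<subseteq> J0" "dual_system J n e"
      using dual_subsystem_exists[of J0 n] assms(1) unfolding J0_def by auto
    have "n a \<bullet> v = b a" if "a \<in> J" for a using that J(1) unfolding J0_def h_def by auto
    moreover have "J \<subseteq> A" using J(1) unfolding J0_def by blast
    ultimately show ?thesis using vert[OF _ J(2) _ a, of v] unfolding h_def by auto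
  qed
  define w' where "w' = (\<Sum>v\<in>B. (1 / (real DIM('a) + 1)) *\<^sub>R v)"
  have hw': "\<sigma> a * h a w' \<ge> d a / (real DIM('a) + 1)" if a: "a \<in> A" for a
  proof -
    have nn: "\<sigma> a * h a v \<ge> 0" if "v \<in> B" for v using that B(2) VP a unfolding P_def by blast
    \<comment> \<open>The n + 1 points do not all lie on one hyperplane. One of them contributes at
      least \<open>d a\<close> to the average and the others contribute with the same sign; this is
      where the divisor n + 1 comes from.\<close>
    have "\<exists>v\<in>B. h a v \<noteq> 0"
    proof (rule ccontr)
      assume "\<not> (\<exists>v\<in>B. h a v \<noteq> 0)"
      then have "B \<subseteq> {x. n a \<bullet> x = b a}" unfolding h_def by auto
      then have "affine hull B \<subseteq> {x. n a \<bullet> x = b a}" by (intro hull_minimal affine_hyperplane)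
      then show False using B(3) w0[OF a] by auto
    qed
    then obtain v where v: "v \<in> B" "h a v \<noteq> 0" by blast
    have "\<sigma> a * h a v = \<bar>\<sigma> a * h a v\<bar>" using nn[OF v(1)] by simp
    also have "\<dots> = \<bar>h a v\<bar>" using \<sigma>1[OF a] by (simp add: abs_mult)
    finally have "\<sigma> a * h a v \<ge> d a" using extreme[OF _ a, of v] v B(2) by auto
    also have "\<sigma> a * h a v \<le> (\<Sum>v\<in>B. \<sigma> a * h a v)" using v finB nn by (intro member_le_sum) auto
    finally have "d a / (real DIM('a) + 1) \<le> (\<Sum>v\<in>B. \<sigma> a * h a v) / (real DIM('a) + 1)"
      by (intro divide_right_mono) auto
    also have "(\<Sum>v\<in>B. \<sigma> a * h a v) = \<sigma> a * ((\<Sum>v\<in>B. n a \<bullet> v) - (real DIM('a) + 1) * b a)"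
      using cB by (simp add: h_def sum_subtractf flip: sum_distrib_left)
    also have "\<dots> / (real DIM('a) + 1) = \<sigma> a * h a w'"
      unfolding h_def w'_def inner_sum_right inner_scaleR_right sum_distrib_left[symmetric]
      by (simp add: field_simps)
    finally show ?thesis .
  qed
  show ?thesis
  proof (intro exI[of _ w'] allI impI ballI)
    fix w a assume w: "\<forall>a\<in>A. \<bar>n a \<bullet> (w - w')\<bar> < d a / (real DIM('a) + 1)" and a: "a \<in> A"
    have "\<sigma> a * h a w = \<sigma> a * h a w' + \<sigma> a * (n a \<bullet> (w - w'))"
      by (simp add: h_def inner_diff_right algebra_simps)
    moreover have "\<bar>\<sigma> a * (n a \<bullet> (w - w'))\<bar> < d a / (real DIM('a) + 1)"
      using w a \<sigma>1[OF a] by (simp add: abs_mult)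
    ultimately show "0 < sgn (n a \<bullet> w0 - b a) * (n a \<bullet> w - b a)"
      using hw'[OF a] unfolding \<sigma>_def h_def by linarith
  qed
qed

subsection \<open>Patches\<close>

context scheme
begin

abbreviation \<Lambda> :: "'p set" where "\<Lambda> \<equiv> cps \<Gamma> L W"

abbreviation patch :: "('p \<Rightarrow> real) \<Rightarrow> real \<Rightarrow> 'p \<Rightarrow> ('p \<times> 'l) set" where
  "patch Np \<equiv> patch_class Np \<Gamma> L W"

lemma star_eq: "g \<in> \<Gamma> \<Longrightarrow> star \<Gamma> (fst g) = snd g"
  unfolding star_def
proof (rule the_equality)
  fix y assume g: "g \<in> \<Gamma>" "(fst g, y) \<in> \<Gamma>"
  then have "(fst g, y) = g" using inj_fst by (metis fst_conv inj_onD)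
  then show "y = snd g" by (metis snd_conv)
qed simp

lemma cps_lift: "x \<in> \<Lambda> \<Longrightarrow> (x, star \<Gamma> x) \<in> \<Gamma>"
  unfolding cps_def using star_eq by fastforce

lemma cps_star: "x \<in> \<Lambda> \<Longrightarrow> \<exists>l\<in>L. star \<Gamma> x \<in> W l"
  unfolding cps_def by blast

lemma cpsI: "g \<in> \<Gamma> \<Longrightarrow> l \<in> L \<Longrightarrow> snd g \<in> W l \<Longrightarrow> fst g \<in> \<Lambda>"
  unfolding cps_def using star_eq by auto

lemma cps_translate:
  assumes "x \<in> \<Lambda>" and "g \<in> \<Gamma>"
  shows "star \<Gamma> (x + fst g) = star \<Gamma> x + snd g"
    and "l \<in> L \<Longrightarrow> star \<Gamma> x + snd g \<in> W l \<Longrightarrow> x + fst g \<in> \<Lambda>"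
proof -
  have "(x, star \<Gamma> x) + g \<in> \<Gamma>" using cps_lift[OF assms(1)] assms(2) int_mod.subspace_add[OF sub_\<Gamma>] by blast
  then show "star \<Gamma> (x + fst g) = star \<Gamma> x + snd g"
    and "l \<in> L \<Longrightarrow> star \<Gamma> x + snd g \<in> W l \<Longrightarrow> x + fst g \<in> \<Lambda>"
    using star_eq[of "(x, star \<Gamma> x) + g"] cpsI[of "(x, star \<Gamma> x) + g" l] by auto
qed

lemma cps_diff:
  assumes "x \<in> \<Lambda>" and "y \<in> \<Lambda>"
  shows "(y - x, star \<Gamma> y - star \<Gamma> x) \<in> \<Gamma>"
  using int_mod.subspace_diff[OF sub_\<Gamma> cps_lift[OF assms(2)] cps_lift[OF assms(1)]] by simp

text \<open>Up to translation the patch depends on x only through its star, by way of the sets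
  \<open>W l\<close> that contain the translates of the star. All later arguments about patches take
  place in internal space.\<close>

lemma patch_class_eq:
  assumes "x \<in> \<Lambda>"
  shows "patch Np r x = {(fst g, l) | g l. g \<in> \<Gamma> \<and> Np (fst g) \<le> r \<and> l \<in> L \<and> star \<Gamma> x + snd g \<in> W l}"
proof (intro Set.equalityI subsetI)
  fix z assume "z \<in> patch Np r x"
  then obtain y l where y: "z = (y - x, l)" "y \<in> \<Lambda>" "Np (y - x) \<le> r" "l \<in> L" "star \<Gamma> y \<in> W l"
    unfolding patch_class_def labelled_patch_def by auto
  then show "z \<in> {(fst g, l) | g l. g \<in> \<Gamma> \<and> Np (fst g) \<le> r \<and> l \<in> L \<and> star \<Gamma> x + snd g \<in> W l}"
    using cps_diff[OF assms y(2)] by (intro CollectI exI[of _ "(y - x, star \<Gamma> y - star \<Gamma> x)"] exI[of _ l]) auto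
next
  fix z assume "z \<in> {(fst g, l) | g l. g \<in> \<Gamma> \<and> Np (fst g) \<le> r \<and> l \<in> L \<and> star \<Gamma> x + snd g \<in> W l}"
  then obtain g l where g: "z = (fst g, l)" "g \<in> \<Gamma>" "Np (fst g) \<le> r" "l \<in> L" "star \<Gamma> x + snd g \<in> W l" by blast
  have "(x + fst g, l) \<in> labelled_patch Np \<Gamma> L W r x"
    unfolding labelled_patch_def using cps_translate[OF assms g(2)] g by auto
  then show "z \<in> patch Np r x" unfolding patch_class_def g(1) by force
qed

lemma patch_class_eq_iff:
  assumes "x \<in> \<Lambda>" and "y \<in> \<Lambda>"
  shows "patch Np r x = patch Np r y \<longleftrightarrow>
    (\<forall>g\<in>\<Gamma>. \<forall>l\<in>L. Np (fst g) \<le> r \<longrightarrow> (star \<Gamma> x + snd g \<in> W l \<longleftrightarrow> star \<Gamma> y + snd g \<in> W l))"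
proof
  assume e: "patch Np r x = patch Np r y"
  have key: "star \<Gamma> y + snd g \<in> W l"
    if e: "patch Np r x = patch Np r y" and xy: "x \<in> \<Lambda>" "y \<in> \<Lambda>"
      and g: "g \<in> \<Gamma>" "l \<in> L" "Np (fst g) \<le> r" "star \<Gamma> x + snd g \<in> W l" for x y g l
  proof -
    have "(fst g, l) \<in> patch Np r x" unfolding patch_class_eq[OF xy(1)] using g by blast
    then obtain g' where g': "fst g = fst g'" "g' \<in> \<Gamma>" "star \<Gamma> y + snd g' \<in> W l"
      unfolding e patch_class_eq[OF xy(2)] by blast
    then have "g = g'" using inj_fst g(1) by (meson inj_onD)
    then show ?thesis using g'(3) by simp
  qed
  show "\<forall>g\<in>\<Gamma>. \<forall>l\<in>L. Np (fst g) \<le> r \<longrightarrow> (star \<Gamma> x + snd g \<in> W l \<longleftrightarrow> star \<Gamma> y + snd g \<in> W l)"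
    using key[OF e assms] key[OF e[symmetric] assms(2,1)] by blast
next
  assume "\<forall>g\<in>\<Gamma>. \<forall>l\<in>L. Np (fst g) \<le> r \<longrightarrow> (star \<Gamma> x + snd g \<in> W l \<longleftrightarrow> star \<Gamma> y + snd g \<in> W l)"
  then show "patch Np r x = patch Np r y"
    unfolding patch_class_eq[OF assms(1)] patch_class_eq[OF assms(2)] by blast
qed

lemma W_bounded: "\<exists>D>0. \<forall>l\<in>L. \<forall>w\<in>W l. norm w \<le> D"
proof -
  have "compact (\<Union>l\<in>L. W l)" using polytopal_union unfolding polytopal_def by blast
  then obtain D where "D > 0" "\<And>w. w \<in> (\<Union>l\<in>L. W l) \<Longrightarrow> norm w \<le> D"
    using compact_imp_bounded bounded_pos by metis
  then show ?thesis by blast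
qed

lemma interior_W_nonempty: "\<exists>l\<in>L. interior (W l) \<noteq> {}"
proof -
  obtain l where "l \<in> L" "W l \<noteq> {}" using W_nonempty by blast
  then show ?thesis using polytopal_W[of l] unfolding polytopal_def by (metis closure_empty)
qed

text \<open>If the normals did not span, a line parallel to all hyperplanes through a generic point
  of the window would never cross the frontier, so the window would be unbounded.\<close>

lemma flag_exists: "\<exists>f. f \<in> flags Hs"
proof -
  have "x = 0" if x: "\<And>H. H \<in> Hs \<Longrightarrow> nrm H \<bullet> x = 0" for x
  proof (rule ccontr)
    assume x0: "x \<noteq> 0"
    obtain l where l: "l \<in> L" "interior (W l) \<noteq> {}" using interior_W_nonempty by blast
    have "interior (W l) \<inter> UNIV - \<Union>Hs \<noteq> {}"
    proof (rule affine_not_covered[OF finite_Hs])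
      fix H assume H: "H \<in> Hs"
      have "off H + 1 = nrm H \<bullet> ((off H + 1) / (nrm H \<bullet> nrm H)) *\<^sub>R nrm H"
        using nrm_nz[OF H] by simp
      then have "((off H + 1) / (nrm H \<bullet> nrm H)) *\<^sub>R nrm H \<notin> H"
        using in_hyperplane[OF H] by (metis add_cancel_right_right zero_neq_one)
      moreover have "H = {x. nrm H \<bullet> x = off H}" using in_hyperplane[OF H] by blast
      then have "closed H" "affine H" using closed_affine_hyperplane by metis+
      ultimately show "closed H \<and> affine H \<and> \<not> UNIV \<subseteq> H" by blast
    qed (use l in auto)
    then obtain w where w: "w \<in> W l" "w \<notin> \<Union>Hs" using interior_subset by blast
    let ?T = "range (\<lambda>t::real. w + t *\<^sub>R x)"
    have "connected ?T" by (intro connected_continuous_image continuous_intros connected_UNIV)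
    moreover have "?T \<inter> frontier (W l) = {}"
    proof -
      have "w + t *\<^sub>R x \<notin> H" if "H \<in> Hs" for t H
        using w(2) that x[OF that] by (auto simp: in_hyperplane inner_add_right)
      then show ?thesis using frontier_W[OF l(1)] by blast
    qed
    moreover have "w + 0 *\<^sub>R x \<in> ?T" by (rule rangeI)
    ultimately have T: "w + t *\<^sub>R x \<in> W l" for t
      using connected_frontier_same[of ?T "W l" "w + 0 *\<^sub>R x" "w + t *\<^sub>R x"] w(1) by auto
    obtain D where D: "D > 0" "\<And>w. w \<in> W l \<Longrightarrow> norm w \<le> D" using W_bounded l(1) by blast
    have "norm (w + (3 * D / norm x) *\<^sub>R x) \<le> D" by (rule D(2)[OF T])
    moreover have "norm ((3 * D / norm x) *\<^sub>R x) = 3 * D" using x0 D(1) by simp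
    moreover have "norm ((3 * D / norm x) *\<^sub>R x) \<le> norm (w + (3 * D / norm x) *\<^sub>R x) + norm w"
      by (metis add_diff_cancel_left' norm_triangle_ineq4)
    ultimately show False using D(2)[OF w(1)] D(1) by linarith
  qed
  then obtain f e where "f \<subseteq> Hs" "dual_system f nrm e"
    using dual_subsystem_exists[OF finite_Hs, of nrm] by blast
  then show ?thesis using flagI' by blast
qed

end

subsection \<open>From the Diophantine condition to linear repetitivity\<close>

context csr
begin

lemma subspace_complement_sum:
  assumes "Q' \<subseteq> Q"
  shows "subspace (set_family_sum Inter Q')"
  unfolding subspace_def
proof (intro conjI ballI allI)
  have X: "S \<in> Q' \<Longrightarrow> subspace (\<Inter>S)" for S using subspace_X assms by blast
  show "0 \<in> set_family_sum Inter Q'" unfolding set_family_sum_def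
    using X subspace_0 by (intro CollectI exI[of _ "\<lambda>_. 0"]) auto
  fix x assume "x \<in> set_family_sum Inter Q'"
  then obtain c where c: "x = sum c Q'" "\<forall>S\<in>Q'. c S \<in> \<Inter>S" unfolding set_family_sum_def by blast
  { fix y assume "y \<in> set_family_sum Inter Q'"
    then obtain d where d: "y = sum d Q'" "\<forall>S\<in>Q'. d S \<in> \<Inter>S" unfolding set_family_sum_def by blast
    have "c S + d S \<in> \<Inter>S" if "S \<in> Q'" for S using subspace_add[OF X[OF that]] c(2) d(2) that by blast
    then show "x + y \<in> set_family_sum Inter Q'" unfolding set_family_sum_def c(1) d(1) sum.distrib[symmetric]
      by (intro CollectI exI[of _ "\<lambda>S. c S + d S"]) blast }
  fix t :: real
  have "t *\<^sub>R c S \<in> \<Inter>S" if "S \<in> Q'" for S using subspace_scale[OF X[OF that]] c(2) that by blast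
  then show "t *\<^sub>R x \<in> set_family_sum Inter Q'" unfolding set_family_sum_def c(1) scaleR_sum_right
    by (intro CollectI exI[of _ "\<lambda>S. t *\<^sub>R c S"]) blast
qed

lemma in_complement_sum:
  assumes "Q' \<subseteq> Q" and "S \<in> Q'" and "x \<in> \<Inter>S"
  shows "x \<in> set_family_sum Inter Q'"
proof -
  have fin: "finite Q'" using assms(1) finite_Q finite_subset by blast
  have "x = (\<Sum>T\<in>Q'. if T = S then x else 0)" using fin assms(2) by simp
  moreover have "(if T = S then x else 0) \<in> \<Inter>T" if "T \<in> Q'" for T
    using assms that subspace_0[OF subspace_X, of T] by auto
  ultimately show ?thesis unfolding set_family_sum_def by blast
qed

lemma nrm_complement_sum:
  assumes "H \<in> Hs" and "y \<in> set_family_sum Inter (Q - {htype H})"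
  shows "nrm H \<bullet> y = 0"
proof -
  obtain c where c: "y = sum c (Q - {htype H})" "\<forall>S\<in>Q - {htype H}. c S \<in> \<Inter>S"
    using assms(2) unfolding set_family_sum_def by blast
  have "nrm H \<bullet> c S = 0" if S: "S \<in> Q - {htype H}" for S
    using S c(2) by (intro nrm_other_type[OF assms(1), of S]) auto
  then show ?thesis unfolding c(1) inner_sum_right by (intro sum.neutral) blast
qed

text \<open>Only the H-coordinate of \<open>\<gamma> H\<close> affects the translate of H, so
  \<open>\<gamma> H\<close> may be replaced by its component along the edge. Such a component exists
  in the lattice only after multiplication by N, whence the factor 1 / N.\<close>

lemma vertex_shift:
  assumes f: "f \<in> flags Hs" and N: "N \<ge> 1" "splits N f"
  shows "\<exists>C>0. \<forall>\<gamma> u. (\<forall>H\<in>f. \<gamma> H \<in> \<Gamma> \<and> nrm H \<bullet> (u + snd (\<gamma> H)) = off H) \<longrightarrow>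
    (\<exists>c. (\<forall>H\<in>f. c H \<in> line f H \<and> snd (c H) \<in> \<Inter>(htype H) \<and> norm (c H) \<le> C * norm (\<gamma> H)) \<and>
      u = vtx f - (1 / real N) *\<^sub>R (\<Sum>H\<in>f. snd (c H)))"
proof -
  note d = flag_dual[OF f]
  obtain C where C: "C > 0" "\<And>g. g \<in> \<Gamma> \<Longrightarrow> \<exists>c. (\<forall>H\<in>f. c H \<in> line f H \<and>
    snd (c H) = (real N * (nrm H \<bullet> snd g)) *\<^sub>R edge f H \<and> norm (c H) \<le> C * norm g)"
    using splits_bounded[OF f N(2)] by metis
  have "\<exists>c. (\<forall>H\<in>f. c H \<in> line f H \<and> snd (c H) \<in> \<Inter>(htype H) \<and> norm (c H) \<le> C * norm (\<gamma> H)) \<and>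
      u = vtx f - (1 / real N) *\<^sub>R (\<Sum>H\<in>f. snd (c H))"
    if g: "\<forall>H\<in>f. \<gamma> H \<in> \<Gamma> \<and> nrm H \<bullet> (u + snd (\<gamma> H)) = off H" for \<gamma> u
  proof -
    have "\<forall>H\<in>f. \<exists>c. c \<in> line f H \<and> snd c = (real N * (nrm H \<bullet> snd (\<gamma> H))) *\<^sub>R edge f H \<and> norm c \<le> C * norm (\<gamma> H)"
    proof
      fix H assume H: "H \<in> f"
      have "\<gamma> H \<in> \<Gamma>" using g H by blast
      from C(2)[OF this] obtain c where "\<forall>K\<in>f. c K \<in> line f K \<and>
        snd (c K) = (real N * (nrm K \<bullet> snd (\<gamma> H))) *\<^sub>R edge f K \<and> norm (c K) \<le> C * norm (\<gamma> H)" by (elim exE)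
      then show "\<exists>c. c \<in> line f H \<and> snd c = (real N * (nrm H \<bullet> snd (\<gamma> H))) *\<^sub>R edge f H \<and> norm c \<le> C * norm (\<gamma> H)"
        using H by blast
    qed
    then obtain c where c: "\<And>H. H \<in> f \<Longrightarrow> c H \<in> line f H \<and>
        snd (c H) = (real N * (nrm H \<bullet> snd (\<gamma> H))) *\<^sub>R edge f H \<and> norm (c H) \<le> C * norm (\<gamma> H)"
      by metis
    have "u = vtx f - (1 / real N) *\<^sub>R (\<Sum>H\<in>f. snd (c H))"
    proof (rule dual_system_eqI[OF d])
      fix H assume H: "H \<in> f"
      have "(\<Sum>H\<in>f. snd (c H)) = (\<Sum>H\<in>f. (real N * (nrm H \<bullet> snd (\<gamma> H))) *\<^sub>R edge f H)"
        using c by (intro sum.cong) auto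
      then have "nrm H \<bullet> (\<Sum>H\<in>f. snd (c H)) = real N * (nrm H \<bullet> snd (\<gamma> H))"
        using dual_system_sum[OF d H, of "\<lambda>H. real N * (nrm H \<bullet> snd (\<gamma> H))"] by simp
      then show "nrm H \<bullet> u = nrm H \<bullet> (vtx f - (1 / real N) *\<^sub>R (\<Sum>H\<in>f. snd (c H)))"
        using vtx_in[OF f H] g H N(1) by (simp add: inner_diff_right inner_add_right algebra_simps)
    qed
    moreover have "snd (c H) \<in> \<Inter>(htype H)" if H: "H \<in> f" for H
      using c[OF H] edge_in[OF f H] subspace_scale[OF subspace_X[OF htype_in_Q(1)]] flag_subset[OF f] H
      by (metis subsetD)
    ultimately show ?thesis using c by blast
  qed
  then show ?thesis using C(1) by blast
qed

lemma sum_type_stabiliser: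
  assumes "finite F" and "\<And>H. H \<in> F \<Longrightarrow> c H \<in> \<Gamma> \<and> snd (c H) \<in> \<Inter>S" and "S \<in> Q"
  shows "(\<Sum>H\<in>F. c H) \<in> stabiliser \<Gamma> S"
  using assms int_mod.subspace_sum[OF stabiliser_subspace[OF Q_subset[OF assms(3)]], of F c]
  by (auto simp: stabiliser_eq)

text \<open>Replacing one hyperplane of a vertex by \<open>H'\<close> moves the vertex along an edge; the two vertices
  differ by an element of \<open>F_S - (1/N) \<Gamma>_S\<close>, to which the Diophantine condition applies.\<close>

lemma edge_separation:
  assumes f: "f \<in> flags Hs" and H1: "H1 \<in> f" and H': "H' \<in> Hs" and nz: "nrm H' \<bullet> edge f H1 \<noteq> 0"
    and N: "N \<ge> 1" "\<And>f. f \<in> flags Hs \<Longrightarrow> splits N f" and K: "K > 0"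
    and dio: "\<exists>c>0. \<forall>a\<in>component Q (vertex_differences Hs) (htype H'). \<forall>g\<in>stabiliser \<Gamma> (htype H'). g \<noteq> 0 \<longrightarrow>
      (1 / real N) *\<^sub>R snd g \<noteq> a \<longrightarrow> norm ((1 / real N) *\<^sub>R snd g - a) \<ge> c * norm g powr (- dexp (htype H'))"
  shows "\<exists>c>0. \<forall>r\<ge>1. \<forall>\<gamma> g' u. (\<forall>H\<in>f. \<gamma> H \<in> \<Gamma> \<and> norm (\<gamma> H) \<le> K * r \<and> nrm H \<bullet> (u + snd (\<gamma> H)) = off H) \<longrightarrow>
    g' \<in> \<Gamma> \<longrightarrow> norm g' \<le> K * r \<longrightarrow> nrm H' \<bullet> (u + snd g') \<noteq> off H' \<longrightarrow>
    \<bar>nrm H' \<bullet> (u + snd g') - off H'\<bar> \<ge> c * r powr (- dexp (htype H'))"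
proof -
  define S where "S = htype H'"
  define f2 where "f2 = insert H' (f - {H1})"
  define \<eta> where "\<eta> = nrm H' \<bullet> edge f H1"
  note d = flag_dual[OF f]
  have S: "S \<in> Q" unfolding S_def by (rule htype_in_Q(1)[OF H'])
  have H'f: "H' \<notin> f - {H1}" using dual_systemD(2)[OF d _ H1, of H'] nz by (auto split: if_splits)
  obtain e2 where e2: "dual_system f2 nrm e2" unfolding f2_def using dual_system_exchange[OF d H1 nz] by blast
  have f2: "f2 \<in> flags Hs" using flag_subset[OF f] H' e2 unfolding f2_def by (intro flagI') auto
  have f1Hs: "H1 \<in> Hs" using flag_subset[OF f] H1 by blast
  have edgeS: "edge f H1 \<in> \<Inter>S"
  proof -
    have "htype H1 = S"
      using nrm_other_type[OF H' htype_in_Q(1)[OF f1Hs] _ edge_in[OF f H1]] nz unfolding S_def by blast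
    then show ?thesis using edge_in[OF f H1] by simp
  qed
  obtain C1 where C1: "C1 > 0" and shift1: "\<And>\<gamma> u. (\<forall>H\<in>f. \<gamma> H \<in> \<Gamma> \<and> nrm H \<bullet> (u + snd (\<gamma> H)) = off H) \<Longrightarrow>
    (\<exists>c. (\<forall>H\<in>f. c H \<in> line f H \<and> snd (c H) \<in> \<Inter>(htype H) \<and> norm (c H) \<le> C1 * norm (\<gamma> H)) \<and>
      u = vtx f - (1 / real N) *\<^sub>R (\<Sum>H\<in>f. snd (c H)))"
    using vertex_shift[OF f N(1) N(2)[OF f]] by blast
  obtain C2 where C2: "C2 > 0" and shift2: "\<And>\<gamma> u. (\<forall>H\<in>f2. \<gamma> H \<in> \<Gamma> \<and> nrm H \<bullet> (u + snd (\<gamma> H)) = off H) \<Longrightarrow>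
    (\<exists>c. (\<forall>H\<in>f2. c H \<in> line f2 H \<and> snd (c H) \<in> \<Inter>(htype H) \<and> norm (c H) \<le> C2 * norm (\<gamma> H)) \<and>
      u = vtx f2 - (1 / real N) *\<^sub>R (\<Sum>H\<in>f2. snd (c H)))"
    using vertex_shift[OF f2 N(1) N(2)[OF f2]] by blast
  obtain c0 where c0: "c0 > 0" "\<And>a g. a \<in> component Q (vertex_differences Hs) S \<Longrightarrow> g \<in> stabiliser \<Gamma> S \<Longrightarrow>
    g \<noteq> 0 \<Longrightarrow> (1 / real N) *\<^sub>R snd g \<noteq> a \<Longrightarrow> norm ((1 / real N) *\<^sub>R snd g - a) \<ge> c0 * norm g powr (- dexp S)"
    using dio unfolding S_def by blast
  define M where "M = real (card f2) * (C2 * K) + real (card f) * (C1 * K) + 1"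
  have M: "M > 0" unfolding M_def using C1 C2 K by (simp add: add_nonneg_pos)
  have e1: "norm (edge f H1) > 0" using nz by auto
  define c1 where "c1 = c0 * M powr (- dexp S) * \<bar>\<eta>\<bar> / norm (edge f H1)"
  \<comment> \<open>The Diophantine condition says nothing about the zero lattice element. In that
    case the deviation from H' has this fixed absolute value; the default 1 stands for a value 0,
    which the hypothesis that u misses the translate of H' excludes.\<close>
  define c2 where "c2 = (if nrm H' \<bullet> (vtx f2 - vtx f) = 0 then 1 else \<bar>nrm H' \<bullet> (vtx f2 - vtx f)\<bar>)"
  have cpos: "c1 > 0" "c2 > 0" unfolding c1_def c2_def \<eta>_def using c0(1) M nz e1 by auto
  have main: "\<bar>nrm H' \<bullet> (u + snd g') - off H'\<bar> \<ge> min c1 c2 * r powr (- dexp S)"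
    if r: "r \<ge> 1" and \<gamma>: "\<forall>H\<in>f. \<gamma> H \<in> \<Gamma> \<and> norm (\<gamma> H) \<le> K * r \<and> nrm H \<bullet> (u + snd (\<gamma> H)) = off H"
      and g': "g' \<in> \<Gamma>" "norm g' \<le> K * r" "nrm H' \<bullet> (u + snd g') \<noteq> off H'" for r \<gamma> g' u
  proof -
    define h where "h = nrm H' \<bullet> (u + snd g') - off H'"
    have h: "h \<noteq> 0" using g' unfolding h_def by simp
    \<comment> \<open>Moving u by t along the edge brings it onto the translate of H', so that u2 is
      a vertex for the exchanged flag.\<close>
    define t where "t = - h / \<eta>"
    define u2 where "u2 = u + t *\<^sub>R edge f H1"
    define \<gamma>2 where "\<gamma>2 = \<gamma>(H' := g')"
    have t\<eta>: "t * \<eta> = - h" unfolding t_def using nz by (simp add: \<eta>_def)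
    have \<gamma>2: "\<forall>H\<in>f2. \<gamma>2 H \<in> \<Gamma> \<and> norm (\<gamma>2 H) \<le> K * r \<and> nrm H \<bullet> (u2 + snd (\<gamma>2 H)) = off H"
    proof
      fix H assume H: "H \<in> f2"
      show "\<gamma>2 H \<in> \<Gamma> \<and> norm (\<gamma>2 H) \<le> K * r \<and> nrm H \<bullet> (u2 + snd (\<gamma>2 H)) = off H"
      proof (cases "H = H'")
        case True
        then show ?thesis using g' t\<eta> unfolding \<gamma>2_def u2_def h_def \<eta>_def
          by (simp add: inner_add_right)
      next
        case False
        then have Hf: "H \<in> f" "H \<noteq> H1" using H unfolding f2_def by auto
        have "nrm H \<bullet> edge f H1 = 0" using dual_systemD(2)[OF d Hf(1) H1] Hf(2) by simp
        then show ?thesis using \<gamma> Hf(1) False unfolding \<gamma>2_def u2_def by (simp add: inner_add_right)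
      qed
    qed
    obtain a where a: "\<And>H. H \<in> f \<Longrightarrow> a H \<in> line f H \<and> snd (a H) \<in> \<Inter>(htype H) \<and> norm (a H) \<le> C1 * norm (\<gamma> H)"
      "u = vtx f - (1 / real N) *\<^sub>R (\<Sum>H\<in>f. snd (a H))"
      using shift1[of \<gamma> u] \<gamma> by blast
    obtain b where b: "\<And>H. H \<in> f2 \<Longrightarrow> b H \<in> line f2 H \<and> snd (b H) \<in> \<Inter>(htype H) \<and> norm (b H) \<le> C2 * norm (\<gamma>2 H)"
      "u2 = vtx f2 - (1 / real N) *\<^sub>R (\<Sum>H\<in>f2. snd (b H))"
      using shift2[of \<gamma>2 u2] \<gamma>2 by blast
    have fin: "finite f" "finite f2" using flag_finite f f2 by auto
    \<comment> \<open>The lattice parts of the two vertices are sorted by type: type S goes into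
      \<open>gS\<close>, the rest into y. Then x + y is a difference of vertices of flags, so x is
      in the S-component of F, and x minus 1 / N times the internal part of \<open>gS\<close> is the
      displacement along the edge.\<close>
    define gS where "gS = (\<Sum>H\<in>{H\<in>f2. htype H = S}. b H) - (\<Sum>H\<in>{H\<in>f. htype H = S}. a H)"
    define y where "y = (1 / real N) *\<^sub>R ((\<Sum>H\<in>{H\<in>f2. htype H \<noteq> S}. snd (b H)) - (\<Sum>H\<in>{H\<in>f. htype H \<noteq> S}. snd (a H)))"
    define x where "x = t *\<^sub>R edge f H1 + (1 / real N) *\<^sub>R snd gS"
    have st: "(\<Sum>H\<in>{H\<in>f2. htype H = S}. b H) \<in> stabiliser \<Gamma> S" "(\<Sum>H\<in>{H\<in>f. htype H = S}. a H) \<in> stabiliser \<Gamma> S"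
    proof -
      have "a H \<in> \<Gamma>" if "H \<in> f" for H using a(1)[OF that] line_subset by blast
      moreover have "b H \<in> \<Gamma>" if "H \<in> f2" for H using b(1)[OF that] line_subset by blast
      ultimately show "(\<Sum>H\<in>{H\<in>f2. htype H = S}. b H) \<in> stabiliser \<Gamma> S"
        "(\<Sum>H\<in>{H\<in>f. htype H = S}. a H) \<in> stabiliser \<Gamma> S"
        using a(1) b(1) fin S by (auto intro!: sum_type_stabiliser)
    qed
    have gS: "gS \<in> stabiliser \<Gamma> S" unfolding gS_def
      by (rule int_mod.subspace_diff[OF stabiliser_subspace[OF Q_subset[OF S]] st])
    have gSX: "snd gS \<in> \<Inter>S" using gS unfolding stabiliser_eq by blast
    have xS: "x \<in> \<Inter>S" unfolding x_def
      using subspace_add[OF subspace_X[OF S]] subspace_scale[OF subspace_X[OF S]] edgeS gSX by blast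
    have yQ: "y \<in> set_family_sum Inter (Q - {S})"
    proof -
      have s: "subspace (set_family_sum Inter (Q - {S}))" by (rule subspace_complement_sum) blast
      have "snd (b H) \<in> set_family_sum Inter (Q - {S})" if "H \<in> f2" "htype H \<noteq> S" for H
        using b(1)[OF that(1)] that htype_in_Q(1)[of H] flag_subset[OF f2]
        by (intro in_complement_sum[of _ "htype H"]) auto
      moreover have "snd (a H) \<in> set_family_sum Inter (Q - {S})" if "H \<in> f" "htype H \<noteq> S" for H
        using a(1)[OF that(1)] that htype_in_Q(1)[of H] flag_subset[OF f]
        by (intro in_complement_sum[of _ "htype H"]) auto
      ultimately show ?thesis unfolding y_def
        by (intro subspace_scale[OF s] subspace_diff[OF s] subspace_sum[OF s]) auto
    qed
    have split: "(\<Sum>H\<in>F. k H) = (\<Sum>H\<in>{H\<in>F. htype H = S}. k H) + (\<Sum>H\<in>{H\<in>F. htype H \<noteq> S}. k H)"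
      if "finite F" for F and k :: "'i set \<Rightarrow> 'i"
    proof -
      have "(\<Sum>H\<in>{H\<in>F. htype H = S} \<union> {H\<in>F. htype H \<noteq> S}. k H) =
        (\<Sum>H\<in>{H\<in>F. htype H = S}. k H) + (\<Sum>H\<in>{H\<in>F. htype H \<noteq> S}. k H)"
        using that by (intro sum.union_disjoint) auto
      moreover have "{H\<in>F. htype H = S} \<union> {H\<in>F. htype H \<noteq> S} = F" by blast
      ultimately show ?thesis by simp
    qed
    have xy: "x + y = vtx f2 - vtx f"
    proof -
      have "vtx f2 - vtx f = u2 - u + (1 / real N) *\<^sub>R ((\<Sum>H\<in>f2. snd (b H)) - (\<Sum>H\<in>f. snd (a H)))"
        using a(2) b(2) by (simp add: scaleR_diff_right)
      also have "\<dots> = x + y"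
        unfolding split[OF fin(1)] split[OF fin(2)] x_def y_def gS_def u2_def
        by (simp add: snd_sum scaleR_diff_right scaleR_add_right)
      finally show ?thesis by simp
    qed
    then have xF: "x \<in> component Q (vertex_differences Hs) S"
      unfolding component_def vertex_differences_def vtx_def[symmetric] using xS yQ f f2 by blast
    have te: "t *\<^sub>R edge f H1 = x - (1 / real N) *\<^sub>R snd gS" by (simp add: x_def)
    have t0: "t \<noteq> 0" using t\<eta> h by auto
    show ?thesis
    proof (cases "gS = 0")
      case True
      then have "h = - (nrm H' \<bullet> x)" using t\<eta> by (simp add: x_def \<eta>_def)
      also have "nrm H' \<bullet> x = nrm H' \<bullet> (vtx f2 - vtx f)"
        using nrm_complement_sum[OF H', of y] yQ xy unfolding S_def by (metis add.right_neutral inner_add_right)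
      finally have "\<bar>h\<bar> = c2" using h unfolding c2_def by auto
      moreover have "min c1 c2 * r powr (- dexp S) \<le> c2 * 1"
        using r cpos dexp_pos[OF f S] by (intro mult_mono) (auto simp: powr_le1 powr_minus field_simps intro!: ge_one_powr_ge_zero)
      ultimately show ?thesis unfolding h_def by simp
    next
      case False
      have "norm gS \<le> M * r"
      proof -
        have "norm (\<Sum>H\<in>{H\<in>f2. htype H = S}. b H) \<le> (\<Sum>H\<in>{H\<in>f2. htype H = S}. C2 * (K * r))"
        proof (rule sum_norm_le)
          fix H assume "H \<in> {H\<in>f2. htype H = S}"
          then show "norm (b H) \<le> C2 * (K * r)"
            using b(1)[of H] \<gamma>2 C2 by (auto intro: order_trans mult_left_mono)
        qed
        also have "\<dots> \<le> real (card f2) * (C2 * (K * r))"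
          using fin C2 K r by (simp add: card_mono mult_right_mono)
        finally have 1: "norm (\<Sum>H\<in>{H\<in>f2. htype H = S}. b H) \<le> real (card f2) * (C2 * (K * r))" .
        have "norm (\<Sum>H\<in>{H\<in>f. htype H = S}. a H) \<le> (\<Sum>H\<in>{H\<in>f. htype H = S}. C1 * (K * r))"
        proof (rule sum_norm_le)
          fix H assume "H \<in> {H\<in>f. htype H = S}"
          then show "norm (a H) \<le> C1 * (K * r)"
            using a(1)[of H] \<gamma> C1 by (auto intro: order_trans mult_left_mono)
        qed
        also have "\<dots> \<le> real (card f) * (C1 * (K * r))"
          using fin C1 K r by (simp add: card_mono mult_right_mono)
        finally have 2: "norm (\<Sum>H\<in>{H\<in>f. htype H = S}. a H) \<le> real (card f) * (C1 * (K * r))" .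
        have "norm gS \<le> real (card f2) * (C2 * (K * r)) + real (card f) * (C1 * (K * r))"
          unfolding gS_def using 1 2 norm_triangle_ineq4 by (smt (verit))
        also have "\<dots> \<le> M * r" unfolding M_def using r by (simp add: algebra_simps)
        finally show ?thesis .
      qed
      then have "c0 * (M * r) powr (- dexp S) \<le> c0 * norm gS powr (- dexp S)"
        using False c0(1) dexp_pos[OF f S] by (intro mult_left_mono powr_mono2') auto
      also have "\<dots> \<le> norm ((1 / real N) *\<^sub>R snd gS - x)"
        using te t0 e1 by (intro c0(2)[OF xF gS False]) auto
      also have "\<dots> = norm (t *\<^sub>R edge f H1)" unfolding te by (rule norm_minus_commute)
      also have "\<dots> = \<bar>t\<bar> * norm (edge f H1)" by simp
      finally have "c0 * (M powr (- dexp S) * r powr (- dexp S)) \<le> \<bar>t\<bar> * norm (edge f H1)"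
        using M r by (simp add: powr_mult)
      then have "c0 * (M powr (- dexp S) * r powr (- dexp S)) * \<bar>\<eta>\<bar> \<le> (\<bar>t\<bar> * norm (edge f H1)) * \<bar>\<eta>\<bar>"
        by (rule mult_right_mono) simp
      also have "\<dots> = \<bar>h\<bar> * norm (edge f H1)" using arg_cong[OF t\<eta>, of abs] by (simp add: abs_mult)
      finally have "c1 * r powr (- dexp S) \<le> \<bar>h\<bar>" unfolding c1_def using e1 by (simp add: field_simps)
      moreover have "min c1 c2 * r powr (- dexp S) \<le> c1 * r powr (- dexp S)" by (intro mult_right_mono) auto
      ultimately show ?thesis unfolding h_def by linarith
    qed
  qed
  have "min c1 c2 > 0" using cpos by simp
  then show ?thesis using main unfolding S_def by blast
qed

text \<open>The edges of f span, so one of them is not parallel to H'. The constant is the minimum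
  over all pairs of a flag and a hyperplane.\<close>

lemma vertex_separation:
  assumes N: "N \<ge> 1" "\<And>f. f \<in> flags Hs \<Longrightarrow> splits N f" and K: "K > 0"
    and dio: "\<And>S. S \<in> Q \<Longrightarrow> \<exists>c>0. \<forall>a\<in>component Q (vertex_differences Hs) S. \<forall>g\<in>stabiliser \<Gamma> S. g \<noteq> 0 \<longrightarrow>
      (1 / real N) *\<^sub>R snd g \<noteq> a \<longrightarrow> norm ((1 / real N) *\<^sub>R snd g - a) \<ge> c * norm g powr (- dexp S)"
  shows "\<exists>c>0. \<forall>f\<in>flags Hs. \<forall>H'\<in>Hs. \<forall>r\<ge>1. \<forall>\<gamma> g' u.
    (\<forall>H\<in>f. \<gamma> H \<in> \<Gamma> \<and> norm (\<gamma> H) \<le> K * r \<and> nrm H \<bullet> (u + snd (\<gamma> H)) = off H) \<longrightarrow>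
    g' \<in> \<Gamma> \<longrightarrow> norm g' \<le> K * r \<longrightarrow> nrm H' \<bullet> (u + snd g') \<noteq> off H' \<longrightarrow>
    \<bar>nrm H' \<bullet> (u + snd g') - off H'\<bar> \<ge> c * r powr (- dexp (htype H'))"
proof -
  define P where "P = (\<lambda>(f, H') c. \<forall>r\<ge>1. \<forall>\<gamma> g' u.
    (\<forall>H\<in>f. \<gamma> H \<in> \<Gamma> \<and> norm (\<gamma> H) \<le> K * r \<and> nrm H \<bullet> (u + snd (\<gamma> H)) = off H) \<longrightarrow>
    g' \<in> \<Gamma> \<longrightarrow> norm g' \<le> K * r \<longrightarrow> nrm H' \<bullet> (u + snd g') \<noteq> off H' \<longrightarrow>
    \<bar>nrm H' \<bullet> (u + snd g') - off H'\<bar> \<ge> c * r powr (- dexp (htype H')))"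
  have "\<exists>c>0::real. \<forall>x\<in>flags Hs \<times> Hs. P x c"
  proof (rule finite_uniform_constant)
    show "finite (flags Hs \<times> Hs)" using finite_flags finite_Hs by blast
    fix x assume "x \<in> flags Hs \<times> Hs"
    then obtain f H' where x: "x = (f, H')" and f: "f \<in> flags Hs" and H': "H' \<in> Hs" by blast
    have "\<exists>H1\<in>f. nrm H' \<bullet> edge f H1 \<noteq> 0"
    proof (rule ccontr)
      assume "\<not> ?thesis"
      then have "nrm H' \<bullet> nrm H' = 0"
        unfolding dual_system_expand[OF flag_dual[OF f], of "nrm H'" "nrm H'"] by (intro sum.neutral) auto
      then show False using nrm_nz[OF H'] by simp
    qed
    then obtain H1 where "H1 \<in> f" "nrm H' \<bullet> edge f H1 \<noteq> 0" by blast
    from edge_separation[OF f this(1) H' this(2) N K dio[OF htype_in_Q(1)[OF H']]]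
    show "\<exists>c>0. P x c" unfolding P_def x by simp
  next
    fix x and c c' :: real assume a: "P x c" "0 < c'" "c' \<le> c"
    obtain f H' where x: "x = (f, H')" by (cases x)
    have "c' * r powr (- dexp (htype H')) \<le> c * r powr (- dexp (htype H'))" for r
      using a(3) by (intro mult_right_mono) auto
    then show "P x c'" using a(1) unfolding P_def x prod.case by (meson order_trans)
  qed
  then obtain c where c: "c > 0" "\<And>f H'. f \<in> flags Hs \<Longrightarrow> H' \<in> Hs \<Longrightarrow> P (f, H') c" by blast
  then show ?thesis unfolding P_def prod.case by (intro exI[of _ c]) blast
qed

text \<open>The box lies in a cell, adjacent to the star of y, of the arrangement of hyperplanes
  translated by lattice elements of size O(r). Its centre is the barycentre from
  \<open>cell_center\<close>, its size comes from the vertex separation.\<close>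

lemma patch_box:
  assumes N: "N \<ge> 1" "\<And>f. f \<in> flags Hs \<Longrightarrow> splits N f" and Np: "is_norm Np"
    and dio: "\<And>S. S \<in> Q \<Longrightarrow> \<exists>c>0. \<forall>a\<in>component Q (vertex_differences Hs) S. \<forall>g\<in>stabiliser \<Gamma> S. g \<noteq> 0 \<longrightarrow>
      (1 / real N) *\<^sub>R snd g \<noteq> a \<longrightarrow> norm ((1 / real N) *\<^sub>R snd g - a) \<ge> c * norm g powr (- dexp S)"
  shows "\<exists>c>0. \<forall>r\<ge>1. \<forall>y\<in>\<Lambda>. \<exists>w'. \<forall>w. (\<forall>H\<in>Hs. \<bar>nrm H \<bullet> (w - w')\<bar> < c * r powr (- dexp (htype H))) \<longrightarrow>
    (\<forall>g\<in>\<Gamma>. \<forall>l\<in>L. Np (fst g) \<le> r \<longrightarrow> (w + snd g \<in> W l \<longleftrightarrow> star \<Gamma> y + snd g \<in> W l))"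
proof -
  obtain D where D: "D > 0" "\<And>l w. l \<in> L \<Longrightarrow> w \<in> W l \<Longrightarrow> norm w \<le> D" using W_bounded by blast
  obtain CN where CN: "CN > 0" "\<And>x. norm x \<le> CN * Np x" using is_norm_equivalent[OF Np] by blast
  define K where "K = CN + 2 * D"
  have K: "K > 0" using CN D by (simp add: K_def)
  have "\<exists>c>0. \<forall>f\<in>flags Hs. \<forall>H'\<in>Hs. \<forall>r\<ge>1. \<forall>\<gamma> g' u.
    (\<forall>H\<in>f. \<gamma> H \<in> \<Gamma> \<and> norm (\<gamma> H) \<le> K * r \<and> nrm H \<bullet> (u + snd (\<gamma> H)) = off H) \<longrightarrow>
    g' \<in> \<Gamma> \<longrightarrow> norm g' \<le> K * r \<longrightarrow> nrm H' \<bullet> (u + snd g') \<noteq> off H' \<longrightarrow>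
    \<bar>nrm H' \<bullet> (u + snd g') - off H'\<bar> \<ge> c * r powr (- dexp (htype H'))"
    by (rule vertex_separation[OF N K dio])
  then obtain c where c: "c > 0" and sep: "\<forall>f\<in>flags Hs. \<forall>H'\<in>Hs. \<forall>r\<ge>1. \<forall>\<gamma> g' u.
    (\<forall>H\<in>f. \<gamma> H \<in> \<Gamma> \<and> norm (\<gamma> H) \<le> K * r \<and> nrm H \<bullet> (u + snd (\<gamma> H)) = off H) \<longrightarrow>
    g' \<in> \<Gamma> \<longrightarrow> norm g' \<le> K * r \<longrightarrow> nrm H' \<bullet> (u + snd g') \<noteq> off H' \<longrightarrow>
    \<bar>nrm H' \<bullet> (u + snd g') - off H'\<bar> \<ge> c * r powr (- dexp (htype H'))"
    by (elim exE conjE)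
  have main: "\<exists>w'. \<forall>w. (\<forall>H\<in>Hs. \<bar>nrm H \<bullet> (w - w')\<bar> < c / (real DIM('i) + 1) * r powr (- dexp (htype H))) \<longrightarrow>
    (\<forall>g\<in>\<Gamma>. \<forall>l\<in>L. Np (fst g) \<le> r \<longrightarrow> (w + snd g \<in> W l \<longleftrightarrow> star \<Gamma> y + snd g \<in> W l))"
    if r: "r \<ge> 1" and y: "y \<in> \<Lambda>" for r y
  proof -
    \<comment> \<open>Elements with larger internal part move the window off itself, so they put no
      point of the window back into the window.\<close>
    define G where "G = {g\<in>\<Gamma>. Np (fst g) \<le> r \<and> norm (snd g) \<le> 2 * D}"
    have GK: "norm g \<le> K * r" if "g \<in> G" for g
    proof -
      have "norm g \<le> norm (fst g) + norm (snd g)"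
        using norm_Pair_le[of "fst g" "snd g"] by simp
      also have "\<dots> \<le> CN * r + 2 * D"
      proof (rule add_mono)
        have "norm (fst g) \<le> CN * Np (fst g)" by (rule CN(2))
        also have "\<dots> \<le> CN * r" using that CN(1) unfolding G_def by (intro mult_left_mono) auto
        finally show "norm (fst g) \<le> CN * r" .
        show "norm (snd g) \<le> 2 * D" using that unfolding G_def by blast
      qed
      also have "2 * D \<le> 2 * D * r" using r D(1) by simp
      finally show ?thesis by (simp add: K_def algebra_simps)
    qed
    have finG: "finite G"
    proof -
      have "\<forall>j\<in>(Basis :: ('p \<times> 'i) set). 1 \<le> K * r + 1" using K r by simp
      then have "finite {g\<in>\<Gamma>. \<forall>j\<in>Basis. \<bar>j \<bullet> g\<bar> \<le> K * r + 1}"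
        using lattice_count[OF lattice dual_system_Basis] by (elim exE conjE) (erule allE, erule (1) impE, erule conjunct1)
      moreover have "G \<subseteq> {g\<in>\<Gamma>. \<forall>j\<in>Basis. \<bar>j \<bullet> g\<bar> \<le> K * r + 1}"
      proof
        fix g assume g: "g \<in> G"
        have "\<bar>j \<bullet> g\<bar> \<le> K * r + 1" if "j \<in> Basis" for j
          using Basis_le_norm[OF that, of g] GK[OF g] by (simp add: inner_commute)
        then show "g \<in> {g\<in>\<Gamma>. \<forall>j\<in>Basis. \<bar>j \<bullet> g\<bar> \<le> K * r + 1}" using g unfolding G_def by blast
      qed
      ultimately show ?thesis by (rule finite_subset[rotated])
    qed
    have "0 \<in> G"
    proof -
      have "Np 0 = 0" using Np unfolding is_norm_def by blast
      then show ?thesis using int_mod.subspace_0[OF sub_\<Gamma>] r D(1) unfolding G_def by simp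
    qed
    let ?A = "Hs \<times> G"
    define n where "n = (\<lambda>a::'i set \<times> 'p \<times> 'i. nrm (fst a))"
    define b where "b = (\<lambda>a::'i set \<times> 'p \<times> 'i. off (fst a) - nrm (fst a) \<bullet> snd (snd a))"
    define d where "d = (\<lambda>a::'i set \<times> 'p \<times> 'i. c * r powr (- dexp (htype (fst a))))"
    have nb: "n (H, g) \<bullet> w - b (H, g) = nrm H \<bullet> (w + snd g) - off H" for H g w
      by (simp add: n_def b_def inner_add_right)
    let ?y = "star \<Gamma> y"
    obtain l0 where l0: "l0 \<in> L" "?y \<in> W l0" using cps_star[OF y] by blast
    \<comment> \<open>The star of y avoids the translated frontiers but may lie on a hyperplane away
      from the part that bounds the window. It is replaced by a generic point w0 so close that no
      frontier is crossed.\<close>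
    have "closed (\<Union>(l, g)\<in>L \<times> G. (\<lambda>w. - snd g + w) ` frontier (W l))"
      using finite_L finG by (intro closed_UN) (auto intro: closed_translation_subtract)
    moreover have "?y \<notin> (\<Union>(l, g)\<in>L \<times> G. (\<lambda>w. - snd g + w) ` frontier (W l))"
    proof
      assume "?y \<in> (\<Union>(l, g)\<in>L \<times> G. (\<lambda>w. - snd g + w) ` frontier (W l))"
      then obtain l g w where lg: "l \<in> L" "g \<in> G" "w \<in> frontier (W l)" "?y = - snd g + w" by blast
      have "(y, ?y) + g \<in> \<Gamma>" using cps_lift[OF y] lg(2) int_mod.subspace_add[OF sub_\<Gamma>] unfolding G_def by blast
      then have "snd ((y, ?y) + g) \<notin> frontier (W l)" by (rule nonsingular[OF _ lg(1)])
      then show False using lg(3,4) by simp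
    qed
    ultimately obtain \<epsilon> where \<epsilon>: "\<epsilon> > 0" "ball ?y \<epsilon> \<inter> (\<Union>(l, g)\<in>L \<times> G. (\<lambda>w. - snd g + w) ` frontier (W l)) = {}"
      by (metis (no_types, lifting) Compl_iff disjoint_eq_subset_Compl openE open_Compl)
    have "ball ?y \<epsilon> \<inter> UNIV - \<Union>((\<lambda>a. {w. n a \<bullet> w = b a}) ` ?A) \<noteq> {}"
    proof (rule affine_not_covered)
      show "finite ((\<lambda>a. {w. n a \<bullet> w = b a}) ` ?A)" using finite_Hs finG by simp
      fix T assume "T \<in> (\<lambda>a. {w. n a \<bullet> w = b a}) ` ?A"
      then obtain a where a: "a \<in> ?A" "T = {w. n a \<bullet> w = b a}" by blast
      have na: "n a \<noteq> 0" using a(1) nrm_nz unfolding n_def by auto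
      have "((b a + 1) / (n a \<bullet> n a)) *\<^sub>R n a \<notin> T" using na unfolding a(2) by simp
      then show "closed T \<and> affine T \<and> \<not> UNIV \<subseteq> T"
        unfolding a(2) using closed_affine_hyperplane by blast
    qed (use \<epsilon>(1) in auto)
    then obtain w0 where w0: "w0 \<in> ball ?y \<epsilon>" "\<And>a. a \<in> ?A \<Longrightarrow> n a \<bullet> w0 \<noteq> b a" by blast
    have same0: "w0 + snd g \<in> W l \<longleftrightarrow> ?y + snd g \<in> W l" if "g \<in> G" "l \<in> L" for g l
    proof (rule connected_frontier_same)
      let ?T = "(\<lambda>w. snd g + w) ` ball ?y \<epsilon>"
      show "connected ?T" by (intro connected_continuous_image continuous_intros connected_ball)
      show "?T \<inter> frontier (W l) = {}"
      proof (rule ccontr)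
        assume "?T \<inter> frontier (W l) \<noteq> {}"
        then obtain w where w: "w \<in> ball ?y \<epsilon>" "snd g + w \<in> frontier (W l)" by blast
        have "w = - snd g + (snd g + w)" by simp
        then have "w \<in> (\<Union>(l, g)\<in>L \<times> G. (\<lambda>w. - snd g + w) ` frontier (W l))" using that w(2) by blast
        then show False using \<epsilon>(2) w(1) by blast
      qed
      show "w0 + snd g \<in> ?T" "?y + snd g \<in> ?T" using w0(1) \<epsilon>(1) by (auto simp: add.commute)
    qed
    define C where "C = {w. \<forall>a\<in>?A. sgn (n a \<bullet> w0 - b a) * (n a \<bullet> w - b a) > 0}"
    have C: "C = (\<Inter>a\<in>?A. {w. (sgn (n a \<bullet> w0 - b a) *\<^sub>R n a) \<bullet> w > sgn (n a \<bullet> w0 - b a) * b a})"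
      unfolding C_def by (auto simp: algebra_simps)
    have convC: "convex C" unfolding C by (intro convex_INT convex_halfspace_gt)
    have w0C: "w0 \<in> C" unfolding C_def mem_Collect_eq
    proof
      fix a assume "a \<in> ?A"
      then have "n a \<bullet> w0 - b a \<noteq> 0" using w0(2) by simp
      then show "0 < sgn (n a \<bullet> w0 - b a) * (n a \<bullet> w0 - b a)" by (simp add: sgn_if)
    qed
    have sameC: "w + snd g \<in> W l \<longleftrightarrow> w0 + snd g \<in> W l" if w1: "w \<in> C" and g1: "g \<in> G" and l1: "l \<in> L" for w g l
    proof (rule connected_frontier_same)
      let ?T = "(\<lambda>w. snd g + w) ` C"
      show "connected ?T" by (intro connected_continuous_image continuous_intros convex_connected convC)
      show "?T \<inter> frontier (W l) = {}"
      proof (rule ccontr)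
        assume "?T \<inter> frontier (W l) \<noteq> {}"
        then obtain w where w: "w \<in> C" "snd g + w \<in> frontier (W l)" by blast
        then obtain H where H: "H \<in> Hs" "snd g + w \<in> H" using frontier_W[OF l1] by blast
        then have "nrm H \<bullet> (w + snd g) - off H = 0" using in_hyperplane by (simp add: add.commute)
        then have "n (H, g) \<bullet> w - b (H, g) = 0" using nb by metis
        moreover have "(H, g) \<in> ?A" using H(1) g1 by blast
        ultimately show False using w(1) unfolding C_def by fastforce
      qed
      show "w + snd g \<in> ?T" "w0 + snd g \<in> ?T" using w0C w1 by (auto simp: add.commute)
    qed
    have CW: "w \<in> W l0" if "w \<in> C" for w
      using sameC[OF that \<open>0 \<in> G\<close> l0(1)] same0[OF \<open>0 \<in> G\<close> l0(1)] l0(2) by simp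
    have sameAll: "w + snd g \<in> W l \<longleftrightarrow> ?y + snd g \<in> W l" if w: "w \<in> C" and g: "g \<in> \<Gamma>" "Np (fst g) \<le> r" and l: "l \<in> L" for w g l
    proof (cases "g \<in> G")
      case True
      then show ?thesis using sameC[OF w True l] same0[OF True l] by simp
    next
      case False
      then have big: "norm (snd g) > 2 * D" using g unfolding G_def by auto
      have "v + snd g \<notin> W l" if "norm v \<le> D" for v
      proof
        assume "v + snd g \<in> W l"
        then have "norm (v + snd g) \<le> D" using D(2) l by blast
        moreover have "norm (snd g) \<le> norm (v + snd g) + norm v"
          by (metis add_diff_cancel_left' norm_triangle_ineq4)
        ultimately show False using that big by linarith
      qed
      then show ?thesis using D(2)[OF l0(1) CW[OF w]] D(2)[OF l0] by blast
    qed
    have "\<exists>w'. \<forall>w. (\<forall>a\<in>?A. \<bar>n a \<bullet> (w - w')\<bar> < d a / (real DIM('i) + 1)) \<longrightarrow>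
      (\<forall>a\<in>?A. sgn (n a \<bullet> w0 - b a) * (n a \<bullet> w - b a) > 0)"
    proof (rule cell_center)
      show "finite ?A" using finite_Hs finG by simp
      show "bounded {w. \<forall>a\<in>?A. sgn (n a \<bullet> w0 - b a) * (n a \<bullet> w - b a) > 0}"
        unfolding C_def[symmetric] bounded_iff using D(2)[OF l0(1)] CW by blast
      fix J e u a
      assume J: "J \<subseteq> ?A" "dual_system J n e" "\<And>a. a \<in> J \<Longrightarrow> n a \<bullet> u = b a" and a: "a \<in> ?A"
      \<comment> \<open>A dual system cannot use the same normal twice, so the pairs in J have
        distinct hyperplanes; these form a flag in which each hyperplane carries its own
        translation.\<close>
      have injJ: "inj_on fst J"
      proof (rule inj_onI)
        fix j k assume jk: "j \<in> J" "k \<in> J" "fst j = fst k"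
        then have "n j = n k" by (simp add: n_def)
        moreover have "n j \<bullet> e j = 1" using dual_systemD(2)[OF J(2) jk(1) jk(1)] by simp
        moreover have "n k \<bullet> e j = (if k = j then 1 else 0)" by (rule dual_systemD(2)[OF J(2) jk(2) jk(1)])
        ultimately show "j = k" by (metis zero_neq_one)
      qed
      define f where "f = fst ` J"
      define \<gamma> where "\<gamma> H = snd (inv_into J fst H)" for H
      have inv: "inv_into J fst H = (H, \<gamma> H)" if "H \<in> f" for H
        using that f_inv_into_f[of H fst J] unfolding f_def \<gamma>_def by (simp add: prod_eq_iff)
      have invJ: "(H, \<gamma> H) \<in> J" if "H \<in> f" for H
        using inv[OF that] inv_into_into[of H fst J] that unfolding f_def by simp
      have finJ: "finite J" using dual_systemD(1)[OF J(2)] .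
      have dual: "dual_system f nrm (\<lambda>H. e (inv_into J fst H))"
        unfolding dual_system_def
      proof (intro conjI ballI allI)
        show "finite f" unfolding f_def using finJ by simp
        fix H H' assume "H \<in> f" "H' \<in> f"
        then show "nrm H \<bullet> e (inv_into J fst H') = (if H = H' then 1 else 0)"
          using dual_systemD(2)[OF J(2) invJ invJ, of H H'] inv by (simp add: n_def)
      next
        fix x
        have "x = (\<Sum>j\<in>J. (n j \<bullet> x) *\<^sub>R e j)" by (rule dual_systemD(3)[OF J(2)])
        also have "\<dots> = (\<Sum>H\<in>f. (nrm H \<bullet> x) *\<^sub>R e (inv_into J fst H))"
          unfolding f_def using injJ by (simp add: sum.reindex n_def)
        finally show "x = (\<Sum>H\<in>f. (nrm H \<bullet> x) *\<^sub>R e (inv_into J fst H))" .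
      qed
      have fl: "f \<in> flags Hs" using J(1) by (intro flagI'[OF _ dual]) (auto simp: f_def)
      have \<gamma>: "\<forall>H\<in>f. \<gamma> H \<in> \<Gamma> \<and> norm (\<gamma> H) \<le> K * r \<and> nrm H \<bullet> (u + snd (\<gamma> H)) = off H"
      proof
        fix H assume H: "H \<in> f"
        have "\<gamma> H \<in> G" using invJ[OF H] J(1) by blast
        moreover have "nrm H \<bullet> (u + snd (\<gamma> H)) = off H" using J(3)[OF invJ[OF H]] nb[of H "\<gamma> H" u] by simp
        ultimately show "\<gamma> H \<in> \<Gamma> \<and> norm (\<gamma> H) \<le> K * r \<and> nrm H \<bullet> (u + snd (\<gamma> H)) = off H"
          using GK unfolding G_def by blast
      qed
      obtain H' g' where a': "a = (H', g')" "H' \<in> Hs" "g' \<in> G" using a by blast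
      have "\<bar>nrm H' \<bullet> (u + snd g') - off H'\<bar> \<ge> c * r powr (- dexp (htype H'))"
        if "nrm H' \<bullet> (u + snd g') \<noteq> off H'"
        using sep[rule_format, OF fl a'(2) r _ _ GK[OF a'(3)] that, of \<gamma>] \<gamma> a'(3)
        unfolding G_def by blast
      then have "nrm H' \<bullet> (u + snd g') - off H' = 0 \<or> \<bar>nrm H' \<bullet> (u + snd g') - off H'\<bar> \<ge> d a"
        unfolding d_def a'(1) by auto
      then show "n a \<bullet> u = b a \<or> \<bar>n a \<bullet> u - b a\<bar> \<ge> d a"
        unfolding a'(1) nb[symmetric] by simp
    qed (use w0(2) in auto)
    then obtain w' where w': "\<And>w. (\<forall>a\<in>?A. \<bar>n a \<bullet> (w - w')\<bar> < d a / (real DIM('i) + 1)) \<Longrightarrow> w \<in> C"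
      unfolding C_def by blast
    show ?thesis
    proof (intro exI[of _ w'] allI impI ballI)
      fix w g l assume w: "\<forall>H\<in>Hs. \<bar>nrm H \<bullet> (w - w')\<bar> < c / (real DIM('i) + 1) * r powr (- dexp (htype H))"
        and g: "g \<in> \<Gamma>" "l \<in> L" "Np (fst g) \<le> r"
      have "w \<in> C" using w by (intro w') (auto simp: n_def d_def)
      then show "w + snd g \<in> W l \<longleftrightarrow> ?y + snd g \<in> W l" using sameAll g by blast
    qed
  qed
  have "c / (real DIM('i) + 1) > 0" using c by (simp add: add_nonneg_pos)
  then show ?thesis using main by blast
qed

text \<open>The boxes passed to \<open>lattice_cover\<close> have volume independent of \<open>r\<close> because the exponents
  sum to \<open>d\<close>.\<close>

lemma approximation:
  assumes f: "f \<in> flags Hs" and N: "N \<ge> 1" "splits N f"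
    and dio: "\<And>S. S \<in> Q \<Longrightarrow> \<exists>c>0. \<forall>g\<in>stabiliser \<Gamma> S. g \<noteq> 0 \<longrightarrow>
      norm ((1 / real N) *\<^sub>R snd g) \<ge> c * norm g powr (- dexp S)"
  shows "\<exists>M>0. \<forall>r\<ge>1. \<forall>z. \<exists>g\<in>\<Gamma>. norm (fst g) \<le> M * r \<and>
    (\<forall>H\<in>f. \<bar>nrm H \<bullet> (z - snd g)\<bar> \<le> M * r powr (- dexp (htype H)))"
proof -
  note d = flag_dual[OF f]
  note dp = dual_system_prod[OF d, where ?'p = 'p]
  let ?J = "(Basis :: 'p set) <+> f"
  have fin: "finite f" by (rule flag_finite[OF f])
  obtain C where C: "C > 0" and cover: "\<And>s z. (\<forall>j\<in>?J. 0 < s j) \<Longrightarrow>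
    (\<forall>g\<in>\<Gamma>. (\<forall>j\<in>?J. \<bar>prod_normal nrm j \<bullet> g\<bar> \<le> 2 * s j) \<longrightarrow> g = 0) \<Longrightarrow>
    (\<exists>g\<in>\<Gamma>. \<forall>j\<in>?J. \<bar>prod_normal nrm j \<bullet> (z - g)\<bar> \<le> C / (\<Prod>j\<in>?J. s j) * s j)"
    using lattice_cover[OF lattice dp] by blast
  obtain B where B: "B > 0" and split: "\<And>g. g \<in> \<Gamma> \<Longrightarrow> \<exists>c. (\<forall>H\<in>f. c H \<in> line f H \<and>
    snd (c H) = (real N * (nrm H \<bullet> snd g)) *\<^sub>R edge f H \<and> norm (c H) \<le> B * norm g) \<and>
    int_scale (int N) g = (\<Sum>H\<in>f. c H)"
    using splits_bounded[OF f N(2)] by blast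
  have "\<exists>c>0. \<forall>S\<in>Q. \<forall>g\<in>stabiliser \<Gamma> S. g \<noteq> 0 \<longrightarrow> norm ((1 / real N) *\<^sub>R snd g) \<ge> c * norm g powr (- dexp S)"
  proof (rule finite_uniform_constant[OF finite_Q dio])
    fix S and c c' :: real assume a: "\<forall>g\<in>stabiliser \<Gamma> S. g \<noteq> 0 \<longrightarrow> norm ((1 / real N) *\<^sub>R snd g) \<ge> c * norm g powr (- dexp S)" "0 < c'" "c' \<le> c"
    have "c' * norm g powr (- dexp S) \<le> c * norm g powr (- dexp S)" for g :: "'p \<times> 'i"
      using a(3) by (intro mult_right_mono) auto
    then show "\<forall>g\<in>stabiliser \<Gamma> S. g \<noteq> 0 \<longrightarrow> norm ((1 / real N) *\<^sub>R snd g) \<ge> c' * norm g powr (- dexp S)"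
      using a(1) by (meson order_trans)
  qed
  then obtain c where c: "c > 0" and dio': "\<And>S g. S \<in> Q \<Longrightarrow> g \<in> stabiliser \<Gamma> S \<Longrightarrow> g \<noteq> 0 \<Longrightarrow>
    norm ((1 / real N) *\<^sub>R snd g) \<ge> c * norm g powr (- dexp S)" by blast
  define E where "E = 1 + (\<Sum>H\<in>f. norm (edge f H))"
  have E: "E \<ge> 1" "\<And>H. H \<in> f \<Longrightarrow> norm (edge f H) \<le> E"
  proof -
    show "E \<ge> 1" unfolding E_def by (simp add: sum_nonneg)
    fix H assume "H \<in> f"
    then have "norm (edge f H) \<le> (\<Sum>H\<in>f. norm (edge f H))" using fin by (intro member_le_sum) auto
    then show "norm (edge f H) \<le> E" unfolding E_def by simp
  qed
  text \<open>\<open>T r\<close> bounds the norm of the lattice points in the doubled box.\<close>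
  define T where "T = 2 * real DIM('p) + 2 * (real (card f) * E)"
  have T: "T > 0" using E(1) unfolding T_def by (simp add: add_pos_nonneg)
  \<comment> \<open>In the doubled box a line component has internal length at most 2 \<kappa> E r
    powr -\<delta> after division by N. The choice of \<kappa> makes this smaller than the
    Diophantine bound c (B T r) powr -\<delta>; the 4 leaves a factor 2 to spare.\<close>
  define \<kappa> where "\<kappa> = Min (insert 1 ((\<lambda>S. c * (B * T) powr (- dexp S) / (4 * E)) ` Q))"
  have \<kappa>: "0 < \<kappa>" "\<kappa> \<le> 1" "\<And>S. S \<in> Q \<Longrightarrow> \<kappa> \<le> c * (B * T) powr (- dexp S) / (4 * E)"
    unfolding \<kappa>_def using finite_Q c B T E(1) by auto
  define M where "M = real DIM('p) * (C / \<kappa> ^ card f) + C / \<kappa> ^ card f * \<kappa>"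
  have Cp: "C / \<kappa> ^ card f > 0" using C \<kappa> by simp
  have "real DIM('p) * (C / \<kappa> ^ card f) > 0" "C / \<kappa> ^ card f * \<kappa> > 0"
    using Cp \<kappa>(1) by (auto intro!: mult_pos_pos simp del: times_divide_eq_right times_divide_eq_left)
  then have M: "M > 0" unfolding M_def by linarith
  have main: "\<exists>g\<in>\<Gamma>. norm (fst g) \<le> M * r \<and> (\<forall>H\<in>f. \<bar>nrm H \<bullet> (z - snd g)\<bar> \<le> M * r powr (- dexp (htype H)))"
    if r: "r \<ge> 1" for r z
  proof -
    define s where "s = (\<lambda>j::'p + 'i set. case j of Inl b \<Rightarrow> r | Inr H \<Rightarrow> \<kappa> * r powr (- dexp (htype H)))"
    have s: "s (Inl b) = r" "s (Inr H) = \<kappa> * r powr (- dexp (htype H))" for b H by (simp_all add: s_def)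
    have spos: "\<forall>j\<in>?J. 0 < s j" using r \<kappa>(1) by (auto simp: s)
    have le1: "r powr (- dexp (htype H)) \<le> 1" if "H \<in> f" for H
      using powr_mono[of "- dexp (htype H)" 0 r] r dexp_flag_pos[OF f that] by simp
    have inj: "g = 0" if g: "g \<in> \<Gamma>" "\<forall>j\<in>?J. \<bar>prod_normal nrm j \<bullet> g\<bar> \<le> 2 * s j" for g
    proof -
      have gp: "\<bar>fst g \<bullet> b\<bar> \<le> 2 * r" if "b \<in> Basis" for b
      proof -
        have "\<bar>prod_normal nrm (Inl b) \<bullet> g\<bar> \<le> 2 * s (Inl b)" using g(2) that by blast
        then show ?thesis by (simp add: s inner_prod_def inner_commute)
      qed
      have gi: "\<bar>nrm H \<bullet> snd g\<bar> \<le> 2 * (\<kappa> * r powr (- dexp (htype H)))" if "H \<in> f" for H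
      proof -
        have "\<bar>prod_normal nrm (Inr H) \<bullet> g\<bar> \<le> 2 * s (Inr H)" using g(2) that by blast
        then show ?thesis by (simp add: s inner_prod_def)
      qed
      have gi1: "\<bar>nrm H \<bullet> snd g\<bar> \<le> 2" if "H \<in> f" for H
      proof -
        have "\<kappa> * r powr (- dexp (htype H)) \<le> 1 * 1"
          using le1[OF that] \<kappa> by (intro mult_mono) auto
        then show ?thesis using gi[OF that] by linarith
      qed
      have "norm g \<le> norm (fst g) + norm (snd g)" using norm_Pair_le[of "fst g" "snd g"] by simp
      also have "norm (fst g) \<le> (\<Sum>b\<in>(Basis::'p set). \<bar>fst g \<bullet> b\<bar>)" by (rule norm_le_l1)
      also have "\<dots> \<le> (\<Sum>b\<in>(Basis::'p set). 2 * r)" by (intro sum_mono gp)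
      also have "norm (snd g) \<le> (\<Sum>H\<in>f. \<bar>nrm H \<bullet> snd g\<bar> * norm (edge f H))"
        by (subst dual_systemD(3)[OF d], rule order_trans[OF norm_sum]) simp
      also have "\<dots> \<le> (\<Sum>H\<in>f. 2 * E)" by (intro sum_mono mult_mono gi1 E(2)) auto
      finally have "norm g \<le> real DIM('p) * (2 * r) + real (card f) * (2 * E)" by simp
      also have "\<dots> \<le> real DIM('p) * (2 * r) + real (card f) * (2 * E) * r"
        using mult_left_mono[OF r, of "real (card f) * (2 * E)"] E(1) by simp
      also have "\<dots> = T * r" by (simp add: T_def algebra_simps)
      finally have gT: "norm g \<le> T * r" .
      obtain k where k: "\<And>H. H \<in> f \<Longrightarrow> k H \<in> line f H \<and>
          snd (k H) = (real N * (nrm H \<bullet> snd g)) *\<^sub>R edge f H \<and> norm (k H) \<le> B * norm g"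
        "int_scale (int N) g = (\<Sum>H\<in>f. k H)"
        using split[OF g(1)] by blast
      \<comment> \<open>N g is the sum of its line components, each in the stabiliser of its type. A
        non-zero one would be too short for the Diophantine bound at 0.\<close>
      have "k H = 0" if H: "H \<in> f" for H
      proof (rule ccontr)
        assume k0: "k H \<noteq> 0"
        let ?S = "htype H"
        have S: "?S \<in> Q" using htype_in_Q(1) flag_subset[OF f] H by blast
        have "snd (k H) \<in> \<Inter>?S" using k(1)[OF H] edge_in[OF f H] subspace_scale[OF subspace_X[OF S]] by metis
        then have "k H \<in> stabiliser \<Gamma> ?S" using k(1)[OF H] line_subset unfolding stabiliser_eq by blast
        then have "c * norm (k H) powr (- dexp ?S) \<le> norm ((1 / real N) *\<^sub>R snd (k H))"
          by (rule dio'[OF S _ k0])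
        also have "(1 / real N) *\<^sub>R snd (k H) = (nrm H \<bullet> snd g) *\<^sub>R edge f H"
          using k(1)[OF H] N(1) by simp
        also have "norm \<dots> \<le> 2 * (\<kappa> * r powr (- dexp ?S)) * E"
          using gi[OF H] E(2)[OF H] by (simp add: mult_mono)
        finally have 1: "c * norm (k H) powr (- dexp ?S) \<le> 2 * (\<kappa> * r powr (- dexp ?S)) * E" .
        have "norm (k H) \<le> B * (T * r)" using k(1)[OF H] gT B by (meson less_imp_le mult_left_mono order_trans)
        then have "c * (B * (T * r)) powr (- dexp ?S) \<le> c * norm (k H) powr (- dexp ?S)"
          using k0 c dexp_pos[OF f S] by (intro mult_left_mono powr_mono2') auto
        also note 1
        also have "(B * (T * r)) powr (- dexp ?S) = (B * T) powr (- dexp ?S) * r powr (- dexp ?S)"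
          using B T r by (simp add: powr_mult flip: mult.assoc)
        finally have "c * (B * T) powr (- dexp ?S) * r powr (- dexp ?S) \<le> 2 * \<kappa> * E * r powr (- dexp ?S)"
          by (simp add: mult_ac)
        then have "c * (B * T) powr (- dexp ?S) \<le> 2 * \<kappa> * E" using r by (simp add: mult_le_cancel_right)
        moreover have "\<kappa> * (4 * E) \<le> c * (B * T) powr (- dexp ?S)" using \<kappa>(3)[OF S] E(1) by (simp add: pos_le_divide_eq)
        moreover have "\<kappa> * E > 0" using \<kappa>(1) E(1) by simp
        ultimately show False by linarith
      qed
      then have "int_scale (int N) g = 0" using k(2) by simp
      then show "g = 0" using N(1) by (simp add: int_scale_def)
    qed
    have "(\<Prod>j\<in>?J. s j) = (\<Prod>b\<in>(Basis::'p set). r) * (\<Prod>H\<in>f. \<kappa> * r powr (- dexp (htype H)))"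
      using fin by (simp add: prod.Plus s)
    also have "(\<Prod>H\<in>f. \<kappa> * r powr (- dexp (htype H))) = \<kappa> ^ card f * r powr (\<Sum>H\<in>f. - dexp (htype H))"
      using r by (simp add: prod.distrib powr_sum)
    also have "(\<Sum>H\<in>f. - dexp (htype H)) = - real DIM('p)" using flag_structure(3)[OF f] by (simp add: sum_negf)
    finally have prod: "(\<Prod>j\<in>?J. s j) = \<kappa> ^ card f"
      using r by (simp add: powr_minus powr_realpow field_simps)
    obtain g where g: "g \<in> \<Gamma>" "\<And>j. j \<in> ?J \<Longrightarrow> \<bar>prod_normal nrm j \<bullet> ((0, z) - g)\<bar> \<le> C / \<kappa> ^ card f * s j"
      using cover[OF spos, of "(0, z)"] inj unfolding prod by blast
    have "norm (fst g) \<le> (\<Sum>b\<in>(Basis::'p set). \<bar>fst g \<bullet> b\<bar>)" by (rule norm_le_l1)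
    also have "\<dots> \<le> (\<Sum>b\<in>(Basis::'p set). C / \<kappa> ^ card f * r)"
    proof (rule sum_mono)
      fix b assume "b \<in> (Basis::'p set)"
      then have "\<bar>prod_normal nrm (Inl b) \<bullet> ((0, z) - g)\<bar> \<le> C / \<kappa> ^ card f * s (Inl b)" by (intro g(2)) auto
      then show "\<bar>fst g \<bullet> b\<bar> \<le> C / \<kappa> ^ card f * r" by (simp add: s inner_prod_def inner_commute)
    qed
    also have "\<dots> = real DIM('p) * (C / \<kappa> ^ card f) * r" by simp
    also have "\<dots> \<le> M * r"
    proof (rule mult_right_mono)
      have "C / \<kappa> ^ card f * \<kappa> > 0" using Cp \<kappa>(1) by (rule mult_pos_pos)
      then show "real DIM('p) * (C / \<kappa> ^ card f) \<le> M" unfolding M_def by linarith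
    qed (use r in simp)
    finally have 1: "norm (fst g) \<le> M * r" .
    have "\<bar>nrm H \<bullet> (z - snd g)\<bar> \<le> M * r powr (- dexp (htype H))" if H: "H \<in> f" for H
    proof -
      have "\<bar>prod_normal nrm (Inr H) \<bullet> ((0, z) - g)\<bar> \<le> C / \<kappa> ^ card f * s (Inr H)" using H by (intro g(2)) auto
      then have "\<bar>nrm H \<bullet> (z - snd g)\<bar> \<le> C / \<kappa> ^ card f * \<kappa> * r powr (- dexp (htype H))"
        by (simp add: s inner_prod_def)
      also have "\<dots> \<le> M * r powr (- dexp (htype H))" 
      proof (rule mult_right_mono)
        have "real DIM('p) * (C / \<kappa> ^ card f) \<ge> 0" using Cp by (intro mult_nonneg_nonneg) auto
        then show "C / \<kappa> ^ card f * \<kappa> \<le> M" unfolding M_def by linarith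
      qed simp
      finally show ?thesis .
    qed
    then show ?thesis using 1 g(1) by blast
  qed
  then show ?thesis using M by blast
qed

text \<open>A lattice element of size O(R r) carries the star of x close to the centre of the box
  for y. Searching R times farther improves the approximation by R powr -\<delta> in each type, so a
  fixed large R brings it into the box of size c r powr -\<delta>.\<close>

lemma linearly_repetitive_if_diophantine:
  assumes N: "N \<ge> 1" "\<And>f. f \<in> flags Hs \<Longrightarrow> splits N f" and Np: "is_norm Np" and Ni: "is_norm Ni"
    and DF: "property_DF Ni (refined_lattice N \<Gamma>) Hs Q"
  shows "linearly_repetitive Np \<Gamma> L W"
proof -
  obtain f where f: "f \<in> flags Hs" using flag_exists by blast
  note d = flag_dual[OF f]
  have fin: "finite f" by (rule flag_finite[OF f])
  have dio: "\<exists>c>0. \<forall>a\<in>component Q (vertex_differences Hs) S. \<forall>g\<in>stabiliser \<Gamma> S. g \<noteq> 0 \<longrightarrow>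
      (1 / real N) *\<^sub>R snd g \<noteq> a \<longrightarrow> norm ((1 / real N) *\<^sub>R snd g - a) \<ge> c * norm g powr (- dexp S)"
    if S: "S \<in> Q" for S
  proof (rule diophantine_lower[OF f S N(1) Ni])
    show "diophantine Ni (snd ` stabiliser (refined_lattice N \<Gamma>) S) (\<Inter>S) (component Q (vertex_differences Hs) S)"
      using DF S unfolding property_DF_def by blast
  qed
  \<comment> \<open>The difference of a vertex with itself puts 0 into the set F, so the condition
    includes a lower bound for the lattice elements themselves.\<close>
  have dio0: "\<exists>c>0. \<forall>g\<in>stabiliser \<Gamma> S. g \<noteq> 0 \<longrightarrow> norm ((1 / real N) *\<^sub>R snd g) \<ge> c * norm g powr (- dexp S)"
    if S: "S \<in> Q" for S
  proof -
    have "0 + 0 \<in> vertex_differences Hs" unfolding vertex_differences_def using f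
      by (intro CollectI exI[of _ f]) simp
    moreover have "0 \<in> set_family_sum Inter (Q - {S})" by (rule subspace_0[OF subspace_complement_sum]) blast
    moreover have "0 \<in> \<Inter>S" by (rule subspace_0[OF subspace_X[OF S]])
    ultimately have "0 \<in> component Q (vertex_differences Hs) S" unfolding component_def by blast
    moreover have "(1 / real N) *\<^sub>R snd g \<noteq> 0" if "g \<in> stabiliser \<Gamma> S" "g \<noteq> 0" for g
      using that snd_eq_0[of g] N(1) stabiliser_sub by auto
    ultimately show ?thesis using dio[OF S] by (metis diff_zero)
  qed
  obtain c where c: "c > 0" and box: "\<And>r y. r \<ge> 1 \<Longrightarrow> y \<in> \<Lambda> \<Longrightarrow>
    \<exists>w'. \<forall>w. (\<forall>H\<in>Hs. \<bar>nrm H \<bullet> (w - w')\<bar> < c * r powr (- dexp (htype H))) \<longrightarrow>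
      (\<forall>g\<in>\<Gamma>. \<forall>l\<in>L. Np (fst g) \<le> r \<longrightarrow> (w + snd g \<in> W l \<longleftrightarrow> star \<Gamma> y + snd g \<in> W l))"
    using patch_box[OF N Np dio] by blast
  obtain M where M: "M > 0" and appr: "\<And>r z. r \<ge> 1 \<Longrightarrow> \<exists>g\<in>\<Gamma>. norm (fst g) \<le> M * r \<and>
    (\<forall>H\<in>f. \<bar>nrm H \<bullet> (z - snd g)\<bar> \<le> M * r powr (- dexp (htype H)))"
    using approximation[OF f N(1) N(2)[OF f] dio0] by blast
  define E where "E = 1 + (\<Sum>H'\<in>Hs. \<Sum>H\<in>f. \<bar>nrm H' \<bullet> edge f H\<bar>)"
  have E: "E > 0" "\<And>H'. H' \<in> Hs \<Longrightarrow> (\<Sum>H\<in>f. \<bar>nrm H' \<bullet> edge f H\<bar>) \<le> E"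
  proof -
    show "E > 0" unfolding E_def by (simp add: add_pos_nonneg sum_nonneg)
    fix H' assume "H' \<in> Hs"
    then have "(\<Sum>H\<in>f. \<bar>nrm H' \<bullet> edge f H\<bar>) \<le> (\<Sum>H'\<in>Hs. \<Sum>H\<in>f. \<bar>nrm H' \<bullet> edge f H\<bar>)"
      using finite_Hs by (intro member_le_sum) (auto intro: sum_nonneg)
    then show "(\<Sum>H\<in>f. \<bar>nrm H' \<bullet> edge f H\<bar>) \<le> E" unfolding E_def by simp
  qed
  have "\<forall>\<^sub>F R in at_top. \<forall>S\<in>Q. R powr (- dexp S) < c / (M * E)"
    unfolding eventually_ball_finite_distrib[OF finite_Q]
  proof
    fix S assume S: "S \<in> Q"
    have "((\<lambda>R. R powr (- dexp S)) \<longlongrightarrow> 0) at_top"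
      using dexp_pos[OF f S] by (intro tendsto_neg_powr filterlim_ident) auto
    then show "\<forall>\<^sub>F R in at_top. R powr (- dexp S) < c / (M * E)"
      by (rule order_tendstoD) (use c M E in simp)
  qed
  then have "\<forall>\<^sub>F R in at_top. (\<forall>S\<in>Q. R powr (- dexp S) < c / (M * E)) \<and> R \<ge> 1"
    by (intro eventually_conj eventually_ge_at_top)
  then obtain R :: real where R: "R \<ge> 1" "\<And>S. S \<in> Q \<Longrightarrow> R powr (- dexp S) < c / (M * E)"
    unfolding eventually_at_top_linorder by blast
  obtain CN where CN: "CN > 0" "\<And>x. Np x \<le> CN * norm x" using is_norm_equivalent[OF Np] by blast
  define C where "C = 1 + CN * (M * R)"
  have C: "C > 0" unfolding C_def using CN M R by (simp add: add_pos_nonneg)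
  have main: "\<exists>z\<in>\<Lambda>. patch Np r z = patch Np r y \<and>
      labelled_patch Np \<Gamma> L W r z \<subseteq> labelled_patch Np \<Gamma> L W (C * r) x"
    if r: "r \<ge> 1" and x: "x \<in> \<Lambda>" and y: "y \<in> \<Lambda>" for r x y
  proof -
    obtain w' where w': "\<And>w. (\<forall>H\<in>Hs. \<bar>nrm H \<bullet> (w - w')\<bar> < c * r powr (- dexp (htype H))) \<Longrightarrow>
      (\<forall>g\<in>\<Gamma>. \<forall>l\<in>L. Np (fst g) \<le> r \<longrightarrow> (w + snd g \<in> W l \<longleftrightarrow> star \<Gamma> y + snd g \<in> W l))"
      using box[OF r y] by blast
    have Rr: "R * r \<ge> 1" using mult_mono[OF R(1) r] R(1) by simp
    obtain g where g: "g \<in> \<Gamma>" "norm (fst g) \<le> M * (R * r)"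
      "\<And>H. H \<in> f \<Longrightarrow> \<bar>nrm H \<bullet> ((w' - star \<Gamma> x) - snd g)\<bar> \<le> M * (R * r) powr (- dexp (htype H))"
      using appr[OF Rr] by blast
    define w where "w = star \<Gamma> x + snd g"
    have same: "\<forall>g\<in>\<Gamma>. \<forall>l\<in>L. Np (fst g) \<le> r \<longrightarrow> (w + snd g \<in> W l \<longleftrightarrow> star \<Gamma> y + snd g \<in> W l)"
    proof (rule w', rule ballI)
      fix H' assume H': "H' \<in> Hs"
      let ?S = "htype H'"
      have S: "?S \<in> Q" by (rule htype_in_Q(1)[OF H'])
      have "\<bar>nrm H' \<bullet> (w - w')\<bar> = \<bar>\<Sum>H\<in>f. (nrm H \<bullet> (w - w')) * (nrm H' \<bullet> edge f H)\<bar>"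
        by (rule arg_cong[OF dual_system_expand[OF d]])
      also have "\<dots> \<le> (\<Sum>H\<in>f. (M * (R * r) powr (- dexp ?S)) * \<bar>nrm H' \<bullet> edge f H\<bar>)"
      proof (rule order_trans[OF sum_abs], rule sum_mono)
        fix H assume H: "H \<in> f"
        have HH: "H \<in> Hs" using flag_subset[OF f] H by blast
        show "\<bar>(nrm H \<bullet> (w - w')) * (nrm H' \<bullet> edge f H)\<bar> \<le> (M * (R * r) powr (- dexp ?S)) * \<bar>nrm H' \<bullet> edge f H\<bar>"
        proof (cases "htype H = ?S")
          case True
          have "w - w' = - ((w' - star \<Gamma> x) - snd g)" by (simp add: w_def)
          then have "\<bar>nrm H \<bullet> (w - w')\<bar> \<le> M * (R * r) powr (- dexp ?S)" using g(3)[OF H] True by (metis abs_minus_cancel inner_minus_right)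
          then show ?thesis by (simp add: abs_mult mult_right_mono)
        next
          case False
          then have "nrm H' \<bullet> edge f H = 0"
            using nrm_other_type[OF H' htype_in_Q(1)[OF HH] _ edge_in[OF f H]] by blast
          then show ?thesis by simp
        qed
      qed
      also have "\<dots> = (M * (R * r) powr (- dexp ?S)) * (\<Sum>H\<in>f. \<bar>nrm H' \<bullet> edge f H\<bar>)"
        by (simp only: sum_distrib_left)
      also have "\<dots> \<le> (M * (R * r) powr (- dexp ?S)) * E"
        using E(2)[OF H'] M by (intro mult_left_mono) auto
      also have "\<dots> = (M * E * R powr (- dexp ?S)) * r powr (- dexp ?S)"
        using R(1) r by (simp add: powr_mult)
      also have "\<dots> < c * r powr (- dexp ?S)"
      proof (rule mult_strict_right_mono)
        show "M * E * R powr (- dexp ?S) < c" using R(2)[OF S] M E(1) by (simp add: pos_less_divide_eq mult.commute)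
      qed (use r in simp)
      finally show "\<bar>nrm H' \<bullet> (w - w')\<bar> < c * r powr (- dexp ?S)" .
    qed
    \<comment> \<open>The zero lattice element in \<open>same\<close> shows that w lies in the
      window, so that z is a point of \<Lambda>.\<close>
    obtain l where l: "l \<in> L" "star \<Gamma> y \<in> W l" using cps_star[OF y] by blast
    have "Np 0 = 0" using Np unfolding is_norm_def by blast
    then have "w \<in> W l" using same int_mod.subspace_0[OF sub_\<Gamma>] l r by (metis (no_types, lifting) add.right_neutral fst_zero snd_zero order_trans zero_le_one)
    define z where "z = x + fst g"
    have z: "z \<in> \<Lambda>" "star \<Gamma> z = w"
      using cps_translate[OF x g(1)] l(1) \<open>w \<in> W l\<close> unfolding z_def w_def by auto
    have "patch Np r z = patch Np r y"
      unfolding patch_class_eq_iff[OF z(1) y] z(2) using same by blast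
    moreover have "labelled_patch Np \<Gamma> L W r z \<subseteq> labelled_patch Np \<Gamma> L W (C * r) x"
    proof
      fix p assume "p \<in> labelled_patch Np \<Gamma> L W r z"
      then obtain u l where p: "p = (u, l)" "u \<in> \<Lambda>" "Np (u - z) \<le> r" "l \<in> L" "star \<Gamma> u \<in> W l"
        unfolding labelled_patch_def by blast
      have tri: "Np (v + v') \<le> Np v + Np v'" for v v' using Np unfolding is_norm_def by blast
      have "u - x = (u - z) + fst g" by (simp add: z_def)
      then have "Np (u - x) \<le> Np (u - z) + Np (fst g)" using tri by metis
      also have "Np (fst g) \<le> CN * (M * (R * r))" using CN g(2) by (meson less_imp_le mult_left_mono order_trans)
      finally have "Np (u - x) \<le> C * r" using p(3) by (simp add: C_def algebra_simps)
      then show "p \<in> labelled_patch Np \<Gamma> L W (C * r) x" using p unfolding labelled_patch_def by blast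
    qed
    ultimately show ?thesis using z(1) by blast
  qed
  show ?thesis unfolding linearly_repetitive_def
    using C main by (intro exI[of _ C] conjI eventually_mono[OF eventually_ge_at_top[of 1]]) blast+
qed

end

subsection \<open>From linear repetitivity to the Diophantine condition\<close>

context scheme
begin

lemma dense_open:
  assumes "open U" and "U \<noteq> {}"
  shows "\<exists>g\<in>\<Gamma>. snd g \<in> U"
proof -
  obtain x \<epsilon> where x: "\<epsilon> > 0" "ball x \<epsilon> \<subseteq> U" using assms by (metis all_not_in_conv openE)
  obtain g where "g \<in> \<Gamma>" "norm (snd g - x) < \<epsilon>" using dense_approx[OF x(1)] by blast
  then show ?thesis using x(2) by (intro bexI[of _ g]) (auto simp: dist_norm norm_minus_commute)
qed

text \<open>The physical sides contribute r ^ d and the internal ones a constant. The sides are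
  enlarged slightly to be at least 1, as the lattice point count demands.\<close>

lemma strip_count:
  assumes Np: "is_norm Np" and D: "D > 0"
  shows "\<exists>C>0. \<forall>r\<ge>1. finite {g\<in>\<Gamma>. Np (fst g) \<le> r \<and> norm (snd g) \<le> D} \<and>
    real (card {g\<in>\<Gamma>. Np (fst g) \<le> r \<and> norm (snd g) \<le> D}) \<le> C * r ^ DIM('p)"
proof -
  obtain CN where CN: "CN > 0" "\<And>x. norm x \<le> CN * Np x" using is_norm_equivalent[OF Np] by blast
  let ?J = "(Basis :: 'p set) <+> (Basis :: 'i set)"
  let ?a = "prod_normal (\<lambda>b::'i. b) :: 'p + 'i \<Rightarrow> 'p \<times> 'i"
  obtain C where C: "C > 0" and count: "\<And>s. (\<forall>j\<in>?J. 1 \<le> s j) \<Longrightarrow> finite {g\<in>\<Gamma>. \<forall>j\<in>?J. \<bar>?a j \<bullet> g\<bar> \<le> s j} \<and>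
    real (card {g\<in>\<Gamma>. \<forall>j\<in>?J. \<bar>?a j \<bullet> g\<bar> \<le> s j}) \<le> C * (\<Prod>j\<in>?J. s j)"
    using lattice_count[OF lattice dual_system_prod[OF dual_system_Basis]] by blast
  have main: "finite {g\<in>\<Gamma>. Np (fst g) \<le> r \<and> norm (snd g) \<le> D} \<and>
    real (card {g\<in>\<Gamma>. Np (fst g) \<le> r \<and> norm (snd g) \<le> D}) \<le> C * ((CN + 1) ^ DIM('p) * (D + 1) ^ DIM('i)) * r ^ DIM('p)"
    if r: "r \<ge> 1" for r
  proof -
    define s where "s = (\<lambda>j::'p + 'i. case j of Inl b \<Rightarrow> (CN + 1) * r | Inr b \<Rightarrow> D + 1)"
    have s: "s (Inl b) = (CN + 1) * r" "s (Inr b') = D + 1" for b b' by (simp_all add: s_def)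
    have "1 * 1 \<le> (CN + 1) * r" using CN r by (intro mult_mono) auto
    then have "\<forall>j\<in>?J. 1 \<le> s j" using D by (auto simp: s)
    note c = count[OF this]
    have sub: "{g\<in>\<Gamma>. Np (fst g) \<le> r \<and> norm (snd g) \<le> D} \<subseteq> {g\<in>\<Gamma>. \<forall>j\<in>?J. \<bar>?a j \<bullet> g\<bar> \<le> s j}"
    proof
      fix g assume g: "g \<in> {g\<in>\<Gamma>. Np (fst g) \<le> r \<and> norm (snd g) \<le> D}"
      have "\<bar>?a j \<bullet> g\<bar> \<le> s j" if j: "j \<in> ?J" for j
      proof (cases j)
        case (Inl b)
        then have "\<bar>b \<bullet> fst g\<bar> \<le> norm (fst g)" using Basis_le_norm[of b "fst g"] j by (auto simp: inner_commute)
        also have "\<dots> \<le> CN * Np (fst g)" by (rule CN(2))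
        also have "\<dots> \<le> CN * r" using g CN(1) by (intro mult_left_mono) auto
        also have "\<dots> \<le> (CN + 1) * r" using r by (intro mult_right_mono) auto
        finally show ?thesis by (simp add: Inl s inner_prod_def)
      next
        case (Inr b)
        then have "\<bar>b \<bullet> snd g\<bar> \<le> norm (snd g)" using Basis_le_norm[of b "snd g"] j by (auto simp: inner_commute)
        then show ?thesis using g by (simp add: Inr s inner_prod_def)
      qed
      then show "g \<in> {g\<in>\<Gamma>. \<forall>j\<in>?J. \<bar>?a j \<bullet> g\<bar> \<le> s j}" using g by blast
    qed
    have "(\<Prod>j\<in>?J. s j) = ((CN + 1) ^ DIM('p) * (D + 1) ^ DIM('i)) * r ^ DIM('p)"
      by (simp add: prod.Plus s power_mult_distrib)
    moreover have "card {g\<in>\<Gamma>. Np (fst g) \<le> r \<and> norm (snd g) \<le> D} \<le> card {g\<in>\<Gamma>. \<forall>j\<in>?J. \<bar>?a j \<bullet> g\<bar> \<le> s j}"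
      using c sub by (intro card_mono) auto
    ultimately show ?thesis using c finite_subset[OF sub] by (simp add: mult.assoc)
  qed
  have "C * ((CN + 1) ^ DIM('p) * (D + 1) ^ DIM('i)) > 0" using C CN D by simp
  then show ?thesis using main by blast
qed

text \<open>Every patch occurs with a centre within C r of a fixed point, and these centres differ
  from it by lattice elements in a strip, of which there are O(r ^ d).\<close>

lemma linearly_repetitive_imp_property_C:
  assumes Np: "is_norm Np" and LR: "linearly_repetitive Np \<Gamma> L W"
  shows "property_C Np \<Gamma> L W"
proof (cases "\<Lambda> = {}")
  case True
  then show ?thesis unfolding property_C_def patches_def
    by (intro exI[of _ 1] conjI eventually_mono[OF eventually_ge_at_top[of 0]]) auto
next
  case False
  then obtain x where x: "x \<in> \<Lambda>" by blast
  obtain D where D: "D > 0" "\<And>l w. l \<in> L \<Longrightarrow> w \<in> W l \<Longrightarrow> norm w \<le> D" using W_bounded by blast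
  have "2 * D > 0" using D by simp
  then obtain C1 where C1: "C1 > 0" "\<And>r. r \<ge> 1 \<Longrightarrow> finite {g\<in>\<Gamma>. Np (fst g) \<le> r \<and> norm (snd g) \<le> 2 * D} \<and>
    real (card {g\<in>\<Gamma>. Np (fst g) \<le> r \<and> norm (snd g) \<le> 2 * D}) \<le> C1 * r ^ DIM('p)"
    using strip_count[OF Np] by meson
  obtain C where C: "C > 0" and ev: "\<forall>\<^sub>F r in at_top. \<forall>x \<in> \<Lambda>. \<forall>y \<in> \<Lambda>. \<exists>z \<in> \<Lambda>.
       patch Np r z = patch Np r y \<and>
       labelled_patch Np \<Gamma> L W r z \<subseteq> labelled_patch Np \<Gamma> L W (C * r) x"
    using LR unfolding linearly_repetitive_def by blast
  have "\<forall>\<^sub>F r in at_top. finite (patches Np \<Gamma> L W r) \<and>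
    real (card (patches Np \<Gamma> L W r)) \<le> C1 * C ^ DIM('p) * r ^ DIM('p)"
    using ev eventually_ge_at_top[of "max 0 (1 / C)"]
  proof eventually_elim
    case (elim r)
    have "r \<ge> 0" "1 / C \<le> r" using elim(2) by simp_all
    then have r: "r \<ge> 0" "C * r \<ge> 1" using C by (simp_all add: pos_divide_le_eq mult.commute)
    define Z where "Z = {z\<in>\<Lambda>. Np (z - x) \<le> C * r}"
    let ?G = "{g\<in>\<Gamma>. Np (fst g) \<le> C * r \<and> norm (snd g) \<le> 2 * D}"
    have sub: "(\<lambda>z. (z - x, star \<Gamma> z - star \<Gamma> x)) ` Z \<subseteq> ?G"
    proof (rule image_subsetI)
      fix z assume z: "z \<in> Z"
      have "norm (star \<Gamma> z) \<le> D" "norm (star \<Gamma> x) \<le> D"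
        using cps_star D(2) x z unfolding Z_def by blast+
      then have "norm (star \<Gamma> z - star \<Gamma> x) \<le> 2 * D" using norm_triangle_ineq4[of "star \<Gamma> z" "star \<Gamma> x"] by linarith
      then show "(z - x, star \<Gamma> z - star \<Gamma> x) \<in> ?G" using z cps_diff[OF x] unfolding Z_def by auto
    qed
    have inj: "inj_on (\<lambda>z. (z - x, star \<Gamma> z - star \<Gamma> x)) Z" by (rule inj_onI) simp
    have finG: "finite ?G" using C1(2)[OF r(2)] by blast
    have finZ: "finite Z" using inj_on_finite[OF inj sub finG] .
    have "card Z \<le> card ?G" by (rule card_inj_on_le[OF inj sub finG])
    then have cZ: "real (card Z) \<le> C1 * (C * r) ^ DIM('p)" using C1(2)[OF r(2)] by linarith
    have pZ: "patches Np \<Gamma> L W r \<subseteq> patch Np r ` Z"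
    proof
      fix P assume "P \<in> patches Np \<Gamma> L W r"
      then obtain y where y: "y \<in> \<Lambda>" "P = patch Np r y" unfolding patches_def by blast
      then obtain z where z: "z \<in> \<Lambda>" "patch Np r z = P"
        "labelled_patch Np \<Gamma> L W r z \<subseteq> labelled_patch Np \<Gamma> L W (C * r) x" using elim(1) x by blast
      obtain l where l: "l \<in> L" "star \<Gamma> z \<in> W l" using cps_star[OF z(1)] by blast
      have "Np (z - z) = 0" using Np unfolding is_norm_def by (metis diff_self)
      then have "Np (z - z) \<le> r" using r(1) by simp
      then have "(z, l) \<in> labelled_patch Np \<Gamma> L W r z" unfolding labelled_patch_def using z(1) l by blast
      then have "z \<in> Z" using z(1,3) unfolding Z_def labelled_patch_def by blast
      then show "P \<in> patch Np r ` Z" using z(2) by blast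
    qed
    have "card (patches Np \<Gamma> L W r) \<le> card Z"
      using pZ finZ by (meson card_image_le card_mono finite_imageI order_trans)
    then have "real (card (patches Np \<Gamma> L W r)) \<le> C1 * (C * r) ^ DIM('p)" using cZ by linarith
    then show ?case using finite_subset[OF pZ] finZ by (simp add: power_mult_distrib mult.assoc)
  qed
  then show ?thesis unfolding property_C_def using C C1(1) by (intro exI[of _ "C1 * C ^ DIM('p)"]) auto
qed

text \<open>From every point of \<Lambda> one of O(r ^ d) lattice elements leads to a point with the
  patch of y. If all stars with this patch lie in a box with half-widths T, translates of the box
  cover a fixed ball in the window, and volumes are compared.\<close>

lemma patch_volume:
  assumes Np: "is_norm Np" and LR: "linearly_repetitive Np \<Gamma> L W" and f: "f \<in> flags Hs"
  shows "\<exists>c>0. \<forall>\<^sub>F r in at_top. \<forall>y\<in>\<Lambda>. \<forall>T u. (\<forall>H\<in>f. 0 \<le> T H) \<longrightarrow>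
    (\<forall>z\<in>\<Lambda>. patch Np r z = patch Np r y \<longrightarrow>
      (\<forall>H\<in>f. \<bar>nrm H \<bullet> (star \<Gamma> z - u)\<bar> \<le> T H)) \<longrightarrow> c \<le> r ^ DIM('p) * (\<Prod>H\<in>f. T H)"
proof -
  note d = flag_dual[OF f]
  have fin: "finite f" by (rule flag_finite[OF f])
  obtain D where D: "D > 0" "\<And>l w. l \<in> L \<Longrightarrow> w \<in> W l \<Longrightarrow> norm w \<le> D" using W_bounded by blast
  have "2 * D > 0" using D by simp
  then obtain C1 where C1: "C1 > 0" "\<And>r. r \<ge> 1 \<Longrightarrow> finite {g\<in>\<Gamma>. Np (fst g) \<le> r \<and> norm (snd g) \<le> 2 * D} \<and>
    real (card {g\<in>\<Gamma>. Np (fst g) \<le> r \<and> norm (snd g) \<le> 2 * D}) \<le> C1 * r ^ DIM('p)"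
    using strip_count[OF Np] by meson
  obtain C where C: "C > 0" and ev: "\<forall>\<^sub>F r in at_top. \<forall>x \<in> \<Lambda>. \<forall>y \<in> \<Lambda>. \<exists>z \<in> \<Lambda>.
       patch Np r z = patch Np r y \<and>
       labelled_patch Np \<Gamma> L W r z \<subseteq> labelled_patch Np \<Gamma> L W (C * r) x"
    using LR unfolding linearly_repetitive_def by blast
  obtain l w0 \<epsilon> where l: "l \<in> L" and w0: "\<epsilon> > 0" "ball w0 \<epsilon> \<subseteq> W l"
  proof -
    obtain l w0 where "l \<in> L" "w0 \<in> interior (W l)" using interior_W_nonempty by blast
    then show ?thesis using that by (meson mem_interior)
  qed
  define E where "E = 1 + (\<Sum>H\<in>f. norm (edge f H))"
  have E: "E > 0" unfolding E_def by (simp add: add_pos_nonneg sum_nonneg)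
  define \<eta> where "\<eta> = \<epsilon> / (2 * E)"
  have \<eta>: "\<eta> > 0" using w0(1) E by (simp add: \<eta>_def)
  have box: "w \<in> ball w0 \<epsilon>" if w: "\<And>H. H \<in> f \<Longrightarrow> \<bar>nrm H \<bullet> (w - w0)\<bar> \<le> \<eta>" for w
  proof -
    have "norm (w - w0) \<le> (\<Sum>H\<in>f. \<bar>nrm H \<bullet> (w - w0)\<bar> * norm (edge f H))"
      by (subst dual_systemD(3)[OF d], rule order_trans[OF norm_sum]) simp
    also have "\<dots> \<le> (\<Sum>H\<in>f. \<eta> * norm (edge f H))" by (intro sum_mono mult_right_mono w) auto
    also have "\<dots> \<le> \<eta> * E" unfolding E_def using \<eta> by (simp add: sum_distrib_left[symmetric])
    also have "\<dots> < \<epsilon>" using w0(1) E by (simp add: \<eta>_def)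
    finally show ?thesis by (simp add: dist_norm norm_minus_commute)
  qed
  define c where "c = \<eta> ^ card f / (C1 * C ^ DIM('p))"
  have c: "c > 0" unfolding c_def using \<eta> C C1 by simp
  have "\<forall>\<^sub>F r in at_top. \<forall>y\<in>\<Lambda>. \<forall>T u. (\<forall>H\<in>f. 0 \<le> T H) \<longrightarrow>
    (\<forall>z\<in>\<Lambda>. patch Np r z = patch Np r y \<longrightarrow>
      (\<forall>H\<in>f. \<bar>nrm H \<bullet> (star \<Gamma> z - u)\<bar> \<le> T H)) \<longrightarrow> c \<le> r ^ DIM('p) * (\<Prod>H\<in>f. T H)"
    using ev eventually_ge_at_top[of "max 0 (1 / C)"]
  proof eventually_elim
    case (elim r)
    have "r \<ge> 0" "1 / C \<le> r" using elim(2) by simp_all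
    then have r: "r \<ge> 0" "C * r \<ge> 1" using C by (simp_all add: pos_divide_le_eq mult.commute)
    show ?case
    proof (intro ballI allI impI)
      fix y T u
      assume y: "y \<in> \<Lambda>" and T: "\<forall>H\<in>f. 0 \<le> T H"
        and u: "\<forall>z\<in>\<Lambda>. patch Np r z = patch Np r y \<longrightarrow>
          (\<forall>H\<in>f. \<bar>nrm H \<bullet> (star \<Gamma> z - u)\<bar> \<le> T H)"
      let ?G = "{g\<in>\<Gamma>. Np (fst g) \<le> C * r \<and> norm (snd g) \<le> 2 * D}"
      have finG: "finite ?G" using C1(2)[OF r(2)] by blast
      define U where "U = (\<Union>g\<in>?G. {w. \<forall>H\<in>f. \<bar>nrm H \<bullet> (w + snd g - u)\<bar> \<le> T H})"
      have "closed {w. \<forall>H\<in>f. \<bar>nrm H \<bullet> (w + snd g - u)\<bar> \<le> T H}" for g :: "'p \<times> 'i"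
      proof -
        have "{w. \<forall>H\<in>f. \<bar>nrm H \<bullet> (w + snd g - u)\<bar> \<le> T H} = (\<Inter>H\<in>f. {w. \<bar>nrm H \<bullet> (w + snd g - u)\<bar> \<le> T H})"
          by blast
        also have "closed \<dots>" by (intro closed_INT ballI closed_Collect_le continuous_intros)
        finally show ?thesis .
      qed
      then have clU: "closed U" unfolding U_def using finG by (intro closed_UN) auto
      \<comment> \<open>The cover is first known on the dense set of lattice projections. As U is a
        finite union of closed sets, an uncovered part of the ball would be open and contain such a
        projection.\<close>
      have inU: "w \<in> U" if w: "w \<in> ball w0 \<epsilon>" for w
      proof (rule ccontr)
        assume "w \<notin> U"
        then have "ball w0 \<epsilon> - U \<noteq> {}" using w by blast
        moreover have "open (ball w0 \<epsilon> - U)" using clU by (intro open_Diff open_ball)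
        ultimately obtain g0 where g0: "g0 \<in> \<Gamma>" "snd g0 \<in> ball w0 \<epsilon> - U" using dense_open by blast
        have "snd g0 \<in> W l" using g0(2) w0(2) by blast
        then have x: "fst g0 \<in> \<Lambda>" "star \<Gamma> (fst g0) = snd g0"
          using cpsI[OF g0(1) l] star_eq[OF g0(1)] by auto
        obtain z where z: "z \<in> \<Lambda>" "patch Np r z = patch Np r y"
          "labelled_patch Np \<Gamma> L W r z \<subseteq> labelled_patch Np \<Gamma> L W (C * r) (fst g0)" using elim(1) x(1) y by blast
        obtain l' where l': "l' \<in> L" "star \<Gamma> z \<in> W l'" using cps_star[OF z(1)] by blast
        have "Np (z - z) = 0" using Np unfolding is_norm_def by (metis diff_self)
      then have "Np (z - z) \<le> r" using r(1) by simp
        then have "(z, l') \<in> labelled_patch Np \<Gamma> L W r z" unfolding labelled_patch_def using z(1) l' by blast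
        then have "Np (z - fst g0) \<le> C * r" using z(3) unfolding labelled_patch_def by blast
        moreover have "norm (star \<Gamma> z - snd g0) \<le> 2 * D"
          using norm_triangle_ineq4[of "star \<Gamma> z" "snd g0"] D(2)[OF l'] D(2)[OF l \<open>snd g0 \<in> W l\<close>] by linarith
        moreover have "(z - fst g0, star \<Gamma> z - snd g0) \<in> \<Gamma>" using cps_diff[OF x(1) z(1)] x(2) by simp
        ultimately have "(z - fst g0, star \<Gamma> z - snd g0) \<in> ?G" by simp
        moreover have "\<forall>H\<in>f. \<bar>nrm H \<bullet> (snd g0 + snd (z - fst g0, star \<Gamma> z - snd g0) - u)\<bar> \<le> T H"
          using u z(1,2) by simp
        ultimately have "snd g0 \<in> U" unfolding U_def by blast
        then show False using g0(2) by blast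
      qed
      have "(\<Prod>H\<in>f. (nrm H \<bullet> w0 + \<eta>) - (nrm H \<bullet> w0 - \<eta>)) \<le> real (card ?G) * (\<Prod>H\<in>f. 2 * T H)"
      proof (rule box_cover[where c = "\<lambda>g H. nrm H \<bullet> (u - snd g)"])
        fix x assume x: "\<And>H. H \<in> f \<Longrightarrow> nrm H \<bullet> w0 - \<eta> \<le> x H \<and> x H \<le> nrm H \<bullet> w0 + \<eta>"
        define w where "w = (\<Sum>H\<in>f. x H *\<^sub>R edge f H)"
        have wx: "nrm H \<bullet> w = x H" if "H \<in> f" for H unfolding w_def by (rule dual_system_sum[OF d that])
        have "w \<in> ball w0 \<epsilon>"
        proof (rule box)
          fix H assume H: "H \<in> f"
          show "\<bar>nrm H \<bullet> (w - w0)\<bar> \<le> \<eta>" using x[OF H] wx[OF H] by (simp add: inner_diff_right abs_le_iff)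
        qed
        then obtain g where g: "g \<in> ?G" "\<forall>H\<in>f. \<bar>nrm H \<bullet> (w + snd g - u)\<bar> \<le> T H" using inU unfolding U_def by blast
        show "\<exists>g\<in>?G. \<forall>H\<in>f. \<bar>x H - nrm H \<bullet> (u - snd g)\<bar> \<le> T H"
        proof (intro bexI[OF _ g(1)] ballI)
          fix H assume H: "H \<in> f"
          have "x H - nrm H \<bullet> (u - snd g) = nrm H \<bullet> (w + snd g - u)"
            using wx[OF H] by (simp add: inner_diff_right inner_add_right)
          then show "\<bar>x H - nrm H \<bullet> (u - snd g)\<bar> \<le> T H" using g(2) H by simp
        qed
      qed (use fin finG \<eta> T in auto)
      moreover have "(\<Prod>H\<in>f. (nrm H \<bullet> w0 + \<eta>) - (nrm H \<bullet> w0 - \<eta>)) = 2 ^ card f * \<eta> ^ card f"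
      proof -
        have "(\<Prod>H\<in>f. (nrm H \<bullet> w0 + \<eta>) - (nrm H \<bullet> w0 - \<eta>)) = (\<Prod>H\<in>f. 2 * \<eta>)"
          by (intro prod.cong) auto
        then show ?thesis by (simp only: prod_constant power_mult_distrib)
      qed
      moreover have "(\<Prod>H\<in>f. 2 * T H) = 2 ^ card f * (\<Prod>H\<in>f. T H)" by (simp only: prod.distrib prod_constant)
      ultimately have "2 ^ card f * \<eta> ^ card f \<le> real (card ?G) * (2 ^ card f * (\<Prod>H\<in>f. T H))" by (simp only:)
      then have "2 ^ card f * \<eta> ^ card f \<le> 2 ^ card f * (real (card ?G) * (\<Prod>H\<in>f. T H))" by (simp only: mult_ac)
      then have "\<eta> ^ card f \<le> real (card ?G) * (\<Prod>H\<in>f. T H)" by (rule mult_left_le_imp_le) simp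
      also have "\<dots> \<le> (C1 * (C * r) ^ DIM('p)) * (\<Prod>H\<in>f. T H)"
        using C1(2)[OF r(2)] T by (intro mult_right_mono prod_nonneg) auto
      also have "\<dots> = (C1 * C ^ DIM('p)) * (r ^ DIM('p) * (\<Prod>H\<in>f. T H))"
        by (simp only: power_mult_distrib mult_ac)
      finally show "c \<le> r ^ DIM('p) * (\<Prod>H\<in>f. T H)"
        unfolding c_def using C C1(1) by (subst pos_divide_le_eq) (simp_all add: mult.commute)
    qed
  qed
  then show ?thesis using c by blast
qed

text \<open>A limit \<open>u \<noteq> 0\<close> of differences \<open>z\<^sup>\<star> - y\<^sup>\<star>\<close> of points with equal, growing patches would
  satisfy \<open>W + u \<subseteq> W\<close>, which is impossible for a bounded window.\<close>

lemma patch_localises: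
  assumes "\<epsilon> > 0"
  shows "\<exists>r0. \<forall>r\<ge>r0. \<forall>y\<in>\<Lambda>. \<forall>z\<in>\<Lambda>.
    patch Np r y = patch Np r z \<longrightarrow> norm (star \<Gamma> z - star \<Gamma> y) < \<epsilon>"
proof (rule ccontr)
  assume "\<not> ?thesis"
  then have "\<forall>n::nat. \<exists>r y z. r \<ge> real n \<and> y \<in> \<Lambda> \<and> z \<in> \<Lambda> \<and>
     patch Np r y = patch Np r z \<and> \<not> norm (star \<Gamma> z - star \<Gamma> y) < \<epsilon>"
    by meson
  then obtain r y z where n: "\<And>n::nat. r n \<ge> real n" "\<And>n. y n \<in> \<Lambda>" "\<And>n. z n \<in> \<Lambda>"
    "\<And>n. patch Np (r n) (y n) = patch Np (r n) (z n)"
    "\<And>n. \<not> norm (star \<Gamma> (z n) - star \<Gamma> (y n)) < \<epsilon>"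
    by metis
  define V where "V = (\<Union>l\<in>L. W l)"
  have V: "compact V" "closure (interior V) = V" using polytopal_union unfolding polytopal_def V_def by auto
  then have clV: "closed V" by (simp add: compact_imp_closed)
  have "compact (V \<times> V)" using V(1) by (intro compact_Times)
  moreover have "\<forall>n. (star \<Gamma> (y n), star \<Gamma> (z n)) \<in> V \<times> V"
    using cps_star[OF n(2)] cps_star[OF n(3)] unfolding V_def by blast
  ultimately obtain p s where ps: "p \<in> V \<times> V" "strict_mono s" "((\<lambda>n. (star \<Gamma> (y n), star \<Gamma> (z n))) \<circ> s) \<longlonglongrightarrow> p"
    using seq_compactE[OF compact_imp_seq_compact, of "V \<times> V" "\<lambda>n. (star \<Gamma> (y n), star \<Gamma> (z n))"] by blast
  define w w' where "w = fst p" and "w' = snd p"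
  have lim: "(\<lambda>n. star \<Gamma> (y (s n))) \<longlonglongrightarrow> w" "(\<lambda>n. star \<Gamma> (z (s n))) \<longlonglongrightarrow> w'"
    using tendsto_fst[OF ps(3)] tendsto_snd[OF ps(3)] by (simp_all add: w_def w'_def o_def)
  have far: "norm (w' - w) \<ge> \<epsilon>"
  proof (rule tendsto_lowerbound)
    show "(\<lambda>n. norm (star \<Gamma> (z (s n)) - star \<Gamma> (y (s n)))) \<longlonglongrightarrow> norm (w' - w)"
      by (intro tendsto_norm tendsto_diff lim)
    show "\<forall>\<^sub>F n in sequentially. \<epsilon> \<le> norm (star \<Gamma> (z (s n)) - star \<Gamma> (y (s n)))"
      using n(5) by (simp add: not_less)
  qed simp
  \<comment> \<open>For fixed g all patches of large radius test g. Openness of the interior makes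
    the hypothesis hold near the limit, and closedness of V preserves the conclusion.\<close>
  have step: "w' + snd g \<in> V" if g: "g \<in> \<Gamma>" "w + snd g \<in> interior V" for g
  proof (rule Lim_in_closed_set[OF clV])
    show "(\<lambda>n. star \<Gamma> (z (s n)) + snd g) \<longlonglongrightarrow> w' + snd g" by (intro tendsto_intros lim)
    have "(\<lambda>n. star \<Gamma> (y (s n)) + snd g) \<longlonglongrightarrow> w + snd g" by (intro tendsto_intros lim)
    then have "\<forall>\<^sub>F n in sequentially. star \<Gamma> (y (s n)) + snd g \<in> interior V"
      using g(2) by (intro topological_tendstoD) auto
    moreover have "\<forall>\<^sub>F n in sequentially. n \<ge> nat \<lceil>Np (fst g)\<rceil>" by (rule eventually_ge_at_top)
    ultimately show "\<forall>\<^sub>F n in sequentially. star \<Gamma> (z (s n)) + snd g \<in> V"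
    proof eventually_elim
      case (elim k)
      have "Np (fst g) \<le> real k" using elim(2) by linarith
      also have "\<dots> \<le> real (s k)" using strict_mono_imp_increasing[OF ps(2)] by simp
      also have "\<dots> \<le> r (s k)" by (rule n(1))
      finally have np: "Np (fst g) \<le> r (s k)" .
      obtain l where l: "l \<in> L" "star \<Gamma> (y (s k)) + snd g \<in> W l"
        using elim(1) interior_subset unfolding V_def by blast
      then have "star \<Gamma> (z (s k)) + snd g \<in> W l"
        using n(4)[of "s k"] g(1) np unfolding patch_class_eq_iff[OF n(2) n(3)] by blast
      then show ?case using l(1) unfolding V_def by blast
    qed
  qed simp
  define u where "u = w' - w"
  \<comment> \<open>The exceptions in the interior form an open set, so by density one of them would
    have the form w + \<open>snd g\<close>, against \<open>step\<close>.\<close>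
  have "p + u \<in> V" if p: "p \<in> interior V" for p
  proof (rule ccontr)
    assume np: "p + u \<notin> V"
    define O1 where "O1 = (\<lambda>q. q - w) ` (interior V \<inter> ((\<lambda>q. q + u) -` (- V)))"
    have "open ((\<lambda>q. q + u) -` (- V))" using clV by (intro open_vimage continuous_intros) auto
    then have "open O1" unfolding O1_def by (intro open_translation_subtract open_Int) auto
    moreover have "p - w \<in> O1" unfolding O1_def using p np by blast
    ultimately obtain g where g: "g \<in> \<Gamma>" "snd g \<in> O1" using dense_open by blast
    then obtain q where q: "snd g = q - w" "q \<in> interior V" "q + u \<notin> V" unfolding O1_def by blast
    have "w + snd g \<in> interior V" using q(1,2) by simp
    then have "w' + snd g \<in> V" by (rule step[OF g(1)])
    then show False using q(1,3) by (simp add: u_def algebra_simps)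
  qed
  then have "interior V \<subseteq> (\<lambda>p. p + u) -` V" by blast
  moreover have "closed ((\<lambda>p. p + u) -` V)" using clV by (intro closed_vimage continuous_intros)
  ultimately have "closure (interior V) \<subseteq> (\<lambda>p. p + u) -` V" by (rule closure_minimal)
  then have tr: "p + u \<in> V" if "p \<in> V" for p using V(2) that by blast
  have it: "w + real k *\<^sub>R u \<in> V" for k
  proof (induction k)
    case 0
    then show ?case using ps(1) by (auto simp: w_def)
  next
    case (Suc k)
    then show ?case using tr[OF Suc] by (simp add: algebra_simps)
  qed
  obtain D where D: "\<And>v. v \<in> V \<Longrightarrow> norm v \<le> D" using V(1) compact_imp_bounded bounded_iff by metis
  obtain k :: nat where k: "real k * \<epsilon> > 2 * D" using reals_Archimedean3[OF assms] by blast
  have "real k * \<epsilon> \<le> norm (real k *\<^sub>R u)" using far by (simp add: u_def mult_left_mono)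
  also have "\<dots> \<le> norm (w + real k *\<^sub>R u) + norm w" by (metis add_diff_cancel_left' norm_triangle_ineq4)
  also have "\<dots> \<le> 2 * D" using D[OF it[of k]] D[OF it[of 0]] by simp
  finally show False using k by simp
qed

text \<open>The translations in the stabiliser of \<open>H\<close> move the part of \<open>H\<close> visible in the boundary of the
  window near the given point of \<open>H\<close>.\<close>

lemma hyperplane_visible:
  assumes f: "f \<in> flags Hs" and N: "N \<ge> 1" "splits N f" and H: "H \<in> f" and q: "nrm H \<bullet> q = off H"
  shows "\<exists>g\<in>\<Gamma>. \<exists>l\<in>L. \<exists>\<rho>>0. \<forall>w. norm (w - q) < \<rho> \<longrightarrow> (w + snd g \<in> W l \<longleftrightarrow> nrm H \<bullet> w \<le> off H)"
proof -
  note d = flag_dual[OF f]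
  have fin: "finite f" by (rule flag_finite[OF f])
  have HH: "H \<in> Hs" using flag_subset[OF f] H by blast
  obtain l wH U where l: "l \<in> L" and U: "wH \<in> H" "open U" "wH \<in> U" "W l \<inter> U = {x. nrm H \<bullet> x \<le> off H} \<inter> U"
    using nrm[OF HH] by blast
  obtain \<rho> where \<rho>: "\<rho> > 0" "ball wH \<rho> \<subseteq> U" using U(2,3) by (meson openE)
  define t where "t = wH - q"
  have tH: "nrm H \<bullet> t = 0" using in_hyperplane[OF HH] U(1) q by (simp add: t_def inner_diff_right)
  define E where "E = 1 + (\<Sum>K\<in>f. real N * norm (nrm K) * norm (edge f K))"
  have E: "E > 0" unfolding E_def by (simp add: add_pos_nonneg sum_nonneg)
  have "\<rho> / (2 * E) > 0" using \<rho> E by simp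
  \<comment> \<open>N \<open>snd g\<close> approximates t. Splitting N g along the edges and
    dropping the component at H gives an element parallel to H that is still close to t, because t
    has no H-coordinate.\<close>
  then obtain g where g: "g \<in> \<Gamma>" "norm (snd g - (1 / real N) *\<^sub>R t) < \<rho> / (2 * E)" using dense_approx by blast
  obtain c where c: "\<And>K. K \<in> f \<Longrightarrow> c K \<in> line f K \<and> snd (c K) = (real N * (nrm K \<bullet> snd g)) *\<^sub>R edge f K"
    using splits_bounded[OF f N(2)] g(1) by meson
  define \<gamma> where "\<gamma> = (\<Sum>K\<in>f - {H}. c K)"
  have \<gamma>: "\<gamma> \<in> \<Gamma>" unfolding \<gamma>_def
    using c line_subset by (intro int_mod.subspace_sum[OF sub_\<Gamma>]) blast
  have s\<gamma>: "snd \<gamma> = (\<Sum>K\<in>f - {H}. (real N * (nrm K \<bullet> snd g)) *\<^sub>R edge f K)"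
    unfolding \<gamma>_def snd_sum using c by (intro sum.cong) auto
  have \<gamma>H: "nrm H \<bullet> snd \<gamma> = 0"
    unfolding s\<gamma> inner_sum_right using dual_systemD(2)[OF d H] by (intro sum.neutral) auto
  have "t = (\<Sum>K\<in>f. (nrm K \<bullet> t) *\<^sub>R edge f K)" by (rule dual_systemD(3)[OF d])
  also have "\<dots> = (\<Sum>K\<in>f - {H}. (nrm K \<bullet> t) *\<^sub>R edge f K)"
    using fin H tH by (subst sum.remove[of _ H]) auto
  finally have "snd \<gamma> - t = (\<Sum>K\<in>f - {H}. (real N * (nrm K \<bullet> snd g)) *\<^sub>R edge f K - (nrm K \<bullet> t) *\<^sub>R edge f K)"
    unfolding s\<gamma> by (simp add: sum_subtractf)
  also have "\<dots> = (\<Sum>K\<in>f - {H}. (real N * (nrm K \<bullet> (snd g - (1 / real N) *\<^sub>R t))) *\<^sub>R edge f K)"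
    using N(1) by (intro sum.cong refl) (simp add: inner_diff_right right_diff_distrib scaleR_diff_left)
  finally have "norm (snd \<gamma> - t) \<le> (\<Sum>K\<in>f - {H}. norm ((real N * (nrm K \<bullet> (snd g - (1 / real N) *\<^sub>R t))) *\<^sub>R edge f K))"
    using norm_sum by metis
  also have "\<dots> \<le> (\<Sum>K\<in>f - {H}. real N * norm (nrm K) * norm (edge f K) * norm (snd g - (1 / real N) *\<^sub>R t))"
  proof (rule sum_mono)
    fix K
    have "real N * \<bar>nrm K \<bullet> (snd g - (1 / real N) *\<^sub>R t)\<bar> * norm (edge f K) \<le>
        real N * (norm (nrm K) * norm (snd g - (1 / real N) *\<^sub>R t)) * norm (edge f K)"
      by (intro mult_right_mono mult_left_mono Cauchy_Schwarz_ineq2) auto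
    then show "norm ((real N * (nrm K \<bullet> (snd g - (1 / real N) *\<^sub>R t))) *\<^sub>R edge f K) \<le>
        real N * norm (nrm K) * norm (edge f K) * norm (snd g - (1 / real N) *\<^sub>R t)"
      by (simp add: abs_mult mult_ac)
  qed
  also have "\<dots> \<le> (\<Sum>K\<in>f. real N * norm (nrm K) * norm (edge f K) * norm (snd g - (1 / real N) *\<^sub>R t))"
    using fin by (intro sum_mono2) auto
  also have "\<dots> \<le> E * norm (snd g - (1 / real N) *\<^sub>R t)"
    unfolding sum_distrib_right[symmetric] E_def by (intro mult_right_mono) auto
  also have "\<dots> < E * (\<rho> / (2 * E))" using g(2) E by (intro mult_strict_left_mono) auto
  also have "\<dots> = \<rho> / 2" using E by simp
  finally have close: "norm (snd \<gamma> - t) < \<rho> / 2" .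
  have "w + snd \<gamma> \<in> W l \<longleftrightarrow> nrm H \<bullet> w \<le> off H" if w: "norm (w - q) < \<rho> / 2" for w
  proof -
    have "w + snd \<gamma> - wH = (w - q) + (snd \<gamma> - t)" by (simp add: t_def)
    then have "norm (w + snd \<gamma> - wH) \<le> norm (w - q) + norm (snd \<gamma> - t)"
      by (simp only: norm_triangle_ineq)
    then have "norm (w + snd \<gamma> - wH) < \<rho>" using w close by linarith
    then have "w + snd \<gamma> \<in> U" using \<rho>(2) by (auto simp: dist_norm norm_minus_commute)
    then have "w + snd \<gamma> \<in> W l \<longleftrightarrow> nrm H \<bullet> (w + snd \<gamma>) \<le> off H" using U(4) by blast
    then show ?thesis using \<gamma>H by (simp add: inner_add_right)
  qed
  then show ?thesis using \<gamma> l \<rho>(1) by (intro bexI[OF _ \<gamma>] bexI[OF _ l] exI[of _ "\<rho> / 2"]) auto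
qed

text \<open>For each hyperplane of f one fixed lattice element makes it visible near the vertex; r1
  bounds their physical sizes. So an r-patch decides the side of a translated hyperplane as long as
  the translation leaves a margin r1.\<close>

lemma patch_detects_side:
  assumes Np: "is_norm Np" and f: "f \<in> flags Hs" and N: "N \<ge> 1" "splits N f"
  shows "\<exists>\<rho>>0. \<exists>r1\<ge>0. \<forall>r y z s H. y \<in> \<Lambda> \<longrightarrow> z \<in> \<Lambda> \<longrightarrow>
    patch Np r z = patch Np r y \<longrightarrow> s \<in> \<Gamma> \<longrightarrow> Np (fst s) \<le> r - r1 \<longrightarrow> H \<in> f \<longrightarrow>
    norm (star \<Gamma> y + snd s - vtx f) < \<rho> \<longrightarrow> norm (star \<Gamma> z + snd s - vtx f) < \<rho> \<longrightarrow>
    (nrm H \<bullet> (star \<Gamma> y + snd s) \<le> off H \<longleftrightarrow> nrm H \<bullet> (star \<Gamma> z + snd s) \<le> off H)"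
proof -
  have fin: "finite f" by (rule flag_finite[OF f])
  have "\<forall>H\<in>f. \<exists>g. g \<in> \<Gamma> \<and> (\<exists>l\<in>L. \<exists>\<rho>>0. \<forall>w. norm (w - vtx f) < \<rho> \<longrightarrow> (w + snd g \<in> W l \<longleftrightarrow> nrm H \<bullet> w \<le> off H))"
    using hyperplane_visible[OF f N _ vtx_in[OF f]] by blast
  then obtain \<gamma> where \<gamma>: "\<And>H. H \<in> f \<Longrightarrow> \<gamma> H \<in> \<Gamma> \<and>
      (\<exists>l\<in>L. \<exists>\<rho>>0. \<forall>w. norm (w - vtx f) < \<rho> \<longrightarrow> (w + snd (\<gamma> H) \<in> W l \<longleftrightarrow> nrm H \<bullet> w \<le> off H))" by metis
  have "\<exists>\<rho>>0. \<forall>H\<in>f. \<exists>l\<in>L. \<forall>w. norm (w - vtx f) < \<rho> \<longrightarrow> (w + snd (\<gamma> H) \<in> W l \<longleftrightarrow> nrm H \<bullet> w \<le> off H)"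
  proof (rule finite_uniform_constant[OF fin])
    fix H assume "H \<in> f"
    then show "\<exists>\<rho>>0. \<exists>l\<in>L. \<forall>w. norm (w - vtx f) < \<rho> \<longrightarrow> (w + snd (\<gamma> H) \<in> W l \<longleftrightarrow> nrm H \<bullet> w \<le> off H)"
      using \<gamma> by blast
  next
    fix H and c c' :: real
    assume "\<exists>l\<in>L. \<forall>w. norm (w - vtx f) < c \<longrightarrow> (w + snd (\<gamma> H) \<in> W l \<longleftrightarrow> nrm H \<bullet> w \<le> off H)" "c' \<le> c"
    then show "\<exists>l\<in>L. \<forall>w. norm (w - vtx f) < c' \<longrightarrow> (w + snd (\<gamma> H) \<in> W l \<longleftrightarrow> nrm H \<bullet> w \<le> off H)"
      by (meson less_le_trans)
  qed
  then obtain \<rho> where \<rho>: "\<rho> > 0" "\<And>H. H \<in> f \<Longrightarrow> \<exists>l\<in>L. \<forall>w. norm (w - vtx f) < \<rho> \<longrightarrow> (w + snd (\<gamma> H) \<in> W l \<longleftrightarrow> nrm H \<bullet> w \<le> off H)"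
    by blast
  have tri: "Np (v + v') \<le> Np v + Np v'" for v v' using Np unfolding is_norm_def by blast
  obtain CN where CN: "CN > 0" "\<And>x. norm x \<le> CN * Np x" using is_norm_equivalent[OF Np] by blast
  have nn: "Np v \<ge> 0" for v using CN(1) order_trans[OF norm_ge_zero CN(2)[of v]] by (simp add: zero_le_mult_iff)
  define r1 where "r1 = (\<Sum>H\<in>f. Np (fst (\<gamma> H)))"
  have "r1 \<ge> 0" unfolding r1_def by (intro sum_nonneg nn)
  moreover have "nrm H \<bullet> (star \<Gamma> y + snd s) \<le> off H \<longleftrightarrow> nrm H \<bullet> (star \<Gamma> z + snd s) \<le> off H"
    if a: "y \<in> \<Lambda>" "z \<in> \<Lambda>" "patch Np r z = patch Np r y" "s \<in> \<Gamma>"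
      "Np (fst s) \<le> r - r1" "H \<in> f" "norm (star \<Gamma> y + snd s - vtx f) < \<rho>" "norm (star \<Gamma> z + snd s - vtx f) < \<rho>"
    for r y z s H
  proof -
    obtain l where l: "l \<in> L" "\<And>w. norm (w - vtx f) < \<rho> \<Longrightarrow> (w + snd (\<gamma> H) \<in> W l \<longleftrightarrow> nrm H \<bullet> w \<le> off H)"
      using \<rho>(2)[OF a(6)] by blast
    have "Np (fst (\<gamma> H)) \<le> r1" unfolding r1_def using a(6) fin nn by (intro member_le_sum) auto
    then have "Np (fst (s + \<gamma> H)) \<le> r" using tri[of "fst s" "fst (\<gamma> H)"] a(5) by simp
    moreover have "s + \<gamma> H \<in> \<Gamma>" using a(4) \<gamma>[OF a(6)] int_mod.subspace_add[OF sub_\<Gamma>] by blast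
    ultimately have "star \<Gamma> z + snd (s + \<gamma> H) \<in> W l \<longleftrightarrow> star \<Gamma> y + snd (s + \<gamma> H) \<in> W l"
      using a(3) l(1) unfolding patch_class_eq_iff[OF a(2,1)] by blast
    then show ?thesis using l(2)[OF a(7)] l(2)[OF a(8)] by (simp add: add.assoc)
  qed
  ultimately show ?thesis using \<rho>(1) by blast
qed

end

section \<open>Thin cells at displaced vertices\<close>

context csr
begin

text \<open>The point \<open>vtx f - x\<close> equals \<open>vtx f' + y\<close>, so it lies on the
  hyperplanes of type S of f' and on the hyperplanes of all other types of f. Their normals span
  type by type, and a flag can be extracted.\<close>

lemma mixed_flag:
  assumes f: "f \<in> flags Hs" and f': "f' \<in> flags Hs" and S: "S \<in> Q" and x: "x \<in> \<Inter>S"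
    and y: "y \<in> set_family_sum Inter (Q - {S})" and xy: "x + y = vtx f - vtx f'"
  shows "\<exists>f2\<in>flags Hs. vtx f2 = vtx f - x"
proof -
  define J where "J = {H\<in>f'. htype H = S} \<union> {H\<in>f. htype H \<noteq> S}"
  have JHs: "J \<subseteq> Hs" using flag_subset f f' unfolding J_def by blast
  have finJ: "finite J" using JHs finite_Hs finite_subset by blast
  have through: "nrm H \<bullet> (vtx f - x) = off H" if H: "H \<in> J" for H
  proof (cases "H \<in> f' \<and> htype H = S")
    case True
    have "vtx f - x = vtx f' + y" using xy by (simp add: algebra_simps)
    moreover have "nrm H \<bullet> y = 0" using nrm_complement_sum[of H y] y True H JHs by blast
    ultimately show ?thesis using vtx_in[OF f'] True by (simp add: inner_add_right)
  next
    case False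
    then have "H \<in> f" "htype H \<noteq> S" using H unfolding J_def by auto
    then show ?thesis using nrm_other_type[of H S x] S x H JHs vtx_in[OF f] by (auto simp: inner_diff_right)
  qed
  have "u = 0" if u: "\<And>H. H \<in> J \<Longrightarrow> nrm H \<bullet> u = 0" for u
  proof -
    obtain c where c: "\<forall>T\<in>Q. c T \<in> \<Inter>T" "u = (\<Sum>T\<in>Q. c T)" using decompose_vector by blast
    have "c T = 0" if T: "T \<in> Q" for T
    proof -
      define F where "F = (if T = S then f' else f)"
      have F: "F \<in> flags Hs" unfolding F_def using f f' by simp
      show ?thesis
      proof (rule dual_system_eqI[OF flag_dual[OF F]])
        fix H assume H: "H \<in> F"
        have HH: "H \<in> Hs" using H flag_subset[OF F] by blast
        show "nrm H \<bullet> c T = nrm H \<bullet> 0"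
        proof (cases "htype H = T")
          case True
          then have "H \<in> J" using H unfolding F_def J_def by (auto split: if_splits)
          then have "nrm H \<bullet> u = 0" by (rule u)
          then show ?thesis using nrm_component[OF HH c(1)] c(2) True by simp
        next
          case False
          then show ?thesis using nrm_other_type[OF HH T, of "c T"] c(1) T by auto
        qed
      qed
    qed
    then show "u = 0" unfolding c(2) by (rule sum.neutral[OF ballI])
  qed
  then obtain f2 e where f2: "f2 \<subseteq> J" "dual_system f2 nrm e"
    using dual_subsystem_exists[OF finJ, of nrm] by blast
  then have "f2 \<in> flags Hs" "vtx f2 = vtx f - x"
    using flagI[of f2 e "vtx f - x"] JHs through by blast+
  then show ?thesis by blast
qed

text \<open>The line group has rank \<delta> + 1, so Dirichlet's exponent 1 - rank is -\<delta>. A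
  sign change makes the H-coordinate positive; it is non-zero because \<open>snd\<close> is
  injective on \<Gamma>.\<close>

lemma line_dirichlet:
  assumes f: "f \<in> flags Hs"
  shows "\<exists>C>0. \<forall>R\<ge>C. \<forall>H\<in>f. \<exists>k\<in>line f H. norm k \<le> R \<and> 0 < nrm H \<bullet> snd k \<and>
    nrm H \<bullet> snd k \<le> C * R powr (- dexp (htype H))"
proof -
  have "\<exists>C>0. \<forall>R\<ge>C. \<exists>k\<in>line f H. norm k \<le> R \<and> 0 < nrm H \<bullet> snd k \<and>
    nrm H \<bullet> snd k \<le> C * R powr (- dexp (htype H))" if H: "H \<in> f" for H
  proof -
    have lin: "linear (\<lambda>g::'p \<times> 'i. nrm H \<bullet> snd g)"
      by (intro linearI) (simp_all add: inner_add_right)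
    have rk: "real (int_rank (line f H)) = dexp (htype H) + 1" by (rule flag_structure(2)[OF f H])
    have pos: "int_rank (line f H) > 0" using rk dexp_flag_pos[OF f H] by linarith
    have ex: "1 - real (int_rank (line f H)) = - dexp (htype H)" using rk by simp
    have "\<exists>C>0. \<forall>R\<ge>C. \<exists>g\<in>line f H. int_rank (line f H) > 0 \<longrightarrow> g \<noteq> 0 \<and> norm g \<le> R \<and>
        \<bar>nrm H \<bullet> snd g\<bar> \<le> C * R powr (- dexp (htype H))"
      using lattice_dirichlet[OF lattice line_subspace line_subset lin, of f H] unfolding ex .
    then obtain C where C: "C > 0" "\<forall>R\<ge>C. \<exists>g\<in>line f H. int_rank (line f H) > 0 \<longrightarrow> g \<noteq> 0 \<and> norm g \<le> R \<and>
        \<bar>nrm H \<bullet> snd g\<bar> \<le> C * R powr (- dexp (htype H))"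
      by (elim exE conjE)
    have "\<exists>k\<in>line f H. norm k \<le> R \<and> 0 < nrm H \<bullet> snd k \<and> nrm H \<bullet> snd k \<le> C * R powr (- dexp (htype H))"
      if R: "R \<ge> C" for R
    proof -
      obtain g where g: "g \<in> line f H" "g \<noteq> 0" "norm g \<le> R" "\<bar>nrm H \<bullet> snd g\<bar> \<le> C * R powr (- dexp (htype H))"
        using C(2) R pos by blast
      have nz: "nrm H \<bullet> snd g \<noteq> 0"
      proof
        assume "nrm H \<bullet> snd g = 0"
        then have "snd g = 0" using line_snd[OF f H g(1)] by simp
        then show False using snd_eq_0 g(1,2) line_subset by blast
      qed
      show ?thesis
      proof (cases "nrm H \<bullet> snd g > 0")
        case True
        then show ?thesis using g by (intro bexI[OF _ g(1)]) auto
      next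
        case False
        have "- g \<in> line f H" by (rule int_mod.subspace_neg[OF line_subspace g(1)])
        then show ?thesis using g nz False by (intro bexI[of _ "- g"]) auto
      qed
    qed
    then show ?thesis using C(1) by blast
  qed
  then obtain C where C: "\<And>H. H \<in> f \<Longrightarrow> C H > 0 \<and> (\<forall>R\<ge>C H. \<exists>k\<in>line f H. norm k \<le> R \<and> 0 < nrm H \<bullet> snd k \<and>
    nrm H \<bullet> snd k \<le> C H * R powr (- dexp (htype H)))" by metis
  define D where "D = 1 + (\<Sum>H\<in>f. C H)"
  have fin: "finite f" by (rule flag_finite[OF f])
  have le: "C H \<le> D" if "H \<in> f" for H
  proof -
    have "C H \<le> (\<Sum>H\<in>f. C H)" using C that fin by (intro member_le_sum) (auto intro: less_imp_le)
    then show ?thesis by (simp add: D_def)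
  qed
  have "D > 0" unfolding D_def using C by (simp add: add_pos_nonneg sum_nonneg less_imp_le)
  moreover have "\<exists>k\<in>line f H. norm k \<le> R \<and> 0 < nrm H \<bullet> snd k \<and> nrm H \<bullet> snd k \<le> D * R powr (- dexp (htype H))"
    if R: "R \<ge> D" and H: "H \<in> f" for R H
  proof -
    have "R \<ge> C H" using le[OF H] R by linarith
    then obtain k where k: "k \<in> line f H" "norm k \<le> R" "0 < nrm H \<bullet> snd k" "nrm H \<bullet> snd k \<le> C H * R powr (- dexp (htype H))"
      using C[OF H] by blast
    moreover have "C H * R powr (- dexp (htype H)) \<le> D * R powr (- dexp (htype H))"
      using le[OF H] by (intro mult_right_mono) auto
    ultimately show ?thesis by (meson order_trans)
  qed
  ultimately show ?thesis by blast
qed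

text \<open>If \<open>v + e\<close>, \<open>e \<noteq> 0\<close> small, is the vertex of the translate of \<open>f2\<close> by \<open>g\<close>, then some hyperplane of
  \<open>f\<close> through \<open>v\<close> cuts off a thin cell at that vertex; the other directions are made thin by the
  translates provided by Dirichlet's theorem.\<close>

lemma separation_from_repetitivity:
  assumes Np: "is_norm Np" and LR: "linearly_repetitive Np \<Gamma> L W"
    and f: "f \<in> flags Hs" and f2: "f2 \<in> flags Hs" and S: "S \<in> Q" and x: "x \<in> \<Inter>S"
    and v2: "vtx f2 = vtx f - x"
  shows "\<exists>c>0. \<forall>g\<in>stabiliser \<Gamma> S. g \<noteq> 0 \<longrightarrow> snd g \<noteq> x \<longrightarrow> norm (snd g - x) \<ge> c * norm g powr (- dexp S)"
proof -
  note d = flag_dual[OF f] and d2 = flag_dual[OF f2]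
  have fin: "finite f" "finite f2" using flag_finite f f2 by auto
  have fHs: "\<And>H. H \<in> f \<Longrightarrow> H \<in> Hs" "\<And>H. H \<in> f2 \<Longrightarrow> H \<in> Hs" using flag_subset f f2 by auto
  have tri: "Np (v + v') \<le> Np v + Np v'" for v v' using Np unfolding is_norm_def by blast
  have Npneg: "Np (- v) = Np v" for v using Np unfolding is_norm_def by (metis abs_minus_cancel abs_one mult_1 scaleR_minus1_left)
  obtain CN where CN: "CN > 0" "\<And>v. norm v \<le> CN * Np v" "\<And>v. Np v \<le> CN * norm v" using is_norm_equivalent[OF Np] by blast
  have Npnn: "Np v \<ge> 0" for v using CN(1) order_trans[OF norm_ge_zero CN(2)[of v]] by (simp add: zero_le_mult_iff)
  obtain N1 N2 where N: "N1 \<ge> 1" "splits N1 f" "N2 \<ge> 1" "splits N2 f2" using splits_exists f f2 by meson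
  obtain \<rho>1 r1 where \<rho>1: "\<rho>1 > 0" "r1 \<ge> 0" and det1: "\<And>r y z s H. y \<in> \<Lambda> \<Longrightarrow> z \<in> \<Lambda> \<Longrightarrow>
    patch Np r z = patch Np r y \<Longrightarrow> s \<in> \<Gamma> \<Longrightarrow> Np (fst s) \<le> r - r1 \<Longrightarrow> H \<in> f \<Longrightarrow>
    norm (star \<Gamma> y + snd s - vtx f) < \<rho>1 \<Longrightarrow> norm (star \<Gamma> z + snd s - vtx f) < \<rho>1 \<Longrightarrow>
    (nrm H \<bullet> (star \<Gamma> y + snd s) \<le> off H \<longleftrightarrow> nrm H \<bullet> (star \<Gamma> z + snd s) \<le> off H)"
    using patch_detects_side[OF Np f N(1,2)] by meson
  obtain \<rho>2 r2 where \<rho>2: "\<rho>2 > 0" "r2 \<ge> 0" and det2: "\<And>r y z s H. y \<in> \<Lambda> \<Longrightarrow> z \<in> \<Lambda> \<Longrightarrow>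
    patch Np r z = patch Np r y \<Longrightarrow> s \<in> \<Gamma> \<Longrightarrow> Np (fst s) \<le> r - r2 \<Longrightarrow> H \<in> f2 \<Longrightarrow>
    norm (star \<Gamma> y + snd s - vtx f2) < \<rho>2 \<Longrightarrow> norm (star \<Gamma> z + snd s - vtx f2) < \<rho>2 \<Longrightarrow>
    (nrm H \<bullet> (star \<Gamma> y + snd s) \<le> off H \<longleftrightarrow> nrm H \<bullet> (star \<Gamma> z + snd s) \<le> off H)"
    using patch_detects_side[OF Np f2 N(3,4)] by meson
  obtain l0 where l0: "l0 \<in> L" "interior (W l0) \<noteq> {}" using interior_W_nonempty by blast
  have "open ((\<lambda>q. q - vtx f) ` interior (W l0))" "(\<lambda>q. q - vtx f) ` interior (W l0) \<noteq> {}"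
    using l0(2) by (auto intro: open_translation_subtract)
  \<comment> \<open>A fixed translation taking the surroundings of the vertex into the window, so
    that lattice points near the vertex become stars of points of \<Lambda>.\<close>
  then obtain \<gamma>0 where \<gamma>0: "\<gamma>0 \<in> \<Gamma>" "snd \<gamma>0 \<in> (\<lambda>q. q - vtx f) ` interior (W l0)" using dense_open by blast
  then have "vtx f + snd \<gamma>0 \<in> interior (W l0)" by auto
  then obtain \<rho>W where \<rho>W: "\<rho>W > 0" "ball (vtx f + snd \<gamma>0) \<rho>W \<subseteq> W l0" by (meson mem_interior)
  define \<rho> where "\<rho> = min \<rho>1 (min \<rho>2 \<rho>W)"
  have \<rho>: "\<rho> > 0" "\<rho> \<le> \<rho>1" "\<rho> \<le> \<rho>2" "\<rho> \<le> \<rho>W" using \<rho>1 \<rho>2 \<rho>W by (auto simp: \<rho>_def)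
  then have "\<rho> / 4 > 0" by simp
  then obtain r0 where loc: "\<And>r y z. r \<ge> r0 \<Longrightarrow> y \<in> \<Lambda> \<Longrightarrow> z \<in> \<Lambda> \<Longrightarrow>
    patch Np r y = patch Np r z \<Longrightarrow> norm (star \<Gamma> z - star \<Gamma> y) < \<rho> / 4"
    using patch_localises[of "\<rho> / 4" Np] by meson
  obtain CD where CD: "CD > 0" and dir: "\<And>R H. R \<ge> CD \<Longrightarrow> H \<in> f2 \<Longrightarrow> \<exists>k\<in>line f2 H. norm k \<le> R \<and>
    0 < nrm H \<bullet> snd k \<and> nrm H \<bullet> snd k \<le> CD * R powr (- dexp (htype H))"
    using line_dirichlet[OF f2] by meson
  obtain cV where cV: "cV > 0" and ev: "\<forall>\<^sub>F r in at_top. \<forall>y\<in>\<Lambda>. \<forall>T u. (\<forall>H\<in>f2. 0 \<le> T H) \<longrightarrow>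
    (\<forall>z\<in>\<Lambda>. patch Np r z = patch Np r y \<longrightarrow>
      (\<forall>H\<in>f2. \<bar>nrm H \<bullet> (star \<Gamma> z - u)\<bar> \<le> T H)) \<longrightarrow> cV \<le> r ^ DIM('p) * (\<Prod>H\<in>f2. T H)"
    using patch_volume[OF Np LR f2] by (elim exE conjE)
  obtain rV where vol: "\<forall>r\<ge>rV. \<forall>y\<in>\<Lambda>. \<forall>T u. (\<forall>H\<in>f2. 0 \<le> T H) \<longrightarrow>
    (\<forall>z\<in>\<Lambda>. patch Np r z = patch Np r y \<longrightarrow>
      (\<forall>H\<in>f2. \<bar>nrm H \<bullet> (star \<Gamma> z - u)\<bar> \<le> T H)) \<longrightarrow> cV \<le> r ^ DIM('p) * (\<Prod>H\<in>f2. T H)"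
    using ev unfolding eventually_at_top_linorder by (elim exE)
  obtain \<epsilon>0 where \<epsilon>0: "\<epsilon>0 > 0" "\<And>g. g \<in> \<Gamma> \<Longrightarrow> g \<noteq> 0 \<Longrightarrow> \<epsilon>0 \<le> norm g" using lattice_discrete[OF lattice] by blast
  define E where "E = 1 + (\<Sum>H\<in>f2. norm (edge f2 H))"
  have E: "E > 0" "\<And>H. H \<in> f2 \<Longrightarrow> norm (edge f2 H) \<le> E"
  proof -
    show "E > 0" unfolding E_def by (simp add: add_pos_nonneg sum_nonneg)
    fix H assume "H \<in> f2"
    then have "norm (edge f2 H) \<le> (\<Sum>H\<in>f2. norm (edge f2 H))" using fin by (intro member_le_sum) auto
    then show "norm (edge f2 H) \<le> E" unfolding E_def by simp
  qed
  have "\<forall>\<^sub>F R in at_top. \<forall>T\<in>Q. R powr (- dexp T) < \<rho> / (4 * CD * E)"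
    unfolding eventually_ball_finite_distrib[OF finite_Q]
  proof
    fix T assume T: "T \<in> Q"
    have "((\<lambda>R. R powr (- dexp T)) \<longlongrightarrow> 0) at_top"
      using dexp_pos[OF f T] by (intro tendsto_neg_powr filterlim_ident) auto
    then show "\<forall>\<^sub>F R in at_top. R powr (- dexp T) < \<rho> / (4 * CD * E)"
      by (rule order_tendstoD) (use \<rho> CD E in simp)
  qed
  then obtain R1 where R1: "\<And>R T. R \<ge> R1 \<Longrightarrow> T \<in> Q \<Longrightarrow> R powr (- dexp T) < \<rho> / (4 * CD * E)"
    unfolding eventually_at_top_linorder by blast
  \<comment> \<open>Lattice elements of norm at most \<kappa> r have physical size at most r /
    2.\<close>
  define \<kappa> where "\<kappa> = 1 / (2 * CN)"
  have \<kappa>: "\<kappa> > 0" "CN * \<kappa> = 1 / 2" using CN by (simp_all add: \<kappa>_def)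
  define Big where "Big = \<bar>r0\<bar> + \<bar>rV\<bar> + 1 + 4 * (Np (fst \<gamma>0) + r1 + r2) + CD / \<kappa> + \<bar>R1\<bar> / \<kappa>"
  have BigGe: "r0 \<le> Big" "rV \<le> Big" "1 \<le> Big" "4 * (Np (fst \<gamma>0) + r1 + r2) \<le> Big" "CD / \<kappa> \<le> Big" "R1 / \<kappa> \<le> Big"
  proof -
    have n: "0 \<le> Np (fst \<gamma>0) + r1 + r2" "0 \<le> CD / \<kappa>" "0 \<le> \<bar>R1\<bar> / \<kappa>" "R1 / \<kappa> \<le> \<bar>R1\<bar> / \<kappa>"
      using Npnn \<rho>1(2) \<rho>2(2) CD \<kappa>(1) by (auto intro!: divide_right_mono)
    have "a \<le> T \<and> b \<le> T \<and> 1 \<le> T \<and> 4 * p \<le> T \<and> q \<le> T \<and> v \<le> T"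
      if "T = \<bar>a\<bar> + \<bar>b\<bar> + 1 + 4 * p + q + u" "0 \<le> p" "0 \<le> q" "0 \<le> u" "v \<le> u" for a b p q u v T :: real
      using that by (intro conjI; linarith)
    from this[OF Big_def n]
    show "r0 \<le> Big" "rV \<le> Big" "1 \<le> Big" "4 * (Np (fst \<gamma>0) + r1 + r2) \<le> Big" "CD / \<kappa> \<le> Big" "R1 / \<kappa> \<le> Big"
      by blast+
  qed
  \<comment> \<open>The radius will be r = K \<open>norm g\<close>. The first summand gives physical
    size at most r / 4 for g; as \<open>norm g\<close> is at least \<epsilon>0, the second gives r
    \<ge> \<open>Big\<close>, which satisfies every requirement that r be large.\<close>
  define K where "K = 4 * CN + Big / \<epsilon>0"
  have K: "K > 0" using CN BigGe(3) \<epsilon>0 unfolding K_def by (simp add: add_pos_nonneg)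
  define A where "A = 1 + (\<Sum>H\<in>f. \<Sum>j\<in>f2. norm (nrm H) / \<bar>nrm H \<bullet> edge f2 j\<bar>)"
  have A: "A > 0" "\<And>H j. H \<in> f \<Longrightarrow> j \<in> f2 \<Longrightarrow> norm (nrm H) / \<bar>nrm H \<bullet> edge f2 j\<bar> \<le> A"
  proof -
    show "A > 0" unfolding A_def by (simp add: add_pos_nonneg sum_nonneg)
    fix H j assume Hj: "H \<in> f" "j \<in> f2"
    have "norm (nrm H) / \<bar>nrm H \<bullet> edge f2 j\<bar> \<le> (\<Sum>j\<in>f2. norm (nrm H) / \<bar>nrm H \<bullet> edge f2 j\<bar>)"
      using Hj fin by (intro member_le_sum) auto
    also have "\<dots> \<le> (\<Sum>H\<in>f. \<Sum>j\<in>f2. norm (nrm H) / \<bar>nrm H \<bullet> edge f2 j\<bar>)"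
      using Hj fin by (intro member_le_sum) (auto intro: sum_nonneg)
    finally show "norm (nrm H) / \<bar>nrm H \<bullet> edge f2 j\<bar> \<le> A" unfolding A_def by simp
  qed
  define \<delta> where "\<delta> = dexp S"
  have \<delta>: "\<delta> > 0" unfolding \<delta>_def by (rule dexp_pos[OF f S])
  define B where "B = A * CD ^ (card f2 - 1) * \<kappa> powr (\<delta> - real DIM('p))"
  have B: "B > 0" unfolding B_def using A CD \<kappa> by simp
  \<comment> \<open>The second entry settles the case that \<open>snd g\<close> is not within \<rho>
    / 8 of x, using only the lower bound \<epsilon>0 for \<open>norm g\<close>.\<close>
  define c where "c = min (cV / B * K powr (- \<delta>)) (\<rho> / 8 * \<epsilon>0 powr \<delta>)"
  have c: "c > 0" unfolding c_def using cV B K \<rho> \<epsilon>0 by simp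
  have main: "norm (snd g - x) \<ge> c * norm g powr (- \<delta>)"
    if g: "g \<in> stabiliser \<Gamma> S" "g \<noteq> 0" "snd g \<noteq> x" for g
  proof -
    define e where "e = snd g - x"
    have g\<Gamma>: "g \<in> \<Gamma>" using g(1) stabiliser_sub by blast
    have gn: "\<epsilon>0 \<le> norm g" by (rule \<epsilon>0(2)[OF g\<Gamma> g(2)])
    have e0: "e \<noteq> 0" using g(3) by (simp add: e_def)
    have eS: "e \<in> \<Inter>S" unfolding e_def using g(1) x subspace_diff[OF subspace_X[OF S]] unfolding stabiliser_eq by blast
    show ?thesis
    proof (cases "norm e < \<rho> / 8")
      case False
      have "c * norm g powr (- \<delta>) \<le> (\<rho> / 8 * \<epsilon>0 powr \<delta>) * \<epsilon>0 powr (- \<delta>)"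
      proof (intro mult_mono powr_mono2')
        show "c \<le> \<rho> / 8 * \<epsilon>0 powr \<delta>" unfolding c_def by (rule min.cobounded2)
      qed (use \<epsilon>0(1) gn \<delta> \<rho>(1) in auto)
      also have "\<dots> = \<rho> / 8" using \<epsilon>0(1) by (simp add: powr_minus)
      finally show ?thesis using False unfolding e_def by linarith
    next
      case True
      define r where "r = K * norm g"
      have rg: "4 * CN * norm g \<le> r" "Big \<le> r"
      proof -
        have *: "r = 4 * CN * norm g + Big / \<epsilon>0 * norm g" by (simp add: r_def K_def algebra_simps)
        have "Big / \<epsilon>0 * \<epsilon>0 \<le> Big / \<epsilon>0 * norm g" using gn BigGe(3) \<epsilon>0(1) by (intro mult_left_mono) auto
        then have "Big \<le> Big / \<epsilon>0 * norm g" using \<epsilon>0(1) by simp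
        moreover have "0 \<le> 4 * CN * norm g" using CN(1) by simp
        ultimately show "4 * CN * norm g \<le> r" "Big \<le> r" using * BigGe(3) by linarith+
      qed
      have r: "r \<ge> r0" "r \<ge> rV" "r \<ge> 1" "4 * (Np (fst \<gamma>0) + r1 + r2) \<le> r" using BigGe rg(2) by linarith+
      define R where "R = \<kappa> * r"
      have R: "R \<ge> CD" "R \<ge> R1" "R > 0" "CN * R = r / 2"
      proof -
        have "CD / \<kappa> \<le> r" "R1 / \<kappa> \<le> r" using BigGe rg(2) by linarith+
        then show "R \<ge> CD" "R \<ge> R1" unfolding R_def using \<kappa>(1) by (simp_all add: pos_divide_le_eq mult.commute)
        show "R > 0" unfolding R_def using \<kappa>(1) r(3) by simp
        show "CN * R = r / 2" unfolding R_def using \<kappa>(2) by (metis mult.assoc mult.commute times_divide_eq_right mult_1_right)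
      qed
      have "\<forall>j\<in>f2. \<exists>k. k \<in> line f2 j \<and> norm k \<le> R \<and> 0 < nrm j \<bullet> snd k \<and> nrm j \<bullet> snd k \<le> CD * R powr (- dexp (htype j))"
        using dir[OF R(1)] by blast
      then obtain k where k: "\<And>j. j \<in> f2 \<Longrightarrow> k j \<in> line f2 j \<and> norm (k j) \<le> R \<and> 0 < nrm j \<bullet> snd (k j) \<and>
        nrm j \<bullet> snd (k j) \<le> CD * R powr (- dexp (htype j))" by metis
      define t where "t j = nrm j \<bullet> snd (k j)" for j
      have t: "t j > 0" "t j \<le> CD * R powr (- dexp (htype j))" if "j \<in> f2" for j using k[OF that] by (auto simp: t_def)
      have snd_k: "snd (k j) = t j *\<^sub>R edge f2 j" if "j \<in> f2" for j
        unfolding t_def using line_snd[OF f2 that] k[OF that] by blast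
      have small_k: "norm (snd (k j)) < \<rho> / 4" if j: "j \<in> f2" for j
      proof -
        have "norm (snd (k j)) = t j * norm (edge f2 j)" using snd_k[OF j] t(1)[OF j] by simp
        also have "\<dots> \<le> (CD * R powr (- dexp (htype j))) * E" using t[OF j] E j CD by (intro mult_mono) auto
        also have "\<dots> < \<rho> / 4"
          using R1[OF R(2) htype_in_Q(1)[OF fHs(2)[OF j]]] CD E(1) by (simp add: pos_less_divide_eq field_simps)
        finally show ?thesis .
      qed
      \<comment> \<open>As e \<noteq> 0, some hyperplane of f misses the displaced vertex;
        \<open>j0\<close> will be a hyperplane of f2 whose edge crosses it. Since e lies in the
        summand S, both are of type S, which produces the exponent of S.\<close>
      obtain H0 where H0: "H0 \<in> f" "nrm H0 \<bullet> e \<noteq> 0"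
        using dual_system_eqI[OF d, of e 0] e0 by auto
      define \<alpha> where "\<alpha> j = nrm H0 \<bullet> edge f2 j" for j
      define \<beta> where "\<beta> = - (nrm H0 \<bullet> e)"
      have \<beta>0: "\<beta> \<noteq> 0" using H0 by (simp add: \<beta>_def)
      have "\<exists>j0\<in>f2. \<alpha> j0 \<noteq> 0"
      proof (rule ccontr)
        assume "\<not> ?thesis"
        then have "nrm H0 \<bullet> e = 0" unfolding dual_system_expand[OF d2, of "nrm H0" e] \<alpha>_def by (intro sum.neutral) auto
        then show False using H0(2) by simp
      qed
      then obtain j0 where j0: "j0 \<in> f2" "\<alpha> j0 \<noteq> 0" by blast
      have tH0: "htype H0 = S" using nrm_other_type[OF fHs(1)[OF H0(1)] S _ eS] H0(2) by blast
      have tj0: "htype j0 = S"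
        using nrm_other_type[OF fHs(1)[OF H0(1)] htype_in_Q(1)[OF fHs(2)[OF j0(1)]] _ edge_in[OF f2 j0(1)]] j0(2) tH0
        unfolding \<alpha>_def by metis
      \<comment> \<open>Coordinates centred at the displaced vertex, along the edges of f2. In them
        H0 is given by \<open>(\<Sum>j\<in>f2. \<alpha> j * X j w) = \<beta>\<close>.\<close>
      define X where "X j w = nrm j \<bullet> (w - (vtx f + e))" for j w
      define \<sigma> where "\<sigma> = sgn \<beta>"
      \<comment> \<open>Signs of the orthant in which \<sigma> times this sum has only non-negative
        terms. There H0 cuts off a corner, on which the coordinate at \<open>j0\<close> is bounded
        by |\<beta>| / |\<alpha> \<open>j0\<close>|.\<close>
      define s where "s j = (if \<alpha> j = 0 then 1 else \<sigma> * sgn (\<alpha> j))" for j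
      have \<sigma>: "\<sigma> = 1 \<or> \<sigma> = -1" "\<sigma> * \<beta> = \<bar>\<beta>\<bar>" using \<beta>0 by (auto simp: \<sigma>_def sgn_if)
      have s1: "s j = 1 \<or> s j = -1" for j using \<sigma>(1) by (auto simp: s_def sgn_if)
      have s\<alpha>: "\<sigma> * \<alpha> j = \<bar>\<alpha> j\<bar> * s j" for j using \<sigma>(1) by (auto simp: s_def sgn_if)
      have nH0: "nrm H0 \<bullet> (w - vtx f) = (\<Sum>j\<in>f2. \<alpha> j * X j w) - \<beta>" for w
      proof -
        have "nrm H0 \<bullet> (w - vtx f) = nrm H0 \<bullet> (w - (vtx f + e)) + nrm H0 \<bullet> e" by (simp add: inner_diff_right inner_add_right)
        also have "nrm H0 \<bullet> (w - (vtx f + e)) = (\<Sum>j\<in>f2. X j w * \<alpha> j)"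
          unfolding X_def \<alpha>_def by (rule dual_system_expand[OF d2])
        finally show ?thesis by (simp add: \<beta>_def mult.commute)
      qed
      have X2: "X j w = nrm j \<bullet> (w - snd g) - off j" if "j \<in> f2" for j w
      proof -
        have "vtx f + e = vtx f2 + snd g" using v2 by (simp add: e_def)
        then show ?thesis using vtx_in[OF f2 that] by (simp add: X_def inner_diff_right inner_add_right)
      qed
      define cell where "cell = {w. (\<forall>j\<in>f2. 0 < s j * X j w \<and> s j * X j w < t j) \<and>
        \<sigma> * (\<Sum>j\<in>f2. \<alpha> j * X j w) < \<bar>\<beta>\<bar> \<and> norm (w - vtx f) < \<rho> / 4}"
      have contX: "continuous_on UNIV (X j)" for j unfolding X_def by (intro continuous_intros)
      have "open cell"
      proof -
        have "cell = (\<Inter>j\<in>f2. {w. 0 < s j * X j w} \<inter> {w. s j * X j w < t j}) \<inter>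
          {w. \<sigma> * (\<Sum>j\<in>f2. \<alpha> j * X j w) < \<bar>\<beta>\<bar>} \<inter> {w. norm (w - vtx f) < \<rho> / 4}"
          unfolding cell_def by auto
        also have "open \<dots>" using fin
          by (intro open_Int open_INT ballI open_Collect_less continuous_intros contX) auto
        finally show ?thesis .
      qed
      moreover have "cell \<noteq> {}"
      proof -
        define A1 where "A1 = (\<Sum>j\<in>f2. \<bar>\<alpha> j\<bar>) + 1"
        have A1: "A1 > 0" unfolding A1_def by (simp add: add_nonneg_pos sum_nonneg)
        \<comment> \<open>A point with all coordinates of size \<tau>: the three entries keep it
          inside the box, on the vertex side of H0, and close to the vertex.\<close>
        define \<tau> where "\<tau> = min (Min (t ` f2)) (min (\<bar>\<beta>\<bar> / A1) (\<rho> / (8 * E))) / 2"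
        have mpos: "Min (t ` f2) > 0" using j0(1) fin t(1) by (subst Min_gr_iff) auto
        have \<tau>: "\<tau> > 0" "\<tau> < Min (t ` f2)" "\<tau> < \<bar>\<beta>\<bar> / A1" "\<tau> < \<rho> / (8 * E)"
        proof -
          have p: "\<bar>\<beta>\<bar> / A1 > 0" "\<rho> / (8 * E) > 0" using \<beta>0 A1 \<rho> E by auto
          have "0 < T \<and> T < a \<and> T < b \<and> T < c"
            if "T = min a (min b c) / 2" "0 < a" "0 < b" "0 < c" for a b c T :: real
            using that by (auto simp: min_def split: if_splits)
          from this[OF \<tau>_def mpos p]
          show "\<tau> > 0" "\<tau> < Min (t ` f2)" "\<tau> < \<bar>\<beta>\<bar> / A1" "\<tau> < \<rho> / (8 * E)"
            by blast+
        qed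
        define w where "w = vtx f + e + (\<Sum>j\<in>f2. (s j * \<tau>) *\<^sub>R edge f2 j)"
        have Xw: "X j w = s j * \<tau>" if "j \<in> f2" for j
          unfolding X_def w_def using dual_system_sum[OF d2 that, of "\<lambda>j. s j * \<tau>"] by simp
        have ss: "s j * (s j * \<tau>) = \<tau>" for j using s1[of j] by auto
        have sX: "s j * X j w = \<tau>" if "j \<in> f2" for j unfolding Xw[OF that] by (rule ss)
        have \<tau>t: "\<tau> < t j" if "j \<in> f2" for j
        proof -
          have "Min (t ` f2) \<le> t j" using fin that by (intro Min_le) auto
          then show ?thesis using \<tau>(2) by linarith
        qed
        have "\<sigma> * (\<Sum>j\<in>f2. \<alpha> j * X j w) < \<bar>\<beta>\<bar>"
        proof -
          have "\<sigma> * (\<Sum>j\<in>f2. \<alpha> j * X j w) = (\<Sum>j\<in>f2. \<bar>\<alpha> j\<bar> * \<tau>)"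
            unfolding sum_distrib_left
          proof (rule sum.cong[OF refl])
            fix j assume j: "j \<in> f2"
            have "\<sigma> * (\<alpha> j * X j w) = (\<sigma> * \<alpha> j) * (s j * \<tau>)" using Xw[OF j] by simp
            also have "\<dots> = \<bar>\<alpha> j\<bar> * (s j * (s j * \<tau>))" unfolding s\<alpha> by simp
            finally show "\<sigma> * (\<alpha> j * X j w) = \<bar>\<alpha> j\<bar> * \<tau>" using ss by simp
          qed
          also have "\<dots> \<le> A1 * \<tau>" using \<tau>(1) by (simp add: A1_def sum_distrib_right[symmetric])
          also have "\<dots> < \<bar>\<beta>\<bar>" using \<tau>(3) A1 by (simp add: pos_less_divide_eq mult.commute)
          finally show ?thesis .
        qed
        moreover have "norm (w - vtx f) < \<rho> / 4"
        proof -
          have "norm (\<Sum>j\<in>f2. (s j * \<tau>) *\<^sub>R edge f2 j) \<le> (\<Sum>j\<in>f2. \<tau> * norm (edge f2 j))"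
          proof (rule sum_norm_le)
            fix j show "norm ((s j * \<tau>) *\<^sub>R edge f2 j) \<le> \<tau> * norm (edge f2 j)"
              using s1[of j] \<tau>(1) by auto
          qed
          also have "\<dots> \<le> \<tau> * E" unfolding E_def sum_distrib_left[symmetric] using \<tau>(1) by (intro mult_left_mono) auto
          also have "\<dots> < \<rho> / 8" using \<tau>(4) E(1) by (simp add: pos_less_divide_eq field_simps)
          finally have "norm (\<Sum>j\<in>f2. (s j * \<tau>) *\<^sub>R edge f2 j) < \<rho> / 8" .
          moreover have "w - vtx f = e + (\<Sum>j\<in>f2. (s j * \<tau>) *\<^sub>R edge f2 j)" by (simp add: w_def)
          then have "norm (w - vtx f) \<le> norm e + norm (\<Sum>j\<in>f2. (s j * \<tau>) *\<^sub>R edge f2 j)"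
            by (simp only: norm_triangle_ineq)
          ultimately show ?thesis using True by linarith
        qed
        ultimately have "w \<in> cell" unfolding cell_def using \<tau>(1) sX \<tau>t by simp
        then show ?thesis by blast
      qed
      moreover have "open ((\<lambda>w. w + snd \<gamma>0) ` cell)" using \<open>open cell\<close>
        using open_translation[of cell "snd \<gamma>0"] by (simp add: add.commute)
      ultimately obtain gy where gy: "gy \<in> \<Gamma>" "snd gy \<in> (\<lambda>w. w + snd \<gamma>0) ` cell"
        using dense_open[of "(\<lambda>w. w + snd \<gamma>0) ` cell"] by blast
      define y where "y = fst gy"
      define wy where "wy = snd gy - snd \<gamma>0"
      have wy: "wy \<in> cell" using gy(2) by (auto simp: wy_def)
      have "snd gy \<in> ball (vtx f + snd \<gamma>0) \<rho>W"
      proof -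
        have "norm (wy - vtx f) < \<rho> / 4" using wy unfolding cell_def by blast
        moreover have "dist (vtx f + snd \<gamma>0) (snd gy) = norm (wy - vtx f)"
          by (simp add: wy_def dist_norm norm_minus_commute algebra_simps)
        ultimately show ?thesis using \<rho> by simp
      qed
      then have "snd gy \<in> W l0" using \<rho>W(2) by blast
      then have y: "y \<in> \<Lambda>" "star \<Gamma> y = wy + snd \<gamma>0"
        using cpsI[OF gy(1) l0(1)] star_eq[OF gy(1)] by (auto simp: y_def wy_def)
      have Npg: "Np (fst g) \<le> r / 4"
      proof -
        have "Np (fst g) \<le> CN * norm (fst g)" by (rule CN(3))
        also have "\<dots> \<le> CN * norm g" using norm_fst_le[of "fst g" "snd g"] CN(1) by (intro mult_left_mono) auto
        finally show ?thesis using rg(1) by linarith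
      qed
      have Npk: "Np (fst (k j)) \<le> r / 2" if "j \<in> f2" for j
      proof -
        have "Np (fst (k j)) \<le> CN * norm (fst (k j))" by (rule CN(3))
        also have "\<dots> \<le> CN * norm (k j)" using norm_fst_le[of "fst (k j)" "snd (k j)"] CN(1) by (intro mult_left_mono) auto
        also have "\<dots> \<le> CN * R" using k[OF that] CN(1) by (intro mult_left_mono) auto
        finally show ?thesis using R(4) by simp
      qed
      \<comment> \<open>Half-widths of the region of the patch: O(\<open>norm e\<close>) in the
        direction that H0 limits, Dirichlet lengths in the others.\<close>
      define T where "T j = (if j = j0 then A * norm e else CD * R powr (- dexp (htype j)))" for j
      define u where "u = vtx f + e + snd \<gamma>0"
      have bound: "\<bar>nrm j \<bullet> (star \<Gamma> z - u)\<bar> \<le> T j"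
        if z: "z \<in> \<Lambda>" and eq: "patch Np r z = patch Np r y" and j: "j \<in> f2" for z j
      proof -
        define wz where "wz = star \<Gamma> z - snd \<gamma>0"
        have cy: "norm (wy - vtx f) < \<rho> / 4" using wy unfolding cell_def by blast
        have "norm (star \<Gamma> z - star \<Gamma> y) < \<rho> / 4" using loc[OF r(1) y(1) z] eq by simp
        then have "norm (wz - wy) < \<rho> / 4" unfolding wz_def y(2) by (simp add: algebra_simps)
        then have cz: "norm (wz - vtx f) < \<rho> / 2"
          using cy norm_triangle_ineq[of "wz - wy" "wy - vtx f"] by simp
        have sy: "star \<Gamma> y = wy + snd \<gamma>0" "star \<Gamma> z = wz + snd \<gamma>0" using y(2) by (simp_all add: wz_def)
        have D0: "nrm H0 \<bullet> wy \<le> off H0 \<longleftrightarrow> nrm H0 \<bullet> wz \<le> off H0"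
        proof -
          have "- \<gamma>0 \<in> \<Gamma>" by (rule int_mod.subspace_neg[OF sub_\<Gamma> \<gamma>0(1)])
          moreover have "Np (fst (- \<gamma>0)) \<le> r - r1" using r(4) Npneg Npnn[of "fst \<gamma>0"] \<rho>1(2) \<rho>2(2) by simp
          ultimately show ?thesis
            using det1[OF y(1) z eq, of "- \<gamma>0" H0] H0(1) cy cz \<rho> unfolding sy by simp
        qed
        \<comment> \<open>A test against the hyperplane i of f2 translated by g + h, used with h =
          0, \<open>k i\<close> and - \<open>k i\<close>. The physical sizes at most r / 4 for g and
          r / 2 for h leave r / 4 for \<gamma>0 and the margin r2.\<close>
        have D2: "X i wy \<le> \<theta> \<longleftrightarrow> X i wz \<le> \<theta>"
          if i: "i \<in> f2" and h: "h \<in> \<Gamma>" "Np (fst h) \<le> r / 2" "norm (snd h) < \<rho> / 4" "nrm i \<bullet> snd h = \<theta>" for i h \<theta>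
        proof -
          let ?s = "- \<gamma>0 - g - h"
          have s: "?s \<in> \<Gamma>"
            by (intro int_mod.subspace_diff[OF sub_\<Gamma>] int_mod.subspace_neg[OF sub_\<Gamma>] \<gamma>0(1) g\<Gamma> h(1))
          have "Np (fst ?s) \<le> Np (fst \<gamma>0) + Np (fst g) + Np (fst h)"
            using tri[of "- fst \<gamma>0 - fst g" "- fst h"] tri[of "- fst \<gamma>0" "- fst g"] Npneg by simp
          moreover have "a' \<le> r - r2"
            if "a' \<le> a + b + c" "b \<le> r / 4" "c \<le> r / 2" "4 * (a + r1 + r2) \<le> r" for a a' b c :: real
            using that \<rho>1(2) by argo
          ultimately have Ns: "Np (fst ?s) \<le> r - r2" using Npg h(2) r(4) by blast
          have near: "norm (w - snd g - snd h - vtx f2) < \<rho>2" if "norm (w - vtx f) < \<rho> / 2" for w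
          proof -
            have "w - snd g - snd h - vtx f2 = (w - vtx f) - (e + snd h)" unfolding v2 e_def by simp
            then have "norm (w - snd g - snd h - vtx f2) \<le> norm (w - vtx f) + norm (e + snd h)"
              by (simp only: norm_triangle_ineq4)
            moreover have "norm (e + snd h) \<le> norm e + norm (snd h)" by (rule norm_triangle_ineq)
            ultimately have "norm (w - snd g - snd h - vtx f2) \<le> norm (w - vtx f) + (norm e + norm (snd h))"
              by linarith
            then show ?thesis using that True h(3) \<rho> by linarith
          qed
          have "nrm i \<bullet> (wy - snd g - snd h) \<le> off i \<longleftrightarrow> nrm i \<bullet> (wz - snd g - snd h) \<le> off i"
            using det2[OF y(1) z eq s Ns i] near[of wy] near[of wz] cy cz \<rho>(1) unfolding sy by (simp add: algebra_simps)
          then show ?thesis unfolding X2[OF i] using h(4) by (simp add: inner_diff_right algebra_simps)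
        qed
        \<comment> \<open>The walls at 0, \<open>t i\<close> and - \<open>t i\<close> are all tested
          because the sign \<open>s i\<close> decides which side of 0 the cell occupies. Strict
          inequalities become weak, since the tests compare only by \<le>.\<close>
        have Xz: "0 \<le> s i * X i wz \<and> s i * X i wz \<le> t i" if i: "i \<in> f2" for i
        proof -
          have Xy: "0 < s i * X i wy" "s i * X i wy < t i" using wy i unfolding cell_def by auto
          have z0: "X i wy \<le> 0 \<longleftrightarrow> X i wz \<le> 0"
          proof (rule D2[OF i int_mod.subspace_0[OF sub_\<Gamma>]])
            have "Np 0 = 0" using Np unfolding is_norm_def by blast
            then show "Np (fst (0::'p \<times> 'i)) \<le> r / 2" using r(3) by simp
          qed (use \<rho> in auto)
          have ki: "k i \<in> \<Gamma>" "- k i \<in> \<Gamma>" using k[OF i] subsetD[OF line_subset] int_mod.subspace_neg[OF sub_\<Gamma>] by blast+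
          have zp: "X i wy \<le> t i \<longleftrightarrow> X i wz \<le> t i"
            by (rule D2[OF i ki(1) Npk[OF i] small_k[OF i]]) (simp add: t_def)
          have zm: "X i wy \<le> - t i \<longleftrightarrow> X i wz \<le> - t i"
            using Npk[OF i] small_k[OF i] Npneg by (intro D2[OF i ki(2)]) (simp_all add: t_def)
          show ?thesis using s1[of i] Xy z0 zp zm by auto
        qed
        have H0z: "\<sigma> * (\<Sum>i\<in>f2. \<alpha> i * X i wz) \<le> \<bar>\<beta>\<bar>"
        proof -
          have "\<sigma> * (\<Sum>i\<in>f2. \<alpha> i * X i wy) < \<sigma> * \<beta>" using wy unfolding cell_def \<sigma>(2) by blast
          then have "\<sigma> * (nrm H0 \<bullet> (wy - vtx f)) < 0" unfolding nH0 by (simp add: right_diff_distrib)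
          then have "\<sigma> * (nrm H0 \<bullet> (wz - vtx f)) \<le> 0"
            using D0 \<sigma>(1) vtx_in[OF f H0(1)] by (auto simp: inner_diff_right)
          then show ?thesis unfolding nH0 \<sigma>(2)[symmetric] by (simp add: right_diff_distrib)
        qed
        have Xeq: "nrm j \<bullet> (star \<Gamma> z - u) = X j wz" unfolding X_def wz_def u_def by (simp add: algebra_simps)
        have abs: "\<bar>X i wz\<bar> = s i * X i wz" if "i \<in> f2" for i using Xz[OF that] s1[of i] by auto
        show ?thesis
        proof (cases "j = j0")
          case False
          then show ?thesis using abs[OF j] Xz[OF j] t(2)[OF j] unfolding T_def Xeq by simp
        next
          case True
          have summand: "\<sigma> * (\<alpha> i * X i wz) = \<bar>\<alpha> i\<bar> * \<bar>X i wz\<bar>" if "i \<in> f2" for i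
          proof -
            have "\<sigma> * (\<alpha> i * X i wz) = (\<sigma> * \<alpha> i) * X i wz" by simp
            then show ?thesis unfolding s\<alpha> abs[OF that] by simp
          qed
          have "\<bar>\<alpha> j0\<bar> * \<bar>X j0 wz\<bar> \<le> (\<Sum>i\<in>f2. \<bar>\<alpha> i\<bar> * \<bar>X i wz\<bar>)" using fin j0(1) by (intro member_le_sum) auto
          also have "\<dots> = \<sigma> * (\<Sum>i\<in>f2. \<alpha> i * X i wz)" unfolding sum_distrib_left using summand by (intro sum.cong) auto
          also have "\<dots> \<le> \<bar>\<beta>\<bar>" by (rule H0z)
          also have "\<dots> \<le> norm (nrm H0) * norm e" unfolding \<beta>_def using Cauchy_Schwarz_ineq2[of "nrm H0" e] by simp
          finally have "\<bar>X j0 wz\<bar> \<le> norm (nrm H0) / \<bar>\<alpha> j0\<bar> * norm e" using j0(2) by (simp add: field_simps)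
          also have "\<dots> \<le> A * norm e" using A(2)[OF H0(1) j0(1)] unfolding \<alpha>_def by (intro mult_right_mono) auto
          finally show ?thesis unfolding Xeq T_def using True by simp
        qed
      qed
      have T0: "\<forall>j\<in>f2. 0 \<le> T j" unfolding T_def using A(1) CD by simp
      \<comment> \<open>The exponents of f2 apart from \<open>j0\<close> sum to d - \<delta>, so the
        right-hand side becomes \<open>B * norm e * r powr \<delta>\<close>, and the bound on e
        follows.\<close>
      have "cV \<le> r ^ DIM('p) * (\<Prod>j\<in>f2. T j)" 
        using vol[rule_format, OF r(2) y(1), of T u] T0 bound by blast
      also have "(\<Prod>j\<in>f2. T j) = A * norm e * (\<Prod>j\<in>f2 - {j0}. CD * R powr (- dexp (htype j)))"
        using fin j0(1) by (subst prod.remove[of _ j0]) (auto simp: T_def)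
      also have "(\<Prod>j\<in>f2 - {j0}. CD * R powr (- dexp (htype j))) = CD ^ (card f2 - 1) * R powr (\<Sum>j\<in>f2 - {j0}. - dexp (htype j))"
        using fin j0(1) R(3) by (simp add: prod.distrib powr_sum card_Diff_singleton)
      also have "(\<Sum>j\<in>f2 - {j0}. - dexp (htype j)) = \<delta> - real DIM('p)"
      proof -
        have "(\<Sum>j\<in>f2. dexp (htype j)) = dexp (htype j0) + (\<Sum>j\<in>f2 - {j0}. dexp (htype j))"
          using fin j0(1) by (intro sum.remove) auto
        then show ?thesis using flag_structure(3)[OF f2] tj0 by (simp add: sum_negf \<delta>_def)
      qed
      also have "R powr (\<delta> - real DIM('p)) = \<kappa> powr (\<delta> - real DIM('p)) * (r powr \<delta> / r ^ DIM('p))"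
        unfolding R_def using \<kappa>(1) r(3) by (simp add: powr_mult powr_diff powr_realpow)
      also have "r ^ DIM('p) * (A * norm e * (CD ^ (card f2 - 1) * (\<kappa> powr (\<delta> - real DIM('p)) * (r powr \<delta> / r ^ DIM('p))))) = B * norm e * r powr \<delta>"
        unfolding B_def using r(3) by simp
      finally have le: "cV \<le> B * norm e * r powr \<delta>" .
      have rpos: "r powr \<delta> > 0" using r(3) by simp
      have "cV / B * r powr (- \<delta>) \<le> norm e"
        using le B rpos by (simp add: powr_minus field_simps)
      moreover have "r powr (- \<delta>) = K powr (- \<delta>) * norm g powr (- \<delta>)" unfolding r_def using K by (simp add: powr_mult)
      moreover have "c * norm g powr (- \<delta>) \<le> (cV / B * K powr (- \<delta>)) * norm g powr (- \<delta>)"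
        unfolding c_def by (intro mult_right_mono) auto
      ultimately show ?thesis unfolding e_def by (simp add: mult.assoc)
    qed
  qed
  then show ?thesis using c unfolding \<delta>_def by blast
qed

text \<open>A pair of flags determines at most one component in S, since normals of type S vanish on
  the other summands and the remaining normals vanish on \<open>\<Inter>S\<close>. Hence only
  finitely many separation constants have to be minimised.\<close>

lemma diophantine_from_repetitivity:
  assumes Np: "is_norm Np" and Ni: "is_norm Ni" and LR: "linearly_repetitive Np \<Gamma> L W"
  shows "property_DF Ni \<Gamma> Hs Q"
  unfolding property_DF_def
proof
  fix S assume S: "S \<in> Q"
  let ?F = "component Q (vertex_differences Hs) S"
  let ?G = "stabiliser \<Gamma> S"
  define comp where "comp ff x \<longleftrightarrow> x \<in> \<Inter>S \<and> (\<exists>y\<in>set_family_sum Inter (Q - {S}). x + y = vtx (fst ff) - vtx (snd ff))"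
    for ff :: "'i set set \<times> 'i set set" and x
  define P where "P ff c \<longleftrightarrow> (\<forall>x. comp ff x \<longrightarrow> (\<forall>g\<in>?G. g \<noteq> 0 \<longrightarrow> snd g \<noteq> x \<longrightarrow>
    norm (snd g - x) \<ge> c * norm g powr (- dexp S)))" for ff and c :: real
  obtain f0 where f0: "f0 \<in> flags Hs" using flag_exists by blast
  have "\<exists>c>0. \<forall>ff\<in>flags Hs \<times> flags Hs. P ff c"
  proof (rule finite_uniform_constant)
    show "finite (flags Hs \<times> flags Hs)" using finite_flags by blast
    fix ff assume "ff \<in> flags Hs \<times> flags Hs"
    then obtain f f' where ff: "ff = (f, f')" "f \<in> flags Hs" "f' \<in> flags Hs" by blast
    show "\<exists>c>0. P ff c"
    proof (cases "\<exists>x. comp ff x")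
      case False
      then show ?thesis unfolding P_def by (intro exI[of _ 1]) auto
    next
      case True
      then obtain x y where x: "x \<in> \<Inter>S" "y \<in> set_family_sum Inter (Q - {S})" "x + y = vtx f - vtx f'"
        unfolding comp_def ff(1) fst_conv snd_conv by blast
      have uniq: "x' = x" if cx: "comp ff x'" for x'
      proof -
        obtain y' where x': "x' \<in> \<Inter>S" "y' \<in> set_family_sum Inter (Q - {S})" "x' + y' = vtx f - vtx f'"
          using cx unfolding comp_def ff(1) fst_conv snd_conv by blast
        show ?thesis
        proof (rule dual_system_eqI[OF flag_dual[OF f0]])
          fix H assume "H \<in> f0"
          then have H: "H \<in> Hs" using flag_subset[OF f0] by blast
          show "nrm H \<bullet> x' = nrm H \<bullet> x"
          proof (cases "htype H = S")
            case True
            then have "nrm H \<bullet> y = 0" "nrm H \<bullet> y' = 0" using nrm_complement_sum[OF H] x(2) x'(2) by auto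
            then show ?thesis using arg_cong[OF x(3), of "inner (nrm H)"] arg_cong[OF x'(3), of "inner (nrm H)"]
              by (simp add: inner_add_right)
          next
            case False
            then have "nrm H \<bullet> x = 0" "nrm H \<bullet> x' = 0"
              using nrm_other_type[OF H S, of x] nrm_other_type[OF H S, of x'] x(1) x'(1) by metis+
            then show ?thesis by simp
          qed
        qed
      qed
      obtain f2 where f2: "f2 \<in> flags Hs" "vtx f2 = vtx f - x" using mixed_flag[OF ff(2,3) S x] by blast
      obtain c where "c > 0" "\<forall>g\<in>?G. g \<noteq> 0 \<longrightarrow> snd g \<noteq> x \<longrightarrow> norm (snd g - x) \<ge> c * norm g powr (- dexp S)"
        using separation_from_repetitivity[OF Np LR ff(2) f2(1) S x(1) f2(2)] by blast
      then show ?thesis unfolding P_def using uniq by blast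
    qed
  next
    fix ff and c c' :: real assume a: "P ff c" "0 < c'" "c' \<le> c"
    have "c' * norm g powr (- dexp S) \<le> c * norm g powr (- dexp S)" for g :: "'p \<times> 'i"
      using a(3) by (intro mult_right_mono) auto
    then show "P ff c'" using a(1) unfolding P_def by (meson order_trans)
  qed
  then obtain c where c: "c > 0" "\<And>ff. ff \<in> flags Hs \<times> flags Hs \<Longrightarrow> P ff c" by blast
  show "diophantine Ni (snd ` ?G) (\<Inter>S) ?F"
  proof (rule diophantine_upper[OF f0 S Ni c(1)])
    fix a g assume a: "a \<in> ?F" and g: "g \<in> ?G" "g \<noteq> 0" "snd g \<noteq> a"
    obtain f f' where "f \<in> flags Hs" "f' \<in> flags Hs" "comp (f, f') a"
      using a unfolding component_def vertex_differences_def comp_def vtx_def by auto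
    then show "c * norm g powr (- dexp S) \<le> norm (snd g - a)"
      using c(2)[of "(f, f')"] g unfolding P_def by blast
  qed
qed

end

theorem theorem2:
  fixes \<Gamma> :: "('p::euclidean_space \<times> 'i::euclidean_space) set"
    and L :: "'l set" and W :: "'l \<Rightarrow> 'i set"
    and Np :: "'p \<Rightarrow> real" and Ni :: "'i \<Rightarrow> real"
  assumes "polytopal_scheme \<Gamma> L W" and "is_norm Np" and "is_norm Ni"
  shows "(linearly_repetitive Np \<Gamma> L W \<longrightarrow>
            property_C Np \<Gamma> L W \<and>
            (\<forall>Q. CSR_decomposition \<Gamma> (hyperplanes L W) Q \<longrightarrow>
               property_DF Ni \<Gamma> (hyperplanes L W) Q)) \<and>
         (\<exists>N\<ge>1. (DIM('i) = 1 \<longrightarrow> N = 1) \<and>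
            (\<forall>Q. CSR_decomposition \<Gamma> (hyperplanes L W) Q \<longrightarrow>
               property_C Np \<Gamma> L W \<longrightarrow>
               property_DF Ni (refined_lattice N \<Gamma>) (hyperplanes L W) Q \<longrightarrow>
               linearly_repetitive Np \<Gamma> L W))"
proof -
  obtain nrm off where "scheme \<Gamma> L W nrm off" using scheme_exists[OF assms(1)] by blast
  then interpret scheme \<Gamma> L W nrm off .
  have csr: "csr \<Gamma> L W nrm off Q" if "CSR_decomposition \<Gamma> (hyperplanes L W) Q" for Q
    by unfold_locales (rule that)
  obtain N where N: "N \<ge> 1" "DIM('i) = 1 \<longrightarrow> N = 1"
    "\<And>Q f. CSR_decomposition \<Gamma> (hyperplanes L W) Q \<Longrightarrow> f \<in> flags (hyperplanes L W) \<Longrightarrow> splits N f"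
    using common_splitting by blast
  show ?thesis
  proof (intro conjI impI allI exI[of _ N])
    assume "linearly_repetitive Np \<Gamma> L W"
    then show "property_C Np \<Gamma> L W" by (rule linearly_repetitive_imp_property_C[OF assms(2)])
  next
    fix Q assume "linearly_repetitive Np \<Gamma> L W" and Q: "CSR_decomposition \<Gamma> (hyperplanes L W) Q"
    then show "property_DF Ni \<Gamma> (hyperplanes L W) Q"
      using csr.diophantine_from_repetitivity[OF csr[OF Q] assms(2,3)] by blast
  next
    fix Q assume Q: "CSR_decomposition \<Gamma> (hyperplanes L W) Q"
      and "property_DF Ni (refined_lattice N \<Gamma>) (hyperplanes L W) Q"
    then show "linearly_repetitive Np \<Gamma> L W"
      using csr.linearly_repetitive_if_diophantine[OF csr[OF Q] N(1) N(3)[OF Q] assms(2,3)] by blast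
  qed (use N in auto)
qed

end
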